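(* For every positive integer $\alpha$ define \[ \tilde{\delta}_\alpha:=\begin{cases}\dfrac{23\cdot 5^{\alpha}-19}{24}, & \alpha \text{ odd},\\[2mm] \dfrac{19\cdot(5^{\alpha}-1)}{24}, & \alpha\text{ even}.\end{cases} \] Then for every positive integer $\alpha$ and every nonnegative integer $n$, \[ NT\left(1,5,5^{\alpha+1}n+5\tilde{\delta}_\alpha+4\right)\equiv NT\left(4,5,5^{\alpha+1}n+5\tilde{\delta}_\alpha+4\right)\pmod{5^\alpha}. \]
   Context: The rank of an integer partition is its largest part minus its number of parts. For integers $m$, $k\ge 1$, $n\ge 0$, $NT(m,k,n)$ denotes the total number of parts in the partitions of $n$ whose rank is congruent to $m$ modulo $k$ (i.e. the sum, over all partitions of $n$ with rank $\equiv m \pmod k$, of their numbers of parts). *)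

theory Defs
  imports "HOL-Library.Multiset" "HOL-Number_Theory.Number_Theory"
begin

definition partitions_of :: "nat \<Rightarrow> nat multiset set" where
  "partitions_of n = {p. 0 \<notin># p \<and> \<Sum>\<^sub># p = n}"

(* Max is unspecified on the empty set; the empty partition has rank 0. *)
definition partition_rank :: "nat multiset \<Rightarrow> int" where
  "partition_rank p = (if p = {#} then 0 else int (Max (set_mset p)) - int (size p))"

definition NT :: "int \<Rightarrow> nat \<Rightarrow> nat \<Rightarrow> nat" where
  "NT m k n = (\<Sum>p\<in>{p \<in> partitions_of n. [partition_rank p = m] (mod int k)}. size p)"

(* Both quotients are exact for positive a, see delta_tilde_exact below. *)
definition delta_tilde :: "nat \<Rightarrow> nat" where
  "delta_tilde a = (if odd a then (23 * 5 ^ a - 19) div 24 else (19 * (5 ^ a - 1)) div 24)"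

(* The sum defining NT ranges over a finite set, so it is not 0 by convention. *)
lemma finite_partitions_of: "finite (partitions_of n)"
proof -
  have "size p \<le> n \<and> set_mset p \<subseteq> {..n}" if "p \<in> partitions_of n" for p
  proof -
    from that have p: "0 \<notin># p" "\<Sum>\<^sub># p = n" by (auto simp: partitions_of_def)
    from p(1) have "size p \<le> \<Sum>\<^sub># p" by (induction p) auto
    moreover have "x \<le> n" if "x \<in># p" for x
      using that p(2) by (metis sum_mset.remove le_add1)
    ultimately show ?thesis using p(2) by auto
  qed
  then have "partitions_of n \<subseteq> mset ` {xs. set xs \<subseteq> {..n} \<and> length xs \<le> n}"
    by (smt (verit, best) ex_mset image_eqI mem_Collect_eq set_mset_mset size_mset subsetI)
  then show ?thesis
    by (rule finite_subset) (intro finite_imageI finite_lists_length_le finite_atMost)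
qed

lemma delta_tilde_exact:
  assumes "a > 0"
  shows "of_nat (delta_tilde a) =
    (if odd a then (23 * 5 ^ a - 19) / 24 else (19 * (5 ^ a - 1)) / 24 :: rat)"
proof -
  have sq: "\<exists>j. (5::nat) ^ (2 * k) = 24 * j + 1" for k
  proof (induction k)
    case (Suc k)
    then obtain j where "(5::nat) ^ (2 * k) = 24 * j + 1" by blast
    then have "(5::nat) ^ (2 * Suc k) = 24 * (25 * j + 1) + 1" by simp
    then show ?case by blast
  qed simp
  show ?thesis
  proof (cases "odd a")
    case True
    then obtain k where "a = Suc (2 * k)" by (metis oddE Suc_eq_plus1)
    moreover obtain j where "(5::nat) ^ (2 * k) = 24 * j + 1" using sq by blast
    ultimately have pow: "(5::nat) ^ a = 24 * (5 * j) + 5" by simp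
    then have "delta_tilde a = 23 * (5 * j) + 4" using True by (simp add: delta_tilde_def)
    moreover have "(5::rat) ^ a = 24 * (5 * of_nat j) + 5"
      using arg_cong[OF pow, of "of_nat :: nat \<Rightarrow> rat"] by simp
    ultimately show ?thesis using True by simp
  next
    case False
    then obtain k where "a = 2 * k" by auto
    moreover obtain j where "(5::nat) ^ (2 * k) = 24 * j + 1" using sq by blast
    ultimately have pow: "(5::nat) ^ a = 24 * j + 1" by simp
    then have "delta_tilde a = 19 * j" using False by (simp add: delta_tilde_def)
    moreover have "(5::rat) ^ a = 24 * of_nat j + 1"
      using arg_cong[OF pow, of "of_nat :: nat \<Rightarrow> rat"] by simp
    ultimately show ?thesis using False by simp
  qed
qed

end

theory Submission
  imports Defs "HOL-Complex_Analysis.Complex_Analysis"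
begin

text \<open>By Dyson's recurrence for the number of partitions of rank at least \<open>m\<close>, the generating function of
  \<open>NT 4 5 N - NT 1 5 N\<close> is the reciprocal Euler product times a Lambert-type sum over nonzero integers. Extracting
  \<open>N = 5 n + 4\<close> by averaging over fifth roots of unity gives sums that are evaluated by partial fractions of
  quotients of theta functions, and everything collapses to the eta quotient \<open>E(q^5)^4 / E(q)\<close>, where
  \<open>E(q) = (1 - q) (1 - q^2) \<dots>\<close>. The congruences then follow in the style of Hirschhorn and Hunt: with
  \<open>\<tau> = q E(q^5)^6 / E(q)^6\<close>, extracting every fifth coefficient maps \<open>E(q^5)^4 / E(q)\<close> times a polynomial in
  \<open>\<tau>\<close> to \<open>E(q^5)^5 / E(q)^2\<close> times such a polynomial and back, and the modular equation of degree 5 shows that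
  each step gains a factor 5 in the coefficients.\<close>

section \<open>Theta functions and the triple product\<close>

text \<open>Conjugation turns \<open>NT 4 5 N - NT 1 5 N\<close> into the sum of the ranks congruent
  to 1 modulo 5; hence the weights r and -r on positive ranks congruent to 1 and 4. The Lambert sum
  has double poles and no term k = 0, so it is read as five times the derivative at u = 0 of
  exp(u/5) L1(exp u) - exp(4u/5) L4(exp u), where L1 and L4 are Lerch sums with one pole removed.
  Their numerators are fifth-root averages of z^e / \<open>euler z\<close>, quasi-periodic in k with
  period 5. So each full Lerch sum should be a quadratic theta expression in base q^5 over
  \<open>theta y q\<close>: the difference satisfies h(y q^5) = C y^3 h(y), and only 0 does so
  holomorphically on the punctured plane. All theta values reduce to one parameter \<open>a\<close>
  with \<open>a * b = 1\<close>; Jacobi's series for the cube of the Euler product supplies the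
  theta derivatives. In the induction, divisibility of all coefficients by 5^\<alpha> does not
  propagate: at the coefficient of \<tau>^2 a step may gain nothing. The hypothesis with exponent
  \<alpha> + floor(5 j / 2) at \<tau>^j does propagate.\<close>

lemma has_sum_diff:
  fixes f g :: "'a \<Rightarrow> 'b :: real_normed_vector"
  assumes "(f has_sum a) A" "(g has_sum b) A"
  shows "((\<lambda>x. f x - g x) has_sum (a - b)) A"
proof -
  have "((\<lambda>x. - g x) has_sum - b) A" using assms(2) by (simp add: has_sum_uminus)
  from has_sum_add[OF assms(1) this] show ?thesis by simp
qed

text \<open>Dominated convergence for unordered sums: the M-test makes the limit over finite subsets
  uniform, so the two limits may be interchanged. It carries the finite triple product, the
  partitions with bounded parts and the truncated rank sums to the limit.\<close>

lemma has_sum_dominated_limit: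
  fixes f :: "nat \<Rightarrow> 'a \<Rightarrow> 'b :: banach"
  assumes sum: "\<And>N. (f N has_sum S N) A"
    and bound: "\<And>N x. x \<in> A \<Longrightarrow> norm (f N x) \<le> M x" and M: "M summable_on A"
    and lim: "\<And>x. x \<in> A \<Longrightarrow> (\<lambda>N. f N x) \<longlonglongrightarrow> g x" and S: "S \<longlonglongrightarrow> L"
  shows "(g has_sum L) A"
proof -
  have gM: "norm (g x) \<le> M x" if "x \<in> A" for x
    by (rule LIMSEQ_le_const2[OF tendsto_norm[OF lim[OF that]]]) (use bound that in blast)
  have "(\<lambda>x. norm (g x)) summable_on A"
    by (rule summable_on_comparison_test[OF M]) (use gM in auto)
  then have "g summable_on A" by (rule abs_summable_summable)
  then obtain l where l: "(g has_sum l) A" by (auto simp: summable_on_def)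
  have unif: "uniform_limit UNIV (\<lambda>X N. \<Sum>x\<in>X. f N x) S (finite_subsets_at_top A)"
    by (rule Weierstrass_m_test_general'[where M = M]) (use bound sum M in auto)
  have "S \<longlonglongrightarrow> l"
  proof (rule swap_uniform_limit'[OF _ _ unif])
    show "\<forall>\<^sub>F X in finite_subsets_at_top A. (\<lambda>N. \<Sum>x\<in>X. f N x) \<longlonglongrightarrow> (\<Sum>x\<in>X. g x)"
      by (rule eventually_finite_subsets_at_top_weakI) (use lim in \<open>auto intro!: tendsto_sum\<close>)
    show "(sum g \<longlongrightarrow> l) (finite_subsets_at_top A)" using l by (simp add: has_sum_def)
  qed auto
  with S l show ?thesis by (metis LIMSEQ_unique)
qed

text \<open>Weierstrass's theorem for unordered sums under domination on small closed discs; it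
  serves both theta series and Lerch sums, including their termwise derivatives.\<close>

lemma holomorphic_infsum:
  assumes S: "open S" and hol: "\<And>k. k \<in> I \<Longrightarrow> f k holomorphic_on S"
    and dom: "\<And>z. z \<in> S \<Longrightarrow> \<exists>r>0. \<exists>M. cball z r \<subseteq> S \<and> M summable_on I \<and> (\<forall>k\<in>I. \<forall>w\<in>cball z r. norm (f k w) \<le> M k)"
  shows "(\<lambda>z. \<Sum>\<^sub>\<infinity>k\<in>I. f k z) holomorphic_on S"
    and "\<And>z. z \<in> S \<Longrightarrow> ((\<lambda>k. deriv (f k) z) has_sum deriv (\<lambda>z. \<Sum>\<^sub>\<infinity>k\<in>I. f k z) z) I"
    and "\<And>z. z \<in> S \<Longrightarrow> ((\<lambda>k. f k z) has_sum (\<Sum>\<^sub>\<infinity>k\<in>I. f k z)) I"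
proof -
  let ?F = "\<lambda>z. \<Sum>\<^sub>\<infinity>k\<in>I. f k z"
  have *: "(?F has_field_derivative deriv ?F z) (at z) \<and> ((\<lambda>k. deriv (f k) z) has_sum deriv ?F z) I \<and> ((\<lambda>k. f k z) has_sum ?F z) I"
    if z: "z \<in> S" for z
  proof -
    obtain r M where r: "r > 0" "cball z r \<subseteq> S" "M summable_on I" "\<forall>k\<in>I. \<forall>w\<in>cball z r. norm (f k w) \<le> M k"
      using dom[OF z] by blast
    have unif: "uniform_limit (cball z r) (\<lambda>X w. \<Sum>k\<in>X. f k w) ?F (finite_subsets_at_top I)"
      by (rule Weierstrass_m_test_general) (use r in auto)
    have "\<forall>\<^sub>F X in finite_subsets_at_top I. continuous_on (cball z r) (\<lambda>w. \<Sum>k\<in>X. f k w) \<and>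
        (\<forall>w\<in>ball z r. ((\<lambda>w. \<Sum>k\<in>X. f k w) has_field_derivative (\<Sum>k\<in>X. deriv (f k) w)) (at w))"
    proof (rule eventually_finite_subsets_at_top_weakI, goal_cases)
      case (1 X)
      have "continuous_on (cball z r) (f k)" if "k \<in> X" for k
        using that 1 hol r by (meson holomorphic_on_imp_continuous_on holomorphic_on_subset subsetD)
      moreover have "(f k has_field_derivative deriv (f k) w) (at w)" if "k \<in> X" "w \<in> ball z r" for k w
        using that 1 hol r S by (meson ball_subset_cball holomorphic_derivI subsetD)
      ultimately show ?case by (auto intro!: continuous_on_sum DERIV_sum)
    qed
    from has_complex_derivative_uniform_limit[OF this unif _ r(1)] obtain g' where g':
      "\<And>w. w \<in> ball z r \<Longrightarrow> (?F has_field_derivative g' w) (at w) \<and> ((\<lambda>X. \<Sum>k\<in>X. deriv (f k) w) \<longlongrightarrow> g' w) (finite_subsets_at_top I)"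
      by auto
    have "z \<in> ball z r" using r by simp
    from g'[OF this] have g'z: "(?F has_field_derivative g' z) (at z)" "((\<lambda>k. deriv (f k) z) has_sum g' z) I"
      by (simp_all add: has_sum_def)
    moreover have "deriv ?F z = g' z" using g'z(1) by (rule DERIV_imp_deriv)
    moreover have "((\<lambda>k. f k z) has_sum ?F z) I"
      using tendsto_uniform_limitI[OF unif, of z] r by (simp add: has_sum_def)
    ultimately show ?thesis by simp
  qed
  show "?F holomorphic_on S" using * S by (auto simp: holomorphic_on_open)
  show "\<And>z. z \<in> S \<Longrightarrow> ((\<lambda>k. deriv (f k) z) has_sum deriv ?F z) I"
    and "\<And>z. z \<in> S \<Longrightarrow> ((\<lambda>k. f k z) has_sum ?F z) I" using * by blast+
qed

lemma summable_on_geometric_int: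
  fixes r :: real
  assumes "0 \<le> r" "r < 1"
  shows "(\<lambda>j. r ^ nat \<bar>j\<bar>) summable_on (UNIV :: int set)"
proof -
  have s: "(\<lambda>n. r ^ n) summable_on (UNIV :: nat set)"
    using assms by (simp add: summable_on_UNIV_nonneg_real_iff)
  have "(\<lambda>j. r ^ nat \<bar>j\<bar>) summable_on {0::int..}"
    using s by (subst summable_on_reindex_bij_witness[where i = int and j = nat and T = UNIV and h = "\<lambda>n. r ^ n"]) auto
  moreover have "(\<lambda>j. r ^ nat \<bar>j\<bar>) summable_on {..0::int}"
    using s by (subst summable_on_reindex_bij_witness[where i = "\<lambda>n. - int n" and j = "\<lambda>j. nat (- j)" and T = UNIV and h = "\<lambda>n. r ^ n"]) auto
  moreover have "{0::int..} \<union> {..0} = UNIV" by auto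
  ultimately show ?thesis by (metis summable_on_union)
qed

text \<open>The factor \<open>y powi j\<close> is a power of \<rho> with exponent linear in j, and a
  positive quadratic exceeds any linear term; completing the square leaves a geometric comparison
  series.\<close>

lemma summable_on_powi_quadratic:
  fixes \<rho> y :: real and e :: "int \<Rightarrow> int"
  assumes \<rho>: "0 < \<rho>" "\<rho> < 1" and y: "0 < y" and \<delta>: "\<delta> > 0"
    and e: "\<And>j. real_of_int (e j) \<ge> \<delta> * (real_of_int j)\<^sup>2 - B * \<bar>real_of_int j\<bar> - C"
  shows "(\<lambda>j. \<rho> powi e j * y powi j) summable_on UNIV"
proof -
  define t where "t = log \<rho> y"
  \<comment> \<open>The summand 1 reserves one copy of the absolute value of j, which becomes the
    exponent of the geometric series.\<close>
  define b where "b = B + \<bar>t\<bar> + 1"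
  define C' where "C' = C + b\<^sup>2 / (4 * \<delta>)"
  have y_eq: "y = \<rho> powr t" using \<rho> y by (simp add: t_def)
  have bd: "\<rho> powi e j * y powi j \<le> \<rho> powr (- C') * \<rho> ^ nat \<bar>j\<bar>" for j
  proof -
    define J where "J = real_of_int j"
    have "\<rho> powi e j * y powi j = \<rho> powr (e j + t * j)"
      using \<rho> by (simp add: y_eq powr_real_of_int' powr_powr powr_add flip: powr_real_of_int')
    also have "e j + t * j \<ge> \<bar>J\<bar> - C'"
    proof -
      have "(2 * \<delta> * \<bar>J\<bar> - b)\<^sup>2 \<ge> 0" by simp
      then have "4 * \<delta> * (\<delta> * J\<^sup>2 - b * \<bar>J\<bar> + b\<^sup>2 / (4 * \<delta>)) \<ge> 0"
        using \<delta> unfolding power2_diff power_mult_distrib power2_abs by (simp add: power2_eq_square algebra_simps)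
      then have "\<delta> * J\<^sup>2 - b * \<bar>J\<bar> + b\<^sup>2 / (4 * \<delta>) \<ge> 0"
        using \<delta> by (simp add: zero_le_mult_iff)
      moreover have "t * J \<ge> - (\<bar>t\<bar> * \<bar>J\<bar>)" by (metis abs_ge_minus_self abs_mult minus_le_iff)
      ultimately show ?thesis using e[of j] unfolding J_def[symmetric] b_def C'_def
        by (simp add: algebra_simps)
    qed
    then have "\<rho> powr (e j + t * j) \<le> \<rho> powr (\<bar>J\<bar> - C')" using \<rho> by (simp add: powr_mono')
    also have "\<dots> = \<rho> powr (- C') * \<rho> ^ nat \<bar>j\<bar>"
      using \<rho> by (simp add: J_def powr_realpow[symmetric] flip: powr_add)
    finally show ?thesis .
  qed
  have "(\<lambda>j. \<rho> powr (- C') * \<rho> ^ nat \<bar>j\<bar>) summable_on UNIV"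
    using \<rho> by (intro summable_on_cmult_right summable_on_geometric_int) auto
  then show ?thesis
    by (rule summable_on_comparison_test) (use bd \<rho> y in auto)
qed

section \<open>Triangular numbers, infinite products and theta functions\<close>

definition tri :: "int \<Rightarrow> int" where "tri j = j * (j - 1) div 2"

lemma two_tri: "2 * tri j = j * (j - 1)"
  unfolding tri_def by (simp add: even_mult_iff)

lemma tri_add_1: "tri (j + 1) = tri j + j" and tri_diff_1: "tri (j - 1) = tri j - j + 1"
  using two_tri[of "j + 1"] two_tri[of "j - 1"] two_tri[of j] by (auto simp: algebra_simps)

lemma real_tri: "real_of_int (tri j) = real_of_int j * (real_of_int j - 1) / 2"
  using two_tri[of j] by (metis (no_types) mult.commute nonzero_mult_div_cancel_right of_int_1 of_int_diff of_int_mult of_int_numeral zero_neq_numeral)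

definition qpoch :: "complex \<Rightarrow> complex \<Rightarrow> complex" where
  "qpoch a q = (\<Prod>n. 1 - a * q ^ n)"

definition euler :: "complex \<Rightarrow> complex" where
  "euler q = qpoch q q"

text \<open>Jacobi's theta function without the factor \<open>euler q\<close> that the triple
  product attaches to it.\<close>

definition theta :: "complex \<Rightarrow> complex \<Rightarrow> complex" where
  "theta y q = qpoch y q * qpoch (q / y) q"

lemma convergent_qpoch:
  assumes "norm (q :: complex) < 1"
  shows "convergent_prod (\<lambda>n. 1 - a * q ^ n)"
proof -
  have "summable (\<lambda>n. norm (a * q ^ n))"
    unfolding norm_mult norm_power using assms by (intro summable_mult summable_geometric) auto
  then show ?thesis
    by (intro abs_convergent_prod_imp_convergent_prod) (simp add: abs_convergent_prod_conv_summable)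
qed

lemma qpoch_LIMSEQ:
  assumes "norm q < 1"
  shows "(\<lambda>n. \<Prod>i<n. 1 - a * q ^ i) \<longlonglongrightarrow> qpoch a q"
  unfolding qpoch_def by (rule has_prod_imp_tendsto'[OF convergent_prod_has_prod[OF convergent_qpoch[OF assms]]])

lemma qpoch_eq_0_iff:
  assumes "norm q < 1"
  shows "qpoch a q = 0 \<longleftrightarrow> (\<exists>n. a * q ^ n = 1)"
proof -
  have "qpoch a q = 0 \<longleftrightarrow> 0 \<in> range (\<lambda>n. 1 - a * q ^ n)"
    unfolding qpoch_def by (rule has_prod_eq_0_iff[OF convergent_prod_has_prod[OF convergent_qpoch[OF assms]]])
  also have "\<dots> \<longleftrightarrow> (\<exists>n. a * q ^ n = 1)" by (auto simp: image_iff)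
  finally show ?thesis .
qed

lemma qpoch_rec:
  assumes "norm q < 1"
  shows "qpoch a q = (1 - a) * qpoch (a * q) q"
proof -
  have "(\<lambda>n. (1 - a) * (\<Prod>i<n. 1 - (a * q) * q ^ i)) \<longlonglongrightarrow> (1 - a) * qpoch (a * q) q"
    by (intro tendsto_intros qpoch_LIMSEQ assms)
  moreover have "(\<lambda>n. (1 - a) * (\<Prod>i<n. 1 - (a * q) * q ^ i)) = (\<lambda>n. \<Prod>i<Suc n. 1 - a * q ^ i)"
    by (subst prod.lessThan_Suc_shift) (simp add: mult.assoc)
  moreover have "(\<lambda>n. \<Prod>i<Suc n. 1 - a * q ^ i) \<longlonglongrightarrow> qpoch a q"
    by (rule LIMSEQ_Suc[OF qpoch_LIMSEQ[OF assms]])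
  ultimately show ?thesis by (metis LIMSEQ_unique)
qed

text \<open>The exponents are sorted by residue modulo \<open>m\<close>; the partial products of
  length N m agree factor by factor.\<close>

lemma qpoch_split:
  assumes "norm q < 1" "m > 0"
  shows "qpoch a q = (\<Prod>i<m. qpoch (a * q ^ i) (q ^ m))"
proof -
  have qm: "norm (q ^ m) < 1" using assms by (simp add: norm_power power_less_one_iff)
  have "(\<lambda>N. \<Prod>i<m. \<Prod>n<N. 1 - (a * q ^ i) * (q ^ m) ^ n) \<longlonglongrightarrow> (\<Prod>i<m. qpoch (a * q ^ i) (q ^ m))"
    by (intro tendsto_intros qpoch_LIMSEQ qm)
  moreover have "(\<Prod>i<m. \<Prod>n<N. 1 - (a * q ^ i) * (q ^ m) ^ n) = (\<Prod>k<N * m. 1 - a * q ^ k)" for N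
  proof -
    have "(\<Prod>k<N * m. 1 - a * q ^ k) = (\<Prod>n<N. \<Prod>k\<in>{n * m..<n * m + m}. 1 - a * q ^ k)"
      by (simp add: prod.nat_group)
    also have "\<dots> = (\<Prod>n<N. \<Prod>i<m. 1 - a * q ^ (i + n * m))"
    proof (rule prod.cong[OF refl])
      fix n
      show "(\<Prod>k\<in>{n * m..<n * m + m}. 1 - a * q ^ k) = (\<Prod>i<m. 1 - a * q ^ (i + n * m))"
        by (rule prod.reindex_bij_witness[of _ "\<lambda>i. i + n * m" "\<lambda>k. k - n * m"]) auto
    qed
    finally have 1: "(\<Prod>k<N * m. 1 - a * q ^ k) = (\<Prod>n<N. \<Prod>i<m. 1 - a * q ^ (i + n * m))" .
    have 2: "(a * q ^ i) * (q ^ m) ^ n = a * q ^ (i + n * m)" for i n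
      by (simp add: power_add mult.commute[of n] flip: power_mult)
    show ?thesis by (subst prod.swap) (simp only: 1 2)
  qed
  moreover have "(\<lambda>N. \<Prod>k<N * m. 1 - a * q ^ k) \<longlonglongrightarrow> qpoch a q"
    using qpoch_LIMSEQ[OF assms(1)] by (rule filterlim_compose) (use assms(2) in \<open>rule mult_nat_right_at_top\<close>)
  ultimately show ?thesis using LIMSEQ_unique by (simp only:) blast
qed

lemma qpoch_holomorphic:
  assumes "norm q < 1"
  shows "(\<lambda>a. qpoch a q) holomorphic_on UNIV"
proof (rule holomorphic_uniform_sequence)
  show "(\<lambda>a. \<Prod>n<N. 1 - a * q ^ n) holomorphic_on UNIV" for N by (intro holomorphic_intros)
  fix z :: complex
  let ?R = "norm z + 1"
  have "uniformly_convergent_on (cball 0 ?R) (\<lambda>N a. \<Prod>n<N. 1 - a * q ^ n)"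
  proof (rule uniformly_convergent_on_prod')
    show "uniformly_convergent_on (cball 0 ?R) (\<lambda>N a. \<Sum>n<N. norm (1 - a * q ^ n - 1))"
    proof (rule Weierstrass_m_test')
      show "norm (norm (1 - a * q ^ n - 1)) \<le> ?R * norm q ^ n" if "a \<in> cball 0 ?R" for n a
        using that by (simp add: norm_mult norm_power mult_right_mono)
      show "summable (\<lambda>n. ?R * norm q ^ n)" using assms by (intro summable_mult summable_geometric) auto
    qed
  qed (auto intro!: continuous_intros)
  then obtain g where g: "uniform_limit (cball 0 ?R) (\<lambda>N a. \<Prod>n<N. 1 - a * q ^ n) g sequentially"
    by (auto simp: uniformly_convergent_on_def)
  have "g a = qpoch a q" if "a \<in> cball 0 ?R" for a
    using tendsto_uniform_limitI[OF g that] qpoch_LIMSEQ[OF assms] LIMSEQ_unique by blast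
  then have "uniform_limit (cball 0 ?R) (\<lambda>N a. \<Prod>n<N. 1 - a * q ^ n) g sequentially \<longleftrightarrow>
      uniform_limit (cball 0 ?R) (\<lambda>N a. \<Prod>n<N. 1 - a * q ^ n) (\<lambda>a. qpoch a q) sequentially"
    by (intro uniform_limit_cong') auto
  with g have "uniform_limit (cball 0 ?R) (\<lambda>N a. \<Prod>n<N. 1 - a * q ^ n) (\<lambda>a. qpoch a q) sequentially" by blast
  then have "uniform_limit (cball z 1) (\<lambda>N a. \<Prod>n<N. 1 - a * q ^ n) (\<lambda>a. qpoch a q) sequentially"
    by (rule uniform_limit_on_subset) (simp add: cball_subset_cball_iff)
  then show "\<exists>d>0. cball z d \<subseteq> UNIV \<and> uniform_limit (cball z d) (\<lambda>N a. \<Prod>n<N. 1 - a * q ^ n) (\<lambda>a. qpoch a q) sequentially"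
    by (intro exI[of _ 1]) auto
qed auto

lemma euler_nonzero:
  assumes "norm q < 1"
  shows "euler q \<noteq> 0"
proof -
  have "q * q ^ n \<noteq> 1" for n
    using assms by (metis norm_one norm_power power_Suc power_less_one_iff less_irrefl norm_ge_zero zero_less_Suc)
  then show ?thesis using qpoch_eq_0_iff[OF assms] by (simp add: euler_def)
qed

lemma theta_mult_q:
  assumes "norm q < 1" "y \<noteq> 0" "q \<noteq> 0"
  shows "theta (y * q) q = - theta y q / y"
proof -
  have "theta (y * q) q = qpoch (y * q) q * qpoch (1 / y) q" using assms by (simp add: theta_def)
  also have "qpoch (1 / y) q = (1 - 1 / y) * qpoch (q / y) q"
    using qpoch_rec[OF assms(1), of "1 / y"] by simp
  also have "qpoch (y * q) q * ((1 - 1 / y) * qpoch (q / y) q) = - ((1 - y) * qpoch (y * q) q) * qpoch (q / y) q / y"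
    using assms by (simp add: field_simps)
  finally show ?thesis using qpoch_rec[OF assms(1), of y] by (simp add: theta_def)
qed

lemma theta_inverse:
  assumes "y \<noteq> 0" "q \<noteq> 0"
  shows "theta (q / y) q = theta y q"
  using assms by (simp add: theta_def)

lemma theta_holomorphic:
  assumes "norm q < 1"
  shows "(\<lambda>y. theta y q) holomorphic_on (- {0})"
  unfolding theta_def
  by (intro holomorphic_intros holomorphic_on_compose_gen[OF _ qpoch_holomorphic[OF assms], unfolded o_def]
      holomorphic_on_subset[OF qpoch_holomorphic[OF assms]]) auto

lemma theta_eq_0_iff:
  assumes "norm q < 1" "y \<noteq> 0" "q \<noteq> 0"
  shows "theta y q = 0 \<longleftrightarrow> (\<exists>k::int. y = q powi k)"
proof -
  have "theta y q = 0 \<longleftrightarrow> (\<exists>n. y * q ^ n = 1) \<or> (\<exists>n. q / y * q ^ n = 1)"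
    by (simp add: theta_def qpoch_eq_0_iff[OF assms(1)])
  also have "\<dots> \<longleftrightarrow> (\<exists>k::int. y = q powi k)"
  proof safe
    fix n :: nat assume "y * q ^ n = 1"
    then show "\<exists>k::int. y = q powi k"
      using assms by (intro exI[of _ "- int n"]) (simp add: power_int_minus field_simps)
  next
    fix n :: nat assume "q / y * q ^ n = 1"
    then show "\<exists>k::int. y = q powi k"
      using assms by (intro exI[of _ "int (Suc n)"]) (simp add: field_simps del: of_nat_Suc)
  next
    fix k :: int
    assume y: "y = q powi k" and *: "\<nexists>n. q / q powi k * q ^ n = 1"
    show "\<exists>n. q powi k * q ^ n = 1"
    proof (cases "k > 0")
      case True
      then obtain m where m: "k = int (Suc m)" by (metis pos_int_cases gr0_conv_Suc)
      have "q / q powi k * q ^ m = 1" using assms unfolding m by (simp del: of_nat_Suc)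
      with * show ?thesis by blast
    next
      case False
      then obtain m where "k = - int m" by (metis linorder_not_less nonpos_int_cases)
      then show ?thesis using assms by (intro exI[of _ m]) (simp add: power_int_minus)
    qed
  qed
  finally show ?thesis .
qed

text \<open>The value 0 at negative indices makes the coefficients of the finite triple product
  vanish outside the range from -N to N, so its sum can run over all integers and index shifts leave
  no boundary terms.\<close>

definition invpoch :: "complex \<Rightarrow> int \<Rightarrow> complex" where
  "invpoch q k = (if k < 0 then 0 else 1 / (\<Prod>i<nat k. 1 - q ^ Suc i))"

lemma one_minus_power_nonzero:
  assumes "norm (q :: complex) < 1"
  shows "1 - q ^ Suc i \<noteq> 0"
  using assms by (metis eq_iff_diff_eq_0 norm_one norm_power power_less_one_iff less_irrefl norm_ge_zero zero_less_Suc)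

lemma invpoch_diff_1:
  assumes "norm q < 1" "q \<noteq> 0"
  shows "invpoch q (k - 1) = (1 - q powi k) * invpoch q k"
proof (cases "k > 0")
  case True
  then obtain m where m: "k = int (Suc m)" by (metis pos_int_cases gr0_conv_Suc)
  then have "nat k = Suc m" "nat (k - 1) = m" by auto
  then have "invpoch q (k - 1) = 1 / (\<Prod>i<m. 1 - q ^ Suc i)" "invpoch q k = 1 / ((\<Prod>i<m. 1 - q ^ Suc i) * (1 - q ^ Suc m))"
    using True by (simp_all add: invpoch_def)
  moreover have "q powi k = q ^ Suc m" unfolding m by (rule power_int_of_nat)
  ultimately show ?thesis using one_minus_power_nonzero[OF assms(1), of m] by simp
next
  case False
  then show ?thesis by (cases "k = 0") (auto simp: invpoch_def)
qed

text \<open>Passing from N to N + 1 multiplies the product by (1 - y q^N)(1 - q^(N+1)/y), which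
  mixes the sum with its two index shifts. Up to sign and a power of q the coefficients are central
  q-binomial coefficients, and the step is one relation between three neighbours.\<close>

lemma finite_triple_product:
  fixes q y :: complex
  assumes "norm q < 1" "y \<noteq> 0" "q \<noteq> 0"
  shows "((\<lambda>j. (-1) powi j * q powi tri j * (\<Prod>i<2*N. 1 - q ^ Suc i) * invpoch q (int N + j) * invpoch q (int N - j) * y powi j)
    has_sum (\<Prod>i<N. (1 - y * q ^ i) * (1 - q / y * q ^ i))) UNIV"
proof (induction N)
  case 0
  have "invpoch q j * invpoch q (- j) = 0" if "j \<noteq> 0" for j using that by (auto simp: invpoch_def)
  then have *: "(-1) powi j * q powi tri j * (\<Prod>i<2*0. 1 - q ^ Suc i) * invpoch q (int 0 + j) * invpoch q (int 0 - j) * y powi j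
      = (if j = 0 then 1 else 0)" for j :: int
    by (auto simp: mult.assoc invpoch_def tri_def)
  have "((\<lambda>j :: int. if j = 0 then 1 else 0 :: complex) has_sum 1) {0}"
    by (rule has_sum_finiteI) auto
  then have "((\<lambda>j :: int. if j = 0 then 1 else 0 :: complex) has_sum 1) UNIV"
    by (rule has_sum_cong_neutral[THEN iffD1, rotated -1]) auto
  then show ?case unfolding * by simp
next
  case (Suc N)
  define c where "c = (\<lambda>N j. (-1) powi j * q powi tri j * (\<Prod>i<2*N. 1 - q ^ Suc i) * invpoch q (int N + j) * invpoch q (int N - j))"
  define F where "F = (\<lambda>N. \<Prod>i<N. (1 - y * q ^ i) * (1 - q / y * q ^ i))"
  have IH: "((\<lambda>j. c N j * y powi j) has_sum F N) UNIV" using Suc unfolding c_def F_def .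
  have "((\<lambda>j. (c N j * y powi j) * y) has_sum F N * y) UNIV" using IH by (rule has_sum_cmult_left)
  also have "?this \<longleftrightarrow> ((\<lambda>j. c N (j - 1) * y powi j) has_sum F N * y) UNIV"
    by (rule has_sum_reindex_bij_witness[where i = "\<lambda>j. j - 1" and j = "\<lambda>j. j + 1"])
      (use assms in \<open>auto simp: power_int_add\<close>)
  finally have up: "((\<lambda>j. c N (j - 1) * y powi j) has_sum F N * y) UNIV" .
  have "((\<lambda>j. (c N j * y powi j) * (1 / y)) has_sum F N * (1 / y)) UNIV" using IH by (rule has_sum_cmult_left)
  also have "?this \<longleftrightarrow> ((\<lambda>j. c N (j + 1) * y powi j) has_sum F N * (1 / y)) UNIV"
    by (rule has_sum_reindex_bij_witness[where i = "\<lambda>j. j + 1" and j = "\<lambda>j. j - 1"])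
      (use assms in \<open>auto simp: power_int_diff\<close>)
  finally have dn: "((\<lambda>j. c N (j + 1) * y powi j) has_sum F N * (1 / y)) UNIV" .
  have "((\<lambda>j. (1 + q ^ (2*N+1)) * (c N j * y powi j) - q ^ N * (c N (j - 1) * y powi j) - q ^ (N+1) * (c N (j + 1) * y powi j))
    has_sum ((1 + q ^ (2*N+1)) * F N - q ^ N * (F N * y) - q ^ (N+1) * (F N * (1 / y)))) UNIV"
    by (intro has_sum_diff has_sum_cmult_right IH up dn)
  moreover have "(1 + q ^ (2*N+1)) * F N - q ^ N * (F N * y) - q ^ (N+1) * (F N * (1 / y)) = F (Suc N)"
  proof -
    have "q ^ (2 * N + 1) = q ^ N * (q * q ^ N)" by (simp add: mult_2 power_add)
    then show ?thesis using assms by (simp add: F_def field_simps)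
  qed
  moreover have "(1 + q ^ (2*N+1)) * (c N j * y powi j) - q ^ N * (c N (j - 1) * y powi j) - q ^ (N+1) * (c N (j + 1) * y powi j)
    = c (Suc N) j * y powi j" for j
  proof -
    define X where "X = q powi j"
    define Y where "Y = q ^ N"
    define \<alpha> where "\<alpha> = invpoch q (int N + 1 + j)"
    define \<beta> where "\<beta> = invpoch q (int N + 1 - j)"
    define P where "P = (\<Prod>i<2*N. 1 - q ^ Suc i)"
    \<comment> \<open>\<alpha> and \<beta> are taken at the largest indices that occur, so all old
      coefficients and the new one are \<open>s\<close> times a rational expression in q, X and
      Y.\<close>
    define s where "s = (-1) powi j * q powi tri j * P * \<alpha> * \<beta>"
    have X0: "X \<noteq> 0" using assms by (simp add: X_def)
    note inv = invpoch_diff_1[OF assms(1,3)]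
    have p: "q powi (int N + 1 + j) = q * Y * X" "q powi (int N + j) = Y * X"
      "q powi (int N + 1 - j) = q * Y / X" "q powi (int N - j) = Y / X"
      using assms by (simp_all add: power_int_add power_int_diff X_def Y_def)
    have a1: "invpoch q (int N + j) = (1 - q * Y * X) * \<alpha>"
      using inv[of "int N + 1 + j"] p by (simp add: \<alpha>_def)
    have a2: "invpoch q (int N + (j - 1)) = (1 - Y * X) * (1 - q * Y * X) * \<alpha>"
      using inv[of "int N + j"] p a1 by (simp add: add_diff_eq)
    have b1: "invpoch q (int N - j) = (1 - q * Y / X) * \<beta>"
      using inv[of "int N + 1 - j"] p by (simp add: \<beta>_def)
    have b2: "invpoch q (int N - (j + 1)) = (1 - Y / X) * (1 - q * Y / X) * \<beta>"
      using inv[of "int N - j"] p b1 by (simp add: diff_diff_eq)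
    have t: "q powi tri (j - 1) = q powi tri j * q / X" "q powi tri (j + 1) = q powi tri j * X"
      using assms by (simp_all add: tri_add_1 tri_diff_1 power_int_add power_int_diff X_def)
    have sg: "(-1) powi (j - 1) = - ((-1 :: complex) powi j)" "(-1) powi (j + 1) = - ((-1 :: complex) powi j)"
      by (simp_all add: power_int_add power_int_diff)
    have c0: "c N j = s * (1 - q * Y * X) * (1 - q * Y / X)"
      unfolding c_def a1 b1 s_def P_def by simp
    have c1: "c N (j - 1) = - s * q / X * (1 - Y * X) * (1 - q * Y * X)"
      unfolding c_def a2 t sg s_def P_def \<beta>_def by (simp add: algebra_simps)
    have c2: "c N (j + 1) = - s * X * (1 - Y / X) * (1 - q * Y / X)"
      unfolding c_def b2 t sg s_def P_def \<alpha>_def by (simp add: add_ac)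
    have c3: "c (Suc N) j = s * (1 - q * Y\<^sup>2) * (1 - q\<^sup>2 * Y\<^sup>2)"
    proof -
      have "(\<Prod>i<2 * Suc N. 1 - q ^ Suc i) = P * (1 - q * Y\<^sup>2) * (1 - q\<^sup>2 * Y\<^sup>2)"
      proof -
        have "(\<Prod>i<2 * Suc N. 1 - q ^ Suc i) = P * (1 - q * q ^ (2 * N)) * (1 - q * (q * q ^ (2 * N)))"
          by (simp add: P_def)
        then show ?thesis by (simp add: Y_def power_even_eq power2_eq_square mult.assoc)
      qed
      then show ?thesis unfolding c_def s_def \<alpha>_def \<beta>_def by (simp add: add_ac add_diff_eq)
    qed
    have "(1 + q * Y\<^sup>2) * (s * (1 - q * Y * X) * (1 - q * Y / X)) - Y * (- s * q / X * (1 - Y * X) * (1 - q * Y * X))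
       - q * Y * (- s * X * (1 - Y / X) * (1 - q * Y / X)) = s * (1 - q * Y\<^sup>2) * (1 - q\<^sup>2 * Y\<^sup>2)"
      using X0 by (simp add: divide_simps) (simp add: power2_eq_square algebra_simps)
    moreover have "q ^ (2 * N) = Y\<^sup>2" "q ^ N = Y"
      by (simp_all add: Y_def power_even_eq)
    ultimately have *: "(1 + q ^ (2*N+1)) * c N j - q ^ N * c N (j - 1) - q ^ (N+1) * c N (j + 1) = c (Suc N) j"
      unfolding c0 c1 c2 c3 by simp
    have "(1 + q ^ (2*N+1)) * (c N j * y powi j) - q ^ N * (c N (j - 1) * y powi j) - q ^ (N+1) * (c N (j + 1) * y powi j)
      = ((1 + q ^ (2*N+1)) * c N j - q ^ N * c N (j - 1) - q ^ (N+1) * c N (j + 1)) * y powi j"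
      by (simp only: left_diff_distrib mult.assoc)
    then show ?thesis by (simp only: *)
  qed
  ultimately show ?case unfolding c_def F_def by simp
qed

lemma summable_on_theta_norm:
  fixes q y :: complex
  assumes "norm q < 1" "q \<noteq> 0" "y \<noteq> 0"
  shows "(\<lambda>j. norm q powi tri j * norm y powi j) summable_on UNIV"
  by (rule summable_on_powi_quadratic[where \<delta> = "1/2" and B = "1/2" and C = 0])
    (use assms in \<open>auto simp: real_tri field_simps power2_eq_square\<close>)

text \<open>Limit of the finite version: the q-binomial coefficients tend to 1 /
  \<open>euler q\<close>, and uniform bounds on the finite products and their reciprocals dominate
  the terms by a theta series of norms.\<close>

theorem triple_product:
  fixes q y :: complex
  assumes "norm q < 1" "y \<noteq> 0" "q \<noteq> 0"
  shows "((\<lambda>j. (-1) powi j * q powi tri j * y powi j) has_sum euler q * theta y q) UNIV"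
proof -
  define Q where "Q = (\<lambda>n. \<Prod>i<n. 1 - q ^ Suc i)"
  have Q: "Q \<longlonglongrightarrow> euler q" using qpoch_LIMSEQ[OF assms(1), of q] by (simp add: Q_def euler_def)
  have Q0: "Q n \<noteq> 0" for n using one_minus_power_nonzero[OF assms(1)] by (auto simp: Q_def)
  obtain K1 where K1: "\<And>n. norm (Q n) \<le> K1" using convergent_imp_Bseq[of Q] Q by (auto simp: convergent_def Bseq_def)
  have iQ: "(\<lambda>n. 1 / Q n) \<longlonglongrightarrow> 1 / euler q" by (intro tendsto_intros Q euler_nonzero assms)
  obtain K2 where K2: "\<And>n. norm (1 / Q n) \<le> K2" "K2 > 0" using convergent_imp_Bseq[of "\<lambda>n. 1 / Q n"] iQ by (auto simp: convergent_def Bseq_def)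
  have "invpoch q k = (if k < 0 then 0 else 1 / Q (nat k))" for k by (simp add: invpoch_def Q_def)
  then have iv: "norm (invpoch q k) \<le> K2" for k using K2 by (cases "k < 0") (auto intro: less_imp_le)
  define f where "f = (\<lambda>N j. (-1) powi j * q powi tri j * Q (2*N) * invpoch q (int N + j) * invpoch q (int N - j) * y powi j)"
  have "((\<lambda>j. (-1) powi j * q powi tri j * euler q * (1 / euler q) * (1 / euler q) * y powi j) has_sum theta y q) UNIV"
  proof (rule has_sum_dominated_limit[where f = f])
    show "(f N has_sum (\<Prod>i<N. (1 - y * q ^ i) * (1 - q / y * q ^ i))) UNIV" for N
      unfolding f_def Q_def by (rule finite_triple_product[OF assms])
    show "norm (f N j) \<le> K1 * K2 * K2 * (norm q powi tri j * norm y powi j)" for N j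
    proof -
      have "norm (f N j) = norm (Q (2*N)) * norm (invpoch q (int N + j)) * norm (invpoch q (int N - j)) * (norm q powi tri j * norm y powi j)"
        by (simp add: f_def norm_mult norm_power_int)
      also have "\<dots> \<le> K1 * K2 * K2 * (norm q powi tri j * norm y powi j)"
        by (intro mult_right_mono mult_mono K1 iv mult_nonneg_nonneg) (use K1[of 0] K2 norm_ge_zero[of "Q 0"] in \<open>auto intro: order_trans[OF norm_ge_zero]\<close>)
      finally show ?thesis .
    qed
    show "(\<lambda>j. K1 * K2 * K2 * (norm q powi tri j * norm y powi j)) summable_on UNIV"
      by (intro summable_on_cmult_right summable_on_theta_norm assms)
    show "(\<lambda>N. f N j) \<longlonglongrightarrow> (-1) powi j * q powi tri j * euler q * (1 / euler q) * (1 / euler q) * y powi j" for j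
    proof -
      have "(\<lambda>N. invpoch q (int N + i)) \<longlonglongrightarrow> 1 / euler q" for i
      proof -
        have "filterlim (\<lambda>N. nat (int N + i)) at_top sequentially"
          unfolding filterlim_at_top
        proof
          fix Z show "\<forall>\<^sub>F N in sequentially. Z \<le> nat (int N + i)"
            using eventually_ge_at_top[of "Z + nat (- i)"] by eventually_elim auto
        qed
        then have "(\<lambda>N. 1 / Q (nat (int N + i))) \<longlonglongrightarrow> 1 / euler q" by (rule filterlim_compose[OF iQ])
        moreover have "\<forall>\<^sub>F N in sequentially. invpoch q (int N + i) = 1 / Q (nat (int N + i))"
          using eventually_ge_at_top[of "nat (- i)"] by eventually_elim (auto simp: invpoch_def Q_def)
        ultimately show ?thesis by (simp add: tendsto_cong)
      qed
      from this[of j] this[of "- j"] have "(\<lambda>N. invpoch q (int N + j)) \<longlonglongrightarrow> 1 / euler q" "(\<lambda>N. invpoch q (int N - j)) \<longlonglongrightarrow> 1 / euler q"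
        by simp_all
      moreover have "(\<lambda>N. Q (2*N)) \<longlonglongrightarrow> euler q"
        using Q by (rule filterlim_compose) (simp add: mult_nat_left_at_top)
      ultimately show ?thesis unfolding f_def by (intro tendsto_intros)
    qed
    show "(\<lambda>N. \<Prod>i<N. (1 - y * q ^ i) * (1 - q / y * q ^ i)) \<longlonglongrightarrow> theta y q"
      unfolding prod.distrib theta_def by (intro tendsto_intros qpoch_LIMSEQ assms)
  qed
  then have "((\<lambda>j. euler q * ((-1) powi j * q powi tri j * euler q * (1 / euler q) * (1 / euler q) * y powi j)) has_sum euler q * theta y q) UNIV"
    by (rule has_sum_cmult_right)
  then show ?thesis using euler_nonzero[OF assms(1)] by (simp add: field_simps)
qed

section \<open>The 5-dissection of the Euler product\<close>

lemma power_int_power_nat: "(x :: complex) \<noteq> 0 \<Longrightarrow> (x ^ n) powi k = x powi (int n * k)"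
  by (simp add: power_int_mult)

text \<open>The triple product in base x^3 at x^2: the three classes of exponents modulo 3
  reassemble to \<open>euler x\<close>. The exponent is k(3k + 1)/2, and this way of writing it
  recurs in the rank series.\<close>

theorem pentagonal_number:
  fixes x :: complex
  assumes "norm x < 1" "x \<noteq> 0"
  shows "((\<lambda>k. (-1) powi k * x powi (3 * tri k + 2 * k)) has_sum euler x) UNIV"
proof -
  have x3: "norm (x ^ 3) < 1" using assms by (simp add: norm_power power_less_one_iff)
  have "((\<lambda>j. (-1) powi j * (x ^ 3) powi tri j * (x ^ 2) powi j) has_sum euler (x ^ 3) * theta (x ^ 2) (x ^ 3)) UNIV"
    by (rule triple_product) (use assms x3 in auto)
  moreover have "(-1) powi j * (x ^ 3) powi tri j * (x ^ 2) powi j = (-1) powi j * x powi (3 * tri j + 2 * j)" for j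
    using assms by (simp add: power_int_power_nat power_int_add)
  moreover have "euler (x ^ 3) * theta (x ^ 2) (x ^ 3) = euler x"
  proof -
    have "{..<3::nat} = {0, 1, 2}" by auto
    moreover have "x ^ 3 / x ^ 2 = x" using assms by (simp add: eval_nat_numeral)
    moreover have "x * x ^ 2 = x ^ 3" "x * x = x ^ 2" by (simp_all add: eval_nat_numeral)
    ultimately show ?thesis
      using qpoch_split[OF assms(1), of 3 x] by (simp add: euler_def theta_def)
  qed
  ultimately show ?thesis by simp
qed

text \<open>The triple product differentiated termwise in y. The factor \<open>y\<close> restores
  the exponent lost by differentiation, so the theta series reappears weighted by
  \<open>j\<close>.\<close>

lemma theta_derivative_sum:
  fixes q y :: complex
  assumes "norm q < 1" "q \<noteq> 0" "y \<noteq> 0"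
  shows "((\<lambda>j. of_int j * ((-1) powi j * q powi tri j * y powi j)) has_sum euler q * (y * deriv (\<lambda>y. theta y q) y)) UNIV"
proof -
  let ?f = "\<lambda>j y. (-1) powi j * q powi tri j * y powi j"
  have dom: "\<exists>r>0. \<exists>M. cball z r \<subseteq> - {0} \<and> M summable_on UNIV \<and> (\<forall>k\<in>UNIV. \<forall>w\<in>cball z r. norm (?f k w) \<le> M k)"
    if "z \<in> - {0}" for z
  proof -
    define r where "r = norm z / 2"
    have r: "r > 0" using that by (simp add: r_def)
    \<comment> \<open>On the closed disc the norm of w lies between r and 3 r; the first summand
      covers nonnegative powers of w, the second negative ones.\<close>
    define M where "M = (\<lambda>j. norm q powi tri j * norm (complex_of_real (3 * r)) powi j + norm q powi tri j * norm (complex_of_real r) powi j)"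
    have "M summable_on UNIV" unfolding M_def
      by (intro summable_on_add summable_on_theta_norm) (use assms r in auto)
    moreover have wr: "r \<le> norm w \<and> norm w \<le> 3 * r" if "w \<in> cball z r" for w
    proof -
      have "norm z \<le> norm w + dist z w" by (metis add.commute dist_norm norm_triangle_sub)
      moreover have "norm w \<le> norm z + dist z w" by (metis dist_commute dist_norm norm_triangle_sub)
      ultimately show ?thesis using that by (simp add: r_def)
    qed
    moreover have "norm (?f k w) \<le> M k" if "w \<in> cball z r" for k w
    proof -
      have "norm w powi k \<le> (3 * r) powi k + r powi k"
      proof (cases "k \<ge> 0")
        case True
        have "norm w powi k \<le> (3 * r) powi k" by (rule power_int_mono) (use wr[OF that] True in auto)
        moreover have "r powi k \<ge> 0" using r by simp
        ultimately show ?thesis by linarith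
      next
        case False
        have "norm w powi k \<le> r powi k" by (rule power_int_antimono) (use wr[OF that] False r in auto)
        moreover have "(3 * r) powi k \<ge> 0" using r by simp
        ultimately show ?thesis by linarith
      qed
      then have "norm q powi tri k * norm w powi k \<le> norm q powi tri k * ((3 * r) powi k + r powi k)"
        by (intro mult_left_mono) auto
      then show ?thesis using r by (simp add: M_def norm_mult norm_power_int distrib_left)
    qed
    moreover have "cball z r \<subseteq> - {0}"
    proof
      fix w assume "w \<in> cball z r"
      from wr[OF this] r show "w \<in> - {0}" by auto
    qed
    ultimately show ?thesis using r by blast
  qed
  have hol: "?f k holomorphic_on - {0}" for k by (auto intro!: holomorphic_intros)
  have eq: "(\<Sum>\<^sub>\<infinity>k. ?f k w) = euler q * theta w q" if "w \<in> - {0}" for w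
    using triple_product[of q w] assms that by (simp add: infsumI)
  have "((\<lambda>k. deriv (?f k) y) has_sum deriv (\<lambda>z. \<Sum>\<^sub>\<infinity>k. ?f k z) y) UNIV"
    by (rule holomorphic_infsum(2)[OF _ hol dom]) (use assms in auto)
  moreover have "deriv (?f k) y = of_int k * ((-1) powi k * q powi tri k * y powi (k - 1))" for k
    by (rule DERIV_imp_deriv) (use assms in \<open>auto intro!: derivative_eq_intros\<close>)
  moreover have "deriv (\<lambda>z. \<Sum>\<^sub>\<infinity>k. ?f k z) y = euler q * deriv (\<lambda>y. theta y q) y"
  proof -
    have "deriv (\<lambda>z. \<Sum>\<^sub>\<infinity>k. ?f k z) y = deriv (\<lambda>w. euler q * theta w q) y"
    proof (rule deriv_cong_ev[OF _ refl])
      have "eventually (\<lambda>w. w \<in> - {0}) (nhds y)" using assms by (intro eventually_nhds_in_open) auto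
      then show "\<forall>\<^sub>F w in nhds y. (\<Sum>\<^sub>\<infinity>k. ?f k w) = euler q * theta w q"
        by eventually_elim (rule eq)
    qed
    also have "\<dots> = euler q * deriv (\<lambda>y. theta y q) y"
      by (rule deriv_cmult) (use theta_holomorphic[OF assms(1)] assms in \<open>auto simp: holomorphic_on_open field_differentiable_def open_Compl\<close>)
    finally show ?thesis .
  qed
  ultimately have "((\<lambda>k. of_int k * ((-1) powi k * q powi tri k * y powi (k - 1))) has_sum euler q * deriv (\<lambda>y. theta y q) y) UNIV" by simp
  then have "((\<lambda>k. y * (of_int k * ((-1) powi k * q powi tri k * y powi (k - 1)))) has_sum y * (euler q * deriv (\<lambda>y. theta y q) y)) UNIV"
    by (rule has_sum_cmult_right)
  moreover have "y * (of_int k * ((-1) powi k * q powi tri k * y powi (k - 1))) = of_int k * ((-1) powi k * q powi tri k * y powi k)" for k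
  proof -
    have "y powi k = y * y powi (k - 1)" using assms by (simp add: power_int_diff)
    then show ?thesis by (simp only: mult_ac)
  qed
  ultimately show ?thesis by (simp only: mult.left_commute[of y "euler q"])
qed

text \<open>Once the factor 1 - y is split off, the derivative at its zero is minus the value of the
  cofactor.\<close>

lemma deriv_theta_1:
  assumes "norm q < 1"
  shows "((\<lambda>y. theta y q) has_field_derivative - (euler q)\<^sup>2) (at 1)"
proof -
  define G where "G = (\<lambda>y. qpoch (y * q) q * qpoch (q / y) q)"
  have "G holomorphic_on - {0}" unfolding G_def
    by (intro holomorphic_intros holomorphic_on_compose_gen[OF _ qpoch_holomorphic[OF assms], unfolded o_def]) auto
  then obtain G' where G': "(G has_field_derivative G') (at 1)"
    by (metis Compl_iff empty_iff holomorphic_derivI insert_iff open_Compl closed_singleton zero_neq_one)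
  have "((\<lambda>y. (1 - y) * G y) has_field_derivative - (euler q)\<^sup>2) (at 1)"
    by (rule derivative_eq_intros G' refl)+ (simp add: G_def euler_def power2_eq_square)
  moreover have "(\<lambda>y. theta y q) = (\<lambda>y. (1 - y) * G y)"
    unfolding theta_def G_def by (rule ext, subst qpoch_rec[OF assms]) (simp only: mult.assoc)
  ultimately show ?thesis by simp
qed

text \<open>The two-sided form of Jacobi's series; the terms j and 1 - j together give the usual one
  with coefficients 2 j - 1.\<close>

theorem jacobi_cube:
  assumes "norm q < 1" "q \<noteq> 0"
  shows "((\<lambda>j. of_int j * ((-1) powi j * q powi tri j)) has_sum - (euler q ^ 3)) UNIV"
  using theta_derivative_sum[OF assms, of 1] DERIV_imp_deriv[OF deriv_theta_1[OF assms(1)]]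
  by (simp add: power3_eq_cube power2_eq_square mult.assoc)

lemma has_sum_mod5:
  fixes f :: "int \<Rightarrow> complex"
  assumes "(f has_sum S) UNIV"
  shows "S = (\<Sum>\<^sub>\<infinity>m. f (5 * m)) + (\<Sum>\<^sub>\<infinity>m. f (5 * m + 1)) + (\<Sum>\<^sub>\<infinity>m. f (5 * m + 2)) + (\<Sum>\<^sub>\<infinity>m. f (5 * m + 3)) + (\<Sum>\<^sub>\<infinity>m. f (5 * m + 4))"
    and "(\<lambda>m. f (5 * m + r)) summable_on UNIV"
proof -
  have sub: "f summable_on B" for B using assms by (meson has_sum_imp_summable summable_on_subset_banach subset_UNIV)
  have bij: "bij_betw (\<lambda>m. 5 * m + r) UNIV (range (\<lambda>m. 5 * m + r))" for r :: int
    by (simp add: bij_betw_def inj_on_def)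
  show "(\<lambda>m. f (5 * m + r)) summable_on UNIV" for r
    using sub summable_on_reindex_bij_betw[OF bij[of r], of f] by blast
  define B where "B = (\<lambda>r :: int. range (\<lambda>m. 5 * m + r))"
  have Bsum: "(f has_sum (\<Sum>\<^sub>\<infinity>m. f (5 * m + r))) (B r)" for r
    using sub infsum_reindex_bij_betw[OF bij[of r], of f] by (simp add: B_def)
  have "(f has_sum (\<Sum>r\<in>{0, 1, 2, 3, 4}. \<Sum>\<^sub>\<infinity>m. f (5 * m + r))) (\<Union>r\<in>{0, 1, 2, 3, 4}. B r)"
  proof (rule sum_has_sum)
    show "B r \<inter> B s = {}" if "r \<in> {0, 1, 2, 3, 4}" "s \<in> {0, 1, 2, 3, 4}" "r \<noteq> s" for r s
    proof -
      have "5 * m + r \<noteq> 5 * k + s" for m k using that by (auto; presburger)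
      then show ?thesis by (auto simp: B_def)
    qed
  qed (use Bsum in auto)
  moreover have "(\<Union>r\<in>{0, 1, 2, 3, 4}. B r) = UNIV"
  proof -
    have "k \<in> B (k mod 5)" for k unfolding B_def by (rule range_eqI[of _ _ "k div 5"]) simp
    moreover have "k mod 5 \<in> {0, 1, 2, 3, 4}" for k :: int by (auto; presburger)
    ultimately show ?thesis by blast
  qed
  ultimately show "S = (\<Sum>\<^sub>\<infinity>m. f (5 * m)) + (\<Sum>\<^sub>\<infinity>m. f (5 * m + 1)) + (\<Sum>\<^sub>\<infinity>m. f (5 * m + 2)) + (\<Sum>\<^sub>\<infinity>m. f (5 * m + 3)) + (\<Sum>\<^sub>\<infinity>m. f (5 * m + 4))"
    using has_sum_unique[OF assms] by (simp add: add.assoc)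
qed

text \<open>A polynomial of degree at most 4 with five roots is 0. This separates the exponent
  classes modulo 5 of an identity in x whose coefficients depend on x^5 only.\<close>

lemma fifth_root_extract:
  fixes c0 c1 c2 c3 c4 :: complex
  assumes "\<And>w. w ^ 5 = 1 \<Longrightarrow> c0 + c1 * w + c2 * w ^ 2 + c3 * w ^ 3 + c4 * w ^ 4 = 0"
  shows "c0 = 0 \<and> c1 = 0 \<and> c2 = 0 \<and> c3 = 0 \<and> c4 = 0"
proof -
  define p where "p = [:c0, c1, c2, c3, c4:]"
  have "p = 0"
  proof (rule ccontr)
    assume p: "p \<noteq> 0"
    have sub: "{w. w ^ 5 = 1} \<subseteq> {w. poly p w = 0}"
      using assms by (auto simp: p_def eval_nat_numeral algebra_simps)
    have "card {w :: complex. w ^ 5 = 1} \<le> card {w. poly p w = 0}"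
      by (rule card_mono[OF poly_roots_finite[OF p] sub])
    also have "\<dots> \<le> degree p" by (rule card_poly_roots_bound[OF p])
    finally have "card {w :: complex. w ^ 5 = 1} \<le> degree p" .
    moreover have "card {w :: complex. w ^ 5 = 1} = 5" by (rule card_roots_unity_eq) simp
    moreover have "degree p \<le> 4" by (simp add: p_def)
    ultimately show False by simp
  qed
  then show ?thesis by (simp add: p_def)
qed

lemma has_sum_product_complex:
  fixes f :: "'a \<Rightarrow> complex" and g :: "'b \<Rightarrow> complex"
  assumes "(f has_sum a) A" "(g has_sum b) B"
  shows "((\<lambda>(x, y). f x * g y) has_sum a * b) (A \<times> B)"
proof (rule has_sum_SigmaI)
  show "((\<lambda>y. (case (x, y) of (x, y) \<Rightarrow> f x * g y)) has_sum f x * b) B" if "x \<in> A" for x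
    using has_sum_cmult_right[OF assms(2), of "f x"] by simp
  show "((\<lambda>x. f x * b) has_sum a * b) A" by (rule has_sum_cmult_left[OF assms(1)])
  have fs: "(\<lambda>x. norm (f x)) summable_on A" and gs: "(\<lambda>y. norm (g y)) summable_on B"
    using assms summable_on_iff_abs_summable_on_complex has_sum_imp_summable by blast+
  have "(\<lambda>(x, y). norm (f x) * norm (g y)) summable_on A \<times> B"
  proof (rule summable_on_SigmaI)
    show "((\<lambda>y. (case (x, y) of (x, y) \<Rightarrow> norm (f x) * norm (g y))) has_sum norm (f x) * (\<Sum>\<^sub>\<infinity>y\<in>B. norm (g y))) B" for x
      using has_sum_cmult_right[OF has_sum_infsum[OF gs], of "norm (f x)"] by simp
    show "(\<lambda>x. norm (f x) * (\<Sum>\<^sub>\<infinity>y\<in>B. norm (g y))) summable_on A" by (rule summable_on_cmult_left[OF fs])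
  qed auto
  then have "(\<lambda>z. norm (case z of (x, y) \<Rightarrow> f x * g y)) summable_on A \<times> B"
    by (simp add: case_prod_unfold norm_mult)
  then show "(\<lambda>(x, y). f x * g y) summable_on A \<times> B" by (rule abs_summable_summable)
qed

lemma tri_mod5: "tri (5 * m + r) = 25 * tri m + (10 + 5 * r) * m + tri r"
proof -
  have "2 * tri (5 * m + r) = 2 * (25 * tri m + (10 + 5 * r) * m + tri r)"
    unfolding distrib_left two_tri mult.left_commute[of 2 25] by (simp add: two_tri algebra_simps)
  then show ?thesis by simp
qed

lemma tri_values: "tri 0 = 0" "tri 1 = 0" "tri 2 = 1" "tri 3 = 3" "tri 4 = 6" "tri 5 = 10"
  by (simp_all add: tri_def)

lemma infsum_theta:
  assumes "norm q < 1" "q \<noteq> 0" "y \<noteq> 0"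
  shows "(\<Sum>\<^sub>\<infinity>m. c * ((-1) powi m * q powi tri m * y powi m)) = c * (euler q * theta y q)"
  using triple_product[OF assms(1,3,2)] by (auto intro!: infsumI has_sum_cmult_right)

lemma euler_theta_cube:
  assumes "norm x < 1" "x \<noteq> 0"
  shows "euler (x ^ 3) * theta x (x ^ 3) = euler x"
proof -
  have "{..<3::nat} = {0, 1, 2}" by auto
  moreover have "x ^ 3 / x = x ^ 2" using assms by (simp add: eval_nat_numeral)
  moreover have "x * x ^ 2 = x ^ 3" "x * x = x ^ 2" by (simp_all add: eval_nat_numeral)
  ultimately show ?thesis
    using qpoch_split[OF assms(1), of 3 x] by (simp add: euler_def theta_def)
qed

text \<open>\<open>dissA (x ^ 5)\<close> and -x^2 \<open>dissB (x ^ 5)\<close> are the parts of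
  \<open>euler x\<close> with exponents 0 and 2 modulo 5; each collects two of the five classes of
  summation indices in the pentagonal series.\<close>

definition dissA :: "complex \<Rightarrow> complex" where
  "dissA q = euler (q ^ 15) * (theta (q ^ 8) (q ^ 15) + q * theta (q ^ 2) (q ^ 15))"

definition dissB :: "complex \<Rightarrow> complex" where
  "dissB q = euler (q ^ 15) * (theta (q ^ 11) (q ^ 15) - q * theta (q ^ 14) (q ^ 15))"

lemma norm_power_less_1: "norm (x :: complex) < 1 \<Longrightarrow> n > 0 \<Longrightarrow> norm (x ^ n) < 1"
  by (simp add: norm_power power_less_one_iff)

text \<open>For k = 0, ..., 4 the exponent k(3k + 1)/2 is 0, 2, 2, 0, 1 modulo 5. The classes 0 and
  3 of k give \<open>dissA\<close>, the classes 1 and 2 give \<open>dissB\<close>, and the class 4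
  is a theta function that collapses to \<open>euler (x ^ 25)\<close>.\<close>

lemma euler_dissection:
  fixes x :: complex
  assumes "norm x < 1" "x \<noteq> 0"
  shows "euler x = dissA (x ^ 5) - x * euler (x ^ 25) - x ^ 2 * dissB (x ^ 5)"
proof -
  define f where "f = (\<lambda>k. (-1) powi k * x powi (3 * tri k + 2 * k))"
  have f: "(f has_sum euler x) UNIV" unfolding f_def by (rule pentagonal_number[OF assms])
  note n = norm_power_less_1[OF assms(1)]
  have fr: "f (5 * m + int r) = ((-1) ^ r * x ^ e) * ((-1) powi m * (x ^ 75) powi tri m * (x ^ (40 + 15 * r)) powi m)"
    if "int e = 3 * tri (int r) + 2 * int r" for m r e
  proof -
    have "3 * tri (5 * m + int r) + 2 * (5 * m + int r) = int e + 75 * tri m + int (40 + 15 * r) * m"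
      unfolding tri_mod5 that by (simp add: algebra_simps)
    moreover have "(-1 :: complex) powi (5 * m + int r) = (-1) ^ r * (-1) powi m"
    proof -
      have "(-1 :: complex) powi (5 * m + int r) = ((-1) ^ 5) powi m * (-1) ^ r"
        by (subst power_int_add) (auto simp: power_int_mult)
      then show ?thesis by simp
    qed
    ultimately show ?thesis using assms unfolding f_def
      by (simp add: power_int_power_nat power_int_add del: of_nat_add)
  qed
  have S: "(\<Sum>\<^sub>\<infinity>m. f (5 * m + int r)) = ((-1) ^ r * x ^ e) * (euler (x ^ 75) * theta (x ^ (40 + 15 * r)) (x ^ 75))"
    if "int e = 3 * tri (int r) + 2 * int r" for r e
    unfolding fr[OF that] by (rule infsum_theta) (use assms n in auto)
  have e25: "euler (x ^ 75) * theta (x ^ 25) (x ^ 75) = euler (x ^ 25)"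
    using euler_theta_cube[of "x ^ 25"] n[of 25] assms by (simp flip: power_mult)
  have "euler x = euler (x ^ 75) * (theta (x ^ 40) (x ^ 75) - x ^ 2 * theta (x ^ 55) (x ^ 75) + x ^ 7 * theta (x ^ 70) (x ^ 75)
     - x ^ 15 * theta (x ^ 85) (x ^ 75) + x ^ 26 * theta (x ^ 100) (x ^ 75))"
    using has_sum_mod5(1)[OF f] S[of 0 0] S[of 2 1] S[of 7 2] S[of 15 3] S[of 26 4]
    by (simp add: tri_values algebra_simps)
  \<comment> \<open>The last two classes have arguments beyond the base x^75; one quasi-period
    brings them back and lowers the outer exponents 15 and 26 to 5 and 1.\<close>
  moreover have "theta (x ^ 85) (x ^ 75) = - theta (x ^ 10) (x ^ 75) / x ^ 10"
    using theta_mult_q[of "x ^ 75" "x ^ 10"] n[of 75] assms by (simp flip: power_add)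
  moreover have "theta (x ^ 100) (x ^ 75) = - theta (x ^ 25) (x ^ 75) / x ^ 25"
    using theta_mult_q[of "x ^ 75" "x ^ 25"] n[of 75] assms by (simp flip: power_add)
  moreover have "x ^ 15 * (- theta (x ^ 10) (x ^ 75) / x ^ 10) = - (x ^ 5 * theta (x ^ 10) (x ^ 75))"
    "x ^ 26 * (- theta (x ^ 25) (x ^ 75) / x ^ 25) = - (x * theta (x ^ 25) (x ^ 75))"
  proof -
    have e: "x ^ 15 / x ^ 10 = x ^ 5" "x ^ 26 / x ^ 25 = x"
      using power_diff[of x 10 15] power_diff[of x 25 26] assms by simp_all
    have "x ^ 15 * (- t / x ^ 10) = - ((x ^ 15 / x ^ 10) * t)" "x ^ 26 * (- t / x ^ 25) = - ((x ^ 26 / x ^ 25) * t)" for t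
      by simp_all
    then show "x ^ 15 * (- theta (x ^ 10) (x ^ 75) / x ^ 10) = - (x ^ 5 * theta (x ^ 10) (x ^ 75))"
      "x ^ 26 * (- theta (x ^ 25) (x ^ 75) / x ^ 25) = - (x * theta (x ^ 25) (x ^ 75))"
      unfolding e by blast+
  qed
  ultimately have 1: "euler x = euler (x ^ 75) * (theta (x ^ 40) (x ^ 75) + x ^ 5 * theta (x ^ 10) (x ^ 75))
      - x * (euler (x ^ 75) * theta (x ^ 25) (x ^ 75))
      - euler (x ^ 75) * (x ^ 2 * theta (x ^ 55) (x ^ 75) - x ^ 7 * theta (x ^ 70) (x ^ 75))"
    by (simp only:) (simp only: distrib_left right_diff_distrib mult_minus_right mult.left_commute[of "euler (x ^ 75)"] diff_minus_eq_add add_uminus_conv_diff, simp only: algebra_simps)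
  have 2: "dissA (x ^ 5) = euler (x ^ 75) * (theta (x ^ 40) (x ^ 75) + x ^ 5 * theta (x ^ 10) (x ^ 75))"
    by (simp add: dissA_def flip: power_mult)
  have 3: "x ^ 2 * dissB (x ^ 5) = euler (x ^ 75) * (x ^ 2 * theta (x ^ 55) (x ^ 75) - x ^ 7 * theta (x ^ 70) (x ^ 75))"
  proof -
    have "x ^ 7 = x ^ 2 * x ^ 5" by (simp flip: power_add)
    then show ?thesis by (simp add: dissB_def algebra_simps flip: power_mult)
  qed
  show ?thesis unfolding 1 2 3 e25 ..
qed

lemma two_mult_cancel: "2 * a = 2 * b \<Longrightarrow> a = (b :: int)"
  by simp

lemma minus_one_powi: "(-1 :: complex) powi a = (if even a then 1 else -1)"
proof -
  have "(-1 :: complex) powi (2 * b) = 1" for b by (simp add: power_int_mult)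
  moreover have "(-1 :: complex) powi (2 * b + 1) = -1" for b by (simp add: power_int_mult power_int_add)
  ultimately show ?thesis by (metis evenE oddE)
qed

text \<open>Rotating the lattice by sixty degrees: \<open>X\<^sup>2 + 3 Y\<^sup>2\<close> is invariant under
  \<open>(X, Y) \<mapsto> ((X \<plusminus> 3 Y) / 2, (X \<mp> Y) / 2)\<close>, where \<open>X = 5 (6 k + 1)\<close>, \<open>Y = 10 n + 1\<close> on the
  one side and \<open>X \<in> {30 m + 1, 30 m + 19}\<close>, \<open>Y = 10 n + 3\<close> on the other.\<close>

lemma dissA_theta:
  assumes "norm q < 1" "q \<noteq> 0"
  shows "dissA q * theta q (q ^ 5) = euler (q ^ 5) * theta (q ^ 2) (q ^ 5)"
proof -
  note n = norm_power_less_1[OF assms(1)]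
  let ?E = "euler (q ^ 5)"
  define f where "f = (\<lambda>(k, n). (-1) powi (k + n) * q powi (5 * (3 * tri k + 2 * k) + 5 * tri n + 3 * n))"
  define g where "g = (\<lambda>(m, n). (-1) powi (m + n) * q powi (15 * tri m + 8 * m + 5 * tri n + 4 * n))"
  define h where "h = (\<lambda>(m, n). (-1) powi (m + n) * q powi (15 * tri m + 17 * m + 3 + 5 * tri n + 4 * n))"
  \<comment> \<open>The rotation has half-integral entries, so each double sum is split by the
    parity of m + n. The even part of \<open>f\<close> is that of \<open>g\<close>, its odd part is
    minus the even part of \<open>h\<close>, and the odd parts of \<open>g\<close> and
    \<open>h\<close> agree; hence f sums to g - h.\<close>
  define P where "P = {(m :: int, n :: int). even (m + n)}"
  have th: "((\<lambda>j. (-1) powi j * q powi (int a * tri j + int b * j)) has_sum euler (q ^ a) * theta (q ^ b) (q ^ a)) UNIV"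
    if "a > 0" for a b
  proof -
    have "((\<lambda>j. (-1) powi j * (q ^ a) powi tri j * (q ^ b) powi j) has_sum euler (q ^ a) * theta (q ^ b) (q ^ a)) UNIV"
      by (rule triple_product) (use assms n that in auto)
    then show ?thesis using assms by (simp add: power_int_power_nat power_int_add mult.assoc)
  qed
  have t3: "theta (q ^ 3) (q ^ 5) = theta (q ^ 2) (q ^ 5)"
    using theta_inverse[of "q ^ 2" "q ^ 5"] assms by (simp add: eval_nat_numeral)
  have t4: "theta (q ^ 4) (q ^ 5) = theta q (q ^ 5)"
    using theta_inverse[of q "q ^ 5"] assms by (simp add: eval_nat_numeral)
  have E: "((\<lambda>k. (-1) powi k * q powi (5 * (3 * tri k + 2 * k))) has_sum ?E) UNIV"
    using pentagonal_number[of "q ^ 5"] n[of 5] assms by (simp add: power_int_power_nat)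
  have f: "(f has_sum ?E * (?E * theta (q ^ 2) (q ^ 5))) (UNIV \<times> UNIV)"
  proof -
    have "((\<lambda>(k, n). ((-1) powi k * q powi (5 * (3 * tri k + 2 * k))) * ((-1) powi n * q powi (int 5 * tri n + int 3 * n)))
      has_sum ?E * (?E * theta (q ^ 3) (q ^ 5))) (UNIV \<times> UNIV)"
      by (rule has_sum_product_complex[OF E th]) simp
    moreover have "(\<lambda>(k, n). ((-1) powi k * q powi (5 * (3 * tri k + 2 * k))) * ((-1) powi n * q powi (int 5 * tri n + int 3 * n))) = f"
      using assms by (auto simp: f_def fun_eq_iff power_int_add)
    ultimately show ?thesis by (simp add: t3)
  qed
  have g: "(g has_sum (euler (q ^ 15) * theta (q ^ 8) (q ^ 15)) * (?E * theta q (q ^ 5))) (UNIV \<times> UNIV)"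
  proof -
    have "((\<lambda>(k, n). ((-1) powi k * q powi (int 15 * tri k + int 8 * k)) * ((-1) powi n * q powi (int 5 * tri n + int 4 * n)))
      has_sum (euler (q ^ 15) * theta (q ^ 8) (q ^ 15)) * (?E * theta (q ^ 4) (q ^ 5))) (UNIV \<times> UNIV)"
      by (rule has_sum_product_complex[OF th th]) simp_all
    moreover have "(\<lambda>(k, n). ((-1) powi k * q powi (int 15 * tri k + int 8 * k)) * ((-1) powi n * q powi (int 5 * tri n + int 4 * n))) = g"
      using assms by (auto simp: g_def fun_eq_iff power_int_add)
    ultimately show ?thesis by (simp add: t4)
  qed
  have h: "(h has_sum q ^ 3 * (euler (q ^ 15) * theta (q ^ 17) (q ^ 15)) * (?E * theta q (q ^ 5))) (UNIV \<times> UNIV)"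
  proof -
    have "((\<lambda>(k, n). (q ^ 3 * ((-1) powi k * q powi (int 15 * tri k + int 17 * k))) * ((-1) powi n * q powi (int 5 * tri n + int 4 * n)))
      has_sum (q ^ 3 * (euler (q ^ 15) * theta (q ^ 17) (q ^ 15))) * (?E * theta (q ^ 4) (q ^ 5))) (UNIV \<times> UNIV)"
      by (intro has_sum_product_complex th has_sum_cmult_right) simp_all
    moreover have "(\<lambda>(k, n). (q ^ 3 * ((-1) powi k * q powi (int 15 * tri k + int 17 * k))) * ((-1) powi n * q powi (int 5 * tri n + int 4 * n))) = h"
      using assms by (auto simp: h_def fun_eq_iff power_int_add)
    ultimately show ?thesis by (simp add: t4)
  qed
  have sub: "F summable_on B" if "(F has_sum s) (UNIV \<times> UNIV)" for F :: "int \<times> int \<Rightarrow> complex" and s B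
  proof -
    have "F summable_on UNIV" using has_sum_imp_summable[OF that] by simp
    then show ?thesis by (rule summable_on_subset_banach) simp
  qed
  have split: "s = infsum F P + infsum F (- P)" if F: "(F has_sum s) (UNIV \<times> UNIV)" for F :: "int \<times> int \<Rightarrow> complex" and s
    using infsum_Un_disjoint[OF sub[OF F, of P] sub[OF F, of "- P"]] infsumI[OF F] by simp
  have sgn: "(-1 :: complex) powi a = (-1) powi b" if "even (a - b)" for a b
    using that by (simp add: minus_one_powi)
  have even_cases: "\<exists>k l. a = (k, k + 2 * l)" if "a \<in> P" for a
  proof -
    obtain k n where kn: "a = (k, n)" by (cases a)
    with that have "even (n - k)" by (auto simp: P_def)
    then obtain l where "n - k = 2 * l" by (elim evenE)
    then show ?thesis using kn by (intro exI[of _ k] exI[of _ l]) simp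
  qed
  have odd_cases: "\<exists>k l. a = (k, k + 2 * l + 1)" if "a \<in> - P" for a
  proof -
    obtain k n where kn: "a = (k, n)" by (cases a)
    with that have "odd (n - k)" by (auto simp: P_def)
    then obtain l where "n - k = 2 * l + 1" by (elim oddE)
    then show ?thesis using kn by (intro exI[of _ k] exI[of _ l]) simp
  qed
  have neg_div: "- (2 * l) div 2 = - l" for l :: int by simp
  have fg: "infsum f P = infsum g P"
  proof (rule infsum_reindex_bij_witness[where j = "\<lambda>(k, n). ((k - n) div 2, (3 * k + n) div 2)" and i = "\<lambda>(m, n). ((m + n) div 2, (n - 3 * m) div 2)"])
    fix a assume "a \<in> P"
    obtain k l where a: "a = (k, k + 2 * l)" using even_cases[OF \<open>a \<in> P\<close>] by blast
    have j: "(case a of (k, n) \<Rightarrow> ((k - n) div 2, (3 * k + n) div 2)) = (- l, 2 * k + l)" unfolding a by simp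
    have "2 * (15 * tri (- l) + 8 * (- l) + 5 * tri (2 * k + l) + 4 * (2 * k + l)) = 2 * (5 * (3 * tri k + 2 * k) + 5 * tri (k + 2 * l) + 3 * (k + 2 * l))"
      using two_tri[of "- l"] two_tri[of "2 * k + l"] two_tri[of k] two_tri[of "k + 2 * l"] by (simp add: algebra_simps)
    then have "15 * tri (- l) + 8 * (- l) + 5 * tri (2 * k + l) + 4 * (2 * k + l) = 5 * (3 * tri k + 2 * k) + 5 * tri (k + 2 * l) + 3 * (k + 2 * l)" by (rule two_mult_cancel)
    moreover have "(-1 :: complex) powi (- l + (2 * k + l)) = (-1) powi (k + (k + 2 * l))" by (rule sgn) simp
    ultimately show "g (case a of (k, n) \<Rightarrow> ((k - n) div 2, (3 * k + n) div 2)) = f a"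
      unfolding j unfolding a f_def g_def prod.case by (simp only:)
    show "(case (case a of (k, n) \<Rightarrow> ((k - n) div 2, (3 * k + n) div 2)) of (m, n) \<Rightarrow> ((m + n) div 2, (n - 3 * m) div 2)) = a" unfolding j unfolding a by (simp add: neg_div)
    show "(case a of (k, n) \<Rightarrow> ((k - n) div 2, (3 * k + n) div 2)) \<in> P" unfolding j by (auto simp: P_def neg_div)
  next
    fix b assume "b \<in> P"
    then obtain k l where b: "b = (k, k + 2 * l)" using even_cases by blast
    show "(case (case b of (m, n) \<Rightarrow> ((m + n) div 2, (n - 3 * m) div 2)) of (k, n) \<Rightarrow> ((k - n) div 2, (3 * k + n) div 2)) = b" unfolding b by (simp add: neg_div)
    show "(case b of (m, n) \<Rightarrow> ((m + n) div 2, (n - 3 * m) div 2)) \<in> P" unfolding b by (auto simp: P_def neg_div)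
  qed
  have fh: "infsum f (- P) = infsum (\<lambda>a. - h a) P"
  proof (rule infsum_reindex_bij_witness[where j = "\<lambda>(k, n). ((k + n - 1) div 2, (n - 3 * k - 1) div 2)" and i = "\<lambda>(m, n). ((m - n) div 2, (3 * m + n) div 2 + 1)"])
    fix a assume "a \<in> - P"
    obtain k l where a: "a = (k, k + 2 * l + 1)" using odd_cases[OF \<open>a \<in> - P\<close>] by blast
    have j: "(case a of (k, n) \<Rightarrow> ((k + n - 1) div 2, (n - 3 * k - 1) div 2)) = (k + l, l - k)" unfolding a by simp
    have "2 * (15 * tri (k + l) + 17 * (k + l) + 3 + 5 * tri (l - k) + 4 * (l - k)) = 2 * (5 * (3 * tri k + 2 * k) + 5 * tri (k + 2 * l + 1) + 3 * (k + 2 * l + 1))"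
      using two_tri[of "k + l"] two_tri[of "l - k"] two_tri[of k] two_tri[of "k + 2 * l + 1"] by (simp add: algebra_simps)
    then have "15 * tri (k + l) + 17 * (k + l) + 3 + 5 * tri (l - k) + 4 * (l - k) = 5 * (3 * tri k + 2 * k) + 5 * tri (k + 2 * l + 1) + 3 * (k + 2 * l + 1)" by (rule two_mult_cancel)
    moreover have "- ((-1 :: complex) powi (k + l + (l - k))) = (-1) powi (k + (k + 2 * l + 1))" by (simp add: minus_one_powi)
    ultimately show "- h (case a of (k, n) \<Rightarrow> ((k + n - 1) div 2, (n - 3 * k - 1) div 2)) = f a"
      unfolding j unfolding a f_def h_def prod.case by (simp only: mult_minus_left[symmetric])
    show "(case (case a of (k, n) \<Rightarrow> ((k + n - 1) div 2, (n - 3 * k - 1) div 2)) of (m, n) \<Rightarrow> ((m - n) div 2, (3 * m + n) div 2 + 1)) = a" unfolding j unfolding a by (simp add: neg_div)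
    show "(case a of (k, n) \<Rightarrow> ((k + n - 1) div 2, (n - 3 * k - 1) div 2)) \<in> P" unfolding j by (auto simp: P_def neg_div)
  next
    fix b assume "b \<in> P"
    then obtain k l where b: "b = (k, k + 2 * l)" using even_cases by blast
    show "(case (case b of (m, n) \<Rightarrow> ((m - n) div 2, (3 * m + n) div 2 + 1)) of (k, n) \<Rightarrow> ((k + n - 1) div 2, (n - 3 * k - 1) div 2)) = b" unfolding b by (simp add: neg_div)
    show "(case b of (m, n) \<Rightarrow> ((m - n) div 2, (3 * m + n) div 2 + 1)) \<in> - P" unfolding b by (auto simp: P_def neg_div)
  qed
  have gh: "infsum g (- P) = infsum h (- P)"
  proof (rule infsum_reindex_bij_witness[where j = "\<lambda>(m, n). ((n - m - 1) div 2, - ((3 * m + n + 1) div 2))" and i = "\<lambda>(m, n). (- ((m + n + 1) div 2), (3 * m - n + 1) div 2)"])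
    fix a assume "a \<in> - P"
    obtain k l where a: "a = (k, k + 2 * l + 1)" using odd_cases[OF \<open>a \<in> - P\<close>] by blast
    have j: "(case a of (m, n) \<Rightarrow> ((n - m - 1) div 2, - ((3 * m + n + 1) div 2))) = (l, - (2 * k + l + 1))" unfolding a by simp
    have "2 * (15 * tri l + 17 * l + 3 + 5 * tri (- (2 * k + l + 1)) + 4 * (- (2 * k + l + 1))) = 2 * (15 * tri k + 8 * k + 5 * tri (k + 2 * l + 1) + 4 * (k + 2 * l + 1))"
      using two_tri[of l] two_tri[of "- (2 * k + l + 1)"] two_tri[of k] two_tri[of "k + 2 * l + 1"] by (simp add: algebra_simps)
    then have "15 * tri l + 17 * l + 3 + 5 * tri (- (2 * k + l + 1)) + 4 * (- (2 * k + l + 1)) = 15 * tri k + 8 * k + 5 * tri (k + 2 * l + 1) + 4 * (k + 2 * l + 1)" by (rule two_mult_cancel)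
    moreover have "(-1 :: complex) powi (l + - (2 * k + l + 1)) = (-1) powi (k + (k + 2 * l + 1))" by (rule sgn) simp
    ultimately show "h (case a of (m, n) \<Rightarrow> ((n - m - 1) div 2, - ((3 * m + n + 1) div 2))) = g a"
      unfolding j unfolding a g_def h_def prod.case by (simp only:)
    show "(case (case a of (m, n) \<Rightarrow> ((n - m - 1) div 2, - ((3 * m + n + 1) div 2))) of (m, n) \<Rightarrow> (- ((m + n + 1) div 2), (3 * m - n + 1) div 2)) = a" unfolding j unfolding a by (simp add: neg_div)
    show "(case a of (m, n) \<Rightarrow> ((n - m - 1) div 2, - ((3 * m + n + 1) div 2))) \<in> - P" unfolding j by (auto simp: P_def neg_div)
  next
    fix b assume "b \<in> - P"
    then obtain k l where b: "b = (k, k + 2 * l + 1)" using odd_cases by blast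
    show "(case (case b of (m, n) \<Rightarrow> (- ((m + n + 1) div 2), (3 * m - n + 1) div 2)) of (m, n) \<Rightarrow> ((n - m - 1) div 2, - ((3 * m + n + 1) div 2))) = b" unfolding b by (simp add: neg_div)
    show "(case b of (m, n) \<Rightarrow> (- ((m + n + 1) div 2), (3 * m - n + 1) div 2)) \<in> - P" unfolding b by (auto simp: P_def neg_div)
  qed
  have "?E * (?E * theta (q ^ 2) (q ^ 5)) = (euler (q ^ 15) * theta (q ^ 8) (q ^ 15)) * (?E * theta q (q ^ 5))
     - q ^ 3 * (euler (q ^ 15) * theta (q ^ 17) (q ^ 15)) * (?E * theta q (q ^ 5))"
    using split[OF f] split[OF g] split[OF h] fg fh gh by (simp add: infsum_uminus)
  moreover have "q ^ 3 * (e * theta (q ^ 17) (q ^ 15)) = - (q * (e * theta (q ^ 2) (q ^ 15)))" for e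
  proof -
    have "theta (q ^ 17) (q ^ 15) = - theta (q ^ 2) (q ^ 15) / q ^ 2"
      using theta_mult_q[of "q ^ 15" "q ^ 2"] n[of 15] assms by (simp flip: power_add)
    then show ?thesis using assms by (simp only:) (simp add: power3_eq_cube power2_eq_square)
  qed
  ultimately have "?E * (?E * theta (q ^ 2) (q ^ 5)) = (euler (q ^ 15) * theta (q ^ 8) (q ^ 15)) * (?E * theta q (q ^ 5))
     - (- (q * (euler (q ^ 15) * theta (q ^ 2) (q ^ 15)))) * (?E * theta q (q ^ 5))" by (simp only:)
  then have "?E * (?E * theta (q ^ 2) (q ^ 5)) = ?E * (dissA q * theta q (q ^ 5))"
    by (simp add: dissA_def algebra_simps)
  then show ?thesis using euler_nonzero[OF n[of 5]] by simp
qed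

text \<open>\<alpha> and \<beta> are the two quadratic Gaussian periods, the roots of t^2 + t - 1;
  complex conjugate factors pair to quadratics with these as coefficients.\<close>

lemma prod_fifth_roots:
  fixes w :: complex
  assumes "w ^ 5 = 1" "w \<noteq> 1"
  defines "\<alpha> \<equiv> w + w ^ 4" and "\<beta> \<equiv> w ^ 2 + w ^ 3"
  shows "\<alpha> + \<beta> = -1" "\<alpha> * \<beta> = -1"
    and "(1 - u) * (1 - w * u) * (1 - w ^ 2 * u) * (1 - w ^ 3 * u) * (1 - w ^ 4 * u) = 1 - u ^ 5"
proof -
  have "(w - 1) * (1 + w + w ^ 2 + w ^ 3 + w ^ 4) = w ^ 5 - 1"
    by (simp add: algebra_simps eval_nat_numeral)
  then have s: "1 + w + w ^ 2 + w ^ 3 + w ^ 4 = 0" using assms by simp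
  have "\<alpha> + \<beta> = (1 + w + w ^ 2 + w ^ 3 + w ^ 4) - 1" by (simp add: \<alpha>_def \<beta>_def)
  then show 1: "\<alpha> + \<beta> = -1" using s by simp
  have "\<alpha> * \<beta> = w ^ 3 + w ^ 4 + w ^ 5 * w + w ^ 5 * w ^ 2"
    unfolding \<alpha>_def \<beta>_def by (simp add: algebra_simps eval_nat_numeral)
  then have "\<alpha> * \<beta> = (1 + w + w ^ 2 + w ^ 3 + w ^ 4) - 1" unfolding assms(1) by simp
  then show 2: "\<alpha> * \<beta> = -1" using s by simp
  have "(1 - w * u) * (1 - w ^ 4 * u) = 1 - \<alpha> * u + w ^ 5 * u ^ 2" "(1 - w ^ 2 * u) * (1 - w ^ 3 * u) = 1 - \<beta> * u + w ^ 5 * u ^ 2"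
    unfolding \<alpha>_def \<beta>_def by (simp_all add: algebra_simps eval_nat_numeral)
  then have "(1 - u) * (1 - w * u) * (1 - w ^ 2 * u) * (1 - w ^ 3 * u) * (1 - w ^ 4 * u)
    = (1 - u) * ((1 - \<alpha> * u + u ^ 2) * (1 - \<beta> * u + u ^ 2))"
  proof -
    assume *: "(1 - w * u) * (1 - w ^ 4 * u) = 1 - \<alpha> * u + w ^ 5 * u ^ 2" "(1 - w ^ 2 * u) * (1 - w ^ 3 * u) = 1 - \<beta> * u + w ^ 5 * u ^ 2"
    have "(1 - u) * (1 - w * u) * (1 - w ^ 2 * u) * (1 - w ^ 3 * u) * (1 - w ^ 4 * u)
      = (1 - u) * (((1 - w * u) * (1 - w ^ 4 * u)) * ((1 - w ^ 2 * u) * (1 - w ^ 3 * u)))"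
      by (simp only: mult_ac)
    then show ?thesis by (simp only: * assms(1) mult_1)
  qed
  also have "(1 - \<alpha> * u + u ^ 2) * (1 - \<beta> * u + u ^ 2) = 1 - (\<alpha> + \<beta>) * u + (2 + \<alpha> * \<beta>) * u ^ 2 - (\<alpha> + \<beta>) * u ^ 3 + u ^ 4"
    by (simp add: algebra_simps eval_nat_numeral)
  also have "(1 - u) * \<dots> = 1 - u ^ 5" unfolding 1 2 by (simp add: algebra_simps eval_nat_numeral)
  finally show "(1 - u) * (1 - w * u) * (1 - w ^ 2 * u) * (1 - w ^ 3 * u) * (1 - w ^ 4 * u) = 1 - u ^ 5" .
qed

lemma qpoch_fifth_roots:
  fixes w :: complex
  assumes "w ^ 5 = 1" "w \<noteq> 1" "norm q < 1"
  shows "qpoch u q * qpoch (w * u) q * qpoch (w ^ 2 * u) q * qpoch (w ^ 3 * u) q * qpoch (w ^ 4 * u) q = qpoch (u ^ 5) (q ^ 5)"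
proof -
  have q5: "norm (q ^ 5) < 1" by (rule norm_power_less_1[OF assms(3)]) simp
  have "(\<lambda>n. (\<Prod>i<n. 1 - u * q ^ i) * (\<Prod>i<n. 1 - (w * u) * q ^ i) * (\<Prod>i<n. 1 - (w ^ 2 * u) * q ^ i)
      * (\<Prod>i<n. 1 - (w ^ 3 * u) * q ^ i) * (\<Prod>i<n. 1 - (w ^ 4 * u) * q ^ i))
    \<longlonglongrightarrow> qpoch u q * qpoch (w * u) q * qpoch (w ^ 2 * u) q * qpoch (w ^ 3 * u) q * qpoch (w ^ 4 * u) q"
    by (intro tendsto_intros qpoch_LIMSEQ assms)
  moreover have "(\<Prod>i<n. 1 - u * q ^ i) * (\<Prod>i<n. 1 - (w * u) * q ^ i) * (\<Prod>i<n. 1 - (w ^ 2 * u) * q ^ i)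
      * (\<Prod>i<n. 1 - (w ^ 3 * u) * q ^ i) * (\<Prod>i<n. 1 - (w ^ 4 * u) * q ^ i) = (\<Prod>i<n. 1 - u ^ 5 * (q ^ 5) ^ i)" for n
  proof -
    have "(1 - u * q ^ i) * (1 - (w * u) * q ^ i) * (1 - (w ^ 2 * u) * q ^ i) * (1 - (w ^ 3 * u) * q ^ i) * (1 - (w ^ 4 * u) * q ^ i)
      = 1 - u ^ 5 * (q ^ 5) ^ i" for i
      using prod_fifth_roots(3)[OF assms(1,2), of "u * q ^ i"]
      by (simp add: power_mult_distrib mult.assoc mult.commute[of 5] flip: power_mult)
    then show ?thesis by (simp only: prod.distrib[symmetric])
  qed
  ultimately have "(\<lambda>n. \<Prod>i<n. 1 - u ^ 5 * (q ^ 5) ^ i) \<longlonglongrightarrow> qpoch u q * qpoch (w * u) q * qpoch (w ^ 2 * u) q * qpoch (w ^ 3 * u) q * qpoch (w ^ 4 * u) q"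
    by (simp only:)
  then show ?thesis using qpoch_LIMSEQ[OF q5, of "u ^ 5"] LIMSEQ_unique by blast
qed

text \<open>Sort the factors of each \<open>euler (w ^ k * x)\<close> by exponent modulo 5. For the
  four nonzero classes the product over the roots of unity turns base x^5 into base x^25; the class
  0 is \<open>euler (x ^ 5)\<close> each time. The four products together lack only
  \<open>euler (x ^ 25)\<close> to make a sixth \<open>euler (x ^ 5)\<close>.\<close>

lemma euler_fifth_roots:
  fixes w x :: complex
  assumes w: "w ^ 5 = 1" "w \<noteq> 1" and x: "norm x < 1"
  shows "euler x * euler (w * x) * euler (w ^ 2 * x) * euler (w ^ 3 * x) * euler (w ^ 4 * x) * euler (x ^ 25) = euler (x ^ 5) ^ 6"
proof -
  note n = norm_power_less_1[OF x]
  define e where "e = (\<lambda>i y. qpoch (y ^ Suc i) (x ^ 5))"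
  have euler: "euler z = e 0 z * e 1 z * e 2 z * e 3 z * e 4 z" if "z ^ 5 = x ^ 5" for z
  proof -
    have nz: "norm z < 1"
    proof (rule ccontr)
      assume "\<not> norm z < 1"
      then have "norm (z ^ 5) \<ge> 1" by (simp add: norm_power one_le_power)
      then show False using that n[of 5] by simp
    qed
    have "{..<5::nat} = {0, 1, 2, 3, 4}" by auto
    then show ?thesis using qpoch_split[OF nz, of 5 z] that by (simp add: euler_def e_def mult.assoc eval_nat_numeral)
  qed
  have w': "w ^ 2 \<noteq> 1" "w ^ 3 \<noteq> 1" "w ^ 4 \<noteq> 1" and wp: "w ^ 6 = w" "w ^ 8 = w ^ 3" "w ^ 9 = w ^ 4" "w ^ 12 = w ^ 2" "w ^ 16 = w"
  proof -
    have r: "w ^ (5 + k) = w ^ k" for k using w by (simp add: power_add)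
    show 6: "w ^ 6 = w" using r[of 1] by simp
    show "w ^ 8 = w ^ 3" using r[of 3] by simp
    show "w ^ 9 = w ^ 4" using r[of 4] by simp
    show "w ^ 12 = w ^ 2" using r[of 7] r[of 2] by simp
    show "w ^ 16 = w" using r[of 11] r[of 6] 6 by simp
    show w4: "w ^ 4 \<noteq> 1" using w by (metis mult.right_neutral power_Suc numeral_eq_Suc pred_numeral_simps(3) semiring_norm(26,27))
    show w2: "w ^ 2 \<noteq> 1" using w4 by (metis one_power2 power2_eq_square power4_eq_xxxx mult.assoc)
    show "w ^ 3 \<noteq> 1" using 6 w(2) by (metis mult_2_right numeral_Bit0 power2_eq_square power_add mult_1)
  qed
  have z5: "(w ^ k * x) ^ 5 = x ^ 5" for k using w by (simp add: power_mult_distrib flip: power_mult) (simp add: power_mult mult.commute[of k])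
  have wk5: "(w ^ k) ^ 5 = 1" for k using w by (metis power_mult mult.commute power_one)
  have row: "e i x * e i (w * x) * e i (w ^ 2 * x) * e i (w ^ 3 * x) * e i (w ^ 4 * x) = qpoch ((x ^ 5) ^ Suc i) (x ^ 25)" if "i < 4" for i
  proof -
    have q: "qpoch u (x ^ 5) * qpoch (v * u) (x ^ 5) * qpoch (v ^ 2 * u) (x ^ 5) * qpoch (v ^ 3 * u) (x ^ 5) * qpoch (v ^ 4 * u) (x ^ 5) = qpoch (u ^ 5) (x ^ 25)"
      if "v ^ 5 = 1" "v \<noteq> 1" for u v
      using qpoch_fifth_roots[OF that n[of 5], of u] by (simp flip: power_mult)
    have v: "w ^ Suc i \<noteq> 1"
    proof -
      consider "i = 0" | "i = 1" | "i = 2" | "i = 3" using \<open>i < 4\<close> by linarith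
      then show ?thesis by cases (use w(2) w' in \<open>simp_all add: power2_eq_square power3_eq_cube power4_eq_xxxx mult.assoc\<close>)
    qed
    have e: "e i (w ^ k * x) = qpoch ((w ^ Suc i) ^ k * x ^ Suc i) (x ^ 5)" for k
      unfolding e_def power_mult_distrib power_mult[symmetric] by (simp only: mult.commute[of k])
    have "e i x * e i (w * x) * e i (w ^ 2 * x) * e i (w ^ 3 * x) * e i (w ^ 4 * x) = qpoch ((x ^ Suc i) ^ 5) (x ^ 25)"
      using q[OF wk5[of "Suc i"] v, of "x ^ Suc i"] e[of 0] e[of 1] e[of 2] e[of 3] e[of 4]
      by (simp only: power_0 power_one_right mult_1)
    also have "(x ^ Suc i) ^ 5 = (x ^ 5) ^ Suc i" by (simp only: power_mult[symmetric] mult.commute)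
    finally show ?thesis .
  qed
  have e4: "e 4 (w ^ k * x) = euler (x ^ 5)" "e 4 x = euler (x ^ 5)" "e 4 (w * x) = euler (x ^ 5)" for k
  proof -
    have "e 4 z = qpoch (z ^ 5) (x ^ 5)" for z by (simp only: e_def eval_nat_numeral)
    then show "e 4 (w ^ k * x) = euler (x ^ 5)" "e 4 x = euler (x ^ 5)" "e 4 (w * x) = euler (x ^ 5)"
      using z5[of k] z5[of 1] by (simp_all only: euler_def power_one_right)
  qed
  have x25: "euler (x ^ 5) = qpoch (x ^ 5) (x ^ 25) * qpoch ((x ^ 5) ^ 2) (x ^ 25) * qpoch ((x ^ 5) ^ 3) (x ^ 25) * qpoch ((x ^ 5) ^ 4) (x ^ 25) * euler (x ^ 25)"
  proof -
    have "{..<5::nat} = {0, 1, 2, 3, 4}" by auto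
    then show ?thesis using qpoch_split[OF n[of 5], of 5 "x ^ 5"]
      by (simp add: euler_def mult.assoc flip: power_mult power_add)
  qed
  have z5': "(w * x) ^ 5 = x ^ 5" using z5[of 1] by simp
  have rearr: "(a0 * a1 * a2 * a3 * a4) * (b0 * b1 * b2 * b3 * b4) * (c0 * c1 * c2 * c3 * c4) * (d0 * d1 * d2 * d3 * d4) * (f0 * f1 * f2 * f3 * f4)
    = (a0 * b0 * c0 * d0 * f0) * (a1 * b1 * c1 * d1 * f1) * (a2 * b2 * c2 * d2 * f2) * (a3 * b3 * c3 * d3 * f3) * (a4 * b4 * c4 * d4 * (f4 :: complex))"
    for a0 a1 a2 a3 a4 b0 b1 b2 b3 b4 c0 c1 c2 c3 c4 d0 d1 d2 d3 d4 f0 f1 f2 f3 f4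
    by (simp only: mult_ac)
  have "euler x * euler (w * x) * euler (w ^ 2 * x) * euler (w ^ 3 * x) * euler (w ^ 4 * x)
    = qpoch (x ^ 5) (x ^ 25) * qpoch ((x ^ 5) ^ 2) (x ^ 25) * qpoch ((x ^ 5) ^ 3) (x ^ 25) * qpoch ((x ^ 5) ^ 4) (x ^ 25) * euler (x ^ 5) ^ 5"
  proof -
    have "e 0 x * e 0 (w * x) * e 0 (w ^ 2 * x) * e 0 (w ^ 3 * x) * e 0 (w ^ 4 * x) = qpoch (x ^ 5) (x ^ 25)"
      "e 1 x * e 1 (w * x) * e 1 (w ^ 2 * x) * e 1 (w ^ 3 * x) * e 1 (w ^ 4 * x) = qpoch ((x ^ 5) ^ 2) (x ^ 25)"
      "e 2 x * e 2 (w * x) * e 2 (w ^ 2 * x) * e 2 (w ^ 3 * x) * e 2 (w ^ 4 * x) = qpoch ((x ^ 5) ^ 3) (x ^ 25)"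
      "e 3 x * e 3 (w * x) * e 3 (w ^ 2 * x) * e 3 (w ^ 3 * x) * e 3 (w ^ 4 * x) = qpoch ((x ^ 5) ^ 4) (x ^ 25)"
      using row[of 0] row[of 1] row[of 2] row[of 3] by simp_all
    moreover have "a * a * a * a * a = a ^ 5" for a :: complex by (simp add: eval_nat_numeral)
    ultimately show ?thesis
      unfolding euler[OF refl] euler[OF z5'] euler[OF z5[of 2]] euler[OF z5[of 3]] euler[OF z5[of 4]]
      by (subst rearr) (simp only: e4)
  qed
  then have "euler x * euler (w * x) * euler (w ^ 2 * x) * euler (w ^ 3 * x) * euler (w ^ 4 * x) * euler (x ^ 25) = euler (x ^ 5) * euler (x ^ 5) ^ 5"
    using x25 by (simp add: mult_ac)
  then show ?thesis by (simp add: eval_nat_numeral)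
qed

text \<open>The norm of the three-term dissection over the fifth roots of unity, evaluated in two
  ways. Since A B = E^2, the summands s = x E and t = x^2 B satisfy A t = s^2, and the norm of A - s
  - t becomes A^5 - 11 s^5 - t^5. This is the origin of the constant 11.\<close>

lemma dissection_norm:
  fixes q :: complex
  assumes "norm q < 1" "q \<noteq> 0"
  defines "E \<equiv> euler (q ^ 5)" and "A \<equiv> dissA q" and "B \<equiv> dissB q"
  assumes AB: "A * B = E ^ 2"
  shows "(A ^ 5 - 11 * q * E ^ 5 - q ^ 2 * B ^ 5) * E = euler q ^ 6"
proof -
  define x where "x = exp (Ln q / 5)"
  have x5: "x ^ 5 = q"
  proof -
    have "x ^ 5 = exp (of_nat 5 * (Ln q / 5))" unfolding x_def by (rule exp_of_nat_mult[symmetric])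
    then show ?thesis using assms(2) by simp
  qed
  have x0: "x \<noteq> 0" using x5 assms by auto
  have x1: "norm x < 1"
  proof (rule ccontr)
    assume "\<not> norm x < 1"
    then have "norm (x ^ 5) \<ge> 1" by (simp add: norm_power one_le_power)
    then show False using x5 assms by simp
  qed
  have x25: "x ^ 25 = q ^ 5"
  proof -
    have "x ^ 25 = (x ^ 5) ^ 5" by (simp flip: power_mult)
    then show ?thesis by (simp add: x5)
  qed
  define w where "w = cis (2 * pi / 5)"
  have w: "w ^ 5 = 1" by (simp add: w_def Complex.DeMoivre)
  have w1: "w \<noteq> 1"
  proof
    assume "w = 1"
    then have "sin (2 * pi / 5) = 0" by (simp add: w_def complex_eq_iff)
    moreover have "sin (2 * pi / 5) > 0" by (rule sin_gt_zero) (use pi_gt_zero in auto)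
    ultimately show False by simp
  qed
  have nw: "norm w = 1" by (simp add: w_def)
  have diss: "euler (w ^ k * x) = A - w ^ k * (x * E) - w ^ (2 * k) * (x ^ 2 * B)" for k
  proof -
    have wk: "(w ^ k) ^ 5 = 1" using w by (metis power_mult mult.commute power_one)
    have wk25: "(w ^ k) ^ 25 = 1"
    proof -
      have "(w ^ k) ^ 25 = ((w ^ k) ^ 5) ^ 5" by (simp only: power_mult[symmetric] mult.assoc) simp
      then show ?thesis by (simp add: wk)
    qed
    have "norm (w ^ k * x) < 1" "w ^ k * x \<noteq> 0" using x1 x0 nw by (auto simp: norm_mult norm_power)
    from euler_dissection[OF this] show ?thesis
      using wk wk25 x5 x25 by (simp add: A_def B_def E_def power_mult_distrib mult_ac power_mult[of w 2 k] flip: power_mult[of w k 2])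
  qed
  define \<alpha> where "\<alpha> = w + w ^ 4"
  define \<beta> where "\<beta> = w ^ 2 + w ^ 3"
  have ab: "\<alpha> + \<beta> = -1" "\<alpha> * \<beta> = -1" unfolding \<alpha>_def \<beta>_def by (rule prod_fifth_roots[OF w w1])+
  define s where "s = x * E"
  define t where "t = x ^ 2 * B"
  have At: "A * t = s ^ 2" using AB by (simp add: s_def t_def power_mult_distrib mult_ac)
  have wr: "w ^ 6 = w" "w ^ 8 = w ^ 3" 
    using w power_add[of w 5 1] power_add[of w 5 3] by simp_all
  have p1: "(A - w * s - w ^ 2 * t) * (A - w ^ 4 * s - w ^ 8 * t) = A ^ 2 + s ^ 2 + t ^ 2 - \<alpha> * A * s - \<beta> * A * t + \<alpha> * s * t"
  proof -
    have "(A - w * s - w ^ 2 * t) * (A - w ^ 4 * s - w ^ 3 * t) = A ^ 2 + w ^ 5 * s ^ 2 + w ^ 5 * t ^ 2 - (w + w ^ 4) * A * s - (w ^ 2 + w ^ 3) * A * t + (w ^ 4 + w ^ 6) * s * t"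
      by (simp add: algebra_simps eval_nat_numeral)
    then show ?thesis unfolding wr w by (simp add: \<alpha>_def \<beta>_def add.commute)
  qed
  have p2: "(A - w ^ 2 * s - w ^ 4 * t) * (A - w ^ 3 * s - w ^ 6 * t) = A ^ 2 + s ^ 2 + t ^ 2 - \<beta> * A * s - \<alpha> * A * t + \<beta> * s * t"
  proof -
    have "(A - w ^ 2 * s - w ^ 4 * t) * (A - w ^ 3 * s - w * t) = A ^ 2 + w ^ 5 * s ^ 2 + w ^ 5 * t ^ 2 - (w ^ 2 + w ^ 3) * A * s - (w + w ^ 4) * A * t + (w ^ 3 + w ^ 5 * w ^ 2) * s * t"
      by (simp add: algebra_simps eval_nat_numeral)
    then show ?thesis unfolding wr w by (simp add: \<alpha>_def \<beta>_def add.commute)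
  qed
  have "(A - s - t) * ((A - w * s - w ^ 2 * t) * (A - w ^ 4 * s - w ^ 8 * t)) * ((A - w ^ 2 * s - w ^ 4 * t) * (A - w ^ 3 * s - w ^ 6 * t))
     = A ^ 5 - 11 * s ^ 5 - t ^ 5"
  proof -
    define U where "U = A ^ 2 + s ^ 2 + t ^ 2"
    have e: "A ^ 2 + s ^ 2 + t ^ 2 - \<alpha> * A * s - \<beta> * A * t + \<alpha> * s * t = U + \<alpha> * (s * t - A * s) - \<beta> * s ^ 2"
      "A ^ 2 + s ^ 2 + t ^ 2 - \<beta> * A * s - \<alpha> * A * t + \<beta> * s * t = U + \<beta> * (s * t - A * s) - \<alpha> * s ^ 2"
      unfolding At[symmetric] U_def by (simp_all add: algebra_simps)
    have 0: "(U + \<alpha> * Z - \<beta> * W) * (U + \<beta> * Z - \<alpha> * W) = U ^ 2 + (\<alpha> + \<beta>) * (U * Z - U * W) + (\<alpha> * \<beta>) * (Z ^ 2 + W ^ 2 + 2 * Z * W) - (\<alpha> + \<beta>) ^ 2 * Z * W" for Z W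
      by (simp add: algebra_simps power2_eq_square)
    have 1: "(U + \<alpha> * Z - \<beta> * W) * (U + \<beta> * Z - \<alpha> * W) = U ^ 2 - U * Z + U * W - Z ^ 2 - W ^ 2 - 3 * Z * W" for Z W
      unfolding 0 unfolding ab by (simp add: algebra_simps)
    have "(A - s - t) * (U ^ 2 - U * (s * t - A * s) + U * s ^ 2 - (s * t - A * s) ^ 2 - (s ^ 2) ^ 2 - 3 * (s * t - A * s) * s ^ 2) = A ^ 5 - 11 * s ^ 5 - t ^ 5"
    proof -
      \<comment> \<open>The explicit cofactor exhibits the difference as a multiple of s^2 - A t,
        which is 0.\<close>
      have "(A - s - t) * (U ^ 2 - U * (s * t - A * s) + U * s ^ 2 - (s * t - A * s) ^ 2 - (s ^ 2) ^ 2 - 3 * (s * t - A * s) * s ^ 2)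
         - (A ^ 5 - 11 * s ^ 5 - t ^ 5) = (s ^ 2 - A * t) * (10 * s ^ 3 - 3 * A * s ^ 2 + 3 * s ^ 2 * t + 2 * A ^ 2 * s + 2 * s * t ^ 2 + A ^ 3 + 2 * A * t ^ 2 - 2 * A ^ 2 * t - t ^ 3)"
        unfolding U_def by (simp add: algebra_simps power2_eq_square power3_eq_cube eval_nat_numeral)
      then show ?thesis using At by simp
    qed
    then have 2: "(A - s - t) * ((U + \<alpha> * (s * t - A * s) - \<beta> * s ^ 2) * (U + \<beta> * (s * t - A * s) - \<alpha> * s ^ 2)) = A ^ 5 - 11 * s ^ 5 - t ^ 5"
      by (simp only: 1)
    show ?thesis unfolding p1 p2 e by (rule trans[OF mult.assoc 2])
  qed
  moreover have "(A - s - t) * ((A - w * s - w ^ 2 * t) * (A - w ^ 4 * s - w ^ 8 * t)) * ((A - w ^ 2 * s - w ^ 4 * t) * (A - w ^ 3 * s - w ^ 6 * t))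
     = euler x * euler (w * x) * euler (w ^ 2 * x) * euler (w ^ 3 * x) * euler (w ^ 4 * x)"
    using diss[of 0] diss[of 1] diss[of 2] diss[of 3] diss[of 4] by (simp add: s_def t_def mult_ac)
  ultimately have "(A ^ 5 - 11 * s ^ 5 - t ^ 5) * E = euler q ^ 6"
    using euler_fifth_roots[OF w w1 x1] x5 x25 by (simp add: E_def)
  moreover have "s ^ 5 = q * E ^ 5" "t ^ 5 = q ^ 2 * B ^ 5"
  proof -
    have "(x ^ 2) ^ 5 = (x ^ 5) ^ 2" by (simp flip: power_mult)
    then show "s ^ 5 = q * E ^ 5" "t ^ 5 = q ^ 2 * B ^ 5"
      using x5 by (simp_all only: s_def t_def power_mult_distrib)
  qed
  ultimately show ?thesis by (simp add: algebra_simps)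
qed

text \<open>The exponents j(j - 1)/2 of Jacobi's series are only 0, 1 or 3 modulo 5. Comparing with
  the cube of the three-term dissection, the classes 0 and 1 yield the theta derivatives at q and
  q^2, and the empty class 2 forces A(A B - E^2) = 0. The factor A is removed later, when
  \<open>dissA\<close> is known not to vanish.\<close>

lemma dissection_relations:
  fixes q :: complex
  assumes "norm q < 1" "q \<noteq> 0"
  defines "E \<equiv> euler (q ^ 5)"
    and "f1 \<equiv> theta q (q ^ 5)" and "d1 \<equiv> q * deriv (\<lambda>y. theta y (q ^ 5)) q"
    and "f2 \<equiv> theta (q ^ 2) (q ^ 5)" and "d2 \<equiv> q ^ 2 * deriv (\<lambda>y. theta y (q ^ 5)) (q ^ 2)"
  shows "dissA q ^ 3 - 3 * q * E * dissB q ^ 2 = E * (f2 - 10 * d2)"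
    and "3 * dissA q ^ 2 * E + q * dissB q ^ 3 = E * (3 * f1 - 10 * d1)"
    and "dissA q * (dissA q * dissB q - E ^ 2) = 0"
proof -
  define x where "x = exp (Ln q / 5)"
  have x5: "x ^ 5 = q"
  proof -
    have "x ^ 5 = exp (of_nat 5 * (Ln q / 5))" unfolding x_def by (rule exp_of_nat_mult[symmetric])
    then show ?thesis using assms(2) by simp
  qed
  have x0: "x \<noteq> 0" using x5 assms by auto
  have x1: "norm x < 1"
  proof (rule ccontr)
    assume "\<not> norm x < 1"
    then have "norm (x ^ 5) \<ge> 1" by (simp add: norm_power one_le_power)
    then show False using x5 assms by simp
  qed
  note n = norm_power_less_1[OF assms(1)]
  define p where "p = q ^ 5"
  have p: "norm p < 1" "p \<noteq> 0" unfolding p_def using n assms by auto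
  have x25: "x ^ 25 = p"
  proof -
    have "x ^ 25 = (x ^ 5) ^ 5" by (simp flip: power_mult)
    then show ?thesis by (simp add: x5 p_def)
  qed
  define T where "T = (\<lambda>y. theta y p)"
  define D where "D = (\<lambda>y. y * deriv T y)"
  have Td: "(T has_field_derivative deriv T y) (at y)" if "y \<noteq> 0" for y
    unfolding T_def by (rule holomorphic_derivI[OF theta_holomorphic[OF p(1)]]) (use that in auto)
  have T_inv: "T (p / y) = T y" if "y \<noteq> 0" for y using theta_inverse[OF that p(2)] by (simp add: T_def)
  have D_inv: "D (p / y) = - D y" if y: "y \<noteq> 0" for y
  proof -
    have "((\<lambda>z. T (p / z)) has_field_derivative deriv T (p / y) * (- p / y ^ 2)) (at y)"
      by (rule DERIV_chain2[OF Td]) (use y p in \<open>auto intro!: derivative_eq_intros simp: power2_eq_square\<close>)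
    moreover have "((\<lambda>z. T (p / z)) has_field_derivative deriv T y) (at y)"
    proof (rule has_field_derivative_transform_within_open[OF Td[OF y]])
      show "open (- {0 :: complex})" by auto
    qed (use y T_inv in auto)
    ultimately have "deriv T y = deriv T (p / y) * (- p / y ^ 2)" by (rule DERIV_unique[symmetric])
    then show ?thesis using y by (simp add: D_def field_simps power2_eq_square)
  qed
  have T_q: "T (y * p) = - T y / y" if "y \<noteq> 0" for y using theta_mult_q[OF p(1) that p(2)] by (simp add: T_def)
  have D_q: "D (y * p) = (T y - D y) / y" if y: "y \<noteq> 0" for y
  proof -
    have "((\<lambda>z. T (z * p)) has_field_derivative deriv T (y * p) * p) (at y)"
      by (rule DERIV_chain2[OF Td]) (use y p in \<open>auto intro!: derivative_eq_intros\<close>)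
    moreover have "((\<lambda>z. T (z * p)) has_field_derivative (T y - D y) / y ^ 2) (at y)"
    proof (rule has_field_derivative_transform_within_open[where S = "- {0}"])
      show "((\<lambda>z. - T z / z) has_field_derivative (T y - D y) / y ^ 2) (at y)"
        using Td[OF y] y by (auto intro!: derivative_eq_intros simp: D_def field_simps power2_eq_square)
    qed (use y T_q in auto)
    ultimately have "(T y - D y) / y ^ 2 = deriv T (y * p) * p" by (rule DERIV_unique[symmetric])
    then show ?thesis using y by (simp add: D_def field_simps power2_eq_square)
  qed
  have vals: "T q = f1" "T (q ^ 2) = f2" "D q = d1" "D (q ^ 2) = d2"
    by (simp_all add: T_def D_def p_def f1_def f2_def d1_def d2_def)
  have q3: "p / q ^ 2 = q ^ 3" and q4: "p / q = q ^ 4" and q6: "q * p = q ^ 6"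
    using assms(2) by (simp_all add: p_def eval_nat_numeral)
  have vals': "T (q ^ 3) = f2" "D (q ^ 3) = - d2" "T (q ^ 4) = f1" "D (q ^ 4) = - d1" "T (q ^ 6) = - f1 / q" "D (q ^ 6) = (f1 - d1) / q"
    using T_inv[of "q ^ 2"] D_inv[of "q ^ 2"] T_inv[of q] D_inv[of q] T_q[of q] D_q[of q] assms(2) q3 q4 q6 vals by simp_all
  define A where "A = dissA q"
  define B where "B = dissB q"
  define Wc where "Wc = E * (5 * D p + 3 * T p)"
  have cube: "- (euler z ^ 3) = E * (10 * d2 - f2) + z * (E * (3 * f1 - 10 * d1)) - z ^ 3 * Wc"
    if z5: "z ^ 5 = q" for z
  proof -
    have z0: "z \<noteq> 0" using z5 assms by auto
    have z1: "norm z < 1"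
    proof (rule ccontr)
      assume "\<not> norm z < 1"
      then have "norm (z ^ 5) \<ge> 1" by (simp add: norm_power one_le_power)
      then show False using z5 assms by simp
    qed
    have z25: "z ^ 25 = p"
    proof -
      have "z ^ 25 = (z ^ 5) ^ 5" by (simp flip: power_mult)
      then show ?thesis by (simp add: z5 p_def)
    qed
    define g where "g = (\<lambda>j. of_int j * ((-1) powi j * z powi tri j))"
    have g: "(g has_sum - (euler z ^ 3)) UNIV" unfolding g_def by (rule jacobi_cube[OF z1 z0])
    have gr: "(\<Sum>\<^sub>\<infinity>m. g (5 * m + int r)) = (-1) ^ r * z ^ e * (E * (5 * D (q ^ (2 + r)) + of_nat r * T (q ^ (2 + r))))"
      if e: "int e = tri (int r)" for r e
    proof -
      define t where "t = (\<lambda>m. (-1) powi m * p powi tri m * (q ^ (2 + r)) powi m)"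
      have yr: "q ^ (2 + r) \<noteq> 0" using assms(2) by simp
      have "((\<lambda>m. (-1) ^ r * z ^ e * (5 * (of_int m * t m) + of_nat r * t m)) has_sum
        (-1) ^ r * z ^ e * (5 * (euler p * D (q ^ (2 + r))) + of_nat r * (euler p * T (q ^ (2 + r))))) UNIV"
        unfolding t_def D_def T_def
        by (intro has_sum_cmult_right has_sum_add triple_product theta_derivative_sum p yr)
      moreover have "(-1) ^ r * z ^ e * (5 * (of_int m * t m) + of_nat r * t m) = g (5 * m + int r)" for m
      proof -
        have "tri (5 * m + int r) = int e + (25 * tri m + int (10 + 5 * r) * m)" unfolding tri_mod5 e by simp
        moreover have "z powi (25 * tri m) = p powi tri m"
          using z0 power_int_power_nat[of z 25 "tri m"] z25 by simp
        moreover have "z powi (int (10 + 5 * r) * m) = (q ^ (2 + r)) powi m"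
        proof -
          have "10 + 5 * r = 5 * (2 + r)" by simp
          then have "z ^ (10 + 5 * r) = q ^ (2 + r)" by (simp only: power_mult z5)
          then show ?thesis using z0 power_int_power_nat[of z "10 + 5 * r" m] by simp
        qed
        ultimately have "z powi tri (5 * m + int r) = z ^ e * (p powi tri m * (q ^ (2 + r)) powi m)"
          using z0 by (simp add: power_int_add del: of_nat_add)
        moreover have "(-1 :: complex) powi (5 * m + int r) = (-1) ^ r * (-1) powi m"
        proof -
          have "(-1 :: complex) powi (5 * m + int r) = ((-1) ^ 5) powi m * (-1) ^ r"
            by (subst power_int_add) (auto simp: power_int_mult)
          then show ?thesis by simp
        qed
        ultimately show ?thesis by (simp add: g_def t_def algebra_simps)
      qed
      ultimately show ?thesis by (simp add: infsumI E_def p_def algebra_simps)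
    qed
    have z6: "z ^ 6 = z * q" using z5 power_Suc[of z 5] by simp
    have "- (euler z ^ 3) = E * (5 * d2) - E * (f2 - 5 * d2) + z * (E * (2 * f1 - 5 * d1)) - z ^ 3 * Wc + z ^ 6 * (E * (5 * ((f1 - d1) / q) + 4 * (- f1 / q)))"
      using has_sum_mod5(1)[OF g] gr[of 0 0] gr[of 0 1] gr[of 1 2] gr[of 3 3] gr[of 6 4]
      by (simp add: tri_values vals vals' Wc_def flip: p_def)
    also have "z ^ 6 * (E * (5 * ((f1 - d1) / q) + 4 * (- f1 / q))) = z * (E * (f1 - 5 * d1))"
      unfolding z6 using assms(2) by (simp add: field_simps)
    finally show ?thesis by (simp add: algebra_simps)
  qed
  have diss: "euler z = A - z * E - z ^ 2 * B" if "z ^ 5 = q" for z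
  proof -
    have "z \<noteq> 0" using that assms by auto
    moreover have "norm z < 1"
    proof (rule ccontr)
      assume "\<not> norm z < 1"
      then have "norm (z ^ 5) \<ge> 1" by (simp add: norm_power one_le_power)
      then show False using that assms by simp
    qed
    moreover have "z ^ 25 = q ^ 5"
    proof -
      have "z ^ 25 = (z ^ 5) ^ 5" by (simp flip: power_mult)
      then show ?thesis by (simp add: that)
    qed
    ultimately show ?thesis using euler_dissection[of z] that by (simp add: A_def B_def E_def)
  qed
  \<comment> \<open>Coefficients of z^0, ..., z^4 in the difference of the two expansions of
    \<open>euler z ^ 3\<close>, with z^5 replaced by q; inserting all fifth roots z = x w of q
    separates them.\<close>
  define c0 where "c0 = A ^ 3 - 3 * q * E * B ^ 2 - E * (f2 - 10 * d2)"
  define c1 where "c1 = - 3 * A ^ 2 * E - q * B ^ 3 + E * (3 * f1 - 10 * d1)"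
  define c2 where "c2 = 3 * A * (E ^ 2 - A * B)"
  define c3 where "c3 = 6 * A * B * E - E ^ 3 - Wc"
  define c4 where "c4 = 3 * B * (A * B - E ^ 2)"
  have "c0 + (x * c1) * w + (x ^ 2 * c2) * w ^ 2 + (x ^ 3 * c3) * w ^ 3 + (x ^ 4 * c4) * w ^ 4 = 0" if w: "w ^ 5 = 1" for w
  proof -
    define z where "z = x * w"
    have z5: "z ^ 5 = q" using w x5 by (simp add: z_def power_mult_distrib)
    have "(A - z * E - z ^ 2 * B) ^ 3 = E * (f2 - 10 * d2) - z * (E * (3 * f1 - 10 * d1)) + z ^ 3 * Wc"
      using cube[OF z5] unfolding diss[OF z5] by (simp add: algebra_simps)
    moreover have "c0 + z * c1 + z ^ 2 * c2 + z ^ 3 * c3 + z ^ 4 * c4 =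
      (A - z * E - z ^ 2 * B) ^ 3 - (E * (f2 - 10 * d2) - z * (E * (3 * f1 - 10 * d1)) + z ^ 3 * Wc)"
      unfolding c0_def c1_def c2_def c3_def c4_def z5[symmetric]
      by (simp add: algebra_simps power2_eq_square power3_eq_cube eval_nat_numeral)
    ultimately have "c0 + z * c1 + z ^ 2 * c2 + z ^ 3 * c3 + z ^ 4 * c4 = 0" by simp
    then show ?thesis by (simp add: z_def power_mult_distrib mult_ac)
  qed
  from fifth_root_extract[OF this] have "c0 = 0" "c1 = 0" "c2 = 0" using x0 by auto
  then show "dissA q ^ 3 - 3 * q * E * dissB q ^ 2 = E * (f2 - 10 * d2)"
    "3 * dissA q ^ 2 * E + q * dissB q ^ 3 = E * (3 * f1 - 10 * d1)"
    "dissA q * (dissA q * dissB q - E ^ 2) = 0"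
    by (auto simp: c0_def c1_def c2_def A_def B_def algebra_simps)
qed

section \<open>Partial fractions of Lerch sums\<close>

lemma norm_small_powi:
  fixes q :: complex
  assumes q: "norm q < 1" "q \<noteq> 0" and c: "c > 0"
  obtains n :: nat where "\<And>k. k \<ge> int n \<Longrightarrow> norm (q powi k) \<le> c" "\<And>k. k \<le> - int n \<Longrightarrow> 1 / c \<le> norm (q powi k)"
proof -
  obtain n where n: "norm q ^ n < c" using real_arch_pow_inv[OF c q(1)] by blast
  have 1: "norm (q powi k) \<le> c" if "k \<ge> int n" for k
  proof -
    have "norm q powi k \<le> norm q powi int n" by (rule power_int_decreasing) (use q that in auto)
    with n show ?thesis by (simp add: norm_power_int)
  qed
  moreover have "1 / c \<le> norm (q powi k)" if "k \<le> - int n" for k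
  proof -
    have "norm (q powi (- k)) \<le> c" using 1[of "- k"] that by simp
    moreover have "norm (q powi (- k)) = 1 / norm (q powi k)" using q by (simp add: power_int_minus inverse_eq_divide norm_divide)
    ultimately have "1 / norm (q powi k) \<le> c" by linarith
    moreover have "norm (q powi k) > 0" using q by simp
    ultimately show ?thesis using c by (simp add: field_simps)
  qed
  ultimately show ?thesis using that by blast
qed

text \<open>For k of large absolute value, w q^k is close to 0 or large, uniformly for w near z;
  only finitely many k restrict the radius further. The index set \<open>I\<close> allows k with z
  q^k = 1 to be left out.\<close>

lemma one_minus_powi_bound:
  fixes q z :: complex
  assumes q: "norm q < 1" "q \<noteq> 0" and z: "z \<noteq> 0" and I: "\<And>k. k \<in> I \<Longrightarrow> z * q powi k \<noteq> 1"
  obtains d B where "d > 0" "\<And>w. w \<in> cball z d \<Longrightarrow> w \<noteq> 0"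
    "\<And>w k. w \<in> cball z d \<Longrightarrow> k \<in> I \<Longrightarrow> w * q powi k \<noteq> 1 \<and> norm (1 / (1 - w * q powi k)) \<le> B"
proof -
  define \<zeta> where "\<zeta> = norm z"
  have \<zeta>: "\<zeta> > 0" using z by (simp add: \<zeta>_def)
  \<comment> \<open>On the disc the norm of w lies between \<zeta>/2 and 3 \<zeta>/2; this choice
    makes the norm of w q^k at most 1/2 for large k and at least 2 for very negative k.\<close>
  define c where "c = min (1 / (3 * \<zeta>)) (\<zeta> / 4)"
  have c: "c > 0" "c \<le> 1 / (3 * \<zeta>)" "c \<le> \<zeta> / 4" using \<zeta> by (auto simp: c_def)
  obtain n where n: "\<And>k. k \<ge> int n \<Longrightarrow> norm (q powi k) \<le> c" "\<And>k. k \<le> - int n \<Longrightarrow> 1 / c \<le> norm (q powi k)"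
    using norm_small_powi[OF q c(1)] by blast
  define F where "F = {- int n..int n} \<inter> I"
  have finF: "finite F" by (simp add: F_def)
  define d where "d = Min (insert (\<zeta> / 2) ((\<lambda>k. norm (1 - z * q powi k) / (2 * norm (q powi k))) ` F))"
  define B where "B = 2 + (\<Sum>k\<in>F. 2 / norm (1 - z * q powi k))"
  have d0: "d > 0"
    unfolding d_def using finF \<zeta> q I by (subst Min_gr_iff) (auto simp: F_def)
  have d1: "d \<le> \<zeta> / 2" unfolding d_def using finF by (intro Min_le) auto
  have d2: "d \<le> norm (1 - z * q powi k) / (2 * norm (q powi k))" if "k \<in> F" for k
    unfolding d_def using finF that by (intro Min_le) auto
  have Bge: "B \<ge> 2" "B \<ge> 2 / norm (1 - z * q powi k)" if "k \<in> F" for k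
  proof -
    have "(\<Sum>k\<in>F. 2 / norm (1 - z * q powi k)) \<ge> 0" by (intro sum_nonneg) auto
    then show "B \<ge> 2" by (simp add: B_def)
    have "2 / norm (1 - z * q powi k) \<le> (\<Sum>k\<in>F. 2 / norm (1 - z * q powi k))"
      using finF that by (intro member_le_sum) auto
    then show "B \<ge> 2 / norm (1 - z * q powi k)" by (simp add: B_def)
  qed
  have B2: "B \<ge> 2" unfolding B_def by (simp add: sum_nonneg)
  have w: "\<zeta> / 2 \<le> norm w" "norm w \<le> 3 * \<zeta> / 2" if "w \<in> cball z d" for w
  proof -
    have "norm z \<le> norm w + dist z w" by (metis add.commute dist_norm norm_triangle_sub)
    moreover have "norm w \<le> norm z + dist z w" by (metis dist_commute dist_norm norm_triangle_sub)
    ultimately show "\<zeta> / 2 \<le> norm w" "norm w \<le> 3 * \<zeta> / 2" using that d1 by (simp_all add: \<zeta>_def)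
  qed
  have main: "norm (1 - w * q powi k) \<ge> 1 / B" if wd: "w \<in> cball z d" and k: "k \<in> I" for w k
  proof -
    consider "k \<ge> int n" | "k \<le> - int n" | "k \<in> F" using k by (cases "int n \<le> k"; cases "k \<le> - int n") (auto simp: F_def)
    then show ?thesis
    proof cases
      case 1
      have "norm (w * q powi k) \<le> (3 * \<zeta> / 2) * (1 / (3 * \<zeta>))"
        unfolding norm_mult by (intro mult_mono w wd order_trans[OF n(1)[OF 1] c(2)]) (use \<zeta> in auto)
      then have "norm (w * q powi k) \<le> 1 / 2" using \<zeta> by simp
      then have "norm (1 - w * q powi k) \<ge> 1 / 2" using norm_triangle_ineq2[of 1 "w * q powi k"] by simp
      moreover have "1 / B \<le> 1 / 2" using B2 by (simp add: frac_le)
      ultimately show ?thesis by linarith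
    next
      case 2
      have "4 / \<zeta> \<le> 1 / c" using c \<zeta> by (simp add: field_simps)
      then have "4 / \<zeta> \<le> norm (q powi k)" using n(2)[OF 2] by linarith
      then have "(\<zeta> / 2) * (4 / \<zeta>) \<le> norm w * norm (q powi k)"
        by (intro mult_mono w wd) (use \<zeta> in auto)
      then have "norm (w * q powi k) \<ge> 2" using \<zeta> by (simp add: norm_mult)
      then have "norm (1 - w * q powi k) \<ge> 1" using norm_triangle_ineq2[of "w * q powi k" 1] by (simp add: norm_minus_commute)
      moreover have "1 / B \<le> 1" using B2 by simp
      ultimately show ?thesis by linarith
    next
      case 3
      define b where "b = norm (1 - z * q powi k)"
      have b: "b > 0" using I[OF k] by (simp add: b_def)
      have "1 - w * q powi k = (1 - z * q powi k) - (w - z) * q powi k" by (simp add: algebra_simps)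
      then have "norm (1 - w * q powi k) \<ge> b - norm ((w - z) * q powi k)"
        unfolding b_def by (simp only: norm_triangle_ineq2)
      moreover have "norm ((w - z) * q powi k) \<le> d * norm (q powi k)"
        unfolding norm_mult using wd by (intro mult_right_mono) (auto simp: dist_norm norm_minus_commute)
      moreover have "d * norm (q powi k) \<le> b / 2"
      proof -
        have "d * norm (q powi k) \<le> b / (2 * norm (q powi k)) * norm (q powi k)"
          unfolding b_def by (intro mult_right_mono d2[OF 3]) auto
        then show ?thesis using q by simp
      qed
      ultimately have "norm (1 - w * q powi k) \<ge> b / 2" by linarith
      moreover have "1 / B \<le> b / 2"
      proof -
        have "2 / b \<le> B" using Bge(2)[OF 3] by (simp add: b_def)
        then show ?thesis using b B2 by (simp add: field_simps)
      qed
      ultimately show ?thesis by linarith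
    qed
  qed
  show ?thesis
  proof (rule that[OF d0, of B])
    show "w \<noteq> 0" if "w \<in> cball z d" for w using w[OF that] \<zeta> by auto
    show "w * q powi k \<noteq> 1 \<and> norm (1 / (1 - w * q powi k)) \<le> B" if "w \<in> cball z d" "k \<in> I" for w k
    proof -
      have "norm (1 - w * q powi k) > 0" using main[OF that] B2 by (smt (verit) divide_pos_pos)
      then show ?thesis using main[OF that] B2 by (auto simp: norm_divide field_simps)
    qed
  qed
qed

text \<open>The index set is a parameter so that one polar term can be removed, both for comparing
  residues and for evaluation at y = 1.\<close>

definition lerch :: "(int \<Rightarrow> complex) \<Rightarrow> complex \<Rightarrow> int set \<Rightarrow> complex \<Rightarrow> complex" where
  "lerch r q I y = (\<Sum>\<^sub>\<infinity>k\<in>I. r k / (1 - y * q powi k))"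

lemma lerch_holomorphic:
  fixes q :: complex and I :: "int set"
  assumes q: "norm q < 1" "q \<noteq> 0" and r: "(\<lambda>k. norm (r k)) summable_on UNIV"
  defines "S \<equiv> {y. y \<noteq> 0 \<and> (\<forall>k\<in>I. y * q powi k \<noteq> 1)}"
  shows "open S" "lerch r q I holomorphic_on S"
    and "\<And>y. y \<in> S \<Longrightarrow> ((\<lambda>k. r k / (1 - y * q powi k)) has_sum lerch r q I y) I"
    and "\<And>y. y \<in> S \<Longrightarrow> ((\<lambda>k. r k * q powi k / (1 - y * q powi k) ^ 2) has_sum deriv (lerch r q I) y) I"
proof -
  let ?f = "\<lambda>k y. r k / (1 - y * q powi k)"
  have dom: "\<exists>d>0. \<exists>M. cball z d \<subseteq> S \<and> M summable_on I \<and> (\<forall>k\<in>I. \<forall>w\<in>cball z d. norm (?f k w) \<le> M k)" if "z \<in> S" for z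
  proof -
    obtain d B where d: "d > 0" "\<And>w. w \<in> cball z d \<Longrightarrow> w \<noteq> 0"
      "\<And>w k. w \<in> cball z d \<Longrightarrow> k \<in> I \<Longrightarrow> w * q powi k \<noteq> 1 \<and> norm (1 / (1 - w * q powi k)) \<le> B"
      using one_minus_powi_bound[OF q, of z I] \<open>z \<in> S\<close> unfolding S_def by blast
    have "cball z d \<subseteq> S"
    proof
      fix w assume w: "w \<in> cball z d"
      show "w \<in> S" using d(2)[OF w] d(3)[OF w] by (auto simp: S_def)
    qed
    moreover have "(\<lambda>k. norm (r k) * B) summable_on I"
      by (intro summable_on_cmult_left summable_on_subset_banach[OF r]) auto
    moreover have "norm (?f k w) \<le> norm (r k) * B" if "k \<in> I" "w \<in> cball z d" for k w
    proof -
      have "norm (?f k w) = norm (r k) * norm (1 / (1 - w * q powi k))" by (simp add: norm_divide)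
      also have "\<dots> \<le> norm (r k) * B" using d(3)[OF that(2,1)] by (intro mult_left_mono) auto
      finally show ?thesis .
    qed
    ultimately show ?thesis using d(1) by blast
  qed
  show S: "open S"
  proof (rule openI)
    fix z assume "z \<in> S"
    from dom[OF this] obtain d where "d > 0" "cball z d \<subseteq> S" by blast
    then show "\<exists>e>0. ball z e \<subseteq> S" by (meson ball_subset_cball order_trans)
  qed
  have hol: "?f k holomorphic_on S" if "k \<in> I" for k
    using that by (auto intro!: holomorphic_intros simp: S_def)
  have *: "lerch r q I = (\<lambda>y. \<Sum>\<^sub>\<infinity>k\<in>I. ?f k y)" by (simp add: lerch_def fun_eq_iff)
  show "lerch r q I holomorphic_on S" unfolding * by (rule holomorphic_infsum(1)[OF S hol dom])
  show "((\<lambda>k. ?f k y) has_sum lerch r q I y) I" if "y \<in> S" for y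
    unfolding lerch_def by (rule holomorphic_infsum(3)[OF S hol dom that])
  show "((\<lambda>k. r k * q powi k / (1 - y * q powi k) ^ 2) has_sum deriv (lerch r q I) y) I" if "y \<in> S" for y
  proof -
    have "((\<lambda>k. deriv (?f k) y) has_sum deriv (lerch r q I) y) I"
      unfolding * by (rule holomorphic_infsum(2)[OF S hol dom that])
    moreover have "deriv (?f k) y = r k * q powi k / (1 - y * q powi k) ^ 2" if "k \<in> I" for k
      using that \<open>y \<in> S\<close> by (intro DERIV_imp_deriv) (auto intro!: derivative_eq_intros simp: S_def power2_eq_square field_simps)
    ultimately show ?thesis using has_sum_cong by (metis (no_types, lifting))
  qed
qed

text \<open>The functional equation bounds \<open>h\<close> near \<open>0\<close> and near \<open>\<infinity>\<close> by its maximum on an annulus,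
  and Liouville's theorem applies to \<open>h \<circ> exp\<close>.\<close>

lemma cubic_multiplier_vanishes:
  fixes h :: "complex \<Rightarrow> complex"
  assumes hol: "h holomorphic_on - {0}" and p: "norm p < 1" "p \<noteq> 0" and C: "C \<noteq> 0"
    and fe: "\<And>y. y \<noteq> 0 \<Longrightarrow> h (y * p) = C * y ^ 3 * h y" and y0: "y0 \<noteq> 0"
  shows "h y0 = 0"
proof -
  define c where "c = norm C"
  have c: "c > 0" using C by (simp add: c_def)
  \<comment> \<open>The factor C y^3 has norm at least 1 beyond radius \<open>R\<close> and at most
    1 within radius \<delta>, so the functional equation propagates the bound on the annulus
    \<open>K\<close> in both directions.\<close>
  define R where "R = max 1 (1 / c)"
  define \<delta> where "\<delta> = min 1 (1 / c)"
  have R: "R \<ge> 1" "c * R ^ 3 \<ge> 1"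
  proof -
    show R1: "R \<ge> 1" by (simp add: R_def)
    have "R ^ 1 \<le> R ^ 3" using R1 by (intro power_increasing) auto
    moreover have "1 / c \<le> R" by (simp add: R_def)
    ultimately have "c * (1 / c) \<le> c * R ^ 3" using c by (intro mult_left_mono) auto
    then show "c * R ^ 3 \<ge> 1" using c by simp
  qed
  have \<delta>: "\<delta> > 0" "\<delta> \<le> 1" "c * \<delta> ^ 3 \<le> 1"
  proof -
    show d1: "\<delta> > 0" "\<delta> \<le> 1" using c by (auto simp: \<delta>_def)
    have "\<delta> ^ 3 \<le> \<delta> ^ 1" using d1 by (intro power_decreasing) auto
    moreover have "\<delta> \<le> 1 / c" by (simp add: \<delta>_def)
    ultimately have "c * \<delta> ^ 3 \<le> c * (1 / c)" using c by (intro mult_left_mono) auto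
    then show "c * \<delta> ^ 3 \<le> 1" using c by simp
  qed
  define a where "a = norm p"
  have a: "0 < a" "a < 1" using p by (auto simp: a_def)
  define K where "K = cball 0 (R / a) - ball (0 :: complex) (\<delta> * a)"
  have "compact K" unfolding K_def by (intro compact_diff) auto
  moreover have "continuous_on K h"
    by (rule holomorphic_on_imp_continuous_on[OF holomorphic_on_subset[OF hol]]) (use \<delta> a in \<open>auto simp: K_def\<close>)
  ultimately have "bounded (h ` K)" by (intro compact_imp_bounded compact_continuous_image)
  then obtain M where M: "\<And>y. y \<in> K \<Longrightarrow> norm (h y) \<le> M" by (auto simp: bounded_iff)
  have low: "norm (h y) \<le> M" if "\<delta> * a ^ Suc n \<le> norm y" "norm y \<le> R / a" for n y
    using that
  proof (induction n arbitrary: y)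
    case 0
    then show ?case by (intro M) (auto simp: K_def)
  next
    case (Suc n)
    show ?case
    proof (cases "\<delta> * a ^ Suc n \<le> norm y")
      case True
      then show ?thesis using Suc by blast
    next
      case False
      define z where "z = y / p"
      have y: "y = z * p" using p by (simp add: z_def)
      have nz: "norm y = norm z * a" by (simp add: y norm_mult a_def)
      have "norm z * a < \<delta> * a ^ n * a" using False nz by (simp add: mult_ac)
      then have z1: "norm z < \<delta> * a ^ n" using a by simp
      have "\<delta> * a ^ n \<le> \<delta> * 1" using a \<delta> by (intro mult_left_mono) (auto simp: power_le_one)
      then have z2: "norm z \<le> \<delta>" using z1 by simp
      have "\<delta> * a ^ Suc n * a \<le> norm z * a" using Suc.prems(1) nz by (simp add: mult_ac)
      then have z3: "\<delta> * a ^ Suc n \<le> norm z" by (rule mult_right_le_imp_le) (rule a(1))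
      have "0 < \<delta> * a ^ Suc n" using a \<delta> by (intro mult_pos_pos zero_less_power) auto
      then have "0 < norm z" using z3 by linarith
      then have z0: "z \<noteq> 0" by simp
      have "R / a \<ge> \<delta>" using a R \<delta> by (smt (verit) divide_pos_pos le_divide_eq_1_pos frac_le)
      then have "norm (h z) \<le> M" using Suc.IH[OF z3] z2 by simp
      moreover have "norm (h y) = (c * norm z ^ 3) * norm (h z)" unfolding y fe[OF z0] by (simp add: norm_mult norm_power c_def)
      moreover have "c * norm z ^ 3 \<le> 1"
      proof -
        have "c * norm z ^ 3 \<le> c * \<delta> ^ 3" using z2 c by (intro mult_left_mono power_mono) auto
        then show ?thesis using \<delta> by linarith
      qed
      moreover from this have "(c * norm z ^ 3) * norm (h z) \<le> 1 * norm (h z)" by (intro mult_right_mono) auto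
      ultimately show ?thesis by linarith
    qed
  qed
  have high: "norm (h y) \<le> M" if "norm y \<le> R / a ^ Suc n" "\<delta> * a \<le> norm y" for n y
    using that
  proof (induction n arbitrary: y)
    case 0
    then show ?case by (intro M) (auto simp: K_def)
  next
    case (Suc n)
    show ?case
    proof (cases "norm y \<le> R / a ^ Suc n")
      case True
      then show ?thesis using Suc by blast
    next
      case False
      have "0 < \<delta> * a" using a \<delta> by (intro mult_pos_pos) auto
      then have "0 < norm y" using Suc.prems(2) by linarith
      then have y0: "y \<noteq> 0" by simp
      have nz: "norm (y * p) = norm y * a" by (simp add: norm_mult a_def)
      have 1: "norm (y * p) \<le> R / a ^ Suc n" using Suc.prems(1) a unfolding nz by (simp add: field_simps)
      have "R \<le> R / a ^ n" using a R by (simp add: field_simps power_le_one mult_left_le)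
      moreover have "R / a ^ n < norm y * a" using False a by (simp add: field_simps)
      ultimately have 2: "R \<le> norm (y * p)" unfolding nz by linarith
      have "\<delta> * a \<le> 1" using a \<delta> by (simp add: mult_le_one)
      then have "norm (h (y * p)) \<le> M" using Suc.IH[OF 1] 2 R by linarith
      moreover have "norm (h (y * p)) = (c * norm y ^ 3) * norm (h y)" unfolding fe[OF y0] by (simp add: norm_mult norm_power c_def)
      moreover have "c * norm y ^ 3 \<ge> 1"
      proof -
        have "norm y * a \<le> norm y" using a by (simp add: mult_left_le)
        then have "R \<le> norm y" using 2 nz by linarith
        then have "c * R ^ 3 \<le> c * norm y ^ 3" using c R by (intro mult_left_mono power_mono) auto
        then show ?thesis using R by linarith
      qed
      moreover from this have "1 * norm (h y) \<le> (c * norm y ^ 3) * norm (h y)" by (intro mult_right_mono) auto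
      ultimately show ?thesis by linarith
    qed
  qed
  have bound: "norm (h y) \<le> M" if "y \<noteq> 0" for y
  proof (cases "norm y \<le> R / a")
    case True
    obtain n where "a ^ n < norm y / \<delta>" using real_arch_pow_inv[of "norm y / \<delta>" a] \<open>y \<noteq> 0\<close> a \<delta> by auto
    then have "\<delta> * a ^ n \<le> norm y" using \<delta> by (simp add: field_simps)
    moreover have "\<delta> * a ^ Suc n \<le> \<delta> * a ^ n" using a \<delta> by (intro mult_left_mono power_decreasing) auto
    ultimately show ?thesis using low[of n y] True by linarith
  next
    case False
    obtain n where n: "a ^ n < R / norm y" using real_arch_pow_inv[of "R / norm y" a] \<open>y \<noteq> 0\<close> a R by auto
    have "a ^ Suc n \<le> a ^ n" using a by (intro power_decreasing) auto
    then have "a ^ Suc n < R / norm y" using n by linarith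
    then have "norm y \<le> R / a ^ Suc n" using a that by (simp add: field_simps)
    moreover have "\<delta> * a \<le> norm y"
    proof -
      have "\<delta> * a \<le> 1" using a \<delta> by (simp add: mult_le_one)
      moreover have "1 \<le> R / a" using a R by (simp add: field_simps)
      ultimately show ?thesis using False by linarith
    qed
    ultimately show ?thesis by (rule high)
  qed
  have "(\<lambda>u. h (exp u)) holomorphic_on UNIV"
    by (rule holomorphic_on_compose_gen[OF holomorphic_on_exp hol, unfolded o_def]) auto
  moreover have "bounded (range (\<lambda>u. h (exp u)))" unfolding bounded_iff by (auto intro!: exI[of _ M] bound)
  ultimately have "(\<lambda>u. h (exp u)) constant_on UNIV" by (rule Liouville_theorem)
  then obtain k where k: "\<And>u. h (exp u) = k" by (auto simp: constant_on_def)
  have hk: "h y = k" if "y \<noteq> 0" for y using k[of "Ln y"] that by simp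
  \<comment> \<open>A nonzero constant is excluded by comparing the functional equation at y = 1 and
    y = 2.\<close>
  have "k = C * k" using fe[of 1] hk[of p] hk[of 1] p by simp
  moreover have "k = C * 8 * k" using fe[of 2] hk[of "2 * p"] hk[of 2] p by simp
  ultimately have "k = 8 * k" by (metis mult.assoc mult.commute)
  then have "k = 0" by simp
  then show ?thesis using hk[OF y0] by simp
qed

lemma theta_mult_powi:
  assumes q: "norm q < 1" "q \<noteq> 0" and y: "y \<noteq> 0"
  shows "theta (y * q powi k) q = (- 1) powi k * y powi (- k) * q powi (- tri k) * theta y q"
proof (induction k rule: int_induct[where k = 0])
  case base
  then show ?case by (simp add: tri_def)
next
  case (step1 i)
  have "theta (y * q powi (i + 1)) q = - theta (y * q powi i) q / (y * q powi i)"
    using theta_mult_q[OF q(1) _ q(2), of "y * q powi i"] q y by (simp add: power_int_add mult.assoc)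
  also have "\<dots> = (- ((- 1) powi i)) * (y powi (- i) / y) * (q powi (- tri i) / q powi i) * theta y q"
    unfolding step1.IH by simp
  also have "- ((- 1 :: complex) powi i) = (- 1) powi (i + 1)" by (simp add: minus_one_powi)
  also have "y powi (- i) / y = y powi (- (i + 1))" using y by (simp add: power_int_diff)
  also have "q powi (- tri i) / q powi i = q powi (- tri (i + 1))"
    unfolding tri_add_1 using q by (simp add: power_int_diff)
  finally show ?case .
next
  case (step2 i)
  have "theta (y * q powi i) q = - theta (y * q powi (i - 1)) q / (y * q powi (i - 1))"
    using theta_mult_q[OF q(1) _ q(2), of "y * q powi (i - 1)"] q y by (simp add: power_int_diff mult.assoc)
  then have "theta (y * q powi (i - 1)) q = - (y * q powi (i - 1)) * theta (y * q powi i) q"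
    using q y by (simp add: field_simps)
  also have "\<dots> = (- ((- 1) powi i)) * (y powi (- i) * y) * (q powi (- tri i) * q powi (i - 1)) * theta y q"
    unfolding step2.IH by simp
  also have "- ((- 1 :: complex) powi i) = (- 1) powi (i - 1)" by (simp add: minus_one_powi)
  also have "y powi (- i) * y = y powi (- (i - 1))" using y by (simp add: power_int_diff power_int_minus divide_simps)
  also have "q powi (- tri i) * q powi (i - 1) = q powi (- tri (i - 1))"
    unfolding tri_diff_1 using q by (subst power_int_add[symmetric]) (auto simp: algebra_simps)
  finally show ?case .
qed

lemma int_induct_mod5:
  fixes P :: "int \<Rightarrow> bool"
  assumes base: "\<And>k. k \<in> {0..4} \<Longrightarrow> P k" and up: "\<And>k. P k \<longleftrightarrow> P (k + 5)"
  shows "P k"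
proof -
  have "P (r + 5 * m)" if "P r" for m r
    using that
  proof (induction m rule: int_induct[where k = 0])
    case (step1 i)
    then show ?case using up[of "r + 5 * i"] by (simp add: algebra_simps)
  next
    case (step2 i)
    then show ?case using up[of "r + 5 * (i - 1)"] by (simp add: algebra_simps)
  qed simp
  from this[OF base[of "k mod 5"], of "k div 5"] show ?thesis by (simp add: mod_mult_div_eq)
qed

text \<open>The difference of the two sides has removable singularities: by \<open>match\<close> the
  residues agree at five consecutive poles, and the quasi-periodicity of \<open>r\<close> and
  \<open>U\<close> carries this to all poles. The three vanishing moments remove the inhomogeneous
  terms that the shift of y to y q^5 creates in the Lerch sum, so both sides have the multiplier C
  y^3 and \<open>cubic_multiplier_vanishes\<close> applies.\<close>

theorem partial_fractions:
  fixes q \<kappa> \<mu> y :: complex and r :: "int \<Rightarrow> complex"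
  assumes q: "norm q < 1" "q \<noteq> 0"
    and r: "(\<lambda>k. norm (r k)) summable_on UNIV"
    and rec: "\<And>k. r (k + 5) = - \<kappa> * q powi (3 * k) * r k" and \<kappa>\<mu>: "\<kappa> * \<mu> = q ^ 5"
    and sum0: "(r has_sum 0) UNIV" and sum1: "((\<lambda>k. r k * q powi k) has_sum 0) UNIV"
    and sum2: "((\<lambda>k. r k * q powi (2 * k)) has_sum 0) UNIV"
    and U: "U holomorphic_on - {0}" and Uq: "\<And>y. y \<noteq> 0 \<Longrightarrow> U (y * q ^ 5) = \<mu> / y ^ 2 * U y"
    and match: "\<And>k. k \<in> {0..4} \<Longrightarrow> r k * euler q ^ 2 = (-1) powi k * q powi tri (k + 1) * U (q powi (- k))"
    and y: "y \<noteq> 0" "\<And>k. y * q powi k \<noteq> 1"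
  shows "lerch r q UNIV y = U y / theta y q"
proof -
  have \<kappa>0: "\<kappa> \<noteq> 0" and \<mu>0: "\<mu> \<noteq> 0" using \<kappa>\<mu> q by auto
  have q0: "q powi k \<noteq> 0" for k using q by simp
  have match': "r k * euler q ^ 2 = (-1) powi k * q powi tri (k + 1) * U (q powi (- k))" for k
  proof (induction k rule: int_induct_mod5)
    case (2 k)
    have "U (q powi (- (k + 5)) * q ^ 5) = \<mu> / (q powi (- (k + 5))) ^ 2 * U (q powi (- (k + 5)))"
      by (rule Uq) (rule q0)
    moreover have "q powi (- (k + 5)) * q ^ 5 = q powi (- k)"
      using q by (simp add: power_int_diff power_int_minus power_int_add divide_simps)
    moreover have "(q powi (- (k + 5))) ^ 2 = q powi (- 2 * (k + 5))" by (simp add: power_int_power' algebra_simps)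
    ultimately have "U (q powi (- k)) = \<mu> / q powi (- 2 * (k + 5)) * U (q powi (- (k + 5)))" by simp
    moreover have "a = \<mu> / X * b \<Longrightarrow> X \<noteq> 0 \<Longrightarrow> b = X / \<mu> * a" for a b X using \<mu>0 by simp
    ultimately have U5: "U (q powi (- (k + 5))) = q powi (- 2 * (k + 5)) / \<mu> * U (q powi (- k))"
      using q0 by blast
    have t: "tri (k + 5 + 1) = tri (k + 1) + 5 * k + 15"
      using two_tri[of "k + 6"] two_tri[of "k + 1"] by (simp add: algebra_simps)
    have sg: "(-1 :: complex) powi (k + 5) = - ((-1) powi k)" by (simp add: minus_one_powi)
    have "(-1) powi (k + 5) * q powi tri (k + 5 + 1) * U (q powi (- (k + 5)))
      = - ((-1) powi k * (q powi (tri (k + 1) + 5 * k + 15) * q powi (- 2 * (k + 5)) / \<mu>) * U (q powi (- k)))"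
      unfolding U5 t sg by simp
    also have "q powi (tri (k + 1) + 5 * k + 15) * q powi (- 2 * (k + 5)) = q powi tri (k + 1) * q powi (3 * k) * q ^ 5"
    proof -
      have "q powi (tri (k + 1) + 5 * k + 15) * q powi (- 2 * (k + 5)) = q powi (tri (k + 1) + 3 * k + 5)"
        using q by (subst power_int_add[symmetric]) (auto simp: algebra_simps)
      then show ?thesis using q by (simp add: power_int_add)
    qed
    also have "q powi tri (k + 1) * q powi (3 * k) * q ^ 5 / \<mu> = \<kappa> * q powi (3 * k) * q powi tri (k + 1)"
      unfolding \<kappa>\<mu>[symmetric] using \<mu>0 by simp
    finally have *: "(-1) powi (k + 5) * q powi tri (k + 5 + 1) * U (q powi (- (k + 5)))
      = - \<kappa> * q powi (3 * k) * ((-1) powi k * q powi tri (k + 1) * U (q powi (- k)))" by simp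
    have "r (k + 5) * euler q ^ 2 = - \<kappa> * q powi (3 * k) * (r k * euler q ^ 2)" unfolding rec by simp
    then show ?case unfolding * using \<kappa>0 q by simp
  qed (rule match)
  define S where "S = {y. y \<noteq> 0 \<and> (\<forall>k\<in>UNIV. y * q powi k \<noteq> 1)}"
  define V where "V = lerch r q UNIV"
  define F where "F = (\<lambda>y. U y / theta y q)"
  note L = lerch_holomorphic[OF q r, where I = UNIV, folded S_def V_def]
  have th0: "theta y q = 0 \<longleftrightarrow> (\<exists>k. y * q powi k = 1)" if "y \<noteq> 0" for y
  proof -
    have "y = q powi k \<longleftrightarrow> y * q powi (- k) = 1" for k using q0[of k] by (simp add: power_int_minus field_simps)
    then show ?thesis unfolding theta_eq_0_iff[OF q(1) that q(2)] by (metis minus_minus)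
  qed
  have F_hol: "F holomorphic_on S" unfolding F_def
    by (intro holomorphic_intros holomorphic_on_subset[OF U] holomorphic_on_subset[OF theta_holomorphic[OF q(1)]])
      (auto simp: S_def th0)
  define \<Delta> where "\<Delta> = (\<lambda>y. V y - F y)"
  have \<Delta>_hol: "\<Delta> holomorphic_on S" unfolding \<Delta>_def by (intro holomorphic_intros L F_hol)
  have Sp: "y * q ^ 5 \<in> S" if "y \<in> S" for y
  proof -
    have "y * q ^ 5 * q powi k \<noteq> 1" for k
    proof -
      have e: "y * q ^ 5 * q powi k = y * q powi (5 + k)" using q by (simp add: power_int_add)
      show ?thesis unfolding e using that by (simp add: S_def)
    qed
    then show ?thesis using that q by (simp add: S_def)
  qed
  \<comment> \<open>Under y to y q^5 the numerator gains y^(-2) and the denominator y^(-5), which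
    makes y^3; the condition \<kappa> \<mu> = q^5 makes the constants of both sides equal.\<close>
  define C where "C = - (q ^ 15 / \<kappa>)"
  have C0: "C \<noteq> 0" using q \<kappa>0 by (simp add: C_def)
  have F_fe: "F (y * q ^ 5) = C * y ^ 3 * F y" if "y \<in> S" for y
  proof -
    have y0: "y \<noteq> 0" using that by (simp add: S_def)
    have "theta (y * q powi 5) q = - (1 / y ^ 5 / q ^ 10) * theta y q"
      using theta_mult_powi[OF q y0, of 5] by (simp add: power_int_minus tri_def divide_simps)
    then have "F (y * q ^ 5) = (\<mu> / y ^ 2 * U y) / (- (1 / y ^ 5 / q ^ 10) * theta y q)"
      by (simp add: F_def Uq[OF y0])
    also have "\<dots> = - (\<mu> * q ^ 10) * y ^ 3 * F y" using y0 q by (simp add: F_def field_simps eval_nat_numeral)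
    also have "\<mu> * q ^ 10 = q ^ 15 / \<kappa>"
    proof -
      have "\<mu> = q ^ 5 / \<kappa>" using \<kappa>\<mu> \<kappa>0 by (simp add: field_simps)
      then show ?thesis by (simp flip: power_add)
    qed
    finally show ?thesis by (simp add: C_def)
  qed
  have V_fe: "V (y * q ^ 5) = C * y ^ 3 * V y" if "y \<in> S" for y
  proof -
    have 1: "((\<lambda>k. r k / (1 - y * q powi (k + 5))) has_sum V (y * q ^ 5)) UNIV"
    proof -
      have "y * q ^ 5 * q powi k = y * q powi (k + 5)" for k
        using q by (simp add: power_int_add mult_ac)
      with L(3)[OF Sp[OF that]] show ?thesis by (simp only:)
    qed
    have bij: "bij_betw (\<lambda>k::int. k + 5) UNIV UNIV"
      by (rule bij_betwI[where g = "\<lambda>k. k - 5"]) auto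
    have 2: "((\<lambda>k. C * y ^ 3 * (r (k + 5) / (1 - y * q powi (k + 5)))) has_sum C * y ^ 3 * V y) UNIV"
      using L(3)[OF that] has_sum_reindex_bij_betw[OF bij, of "\<lambda>k. r k / (1 - y * q powi k)"]
      by (intro has_sum_cmult_right) simp
    have 3: "((\<lambda>k. r k + (y * q ^ 5) * (r k * q powi k) + (y * q ^ 5) ^ 2 * (r k * q powi (2 * k))) has_sum
        (0 + (y * q ^ 5) * 0 + (y * q ^ 5) ^ 2 * 0)) UNIV"
      by (intro has_sum_add has_sum_cmult_right sum0 sum1 sum2)
    have "r k / (1 - y * q powi (k + 5)) - C * y ^ 3 * (r (k + 5) / (1 - y * q powi (k + 5)))
       = r k + (y * q ^ 5) * (r k * q powi k) + (y * q ^ 5) ^ 2 * (r k * q powi (2 * k))" for k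
    proof -
      define Y where "Y = y * q powi (k + 5)"
      have Y: "1 - Y \<noteq> 0" using that by (auto simp: S_def Y_def)
      have Y': "Y = y * q ^ 5 * q powi k" using q by (simp add: Y_def power_int_add mult_ac)
      have q3: "q powi (3 * k) = (q powi k) ^ 3" "q powi (2 * k) = (q powi k) ^ 2" by (simp_all add: power_int_power' mult.commute)
      have "C * y ^ 3 * r (k + 5) = r k * Y ^ 3"
        unfolding rec C_def Y' q3 using \<kappa>0 by (simp add: power_mult_distrib flip: power_mult)
      moreover have "r k / (1 - Y) - C * y ^ 3 * (r (k + 5) / (1 - Y)) = (r k - C * y ^ 3 * r (k + 5)) / (1 - Y)"
        by (simp add: diff_divide_distrib)
      ultimately have "r k / (1 - Y) - C * y ^ 3 * (r (k + 5) / (1 - Y)) = (r k - r k * Y ^ 3) / (1 - Y)"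
        by (simp only:)
      \<comment> \<open>The factor 1 - Y^3 cancels the pole and leaves 1 + Y + Y^2, whose three sums
        over k are the vanishing moments.\<close>
      also have "r k - r k * Y ^ 3 = r k * (1 + Y + Y ^ 2) * (1 - Y)"
        by (simp add: algebra_simps power2_eq_square power3_eq_cube)
      finally have "r k / (1 - Y) - C * y ^ 3 * (r (k + 5) / (1 - Y)) = r k * (1 + Y + Y ^ 2)"
        using Y by simp
      then show ?thesis unfolding q3 Y_def[symmetric] by (simp add: Y' algebra_simps power_mult_distrib)
    qed
    with has_sum_diff[OF 1 2] have "((\<lambda>k. r k + (y * q ^ 5) * (r k * q powi k) + (y * q ^ 5) ^ 2 * (r k * q powi (2 * k))) has_sum
        (V (y * q ^ 5) - C * y ^ 3 * V y)) UNIV" by simp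
    from has_sum_unique[OF this 3] show ?thesis by simp
  qed
  have \<Delta>_fe: "\<Delta> (y * q ^ 5) = C * y ^ 3 * \<Delta> y" if "y \<in> S" for y
    using F_fe[OF that] V_fe[OF that] by (simp add: \<Delta>_def algebra_simps)
  define h where "h = remove_sings \<Delta>"
  have hS: "h y = \<Delta> y" if "y \<in> S" for y unfolding h_def
    by (rule remove_sings_at_analytic) (use that L(1) \<Delta>_hol in \<open>auto simp: analytic_at\<close>)
  have near: "\<exists>d>0. \<forall>w\<in>ball z d - {z}. w \<in> S" if z: "z \<noteq> 0" for z
  proof -
    define I where "I = {k. z * q powi k \<noteq> 1}"
    obtain d B where d: "d > 0" "\<And>w. w \<in> cball z d \<Longrightarrow> w \<noteq> 0"
      "\<And>w k. w \<in> cball z d \<Longrightarrow> k \<in> I \<Longrightarrow> w * q powi k \<noteq> 1 \<and> norm (1 / (1 - w * q powi k)) \<le> B"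
      using one_minus_powi_bound[OF q z, of I] unfolding I_def by blast
    have "w \<in> S" if "w \<in> ball z d - {z}" for w
    proof -
      have "w * q powi k \<noteq> 1" for k
      proof (cases "k \<in> I")
        case True
        then show ?thesis using d(3)[of w k] that by auto
      next
        case False
        then have "z * q powi k = 1" by (simp add: I_def)
        then show ?thesis using that q0[of k] by (metis DiffD2 mult_right_cancel singletonI)
      qed
      then show ?thesis using d(2)[of w] that by (auto simp: S_def)
    qed
    then show ?thesis using d(1) by blast
  qed
  have h_an: "h analytic_on {z}" if z: "z \<noteq> 0" for z
  proof (cases "z \<in> S")
    case True
    then have "\<Delta> analytic_on {z}" using L(1) \<Delta>_hol by (auto simp: analytic_at)
    then show ?thesis unfolding h_def by (rule remove_sings_analytic_on)
  next
    case False
    then obtain k where k: "z * q powi k = 1" using z by (auto simp: S_def)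
    have zk: "z = q powi (- k)" using k q0[of k] by (simp add: power_int_minus field_simps)
    have other: "z * q powi j \<noteq> 1" if "j \<in> - {k}" for j
    proof
      assume "z * q powi j = 1"
      then have "q powi (j - k) = 1" using k q zk by (simp add: power_int_diff power_int_minus field_simps)
      then have n1: "norm q powi (j - k) = 1" by (metis norm_one norm_power_int)
      have "j - k \<noteq> 0" using that by simp
      then consider "j - k > 0" | "j - k < 0" by linarith
      then show False
      proof cases
        case 1
        have "norm q powi (j - k) < norm q powi 0" by (rule power_int_strict_decreasing) (use 1 q in auto)
        then show False using n1 by simp
      next
        case 2
        have "norm q powi 0 < norm q powi (j - k)" by (rule power_int_strict_decreasing) (use 2 q in auto)
        then show False using n1 by simp
      qed
    qed
    obtain d where d: "d > 0" "\<forall>w\<in>ball z d - {z}. w \<in> S" using near[OF z] by blast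
    have iso: "isolated_singularity_at \<Delta> z"
      unfolding isolated_singularity_at_def
    proof (intro exI conjI)
      have "\<Delta> holomorphic_on ball z d - {z}" using \<Delta>_hol d(2) by (meson holomorphic_on_subset subsetI)
      then show "\<Delta> analytic_on ball z d - {z}" by (simp add: analytic_on_open open_Diff)
    qed (rule d(1))
    define Lk where "Lk = lerch r q (- {k})"
    define Sk where "Sk = {y. y \<noteq> 0 \<and> (\<forall>j\<in>- {k}. y * q powi j \<noteq> 1)}"
    note Lk = lerch_holomorphic[OF q r, where I = "- {k}", folded Sk_def Lk_def]
    have zSk: "z \<in> Sk" using z other by (auto simp: Sk_def)
    define G where "G = (\<lambda>x. qpoch (x * q) q * qpoch (q / x) q)"
    \<comment> \<open>\<open>theta y q\<close> without its simple zero factor 1 - y q^k at z =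
      q^(-k). The residue condition becomes \<open>\<phi> z = 0\<close>, and near z the polar part
      of \<Delta> is -z times a difference quotient of \<phi>.\<close>
    define w where "w = (\<lambda>y. (-1) powi k * (y * q powi k) powi k * q powi (- tri (k + 1)) * G (y * q powi k))"
    define \<phi> where "\<phi> = (\<lambda>y. r k - U y / w y)"
    have tr: "tri (- k) = tri (k + 1)" using two_tri[of "- k"] two_tri[of "k + 1"] by (simp add: algebra_simps)
    have theta_w: "theta y q = (1 - y * q powi k) * w y" if "y \<noteq> 0" for y
    proof -
      have "theta (y * q powi k * q powi (- k)) q = (- 1) powi (- k) * (y * q powi k) powi k * q powi (- tri (k + 1)) * theta (y * q powi k) q"
        using theta_mult_powi[OF q, of "y * q powi k" "- k"] that q0[of k] by (simp add: tr)
      moreover have "y * q powi k * q powi (- k) = y" using q0[of k] by (simp add: power_int_minus)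
      moreover have "(-1 :: complex) powi (- k) = (-1) powi k" by (simp add: minus_one_powi)
      moreover have "theta x q = (1 - x) * G x" for x using qpoch_rec[OF q(1), of x] by (simp add: theta_def G_def)
      ultimately show ?thesis by (simp add: w_def)
    qed
    have w_hol: "w holomorphic_on - {0}" unfolding w_def G_def
      by (intro holomorphic_intros holomorphic_on_compose_gen[OF _ qpoch_holomorphic[OF q(1)], unfolded o_def]) (use q0 in auto)
    have wz: "w z = (-1) powi k * q powi (- tri (k + 1)) * euler q ^ 2"
      unfolding w_def k by (simp add: G_def euler_def power2_eq_square)
    have wz0: "w z \<noteq> 0" using wz q0 euler_nonzero[OF q(1)] by simp
    have \<phi>z: "\<phi> z = 0"
    proof -
      have "U z = r k * w z"
      proof -
        have "r k * w z = (-1) powi k * q powi (- tri (k + 1)) * (r k * euler q ^ 2)" unfolding wz by simp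
        also have "\<dots> = ((-1) powi k * (-1) powi k) * (q powi (- tri (k + 1)) * q powi tri (k + 1)) * U z"
          unfolding match' zk by simp
        also have "\<dots> = U z" using q0 by (simp add: minus_one_powi power_int_minus)
        finally show ?thesis by simp
      qed
      then show ?thesis using wz0 by (simp add: \<phi>_def)
    qed
    have "(\<lambda>y. U y / w y) field_differentiable at z"
      using U w_hol wz0 z by (intro derivative_intros) (auto simp: holomorphic_on_open field_differentiable_def open_Compl)
    then obtain D where D: "((\<lambda>y. U y / w y) has_field_derivative D) (at z)" by (auto simp: field_differentiable_def)
    have "(\<phi> has_field_derivative - D) (at z)"
      using DERIV_diff[OF DERIV_const[of "r k"] D] by (simp add: \<phi>_def)
    then have lim1: "((\<lambda>y. (\<phi> y - \<phi> z) / (y - z)) \<longlongrightarrow> - D) (at z)" by (simp add: has_field_derivative_iff)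
    have "isCont Lk z" using Lk(1,2) zSk by (meson continuous_on_eq_continuous_at holomorphic_on_imp_continuous_on)
    then have lim2: "(Lk \<longlongrightarrow> Lk z) (at z)" by (simp add: isCont_def)
    have "((\<lambda>y. Lk y + ((\<phi> y - \<phi> z) / (y - z)) * (- z)) \<longlongrightarrow> Lk z + (- D) * (- z)) (at z)"
      by (intro tendsto_intros lim1 lim2)
    moreover have "\<forall>\<^sub>F y in at z. Lk y + ((\<phi> y - \<phi> z) / (y - z)) * (- z) = \<Delta> y"
    proof -
      have "\<forall>\<^sub>F y in at z. y \<in> ball z d - {z}" using d(1) by (intro eventually_at_in_open) auto
      moreover have "w \<midarrow>z\<rightarrow> w z"
        using w_hol z by (metis ComplI continuous_on_eq_continuous_at holomorphic_on_imp_continuous_on isCont_def open_Compl closed_singleton singletonD)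
      then have "\<forall>\<^sub>F y in at z. w y \<noteq> 0" using wz0 by (rule tendsto_imp_eventually_ne)
      ultimately show ?thesis
      proof eventually_elim
        case (elim y)
        have yS: "y \<in> S" using elim d by blast
        then have y0: "y \<noteq> 0" and yk: "1 - y * q powi k \<noteq> 0" by (auto simp: S_def)
        have "y \<in> Sk" using yS by (auto simp: S_def Sk_def)
        then have "((\<lambda>j. r j / (1 - y * q powi j)) has_sum r k / (1 - y * q powi k) + Lk y) (insert k (- {k}))"
          using Lk(3) by (intro has_sum_insert) auto
        moreover have "insert k (- {k}) = UNIV" by auto
        ultimately have V: "V y = r k / (1 - y * q powi k) + Lk y" using L(3)[OF yS] has_sum_unique by metis
        have "\<Delta> y = Lk y + \<phi> y / (1 - y * q powi k)"
          by (simp add: \<Delta>_def V F_def theta_w[OF y0] \<phi>_def diff_divide_distrib mult.commute)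
        moreover have "1 - y * q powi k = (y - z) / (- z)" using k z by (simp add: field_simps)
        moreover have "y \<noteq> z" using elim by simp
        ultimately show ?case using \<phi>z z by (simp add: field_simps)
      qed
    qed
    ultimately have "\<Delta> \<midarrow>z\<rightarrow> Lk z + (- D) * (- z)" by (rule Lim_transform_eventually)
    then show ?thesis unfolding h_def by (rule remove_sings_analytic_at[OF iso])
  qed
  have h_hol: "h holomorphic_on - {0}"
  proof -
    have "h analytic_on - {0}" using h_an by (subst analytic_on_analytic_at) auto
    then show ?thesis by (rule analytic_imp_holomorphic)
  qed
  have h_cont: "h \<midarrow>z\<rightarrow> h z" if "z \<noteq> 0" for z
    using h_hol that by (metis ComplI continuous_on_eq_continuous_at holomorphic_on_imp_continuous_on isCont_def open_Compl closed_singleton singletonD)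
  have h_fe: "h (z * q ^ 5) = C * z ^ 3 * h z" if z: "z \<noteq> 0" for z
  proof -
    obtain d where d: "d > 0" "\<forall>w\<in>ball z d - {z}. w \<in> S" using near[OF z] by blast
    have "isCont (\<lambda>w. h (w * q ^ 5)) z"
    proof -
      have "isCont h (z * q ^ 5)" using h_cont[of "z * q ^ 5"] z q by (simp add: isCont_def)
      moreover have "isCont (\<lambda>w. w * q ^ 5) z" by (intro continuous_intros)
      ultimately show ?thesis by (rule isCont_o2[rotated])
    qed
    then have 1: "((\<lambda>w. h (w * q ^ 5)) \<longlongrightarrow> h (z * q ^ 5)) (at z)" by (simp add: isCont_def)
    have 2: "((\<lambda>w. C * w ^ 3 * h w) \<longlongrightarrow> C * z ^ 3 * h z) (at z)"
      by (intro tendsto_intros h_cont z)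
    have "\<forall>\<^sub>F w in at z. w \<in> ball z d - {z}" using d(1) by (intro eventually_at_in_open) auto
    then have "\<forall>\<^sub>F w in at z. h (w * q ^ 5) = C * w ^ 3 * h w"
    proof eventually_elim
      case (elim w)
      then have "w \<in> S" using d by blast
      then show ?case using hS Sp \<Delta>_fe by simp
    qed
    then have "((\<lambda>w. C * w ^ 3 * h w) \<longlongrightarrow> h (z * q ^ 5)) (at z)" using 1 by (rule Lim_transform_eventually[rotated])
    from tendsto_unique[OF _ this 2] show ?thesis by simp
  qed
  have q5: "norm (q ^ 5) < 1" "q ^ 5 \<noteq> 0" using norm_power_less_1[OF q(1)] q by auto
  have "h y = 0" by (rule cubic_multiplier_vanishes[OF h_hol q5 C0 h_fe y(1)])
  moreover have "y \<in> S" using y by (simp add: S_def)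
  ultimately have "\<Delta> y = 0" using hS by simp
  then show ?thesis by (simp add: \<Delta>_def V_def F_def)
qed

section \<open>Averaging over fifth roots of unity\<close>

definition om :: complex where "om = cis (2 * pi / 5)"

lemma om_pow5: "om ^ 5 = 1"
  by (simp add: om_def Complex.DeMoivre)

lemma om_neq_1: "om \<noteq> 1"
proof
  assume "om = 1"
  then have "sin (2 * pi / 5) = 0" by (simp add: om_def complex_eq_iff)
  moreover have "sin (2 * pi / 5) > 0" by (rule sin_gt_zero) (use pi_gt_zero in auto)
  ultimately show False by simp
qed

lemma norm_om [simp]: "norm om = 1" and om_nonzero [simp]: "om \<noteq> 0"
  by (auto simp: om_def)

text \<open>Projection onto the exponents divisible by 5; the result is still a function of x, not
  of x^5.\<close>

definition avg :: "(complex \<Rightarrow> complex) \<Rightarrow> complex \<Rightarrow> complex" where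
  "avg f x = (f x + f (om * x) + f (om ^ 2 * x) + f (om ^ 3 * x) + f (om ^ 4 * x)) / 5"

lemma avg_cong:
  assumes "\<And>k. k < 5 \<Longrightarrow> f (om ^ k * x) = g (om ^ k * x)"
  shows "avg f x = avg g x"
  using assms[of 0] assms[of 1] assms[of 2] assms[of 3] assms[of 4] by (simp add: avg_def)

lemma avg_add: "avg (\<lambda>z. f z + g z) x = avg f x + avg g x"
  and avg_cmult: "avg (\<lambda>z. c * f z) x = c * avg f x"
  by (simp_all add: avg_def algebra_simps add_divide_distrib)

lemma avg_0: "avg (\<lambda>z. 0) x = 0"
  by (simp add: avg_def)

lemma avg_powi:
  assumes "x \<noteq> 0"
  shows "avg (\<lambda>z. z powi e) x = (if e mod 5 = 0 then x powi e else 0)"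
proof -
  define v where "v = om powi e"
  have v5: "v ^ 5 = 1"
    unfolding v_def power_int_power' by (simp add: power_int_mult mult.commute[of e] om_pow5)
  have k: "(om ^ k * x) powi e = v ^ k * x powi e" for k
    by (simp add: v_def power_int_mult_distrib power_int_power power_int_power' mult.commute)
  have sum: "avg (\<lambda>z. z powi e) x = (1 + v + v ^ 2 + v ^ 3 + v ^ 4) * x powi e / 5"
    unfolding avg_def using k[of 0] k[of 1] k[of 2] k[of 3] k[of 4] by (simp add: algebra_simps)
  have ve: "v = om ^ nat (e mod 5)"
  proof -
    have "om powi e = om powi (5 * (e div 5) + e mod 5)" by simp
    also have "\<dots> = om powi (e mod 5)" by (subst power_int_add) (simp_all add: power_int_mult om_pow5)
    finally show ?thesis by (simp add: v_def power_int_nonneg_exp)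
  qed
  show ?thesis
  proof (cases "e mod 5 = 0")
    case True
    then have "v = 1" using ve by simp
    then show ?thesis using True sum by simp
  next
    case False
    have "v \<noteq> 1"
    proof
      assume v1: "v = 1"
      have o: "om ^ 6 = om" "om ^ 16 = om"
        using power_add[of om 5 1] power_add[of om 5 11] power_add[of om 5 6] om_pow5 by simp_all
      have "0 \<le> e mod 5" "e mod 5 < 5" by auto
      with False consider "nat (e mod 5) = 1" | "nat (e mod 5) = 2" | "nat (e mod 5) = 3" | "nat (e mod 5) = 4" by linarith
      then show False
      proof cases
        case 1
        then show False using v1 ve om_neq_1 by simp
      next
        case 2
        then have "om ^ 2 = 1" using v1 ve by simp
        then have "om ^ (2 * 3) = 1" by (simp only: power_mult power_one)
        then show False using o om_neq_1 by simp
      next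
        case 3
        then have "om ^ 3 = 1" using v1 ve by simp
        then have "om ^ (3 * 2) = 1" by (simp only: power_mult power_one)
        then show False using o om_neq_1 by simp
      next
        case 4
        then have "om ^ 4 = 1" using v1 ve by simp
        then have "om ^ (4 * 4) = 1" by (simp only: power_mult power_one)
        then show False using o om_neq_1 by simp
      qed
    qed
    moreover have "(v - 1) * (1 + v + v ^ 2 + v ^ 3 + v ^ 4) = v ^ 5 - 1"
      by (simp add: algebra_simps eval_nat_numeral)
    ultimately have "1 + v + v ^ 2 + v ^ 3 + v ^ 4 = 0" using v5 by simp
    then show ?thesis using False sum by simp
  qed
qed

lemma has_sum_avg:
  assumes "\<And>k. k < 5 \<Longrightarrow> ((\<lambda>j. f j (om ^ k * x)) has_sum s (om ^ k * x)) A"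
  shows "((\<lambda>j. avg (f j) x) has_sum avg s x) A"
proof -
  have "((\<lambda>j. (f j x + f j (om * x) + f j (om ^ 2 * x) + f j (om ^ 3 * x) + f j (om ^ 4 * x)) * (1 / 5)) has_sum
     (s x + s (om * x) + s (om ^ 2 * x) + s (om ^ 3 * x) + s (om ^ 4 * x)) * (1 / 5)) A"
    using assms[of 0] assms[of 1] assms[of 2] assms[of 3] assms[of 4]
    by (intro has_sum_cmult_left has_sum_add) simp_all
  then show ?thesis by (simp add: avg_def)
qed

lemma om_power_mult:
  assumes "norm x < 1" "x \<noteq> 0"
  shows "norm (om ^ k * x) < 1" "om ^ k * x \<noteq> 0" "(om ^ k * x) ^ 5 = x ^ 5"
proof -
  have "(om ^ k) ^ 5 = (om ^ 5) ^ k" by (simp only: power_mult[symmetric] mult.commute)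
  then have "(om ^ k) ^ 5 = 1" by (simp add: om_pow5)
  then show "(om ^ k * x) ^ 5 = x ^ 5" by (simp add: power_mult_distrib)
qed (use assms in \<open>auto simp: norm_mult norm_power\<close>)

text \<open>\<open>f1 / f2\<close> is the Rogers--Ramanujan continued fraction without its fractional power of \<open>q\<close>.\<close>

locale dissected =
  fixes x q E a b f1 f2 d1 d2 Dt :: complex
  assumes x: "norm x < 1" "x \<noteq> 0"
  defines "q \<equiv> x ^ 5" and "E \<equiv> euler (q ^ 5)"
    and "f1 \<equiv> theta q (q ^ 5)" and "f2 \<equiv> theta (q ^ 2) (q ^ 5)"
    and "d1 \<equiv> q * deriv (\<lambda>y. theta y (q ^ 5)) q" and "d2 \<equiv> q ^ 2 * deriv (\<lambda>y. theta y (q ^ 5)) (q ^ 2)"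
    and "a \<equiv> f2 / f1" and "b \<equiv> f1 / f2" and "Dt \<equiv> a ^ 5 - 11 * q - q ^ 2 * b ^ 5"
begin

lemma q: "norm q < 1" "q \<noteq> 0"
  using norm_power_less_1[OF x(1), of 5] x by (auto simp: q_def)

lemma q5: "norm (q ^ 5) < 1" "q ^ 5 \<noteq> 0"
  using norm_power_less_1[OF q(1), of 5] q by auto

lemma E0: "E \<noteq> 0"
  unfolding E_def by (rule euler_nonzero[OF q5(1)])

lemma f1f2: "f1 * f2 = euler q / E"
proof -
  have "qpoch q q = (\<Prod>i<5. qpoch (q * q ^ i) (q ^ 5))" by (rule qpoch_split[OF q(1)]) simp
  also have "{..<5::nat} = {0, 1, 2, 3, 4}" by auto
  finally have *: "qpoch q q = (\<Prod>i\<in>{0, 1, 2, 3, 4}. qpoch (q * q ^ i) (q ^ 5))" .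
  have e: "euler q = qpoch q (q ^ 5) * qpoch (q ^ 2) (q ^ 5) * qpoch (q ^ 3) (q ^ 5) * qpoch (q ^ 4) (q ^ 5) * E"
  proof -
    have "q * q = q ^ 2" "q * q ^ 2 = q ^ 3" "q * q ^ 3 = q ^ 4" "q * q ^ 4 = q ^ 5"
      by (simp_all add: eval_nat_numeral)
    with * show ?thesis by (simp add: euler_def E_def mult.assoc)
  qed
  have "q ^ 5 / q = q ^ 4" "q ^ 5 / q ^ 2 = q ^ 3" using q by (simp_all add: eval_nat_numeral)
  then show ?thesis using E0 by (simp add: f1_def f2_def theta_def e)
qed

lemma f0: "f1 \<noteq> 0" "f2 \<noteq> 0"
  using f1f2 euler_nonzero[OF q(1)] E0 by auto

lemma ab: "a * b = 1" "a \<noteq> 0" "b \<noteq> 0" "f2 = a * f1"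
  using f0 by (auto simp: a_def b_def)

lemma dissA_eq: "dissA q = E * a"
  using dissA_theta[OF q] f0 by (simp add: E_def a_def f1_def f2_def field_simps)

lemma dissB_eq: "dissB q = E * b"
proof -
  have "dissA q * dissB q = E ^ 2"
    using dissection_relations(3)[OF q] E0 ab dissA_eq by (simp add: E_def)
  then have "E * a * dissB q = E * a * (E * b)" unfolding dissA_eq using ab(1) by (simp add: power2_eq_square mult_ac)
  then show ?thesis using E0 ab by simp
qed

lemma derivs: "f2 - 10 * d2 = E ^ 2 * (a ^ 3 - 3 * q * b ^ 2)" "3 * f1 - 10 * d1 = E ^ 2 * (3 * a ^ 2 + q * b ^ 3)"
proof -
  have "E * (f2 - 10 * d2) = E * (E ^ 2 * (a ^ 3 - 3 * q * b ^ 2))"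
    using dissection_relations(1)[OF q] unfolding dissA_eq dissB_eq
    by (simp add: E_def f2_def d2_def power_mult_distrib power2_eq_square power3_eq_cube algebra_simps)
  then show "f2 - 10 * d2 = E ^ 2 * (a ^ 3 - 3 * q * b ^ 2)" using E0 by simp
  have "E * (3 * f1 - 10 * d1) = E * (E ^ 2 * (3 * a ^ 2 + q * b ^ 3))"
    using dissection_relations(2)[OF q] unfolding dissA_eq dissB_eq
    by (simp add: E_def f1_def d1_def power_mult_distrib power2_eq_square power3_eq_cube algebra_simps)
  then show "3 * f1 - 10 * d1 = E ^ 2 * (3 * a ^ 2 + q * b ^ 3)" using E0 by simp
qed

lemma Dt: "E ^ 6 * Dt = euler q ^ 6" "Dt \<noteq> 0"
proof -
  have AB: "dissA q * dissB q = euler (q ^ 5) ^ 2"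
    unfolding dissA_eq dissB_eq E_def[symmetric] using ab(1) by (simp add: power2_eq_square mult_ac)
  show "E ^ 6 * Dt = euler q ^ 6"
    using dissection_norm[OF q AB] unfolding dissA_eq dissB_eq E_def[symmetric] Dt_def
    by (simp add: power_mult_distrib algebra_simps eval_nat_numeral)
  then show "Dt \<noteq> 0" using euler_nonzero[OF q(1)] by auto
qed

text \<open>The product of the four other conjugates of a - z - z^2 b under the fifth roots of
  unity, simplified by a b = 1; it rationalises 1 / \<open>euler z\<close> to the denominator
  \<open>E * Dt\<close>, which depends on q only.\<close>

definition num :: "complex \<Rightarrow> complex" where
  "num z = a ^ 4 + z * a ^ 3 + 2 * z ^ 2 * a ^ 2 + 3 * z ^ 3 * a + 5 * z ^ 4 - 3 * z ^ 5 * b + 2 * z ^ 6 * b ^ 2 - z ^ 7 * b ^ 3 + z ^ 8 * b ^ 4"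

lemma inverse_euler:
  assumes "norm z < 1" "z \<noteq> 0" "z ^ 5 = q"
  shows "1 / euler z = num z / (E * Dt)"
proof -
  have z25: "z ^ 25 = q ^ 5"
  proof -
    have "z ^ 25 = (z ^ 5) ^ 5" by (simp flip: power_mult)
    then show ?thesis by (simp add: assms)
  qed
  have z10: "z ^ 10 = q ^ 2"
  proof -
    have "z ^ 10 = (z ^ 5) ^ 2" by (simp flip: power_mult)
    then show ?thesis by (simp add: assms)
  qed
  have "euler z = E * (a - z - z ^ 2 * b)"
    using euler_dissection[OF assms(1,2)] unfolding assms(3) z25 dissA_eq dissB_eq E_def[symmetric] by (simp add: algebra_simps)
  moreover have "(a - z - z ^ 2 * b) * num z = Dt"
  proof -
    define c where "c = a * b - 1"
    have c: "c = 0" using ab(1) by (simp add: c_def)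
    have "(a - z - z ^ 2 * b) * num z - (a ^ 5 - 11 * z ^ 5 - z ^ 10 * b ^ 5)
      = c * (z ^ 8 * b ^ 3 - z ^ 2 * a ^ 3 - z ^ 3 * a ^ 2 - 2 * z ^ 4 * a - 6 * z ^ 5 + 2 * z ^ 6 * b - z ^ 7 * b ^ 2)"
      unfolding num_def c_def by (simp add: algebra_simps eval_nat_numeral)
    then have "(a - z - z ^ 2 * b) * num z = a ^ 5 - 11 * z ^ 5 - z ^ 10 * b ^ 5" using c by simp
    then show ?thesis by (simp add: Dt_def assms(3) z10)
  qed
  ultimately have "euler z * num z = E * Dt" by (simp add: mult.assoc)
  then show ?thesis using E0 Dt euler_nonzero[OF assms(1)] by (simp add: field_simps)
qed

lemma avg_inverse_euler:
  "avg (\<lambda>z. z powi e / euler z) x = (1 / (E * Dt)) *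
    (a ^ 4 * avg (\<lambda>z. z powi e) x + a ^ 3 * avg (\<lambda>z. z powi (e + 1)) x + 2 * a ^ 2 * avg (\<lambda>z. z powi (e + 2)) x
    + 3 * a * avg (\<lambda>z. z powi (e + 3)) x + 5 * avg (\<lambda>z. z powi (e + 4)) x + (- 3 * b) * avg (\<lambda>z. z powi (e + 5)) x
    + 2 * b ^ 2 * avg (\<lambda>z. z powi (e + 6)) x + (- (b ^ 3)) * avg (\<lambda>z. z powi (e + 7)) x + b ^ 4 * avg (\<lambda>z. z powi (e + 8)) x)"
proof -
  have "avg (\<lambda>z. z powi e / euler z) x = avg (\<lambda>z. (1 / (E * Dt)) *
    (a ^ 4 * z powi e + a ^ 3 * z powi (e + 1) + 2 * a ^ 2 * z powi (e + 2)
    + 3 * a * z powi (e + 3) + 5 * z powi (e + 4) + (- 3 * b) * z powi (e + 5)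
    + 2 * b ^ 2 * z powi (e + 6) + (- (b ^ 3)) * z powi (e + 7) + b ^ 4 * z powi (e + 8))) x"
  proof (rule avg_cong)
    fix k :: nat
    define z where "z = om ^ k * x"
    have z: "norm z < 1" "z \<noteq> 0" "z ^ 5 = q" using om_power_mult[OF x] by (auto simp: z_def q_def)
    have "z powi e / euler z = z powi e * (num z / (E * Dt))" using inverse_euler[OF z] by (simp add: divide_inverse)
    also have "\<dots> = (1 / (E * Dt)) * (z powi e * num z)" by simp
    also have "z powi e * num z = a ^ 4 * z powi e + a ^ 3 * z powi (e + 1) + 2 * a ^ 2 * z powi (e + 2)
      + 3 * a * z powi (e + 3) + 5 * z powi (e + 4) + (- 3 * b) * z powi (e + 5)
      + 2 * b ^ 2 * z powi (e + 6) + (- (b ^ 3)) * z powi (e + 7) + b ^ 4 * z powi (e + 8)"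
      using z(2) by (simp add: num_def power_int_add algebra_simps)
    finally show "z powi e / euler z = (1 / (E * Dt)) * (a ^ 4 * z powi e + a ^ 3 * z powi (e + 1) + 2 * a ^ 2 * z powi (e + 2)
      + 3 * a * z powi (e + 3) + 5 * z powi (e + 4) + (- 3 * b) * z powi (e + 5)
      + 2 * b ^ 2 * z powi (e + 6) + (- (b ^ 3)) * z powi (e + 7) + b ^ 4 * z powi (e + 8))" unfolding z_def .
  qed
  then show ?thesis by (simp only: avg_add avg_cmult)
qed

text \<open>For exponent 5 m - j only the coefficients of z^j and z^(j+5) in \<open>num\<close>
  survive the average. For j = 4 there is just one, the 5 of Ramanujan's congruence for p(5 n +
  4).\<close>

lemma avg_class:
  shows "avg (\<lambda>z. z powi (5 * m) / euler z) x = q powi m * (a ^ 4 - 3 * q * b) / (E * Dt)"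
    and "avg (\<lambda>z. z powi (5 * m - 1) / euler z) x = q powi m * (a ^ 3 + 2 * q * b ^ 2) / (E * Dt)"
    and "avg (\<lambda>z. z powi (5 * m - 2) / euler z) x = q powi m * (2 * a ^ 2 - q * b ^ 3) / (E * Dt)"
    and "avg (\<lambda>z. z powi (5 * m - 3) / euler z) x = q powi m * (3 * a + q * b ^ 4) / (E * Dt)"
    and "avg (\<lambda>z. z powi (5 * m - 4) / euler z) x = q powi m * 5 / (E * Dt)"
proof -
  have P0: "avg (\<lambda>z. z powi (5 * n)) x = q powi n" for n
    using x by (simp add: avg_powi q_def power_int_power)
  have P1: "avg (\<lambda>z. z powi (5 * n + r)) x = 0" if "r \<in> {1, 2, 3, 4}" for n r
  proof -
    have "(5 * n + r) mod 5 = r mod 5" by simp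
    then have "(5 * n + r) mod 5 \<noteq> 0" using that by auto
    then show ?thesis using x by (simp add: avg_powi)
  qed
  have Q: "avg (\<lambda>z. z powi (5 * m + r)) x = (if r = 0 then q powi m else if r = 5 then q powi (m + 1) else if r = -5 then q powi (m - 1) else 0)"
    if r: "r \<in> {-4..8}" for r
  proof -
    have "r = -4 \<or> r = -3 \<or> r = -2 \<or> r = -1 \<or> r = 0 \<or> r = 1 \<or> r = 2 \<or> r = 3 \<or> r = 4 \<or> r = 5 \<or> r = 6 \<or> r = 7 \<or> r = 8"
      using r unfolding atLeastAtMost_iff by presburger
    then consider "r = 0" | "r = 5" | "r \<in> {1, 2, 3, 4}" | "r \<in> {6, 7, 8}" | "r \<in> {-4, -3, -2, -1}" by blast
    then show ?thesis
    proof cases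
      case 1
      then show ?thesis using P0[of m] by simp
    next
      case 2
      then show ?thesis using P0[of "m + 1"] by (simp add: algebra_simps)
    next
      case 3
      then show ?thesis using P1[of r m] by auto
    next
      case 4
      then show ?thesis using P1[of "r - 5" "m + 1"] by (auto simp: algebra_simps)
    next
      case 5
      then show ?thesis using P1[of "r + 5" "m - 1"] by (auto simp: algebra_simps)
    qed
  qed
  have q1: "q powi (m + 1) = q powi m * q" using q by (simp add: power_int_add)
  note Q' = Q[of "-4"] Q[of "-3"] Q[of "-2"] Q[of "-1"] Q[of 0] Q[of 1] Q[of 2] Q[of 3] Q[of 4] Q[of 5] Q[of 6] Q[of 7] Q[of 8]
  show "avg (\<lambda>z. z powi (5 * m) / euler z) x = q powi m * (a ^ 4 - 3 * q * b) / (E * Dt)"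
    using avg_inverse_euler[of "5 * m"] Q' q1 by (simp add: algebra_simps add_divide_distrib diff_divide_distrib)
  show "avg (\<lambda>z. z powi (5 * m - 1) / euler z) x = q powi m * (a ^ 3 + 2 * q * b ^ 2) / (E * Dt)"
    using avg_inverse_euler[of "5 * m - 1"] Q' q1 by (simp add: algebra_simps add_divide_distrib diff_divide_distrib)
  show "avg (\<lambda>z. z powi (5 * m - 2) / euler z) x = q powi m * (2 * a ^ 2 - q * b ^ 3) / (E * Dt)"
    using avg_inverse_euler[of "5 * m - 2"] Q' q1 by (simp add: algebra_simps add_divide_distrib diff_divide_distrib)
  show "avg (\<lambda>z. z powi (5 * m - 3) / euler z) x = q powi m * (3 * a + q * b ^ 4) / (E * Dt)"
    using avg_inverse_euler[of "5 * m - 3"] Q' q1 by (simp add: algebra_simps add_divide_distrib diff_divide_distrib)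
  show "avg (\<lambda>z. z powi (5 * m - 4) / euler z) x = q powi m * 5 / (E * Dt)"
    using avg_inverse_euler[of "5 * m - 4"] Q' q1 by (simp add: algebra_simps add_divide_distrib diff_divide_distrib)
qed

text \<open>The pentagonal exponent is shifted by \<open>c * k\<close>, where c = 1 and c = 4 belong
  to the powers z and z^4 in \<open>weight_gf\<close> at z^k, and by -4, which selects the arguments
  5 n + 4.\<close>

definition R :: "int \<Rightarrow> int \<Rightarrow> complex \<Rightarrow> complex" where
  "R c k z = (-1) powi k * (z powi (3 * tri k + 2 * k + c * k - 4) / euler z)"

definition r :: "int \<Rightarrow> int \<Rightarrow> complex" where
  "r c k = avg (R c k) x"

lemma r_eq: "r c k = (-1) powi k * avg (\<lambda>z. z powi (3 * tri k + 2 * k + c * k - 4) / euler z) x"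
  unfolding r_def R_def by (rule avg_cmult)

text \<open>The exponents for k = 0, ..., 4 are -4, -1, 5, 14, 26 here and -4, 2, 11, 23, 38 in
  \<open>r4_values\<close>; their classes modulo 5 pick the formulas of
  \<open>avg_class\<close>.\<close>

lemma r1_values:
  "r 1 0 = 5 / (E * Dt)" "r 1 1 = - (a ^ 3 + 2 * q * b ^ 2) / (E * Dt)" "r 1 2 = q * (a ^ 4 - 3 * q * b) / (E * Dt)"
  "r 1 3 = - (q ^ 3) * (a ^ 3 + 2 * q * b ^ 2) / (E * Dt)" "r 1 4 = q ^ 6 * 5 / (E * Dt)"
  using avg_class(5)[of 0] avg_class(2)[of 0] avg_class(1)[of 1] avg_class(2)[of 3] avg_class(5)[of 6]
  by (simp_all add: r_eq tri_values)

lemma r4_values: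
  "r 4 0 = 5 / (E * Dt)" "r 4 1 = - q * (3 * a + q * b ^ 4) / (E * Dt)" "r 4 2 = q ^ 3 * 5 / (E * Dt)"
  "r 4 3 = - (q ^ 5) * (2 * a ^ 2 - q * b ^ 3) / (E * Dt)" "r 4 4 = q ^ 8 * (2 * a ^ 2 - q * b ^ 3) / (E * Dt)"
  using avg_class(5)[of 0] avg_class(4)[of 1] avg_class(5)[of 3] avg_class(3)[of 5] avg_class(3)[of 8]
  by (simp_all add: r_eq tri_values)

text \<open>Replacing k by k + 5 raises the exponent by 5(8 + c) + 15 k, a multiple of 5, which
  passes through the average as a power of q.\<close>

lemma r_rec: "r c (k + 5) = - (q powi (8 + c)) * q powi (3 * k) * r c k"
proof -
  have "R c (k + 5) (om ^ i * x) = (- (q powi (8 + c)) * q powi (3 * k)) * R c k (om ^ i * x)" for i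
  proof -
    define z where "z = om ^ i * x"
    have z: "z \<noteq> 0" "z ^ 5 = q" using om_power_mult[OF x] by (auto simp: z_def q_def)
    have "tri (k + 5) = tri k + 5 * k + 10"
      using two_tri[of "k + 5"] two_tri[of k] by (simp add: algebra_simps)
    then have "3 * tri (k + 5) + 2 * (k + 5) + c * (k + 5) - 4 = 5 * (8 + c) + (5 * (3 * k) + (3 * tri k + 2 * k + c * k - 4))"
      by (simp add: algebra_simps)
    then have "z powi (3 * tri (k + 5) + 2 * (k + 5) + c * (k + 5) - 4)
      = q powi (8 + c) * (q powi (3 * k) * z powi (3 * tri k + 2 * k + c * k - 4))"
      using z(1) by (simp only: power_int_add[OF disjI1[OF z(1)]] power_int_mult power_int_numeral z(2))
    moreover have "(-1 :: complex) powi (k + 5) = - ((-1) powi k)" by (simp add: minus_one_powi)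
    ultimately show ?thesis unfolding R_def z_def[symmetric] by simp
  qed
  then have "avg (R c (k + 5)) x = avg (\<lambda>z. (- (q powi (8 + c)) * q powi (3 * k)) * R c k z) x"
    by (intro avg_cong)
  then show ?thesis unfolding r_def avg_cmult .
qed

lemma summable_R:
  assumes z: "norm z < 1" "z \<noteq> 0"
  shows "(\<lambda>k. norm (R c k z)) summable_on UNIV"
proof -
  have "(\<lambda>k. norm z powi (3 * tri k + 2 * k + c * k - 4) * 1 powi k) summable_on UNIV"
  proof (rule summable_on_powi_quadratic[where \<delta> = "3/2" and B = "1/2 + \<bar>real_of_int c\<bar>" and C = 4])
    fix k :: int
    have "real_of_int c * real_of_int k \<ge> - (\<bar>real_of_int c\<bar> * \<bar>real_of_int k\<bar>)" by (metis abs_ge_minus_self abs_mult minus_le_iff)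
    moreover have "real_of_int (3 * tri k + 2 * k + c * k - 4) = 3 / 2 * (real_of_int k)\<^sup>2 + real_of_int k / 2 + real_of_int c * real_of_int k - 4"
      by (simp add: real_tri power2_eq_square field_simps)
    moreover have "(1/2 + \<bar>real_of_int c\<bar>) * \<bar>real_of_int k\<bar> = \<bar>real_of_int k\<bar> / 2 + \<bar>real_of_int c\<bar> * \<bar>real_of_int k\<bar>"
      by (simp add: distrib_right)
    ultimately show "3 / 2 * (real_of_int k)\<^sup>2 - (1/2 + \<bar>real_of_int c\<bar>) * \<bar>real_of_int k\<bar> - 4 \<le> real_of_int (3 * tri k + 2 * k + c * k - 4)"
      by linarith
  qed (use z in auto)
  then have "(\<lambda>k. (1 / norm (euler z)) * (norm z powi (3 * tri k + 2 * k + c * k - 4) * 1 powi k)) summable_on UNIV"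
    by (rule summable_on_cmult_right)
  then show ?thesis by (simp add: R_def norm_mult norm_divide norm_power_int)
qed

lemma summable_r: "(\<lambda>k. norm (r c k)) summable_on UNIV"
proof -
  define g where "g = (\<lambda>k. (norm (R c k x) + norm (R c k (om * x)) + norm (R c k (om ^ 2 * x)) + norm (R c k (om ^ 3 * x)) + norm (R c k (om ^ 4 * x))) * (1 / 5))"
  have s: "(\<lambda>k. norm (R c k (om ^ i * x))) summable_on UNIV" for i
    using om_power_mult[OF x, of i] by (intro summable_R)
  have gs: "g summable_on UNIV" unfolding g_def
    using s[of 0] s[of 1] s[of 2] s[of 3] s[of 4] by (intro summable_on_cmult_left summable_on_add) simp_all
  have "norm (r c k) \<le> g k" for k
  proof -
    have "norm (a1 + a2 + a3 + a4 + a5) \<le> norm a1 + norm a2 + norm a3 + norm a4 + norm a5" for a1 a2 a3 a4 a5 :: complex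
      using norm_triangle_ineq[of "a1 + a2 + a3 + a4" a5] norm_triangle_ineq[of "a1 + a2 + a3" a4]
        norm_triangle_ineq[of "a1 + a2" a3] norm_triangle_ineq[of a1 a2] by linarith
    then show ?thesis by (simp add: r_def avg_def g_def norm_divide divide_right_mono)
  qed
  then show ?thesis by (intro summable_on_comparison_test[OF gs]) auto
qed

lemma has_sum_R:
  assumes z: "norm z < 1" "z \<noteq> 0"
  shows "((\<lambda>k. R c k z * (z ^ 5) powi (j * k)) has_sum z powi (-4) / euler z * (euler (z ^ 3) * theta (z powi (2 + c + 5 * j)) (z ^ 3))) UNIV"
proof -
  have z3: "norm (z ^ 3) < 1" using norm_power_less_1[OF z(1)] by simp
  have "((\<lambda>k. z powi (-4) / euler z * ((-1) powi k * (z ^ 3) powi tri k * (z powi (2 + c + 5 * j)) powi k)) has_sum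
    z powi (-4) / euler z * (euler (z ^ 3) * theta (z powi (2 + c + 5 * j)) (z ^ 3))) UNIV"
    by (intro has_sum_cmult_right triple_product) (use z z3 in auto)
  moreover have "z powi (-4) / euler z * ((-1) powi k * (z ^ 3) powi tri k * (z powi (2 + c + 5 * j)) powi k) = R c k z * (z ^ 5) powi (j * k)" for k
  proof -
    have "(z ^ 3) powi tri k = z powi (3 * tri k)" "(z powi (2 + c + 5 * j)) powi k = z powi ((2 + c + 5 * j) * k)" "(z ^ 5) powi (j * k) = z powi (5 * (j * k))"
      by (simp_all add: power_int_mult)
    moreover have "z powi (-4) * (z powi (3 * tri k) * z powi ((2 + c + 5 * j) * k)) = z powi (3 * tri k + 2 * k + c * k - 4) * z powi (5 * (j * k))"
      using z(2) by (simp only: power_int_add[OF disjI1[OF z(2)], symmetric]) (simp add: algebra_simps)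
    ultimately show ?thesis unfolding R_def by (simp add: mult_ac)
  qed
  ultimately show ?thesis by simp
qed

text \<open>Quasi-periodicity in base z^3 reduces the argument to 1, z or z^2: the first is a zero,
  and the other two recombine with \<open>euler (z ^ 3)\<close> to \<open>euler z\<close>.\<close>

lemma theta_cube:
  assumes z: "norm z < 1" "z \<noteq> 0"
  shows "euler (z ^ 3) * theta (z powi (3 * m)) (z ^ 3) = 0"
    and "euler (z ^ 3) * theta (z powi (1 + 3 * m)) (z ^ 3) = (-1) powi m * z powi (- m - 3 * tri m) * euler z"
    and "euler (z ^ 3) * theta (z powi (2 + 3 * m)) (z ^ 3) = (-1) powi m * z powi (- 2 * m - 3 * tri m) * euler z"
proof -
  have z3: "norm (z ^ 3) < 1" "z ^ 3 \<noteq> 0" using norm_power_less_1[OF z(1)] z by auto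
  have zm: "z powi (3 * m) = (z ^ 3) powi m" by (simp add: power_int_mult)
  have t: "(z ^ 3) powi (- tri m) = z powi (- 3 * tri m)" by (simp add: power_int_power)
  show "euler (z ^ 3) * theta (z powi (3 * m)) (z ^ 3) = 0"
    unfolding zm using theta_eq_0_iff[OF z3(1) _ z3(2)] z3 by auto
  have "theta (z powi (1 + 3 * m)) (z ^ 3) = (-1) powi m * z powi (- m) * (z ^ 3) powi (- tri m) * theta z (z ^ 3)"
    using theta_mult_powi[OF z3 z(2), of m] zm z by (simp add: power_int_add)
  then show "euler (z ^ 3) * theta (z powi (1 + 3 * m)) (z ^ 3) = (-1) powi m * z powi (- m - 3 * tri m) * euler z"
    using z unfolding t euler_theta_cube[OF z, symmetric] by (simp add: power_int_diff power_int_minus divide_inverse mult_ac)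
  have "z ^ 3 / z = z ^ 2" using z by (simp add: eval_nat_numeral)
  then have th: "theta (z ^ 2) (z ^ 3) = theta z (z ^ 3)" using theta_inverse[OF z(2) z3(2)] by simp
  have "(z ^ 2) powi (- m) = z powi (- 2 * m)" by (simp add: power_int_power)
  then have "theta (z powi (2 + 3 * m)) (z ^ 3) = (-1) powi m * z powi (- 2 * m) * (z ^ 3) powi (- tri m) * theta z (z ^ 3)"
    using theta_mult_powi[OF z3, of "z ^ 2" m] zm z by (simp add: power_int_add th)
  then show "euler (z ^ 3) * theta (z powi (2 + 3 * m)) (z ^ 3) = (-1) powi m * z powi (- 2 * m - 3 * tri m) * euler z"
    using z unfolding t euler_theta_cube[OF z, symmetric] by (simp add: power_int_diff power_int_minus divide_inverse mult_ac)
qed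

lemma has_sum_r:
  "((\<lambda>k. r c k * q powi (j * k)) has_sum avg (\<lambda>z. z powi (-4) / euler z * (euler (z ^ 3) * theta (z powi (2 + c + 5 * j)) (z ^ 3))) x) UNIV"
proof -
  have "((\<lambda>k. avg (\<lambda>z. q powi (j * k) * R c k z) x) has_sum avg (\<lambda>z. z powi (-4) / euler z * (euler (z ^ 3) * theta (z powi (2 + c + 5 * j)) (z ^ 3))) x) UNIV"
  proof (rule has_sum_avg)
    fix k :: nat
    show "((\<lambda>j'. q powi (j * j') * R c j' (om ^ k * x)) has_sum
      (om ^ k * x) powi (-4) / euler (om ^ k * x) * (euler ((om ^ k * x) ^ 3) * theta ((om ^ k * x) powi (2 + c + 5 * j)) ((om ^ k * x) ^ 3))) UNIV"
      using has_sum_R[OF om_power_mult(1,2)[OF x, of k], where c = c and j = j] unfolding om_power_mult(3)[OF x] q_def[symmetric] by (simp add: mult.commute)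
  qed
  moreover have "avg (\<lambda>z. q powi (j * k) * R c k z) x = r c k * q powi (j * k)" for k
    unfolding avg_cmult r_def by (rule mult.commute)
  ultimately show ?thesis by (simp only:)
qed

text \<open>Before averaging, each sum is a theta value in base z^3 times a power of z, divided by
  \<open>euler z\<close>. Either it vanishes, or \<open>euler z\<close> cancels and a single power
  remains whose exponent is not divisible by 5, so the average is 0. These are the moments required
  in \<open>partial_fractions\<close>.\<close>

lemma has_sum_r_0:
  assumes "(c, j) \<in> {(1, 0), (1, 1), (1, 2), (4, 0), (4, 1), (4, 2)}"
  shows "((\<lambda>k. r c k * q powi (j * k)) has_sum 0) UNIV"
proof -
  have zero: "avg (\<lambda>z. z powi (-4) / euler z * (euler (z ^ 3) * theta (z powi (2 + c + 5 * j)) (z ^ 3))) x = 0"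
    if "(\<exists>m. 2 + c + 5 * j = 3 * m) \<or> (\<exists>e s. e mod 5 \<noteq> 0 \<and> (\<forall>z. norm z < 1 \<longrightarrow> z \<noteq> 0 \<longrightarrow>
       z powi (-4) * (euler (z ^ 3) * theta (z powi (2 + c + 5 * j)) (z ^ 3)) = s * z powi e * euler z))"
    using that
  proof (elim disjE exE conjE)
    fix m assume m: "2 + c + 5 * j = 3 * m"
    have "avg (\<lambda>z. z powi (-4) / euler z * (euler (z ^ 3) * theta (z powi (2 + c + 5 * j)) (z ^ 3))) x = avg (\<lambda>z. 0) x"
      by (rule avg_cong) (simp only: m theta_cube(1)[OF om_power_mult(1,2)[OF x]] mult_zero_right)
    then show ?thesis by (simp add: avg_0)
  next
    fix e s assume e: "e mod 5 \<noteq> 0" and z: "\<forall>z. norm z < 1 \<longrightarrow> z \<noteq> 0 \<longrightarrow>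
       z powi (-4) * (euler (z ^ 3) * theta (z powi (2 + c + 5 * j)) (z ^ 3)) = s * z powi e * euler z"
    have "avg (\<lambda>z. z powi (-4) / euler z * (euler (z ^ 3) * theta (z powi (2 + c + 5 * j)) (z ^ 3))) x = avg (\<lambda>z. s * z powi e) x"
    proof (rule avg_cong)
      fix k :: nat
      define w where "w = om ^ k * x"
      have w: "norm w < 1" "w \<noteq> 0" using om_power_mult(1,2)[OF x] by (auto simp: w_def)
      have "w powi (-4) / euler w * (euler (w ^ 3) * theta (w powi (2 + c + 5 * j)) (w ^ 3)) = (w powi (-4) * (euler (w ^ 3) * theta (w powi (2 + c + 5 * j)) (w ^ 3))) / euler w"
        by simp
      also have "\<dots> = s * w powi e" using z w euler_nonzero[OF w(1)] by simp
      finally show "(om ^ k * x) powi (-4) / euler (om ^ k * x) * (euler ((om ^ k * x) ^ 3) * theta ((om ^ k * x) powi (2 + c + 5 * j)) ((om ^ k * x) ^ 3)) = s * (om ^ k * x) powi e"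
        unfolding w_def .
    qed
    then show ?thesis using e avg_powi[OF x(2)] by (simp add: avg_cmult)
  qed
  have t: "z powi (-4) * (s * z powi e * w) = s * z powi (e - 4) * w" if "z \<noteq> 0" for z w s :: complex and e
    using that by (simp add: power_int_diff power_int_minus divide_inverse)
  have "(\<exists>m. 2 + c + 5 * j = 3 * m) \<or> (\<exists>e s. e mod 5 \<noteq> 0 \<and> (\<forall>z. norm z < 1 \<longrightarrow> z \<noteq> 0 \<longrightarrow>
       z powi (-4) * (euler (z ^ 3) * theta (z powi (2 + c + 5 * j)) (z ^ 3)) = s * z powi e * euler z))"
  proof -
    have A: "z powi (-4) * (euler (z ^ 3) * theta (z powi (1 + 3 * m)) (z ^ 3)) = (-1) powi m * z powi (- m - 3 * tri m - 4) * euler z"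
      and B: "z powi (-4) * (euler (z ^ 3) * theta (z powi (2 + 3 * m)) (z ^ 3)) = (-1) powi m * z powi (- 2 * m - 3 * tri m - 4) * euler z"
      if "norm z < 1" "z \<noteq> 0" for z m
      unfolding theta_cube(2,3)[OF that] by (rule t[OF that(2)])+
    \<comment> \<open>The argument exponents 2 + c + 5 j are 3, 8, 13 and 6, 11, 16. With m from
      division by 3, the surviving exponents are -11, -26, -19 and -39, with sign (-1)^m.\<close>
    consider "c = 1" "j = 0" | "c = 1" "j = 1" | "c = 1" "j = 2" | "c = 4" "j = 0" | "c = 4" "j = 1" | "c = 4" "j = 2"
      using assms by auto
    then show ?thesis
    proof cases
      case 1
      then show ?thesis by (intro disjI1 exI[of _ 1]) simp
    next
      case 2
      show ?thesis using B[of _ 2] 2 by (intro disjI2 exI[of _ "-11"] exI[of _ 1]) (simp add: tri_values)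
    next
      case 3
      show ?thesis using A[of _ 4] 3 by (intro disjI2 exI[of _ "-26"] exI[of _ 1]) (simp add: tri_values)
    next
      case 4
      then show ?thesis by (intro disjI1 exI[of _ 2]) simp
    next
      case 5
      show ?thesis using B[of _ 3] 5 by (intro disjI2 exI[of _ "-19"] exI[of _ "-1"]) (simp add: tri_values)
    next
      case 6
      show ?thesis using A[of _ 5] 6 by (intro disjI2 exI[of _ "-39"] exI[of _ "-1"]) (simp add: tri_values)
    qed
  qed
  from zero[OF this] show ?thesis using has_sum_r[of c j] by simp
qed

section \<open>Theta numerators of the two Lerch sums\<close>

abbreviation th :: "complex \<Rightarrow> complex" where "th y \<equiv> theta y (q ^ 5)"

definition K :: complex where "K = euler q / Dt"
definition \<alpha> :: complex where "\<alpha> = a ^ 3 + 2 * q * b ^ 2"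
definition \<beta> :: complex where "\<beta> = 2 * a ^ 2 - q * b ^ 3"

text \<open>At the five points 1, q^(-1), ..., q^(-4) the two theta products of a numerator vanish
  on disjoint pairs, so each coefficient is read off where the other product is 0. The fifth point,
  q^(-2) for \<open>U1\<close> and q^(-1) for \<open>U4\<close>, is a genuine consistency condition
  between the residues.\<close>

definition U1 :: "complex \<Rightarrow> complex" where
  "U1 y = K * (5 * th (y * q ^ 3) * th (y * q) - \<alpha> * th (y * q ^ 4) * th y)"
definition U4 :: "complex \<Rightarrow> complex" where
  "U4 y = K * (5 * th (y * q ^ 3) * th (y * q ^ 4) + \<beta> / y * th (y * q ^ 2) * th y)"

lemma th_mult: "y \<noteq> 0 \<Longrightarrow> th (y * q ^ 5) = - th y / y"
  by (rule theta_mult_q[OF q5(1) _ q5(2)])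

lemma th_mult': "y \<noteq> 0 \<Longrightarrow> th (y * q ^ 5 * q ^ n) = - th (y * q ^ n) / (y * q ^ n)"
  using th_mult[of "y * q ^ n"] q by (simp add: mult_ac)

lemma th_values:
  "th 1 = 0" "th q = f1" "th (q ^ 2) = f2" "th (q ^ 3) = f2" "th (q ^ 4) = f1"
  "th (q powi (-1)) = - f1 / q" "th (q powi (-2)) = - f2 / q ^ 2" "th (q powi (-3)) = - f2 / q ^ 3" "th (q powi (-4)) = - f1 / q ^ 4"
proof -
  have d: "q ^ 5 / q = q ^ 4" "q ^ 5 / q ^ 2 = q ^ 3" using q by (simp_all add: eval_nat_numeral)
  show v: "th q = f1" "th (q ^ 2) = f2" "th (q ^ 3) = f2" "th (q ^ 4) = f1"
    using theta_inverse[OF q(2) q5(2)] theta_inverse[of "q ^ 2", OF _ q5(2)] q d by (simp_all add: f1_def f2_def)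
  show "th 1 = 0" using theta_eq_0_iff[OF q5(1) _ q5(2), of 1] by (metis one_neq_zero power_int_0_right)
  have m: "th (q powi (- int n)) = - th (q ^ (5 - n)) / q ^ n" if "n < 5" for n
  proof -
    have "q powi (- int n) * q ^ 5 = q ^ (5 - n)"
    proof -
      have "q ^ 5 = q ^ (5 - n) * q ^ n" using that by (simp flip: power_add)
      then show ?thesis using q by (simp add: power_int_minus)
    qed
    then have "th (q ^ (5 - n)) = - th (q powi (- int n)) * q ^ n"
      using th_mult[of "q powi (- int n)"] q by (simp add: power_int_minus divide_inverse)
    then show ?thesis using q by (simp add: field_simps)
  qed
  show "th (q powi (-1)) = - f1 / q" "th (q powi (-2)) = - f2 / q ^ 2" "th (q powi (-3)) = - f2 / q ^ 3" "th (q powi (-4)) = - f1 / q ^ 4"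
    using m[of 1] m[of 2] m[of 3] m[of 4] v by simp_all
qed

lemma q_shift:
  "q powi (-1) * q = 1"
  "q powi (-1) * q ^ 2 = q"
  "q powi (-1) * q ^ 3 = q ^ 2"
  "q powi (-1) * q ^ 4 = q ^ 3"
  "q powi (-2) * q = q powi (-1)"
  "q powi (-2) * q ^ 2 = 1"
  "q powi (-2) * q ^ 3 = q"
  "q powi (-2) * q ^ 4 = q ^ 2"
  "q powi (-3) * q = q powi (-2)"
  "q powi (-3) * q ^ 2 = q powi (-1)"
  "q powi (-3) * q ^ 3 = 1"
  "q powi (-3) * q ^ 4 = q"
  "q powi (-4) * q = q powi (-3)"
  "q powi (-4) * q ^ 2 = q powi (-2)"
  "q powi (-4) * q ^ 3 = q powi (-1)"
  "q powi (-4) * q ^ 4 = 1"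
  using q by (simp_all add: power_int_minus inverse_eq_divide field_simps eval_nat_numeral)

lemma euler_q_eq: "euler q = E * a * f1 ^ 2" "b = 1 / a"
  using f1f2 E0 ab by (simp_all add: field_simps power2_eq_square)

lemma match1:
  assumes "k \<in> {0..4}"
  shows "r 1 k * euler q ^ 2 = (-1) powi k * q powi tri (k + 1) * U1 (q powi (- k))"
proof -
  have "k = 0 \<or> k = 1 \<or> k = 2 \<or> k = 3 \<or> k = 4"
    using assms unfolding atLeastAtMost_iff by presburger
  then consider "k = 0" | "k = 1" | "k = 2" | "k = 3" | "k = 4" by blast
  note k = this
  have u: "U1 1 = K * (5 * f2 * f1)" "U1 (q powi (-1)) = K * (\<alpha> * f2 * (f1 / q))"
    "U1 (q powi (-2)) = K * (5 * f1 * (- f1 / q) - \<alpha> * f2 * (- f2 / q ^ 2))"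
    "U1 (q powi (-3)) = K * (- (\<alpha> * f1 * (- f2 / q ^ 3)))" "U1 (q powi (-4)) = K * (5 * (- f1 / q) * (- f2 / q ^ 3))"
    by (simp_all only: U1_def q_shift th_values mult_1) simp_all
  note e = r1_values tri_values euler_q_eq ab(4) K_def \<alpha>_def
  show ?thesis using k
  proof cases
    case 1
    have "r 1 0 * euler q ^ 2 = (-1) powi 0 * q powi tri (0 + 1) * U1 1"
      using q E0 Dt(2) ab(2) f0(1) unfolding u(1) by (simp add: e field_simps eval_nat_numeral)
    then show ?thesis using 1 by simp
  next
    case 2
    have "r 1 1 * euler q ^ 2 = (-1) powi 1 * q powi tri (1 + 1) * U1 (q powi (-1))"
      using q E0 Dt(2) ab(2) f0(1) unfolding u(2) by (simp add: e field_simps eval_nat_numeral)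
    then show ?thesis using 2 by simp
  next
    case 3
    have "r 1 2 * euler q ^ 2 = (-1) powi 2 * q powi tri (2 + 1) * U1 (q powi (-2))"
      using q E0 Dt(2) ab(2) f0(1) unfolding u(3) by (simp add: e field_simps eval_nat_numeral)
    then show ?thesis using 3 by simp
  next
    case 4
    have "r 1 3 * euler q ^ 2 = (-1) powi 3 * q powi tri (3 + 1) * U1 (q powi (-3))"
      using q E0 Dt(2) ab(2) f0(1) unfolding u(4) by (simp add: e field_simps eval_nat_numeral)
    then show ?thesis using 4 by simp
  next
    case 5
    have "r 1 4 * euler q ^ 2 = (-1) powi 4 * q powi tri (4 + 1) * U1 (q powi (-4))"
      using q E0 Dt(2) ab(2) f0(1) unfolding u(5) by (simp add: e field_simps eval_nat_numeral)
    then show ?thesis using 5 by simp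
  qed
qed

lemma match4:
  assumes "k \<in> {0..4}"
  shows "r 4 k * euler q ^ 2 = (-1) powi k * q powi tri (k + 1) * U4 (q powi (- k))"
proof -
  have "k = 0 \<or> k = 1 \<or> k = 2 \<or> k = 3 \<or> k = 4"
    using assms unfolding atLeastAtMost_iff by presburger
  then consider "k = 0" | "k = 1" | "k = 2" | "k = 3" | "k = 4" by blast
  note k = this
  have "q powi (- int m) = 1 / q ^ m" for m by (simp add: power_int_minus divide_inverse)
  from this[of 1] this[of 2] this[of 3] this[of 4]
  have u: "U4 1 = K * (5 * f2 * f1)" "U4 (q powi (-1)) = K * (5 * f2 * f2 + \<beta> * q * f1 * (- f1 / q))"
    "U4 (q powi (-2)) = K * (5 * f1 * f2)"
    "U4 (q powi (-3)) = K * (\<beta> * q ^ 3 * (- f1 / q) * (- f2 / q ^ 3))" "U4 (q powi (-4)) = K * (\<beta> * q ^ 4 * (- f2 / q ^ 2) * (- f1 / q ^ 4))"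
    by (simp_all only: U4_def q_shift th_values mult_1) simp_all
  note e = r4_values tri_values euler_q_eq ab(4) K_def \<beta>_def
  show ?thesis using k
  proof cases
    case 1
    have "r 4 0 * euler q ^ 2 = (-1) powi 0 * q powi tri (0 + 1) * U4 1"
      using q E0 Dt(2) ab(2) f0(1) unfolding u(1) by (simp add: e field_simps eval_nat_numeral)
    then show ?thesis using 1 by simp
  next
    case 2
    have "r 4 1 * euler q ^ 2 = (-1) powi 1 * q powi tri (1 + 1) * U4 (q powi (-1))"
      using q E0 Dt(2) ab(2) f0(1) unfolding u(2) by (simp add: e field_simps eval_nat_numeral)
    then show ?thesis using 2 by simp
  next
    case 3
    have "r 4 2 * euler q ^ 2 = (-1) powi 2 * q powi tri (2 + 1) * U4 (q powi (-2))"
      using q E0 Dt(2) ab(2) f0(1) unfolding u(3) by (simp add: e field_simps eval_nat_numeral)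
    then show ?thesis using 3 by simp
  next
    case 4
    have "r 4 3 * euler q ^ 2 = (-1) powi 3 * q powi tri (3 + 1) * U4 (q powi (-3))"
      using q E0 Dt(2) ab(2) f0(1) unfolding u(4) by (simp add: e field_simps eval_nat_numeral)
    then show ?thesis using 4 by simp
  next
    case 5
    have "r 4 4 * euler q ^ 2 = (-1) powi 4 * q powi tri (4 + 1) * U4 (q powi (-4))"
      using q E0 Dt(2) ab(2) f0(1) unfolding u(5) by (simp add: e field_simps eval_nat_numeral)
    then show ?thesis using 5 by simp
  qed
qed

lemma th_holomorphic: "th holomorphic_on - {0}"
  by (rule theta_holomorphic[OF q5(1)])

lemma th_holomorphic': "(\<lambda>y. th (y * q ^ n)) holomorphic_on - {0}"
  by (rule holomorphic_on_compose_gen[OF _ th_holomorphic, unfolded o_def]) (use q in \<open>auto intro!: holomorphic_intros\<close>)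

lemma U_holomorphic: "U1 holomorphic_on - {0}" "U4 holomorphic_on - {0}"
  unfolding U1_def U4_def using th_holomorphic'[of 1]
  by (auto intro!: holomorphic_intros th_holomorphic th_holomorphic' simp: power_one_right)

lemma U_mult:
  assumes "y \<noteq> 0"
  shows "U1 (y * q ^ 5) = q powi (-4) / y ^ 2 * U1 y" "U4 (y * q ^ 5) = q powi (-7) / y ^ 2 * U4 y"
proof -
  have t: "th (y * q ^ 5) = - th y / y" "th (y * q ^ 5 * q) = - th (y * q) / (y * q)" "th (y * q ^ 5 * q ^ 2) = - th (y * q ^ 2) / (y * q ^ 2)"
    "th (y * q ^ 5 * q ^ 3) = - th (y * q ^ 3) / (y * q ^ 3)" "th (y * q ^ 5 * q ^ 4) = - th (y * q ^ 4) / (y * q ^ 4)"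
    using th_mult[OF assms] th_mult'[OF assms, of 1] th_mult'[OF assms, of 2] th_mult'[OF assms, of 3] th_mult'[OF assms, of 4] by simp_all
  have p: "q powi (-4) = 1 / (q * q ^ 3)" "q powi (-4) = 1 / q ^ 4" "q powi (-7) = 1 / (q ^ 3 * q ^ 4)" "q powi (-7) = 1 / (q ^ 5 * q ^ 2)"
    using q by (simp_all add: power_int_minus divide_inverse flip: power_add power_Suc)
  have "U1 (y * q ^ 5) = K * (5 * (th (y * q ^ 3) * th (y * q)) * (1 / (q * q ^ 3)) / y ^ 2 - \<alpha> * (th (y * q ^ 4) * th y) * (1 / q ^ 4) / y ^ 2)"
    unfolding U1_def t by (simp add: power2_eq_square mult_ac)
  then show "U1 (y * q ^ 5) = q powi (-4) / y ^ 2 * U1 y"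
    unfolding p(1,2)[symmetric] by (simp add: U1_def algebra_simps diff_divide_distrib)
  have "U4 (y * q ^ 5) = K * (5 * (th (y * q ^ 3) * th (y * q ^ 4)) * (1 / (q ^ 3 * q ^ 4)) / y ^ 2 + \<beta> / y * (th (y * q ^ 2) * th y) * (1 / (q ^ 5 * q ^ 2)) / y ^ 2)"
    unfolding U4_def t by (simp add: power2_eq_square mult_ac)
  then show "U4 (y * q ^ 5) = q powi (-7) / y ^ 2 * U4 y"
    unfolding p(3,4)[symmetric] by (simp add: U4_def algebra_simps add_divide_distrib)
qed

text \<open>\<open>r_rec\<close> gives \<kappa> = q^(8 + c); then \<kappa> \<mu> = q^5 dictates
  \<mu> = q^(-3 - c), which is the multiplier of the chosen numerators.\<close>

lemma lerch_eq:
  assumes "y \<noteq> 0" "\<And>k. y * q powi k \<noteq> 1"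
  shows "lerch (r 1) q UNIV y = U1 y / theta y q" "lerch (r 4) q UNIV y = U4 y / theta y q"
proof -
  have h0: "(r c has_sum 0) UNIV" "((\<lambda>k. r c k * q powi k) has_sum 0) UNIV" "((\<lambda>k. r c k * q powi (2 * k)) has_sum 0) UNIV"
    if "c \<in> {1, 4}" for c
    using has_sum_r_0[of c 0] has_sum_r_0[of c 1] has_sum_r_0[of c 2] that by auto
  show "lerch (r 1) q UNIV y = U1 y / theta y q"
  proof (rule partial_fractions[where \<kappa> = "q powi 9" and \<mu> = "q powi (-4)"])
    show "q powi 9 * q powi (-4) = q ^ 5" using q by (subst power_int_add[symmetric]) auto
    show "r 1 (k + 5) = - (q powi 9) * q powi (3 * k) * r 1 k" for k using r_rec[of 1 k] by simp
  qed (use q summable_r h0 U_holomorphic U_mult match1 assms in auto)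
  show "lerch (r 4) q UNIV y = U4 y / theta y q"
  proof (rule partial_fractions[where \<kappa> = "q powi 12" and \<mu> = "q powi (-7)"])
    show "q powi 12 * q powi (-7) = q ^ 5" using q by (subst power_int_add[symmetric]) auto
    show "r 4 (k + 5) = - (q powi 12) * q powi (3 * k) * r 4 k" for k using r_rec[of 4 k] by simp
  qed (use q summable_r h0 U_holomorphic U_mult match4 assms in auto)
qed

end

section \<open>The Lambert sum\<close>

lemma symmetric_quotient_limit:
  fixes f :: "complex \<Rightarrow> complex"
  assumes "(f has_field_derivative f') (at 0)"
  shows "((\<lambda>u. (f u - f (- u)) / u) \<longlongrightarrow> 2 * f') (at 0)"
proof -
  have "((\<lambda>u. f u - f (- u)) has_field_derivative f' - f' * (- 1)) (at 0)"
    by (rule DERIV_diff[OF assms DERIV_chain2[where g = uminus]])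
       (use assms in \<open>auto intro!: derivative_eq_intros\<close>)
  then show ?thesis unfolding has_field_derivative_iff by simp
qed

text \<open>In T = exp(u/10) all fractional powers of y = exp u that occur are integral, so the
  identity before the limit is purely algebraic.\<close>

lemma exp_tenth_powers:
  fixes u :: complex
  defines "T \<equiv> exp (u / 10)"
  shows "exp u = T ^ 10" "exp (u / 5) = T ^ 2" "exp (4 * u / 5) = T ^ 8" "exp (u / 2) = T ^ 5" "exp (3 * u / 10) = T ^ 3"
    "exp (- u / 10) = 1 / T"
  unfolding T_def by (simp_all add: exp_minus inverse_eq_divide flip: exp_of_nat_mult)

context dissected
begin

lemma q_powi_neq_1: "k \<noteq> 0 \<Longrightarrow> q powi k \<noteq> 1"
proof
  assume k: "k \<noteq> 0" and eq: "q powi k = 1"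
  have "q powi \<bar>k\<bar> = 1" using eq by (cases "k \<ge> 0") (simp_all add: power_int_minus)
  then have "q ^ nat \<bar>k\<bar> = 1" by (simp add: power_int_def)
  then have "norm q ^ nat \<bar>k\<bar> = 1" by (metis norm_one norm_power)
  moreover have "norm q ^ nat \<bar>k\<bar> < 1" using norm_power_less_1[OF q(1), of "nat \<bar>k\<bar>"] k by (simp add: norm_power)
  ultimately show False by simp
qed

definition L :: "int \<Rightarrow> complex \<Rightarrow> complex" where "L c = lerch (r c) q (- {0})"

definition S where "S = {y. y \<noteq> 0 \<and> (\<forall>k\<in>- {0}. y * q powi k \<noteq> 1)}"

lemma L_holomorphic:
  shows "open S" "L c holomorphic_on S"
    and "\<And>y. y \<in> S \<Longrightarrow> ((\<lambda>k. r c k / (1 - y * q powi k)) has_sum L c y) (- {0})"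
    and "\<And>y. y \<in> S \<Longrightarrow> ((\<lambda>k. r c k * q powi k / (1 - y * q powi k) ^ 2) has_sum deriv (L c) y) (- {0})"
  using lerch_holomorphic[OF q summable_r[of c], where I = "- {0}"] unfolding S_def L_def by blast+

lemma one_in_S: "1 \<in> S"
  using q_powi_neq_1 by (auto simp: S_def)

lemma L_eq:
  assumes y: "y \<in> S" "y \<noteq> 1"
  shows "L 1 y = U1 y / theta y q - r 1 0 / (1 - y)" "L 4 y = U4 y / theta y q - r 1 0 / (1 - y)"
proof -
  have yk: "y \<noteq> 0" "y * q powi k \<noteq> 1" for k
    using y unfolding S_def by (cases "k = 0"; auto)+
  have "lerch (r c) q UNIV y = r c 0 / (1 - y) + L c y" for c
  proof -
    have "((\<lambda>k. r c k / (1 - y * q powi k)) has_sum (r c 0 / (1 - y * q powi 0) + L c y)) (insert 0 (- {0}))"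
      by (rule has_sum_insert[OF _ L_holomorphic(3)[OF y(1)]]) simp
    moreover have "insert 0 (- {0}) = (UNIV :: int set)" by auto
    ultimately show ?thesis unfolding lerch_def by (simp add: infsumI)
  qed
  from this[of 1] this[of 4] lerch_eq[OF yk]
  show "L 1 y = U1 y / theta y q - r 1 0 / (1 - y)" "L 4 y = U4 y / theta y q - r 1 0 / (1 - y)"
    by (simp_all add: r1_values(1) r4_values(1))
qed

lemma th_reflect:
  assumes "y \<noteq> 0"
  shows "th (y * q ^ 3) = th (q ^ 2 / y)" "th (y * q ^ 4) = th (q / y)" "th (1 / y) = - th y / y" "theta (1 / y) q = - theta y q / y"
proof -
  have e: "q ^ 5 / (y * q ^ 3) = q ^ 2 / y" "q ^ 5 / (y * q ^ 4) = q / y"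
    using q assms by (simp_all add: field_simps eval_nat_numeral)
  show "th (y * q ^ 3) = th (q ^ 2 / y)" "th (y * q ^ 4) = th (q / y)"
    using theta_inverse[of "y * q ^ 3" "q ^ 5"] theta_inverse[of "y * q ^ 4" "q ^ 5"] e q assms by simp_all
  have t: "theta (1 / y) p = - theta y p / y" if "norm p < 1" "p \<noteq> 0" for p
    using theta_mult_q[OF that(1), of "1 / y"] theta_inverse[of y p] that assms by (simp add: field_simps)
  show "th (1 / y) = - th y / y" "theta (1 / y) q = - theta y q / y" by (rule t[OF q5] t[OF q])+
qed

text \<open>The combination is antisymmetric under y to 1/y, so the polar terms cancel, both
  residues at k = 0 being \<open>r 1 0\<close>. The right side regroups into products of two odd
  factors; after division by u^2 only first derivatives of theta functions will be needed.\<close>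

lemma symmetric_difference:
  fixes T :: complex
  defines "y \<equiv> T ^ 10"
  assumes y: "y \<in> S" "1 / y \<in> S" "y \<noteq> 1"
  shows "(theta y q / T ^ 5) * ((T ^ 2 * L 1 y - T ^ 8 * L 4 y) - (L 1 (1 / y) / T ^ 2 - L 4 (1 / y) / T ^ 8))
    = K * (5 * (th (q ^ 2 / y) - th (y * q ^ 2)) * (th (y * q) / T ^ 3 - T ^ 3 * th (q / y))
      - \<alpha> * (th y / T ^ 5) * (T ^ 2 * th (q / y) - th (y * q) / T ^ 2)
      - \<beta> * (th y / T ^ 5) * (th (y * q ^ 2) / T ^ 2 - T ^ 2 * th (q ^ 2 / y)))"
proof -
  have T0: "T \<noteq> 0" "y \<noteq> 0" using y(1) by (auto simp: S_def y_def)
  have th0: "theta y q \<noteq> 0"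
  proof
    assume "theta y q = 0"
    then obtain k where k: "y = q powi k" using theta_eq_0_iff[OF q(1) T0(2) q(2)] by blast
    then have "y * q powi (- k) = 1" using q by (simp add: power_int_minus)
    then show False using y by (cases "k = 0") (auto simp: S_def)
  qed
  have y1: "1 / y \<noteq> 1" using y(3) by simp
  \<comment> \<open>The polar terms, which cancel because y(T^(-2) - T^(-8)) = T^8 - T^2.\<close>
  have z: "r 1 0 * T ^ 2 / (1 - y) - r 1 0 * T ^ 8 / (1 - y) - (r 1 0 / (1 - 1 / y) / T ^ 2 - r 1 0 / (1 - 1 / y) / T ^ 8) = 0"
  proof -
    have "1 / (1 - 1 / y) = - y / (1 - y)" using y(3) T0 by (simp add: field_simps)
    then have "r 1 0 / (1 - 1 / y) / T ^ 2 - r 1 0 / (1 - 1 / y) / T ^ 8 = r 1 0 * (- y / (1 - y)) * (1 / T ^ 2 - 1 / T ^ 8)"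
      by (metis (no_types, lifting) divide_divide_eq_left mult.right_neutral right_diff_distrib times_divide_eq_right)
    also have "\<dots> = (r 1 0 / (1 - y)) * - (y * (1 / T ^ 2 - 1 / T ^ 8))" by simp
    also have "y * (1 / T ^ 2 - 1 / T ^ 8) = T ^ 8 - T ^ 2"
      using T0 unfolding y_def by (simp add: field_simps eval_nat_numeral)
    finally show ?thesis by (simp add: algebra_simps)
  qed
  have u: "L 1 y = U1 y / theta y q - r 1 0 / (1 - y)" "L 4 y = U4 y / theta y q - r 1 0 / (1 - y)"
    "L 1 (1 / y) = - y * U1 (1 / y) / theta y q - r 1 0 / (1 - 1 / y)" "L 4 (1 / y) = - y * U4 (1 / y) / theta y q - r 1 0 / (1 - 1 / y)"
    using L_eq[OF y(1,3)] L_eq[OF y(2) y1] th_reflect(4)[OF T0(2)] by simp_all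
  have "(T ^ 2 * L 1 y - T ^ 8 * L 4 y) - (L 1 (1 / y) / T ^ 2 - L 4 (1 / y) / T ^ 8)
    = (T ^ 2 * U1 y - T ^ 8 * U4 y + y * (U1 (1 / y) / T ^ 2 - U4 (1 / y) / T ^ 8)) / theta y q
      - (r 1 0 * T ^ 2 / (1 - y) - r 1 0 * T ^ 8 / (1 - y) - (r 1 0 / (1 - 1 / y) / T ^ 2 - r 1 0 / (1 - 1 / y) / T ^ 8))"
    unfolding u by (simp add: algebra_simps add_divide_distrib diff_divide_distrib)
  then have "(theta y q / T ^ 5) * ((T ^ 2 * L 1 y - T ^ 8 * L 4 y) - (L 1 (1 / y) / T ^ 2 - L 4 (1 / y) / T ^ 8))
    = (T ^ 2 * U1 y - T ^ 8 * U4 y + y * (U1 (1 / y) / T ^ 2 - U4 (1 / y) / T ^ 8)) / T ^ 5"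
    unfolding z using th0 by simp
  also have "\<dots> = K * (5 * (th (q ^ 2 / y) - th (y * q ^ 2)) * (th (y * q) / T ^ 3 - T ^ 3 * th (q / y))
      - \<alpha> * (th y / T ^ 5) * (T ^ 2 * th (q / y) - th (y * q) / T ^ 2)
      - \<beta> * (th y / T ^ 5) * (th (y * q ^ 2) / T ^ 2 - T ^ 2 * th (q ^ 2 / y)))"
  proof -
    define A A' B B' C where "A = th (y * q)" "A' = th (q / y)" "B = th (y * q ^ 2)" "B' = th (q ^ 2 / y)" "C = th y"
    note defs = this
    have v: "U1 y = K * (5 * B' * A - \<alpha> * A' * C)" "U4 y = K * (5 * B' * A' + \<beta> / y * B * C)"
      using th_reflect[OF T0(2)] by (simp_all add: U1_def U4_def defs)
    have w: "U1 (1 / y) = K * (5 * B * A' + \<alpha> * A * C / y)" "U4 (1 / y) = K * (5 * B * A - \<beta> * B' * C)"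
    proof -
      have "1 / y \<noteq> 0" using T0 by simp
      from th_reflect[OF this] th_reflect(3)[OF T0(2)] T0(2)
      show "U1 (1 / y) = K * (5 * B * A' + \<alpha> * A * C / y)" "U4 (1 / y) = K * (5 * B * A - \<beta> * B' * C)"
        by (simp_all add: U1_def U4_def defs mult.commute)
    qed
    define t2 t3 t5 n2 n3 where "t2 = T ^ 2" "t3 = T ^ 3" "t5 = T ^ 5" "n2 = 1 / T ^ 2" "n3 = 1 / T ^ 3"
    note ts = this
    define c5 where "c5 = C / T ^ 5"
    have C: "C = c5 * t5" using T0 by (simp add: c5_def ts)
    have m: "n3 * t5 = t2" "t3 * (t5 * (1 / y)) = n2"
      using T0 unfolding ts y_def by (simp_all add: field_simps eval_nat_numeral)
    have "(T ^ 2 * U1 y - T ^ 8 * U4 y + y * (U1 (1 / y) / T ^ 2 - U4 (1 / y) / T ^ 8)) / T ^ 5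
      = n3 * U1 y - t3 * U4 y + t3 * U1 (1 / y) - n3 * U4 (1 / y)"
      using T0(1) unfolding ts y_def by (simp add: field_simps flip: power_add)
    also have "\<dots> = K * (5 * (B' - B) * (A * n3 - t3 * A') - \<alpha> * c5 * (n3 * t5 * A' - A * (t3 * (t5 * (1 / y))))
      - \<beta> * c5 * (B * (t3 * (t5 * (1 / y))) - n3 * t5 * B'))"
      unfolding v w C by (simp add: algebra_simps)
    also have "\<dots> = K * (5 * (B' - B) * (A * n3 - t3 * A') - \<alpha> * c5 * (t2 * A' - A * n2) - \<beta> * c5 * (B * n2 - t2 * B'))"
      unfolding m by simp
    finally show ?thesis unfolding defs c5_def ts by simp
  qed
  finally show ?thesis .
qed

lemma symmetric_difference_exp:
  assumes y: "exp u \<in> S" "exp (- u) \<in> S" "exp u \<noteq> 1"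
  shows "(theta (exp u) q / exp (u / 2)) * ((exp (u / 5) * L 1 (exp u) - exp (4 * u / 5) * L 4 (exp u))
      - (exp (- u / 5) * L 1 (exp (- u)) - exp (4 * (- u) / 5) * L 4 (exp (- u))))
    = K * (- (5 * (th (exp u * q ^ 2) - th (exp (- u) * q ^ 2)) * (th (exp u * q) * exp (- 3 * u / 10) - th (exp (- u) * q) * exp (- 3 * (- u) / 10)))
      - \<alpha> * (th (exp u) / exp (u / 2)) * (exp (u / 5) * th (exp (- u) * q) - exp (- u / 5) * th (exp (- (- u)) * q))
      - \<beta> * (th (exp u) / exp (u / 2)) * (exp (- u / 5) * th (exp u * q ^ 2) - exp (- (- u) / 5) * th (exp (- u) * q ^ 2)))"
proof -
  define T where "T = exp (u / 10)"
  note p = exp_tenth_powers[of u, folded T_def]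
  have m: "exp (- u) = 1 / T ^ 10" "exp (- u / 5) = 1 / T ^ 2" "exp (4 * (- u) / 5) = 1 / T ^ 8" "exp (- 3 * u / 10) = 1 / T ^ 3"
    "exp (- 3 * (- u) / 10) = T ^ 3"
    using p by (simp_all add: exp_minus inverse_eq_divide)
  have "T ^ 10 \<in> S" "1 / T ^ 10 \<in> S" "T ^ 10 \<noteq> 1" using y p m by simp_all
  from symmetric_difference[OF this] show ?thesis
    unfolding m p minus_minus by (simp add: algebra_simps)
qed

text \<open>The sum is 5 X'(0), with X regular at 0 because k = 0 is left out. The theta quotients
  are singular there, so X' is obtained from the limit of (X(u) - X(-u))/u, multiplied by s(u)/u for
  the function s with a simple zero. This leaves only \<open>d1\<close> and \<open>d2\<close>, which
  \<open>derivs\<close> expresses through a and b.\<close>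

theorem lambert_sum:
  "((\<lambda>k. r 1 k * (1 / (1 - q powi k) + 5 * q powi k / (1 - q powi k)\<^sup>2)
       - r 4 k * (4 / (1 - q powi k) + 5 * q powi k / (1 - q powi k)\<^sup>2)) has_sum E ^ 4 / euler q) (- {0})"
proof -
  define X where "X = (\<lambda>u. exp (u / 5) * L 1 (exp u) - exp (4 * u / 5) * L 4 (exp u))"
  define G where "G = (\<lambda>u. th (exp u * q ^ 2))"
  define h where "h = (\<lambda>u. th (exp u * q) * exp (- 3 * u / 10))"
  define g1 where "g1 = (\<lambda>u. exp (u / 5) * th (exp (- u) * q))"
  define g2 where "g2 = (\<lambda>u. exp (- u / 5) * th (exp u * q ^ 2))"
  define s where "s = (\<lambda>u. theta (exp u) q / exp (u / 2))"
  define \<sigma> where "\<sigma> = (\<lambda>u. th (exp u) / exp (u / 2))"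
  define X' where "X' = L 1 1 / 5 + deriv (L 1) 1 - 4 * L 4 1 / 5 - deriv (L 4) 1"
  have dL: "(L c has_field_derivative deriv (L c) 1) (at 1)" for c
    by (rule holomorphic_derivI[OF L_holomorphic(2,1) one_in_S])
  have dth: "(th has_field_derivative deriv th y) (at y)" if "y \<noteq> 0" for y
    by (rule holomorphic_derivI[OF th_holomorphic]) (use that in auto)
  have exp1: "((\<lambda>u::complex. exp u) has_field_derivative 1) (at 0)" by (rule derivative_eq_intros | simp)+
  have exp2: "((\<lambda>u::complex. exp u * c) has_field_derivative c) (at 0)" 
    "((\<lambda>u::complex. exp (- u) * c) has_field_derivative - c) (at 0)" for c
    by (rule derivative_eq_intros | simp)+
  have cL: "((\<lambda>u. L c (exp u)) has_field_derivative deriv (L c) 1) (at 0)" for c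
    using DERIV_chain2[where f = "L c" and g = exp and x = 0 and Da = "deriv (L c) 1", OF _ exp1] dL by simp
  have cth: "((\<lambda>u. th (exp u * c)) has_field_derivative deriv th c * c) (at 0)"
    "((\<lambda>u. th (exp (- u) * c)) has_field_derivative deriv th c * (- c)) (at 0)" if "c \<noteq> 0" for c
    using DERIV_chain2[where f = th and g = "\<lambda>u. exp u * c" and x = 0, OF _ exp2(1)[of c], of "deriv th c"]
      DERIV_chain2[where f = th and g = "\<lambda>u. exp (- u) * c" and x = 0, OF _ exp2(2)[of c], of "deriv th c"] dth[OF that] by simp_all
  have X: "(X has_field_derivative X') (at 0)"
    unfolding X_def X'_def by (auto intro!: derivative_eq_intros cL)
  have G: "(G has_field_derivative d2) (at 0)"
    unfolding G_def d2_def using cth(1)[of "q ^ 2"] q by (simp add: mult.commute)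
  have exp3: "((\<lambda>u::complex. exp (- 3 * u / 10)) has_field_derivative - 3 / 10) (at 0)"
    "((\<lambda>u::complex. exp (u / 5)) has_field_derivative 1 / 5) (at 0)"
    "((\<lambda>u::complex. exp (- u / 5)) has_field_derivative - 1 / 5) (at 0)"
    by (auto intro!: derivative_eq_intros)
  have q2: "q ^ 2 \<noteq> 0" using q by simp
  have h: "(h has_field_derivative d1 - 3 * f1 / 10) (at 0)"
    unfolding h_def d1_def using DERIV_mult[OF cth(1)[OF q(2)] exp3(1)] by (simp add: th_values(2) mult_ac)
  have g1: "(g1 has_field_derivative f1 / 5 - d1) (at 0)"
    unfolding g1_def d1_def using DERIV_mult[OF exp3(2) cth(2)[OF q(2)]] by (simp add: th_values(2) mult_ac)
  have g2: "(g2 has_field_derivative d2 - f2 / 5) (at 0)"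
    unfolding g2_def d2_def using DERIV_mult[OF exp3(3) cth(1)[OF q2]] by (simp add: th_values(3) mult_ac)
  have qt: "((\<lambda>u. theta (exp u) p / exp (u / 2) / u) \<longlongrightarrow> - (euler p)\<^sup>2) (at 0)" if "norm p < 1" "p \<noteq> 0" for p
  proof -
    have t1: "theta 1 p = 0" using theta_eq_0_iff[OF that(1) _ that(2), of 1] by (metis one_neq_zero power_int_0_right)
    have "((\<lambda>u. theta (exp u) p) has_field_derivative - (euler p)\<^sup>2 * 1) (at 0)"
      by (rule DERIV_chain2[where f = "\<lambda>y. theta y p", OF _ exp1]) (use deriv_theta_1[OF that(1)] in simp)
    then have "((\<lambda>u. theta (exp u) p / exp (u / 2)) has_field_derivative - (euler p)\<^sup>2) (at 0)"
      using t1 by (auto intro!: derivative_eq_intros)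
    then show ?thesis unfolding has_field_derivative_iff using t1 by simp
  qed
  have s: "((\<lambda>u. s u / u) \<longlongrightarrow> - (euler q)\<^sup>2) (at 0)" unfolding s_def by (rule qt[OF q])
  have \<sigma>: "((\<lambda>u. \<sigma> u / u) \<longlongrightarrow> - E\<^sup>2) (at 0)" unfolding \<sigma>_def E_def by (rule qt[OF q5])
  have ev: "eventually (\<lambda>u. s u * (X u - X (- u)) = K * (- (5 * (G u - G (- u)) * (h u - h (- u)))
      - \<alpha> * \<sigma> u * (g1 u - g1 (- u)) - \<beta> * \<sigma> u * (g2 u - g2 (- u)))) (at 0)"
  proof -
    have "((\<lambda>u::complex. exp u) \<longlongrightarrow> 1) (at 0)" "((\<lambda>u::complex. exp (- u)) \<longlongrightarrow> 1) (at 0)"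
      by (auto intro!: tendsto_eq_intros)
    then have e1: "eventually (\<lambda>u. exp u \<in> S) (at 0)" "eventually (\<lambda>u. exp (- u) \<in> S) (at 0)"
      using topological_tendstoD[OF _ L_holomorphic(1) one_in_S] by blast+
    have e2: "eventually (\<lambda>u::complex. exp u \<noteq> 1) (at 0)"
    proof -
      have "((\<lambda>u::complex. (exp u - 1) / u) \<longlongrightarrow> 1) (at 0)" using exp1 unfolding has_field_derivative_iff by simp
      then have "eventually (\<lambda>u::complex. (exp u - 1) / u \<noteq> 0) (at 0)" by (rule tendsto_imp_eventually_ne) simp
      then show ?thesis by eventually_elim auto
    qed
    from e1 e2 show ?thesis
    proof eventually_elim
      case (elim u)
      show ?case using symmetric_difference_exp[OF elim]
        unfolding X_def G_def h_def g1_def g2_def s_def \<sigma>_def by simp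
    qed
  qed
  have lim1: "((\<lambda>u. (s u / u) * ((X u - X (- u)) / u)) \<longlongrightarrow> - (euler q)\<^sup>2 * (2 * X')) (at 0)"
    by (intro tendsto_mult s symmetric_quotient_limit X)
  have lim2: "((\<lambda>u. K * (- (5 * ((G u - G (- u)) / u) * ((h u - h (- u)) / u))
      - \<alpha> * (\<sigma> u / u) * ((g1 u - g1 (- u)) / u) - \<beta> * (\<sigma> u / u) * ((g2 u - g2 (- u)) / u))) \<longlongrightarrow>
     K * (- (5 * (2 * d2) * (2 * (d1 - 3 * f1 / 10))) - \<alpha> * (- E\<^sup>2) * (2 * (f1 / 5 - d1)) - \<beta> * (- E\<^sup>2) * (2 * (d2 - f2 / 5)))) (at 0)"
    by (intro tendsto_intros \<sigma> symmetric_quotient_limit G h g1 g2)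
  have eq: "eventually (\<lambda>u. (s u / u) * ((X u - X (- u)) / u) = K * (- (5 * ((G u - G (- u)) / u) * ((h u - h (- u)) / u))
      - \<alpha> * (\<sigma> u / u) * ((g1 u - g1 (- u)) / u) - \<beta> * (\<sigma> u / u) * ((g2 u - g2 (- u)) / u))) (at 0)"
    using ev
  proof eventually_elim
    case (elim u)
    have alg: "(p / u) * (w / u) = c / u\<^sup>2" if "p * w = c" for p w c using that by (simp add: power2_eq_square flip: that)
    have sp: "K * (- (5 * (p1 / u) * (p2 / u)) - \<alpha> * (p3 / u) * (p4 / u) - \<beta> * (p3 / u) * (p6 / u))
      = K * (- (5 * p1 * p2) - \<alpha> * p3 * p4 - \<beta> * p3 * p6) / u\<^sup>2" for p1 p2 p3 p4 p6
      by (simp add: power2_eq_square diff_divide_distrib add_divide_distrib right_diff_distrib mult_ac)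
    show ?case unfolding sp by (rule alg[OF elim])
  qed
  have lim: "- (euler q)\<^sup>2 * (2 * X') =
     K * (- (5 * (2 * d2) * (2 * (d1 - 3 * f1 / 10))) - \<alpha> * (- E\<^sup>2) * (2 * (f1 / 5 - d1)) - \<beta> * (- E\<^sup>2) * (2 * (d2 - f2 / 5)))"
    by (rule tendsto_unique[OF _ lim1 lim2[folded tendsto_cong[OF eq]]]) simp
  define \<gamma> \<delta> where "\<gamma> = a ^ 3 - 3 * q * b ^ 2" and "\<delta> = 3 * a ^ 2 + q * b ^ 3"
  have dd: "d2 = (f2 - E\<^sup>2 * \<gamma>) / 10" "d1 = (3 * f1 - E\<^sup>2 * \<delta>) / 10"
    using derivs unfolding \<gamma>_def \<delta>_def by (simp_all add: field_simps)
  \<comment> \<open>After inserting \<open>d1\<close> and \<open>d2\<close>, this identity cancels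
    the terms linear in f1 and f2, and the next one turns the rest into a multiple of
    \<open>Dt\<close>, the denominator of \<open>K\<close>.\<close>
  have f: "f2 * (\<delta> - \<beta>) = \<alpha> * f1"
  proof -
    have "f2 * (\<delta> - \<beta>) = f1 * (a ^ 3 + 2 * q * b ^ 2 * (a * b))"
      unfolding ab(4) \<delta>_def \<beta>_def by (simp add: algebra_simps eval_nat_numeral)
    then show ?thesis using ab(1) by (simp add: \<alpha>_def)
  qed
  have ee: "\<delta> * (\<alpha> - \<gamma>) - \<beta> * \<gamma> = - 2 * Dt"
  proof -
    have "\<delta> * (\<alpha> - \<gamma>) - \<beta> * \<gamma> = 21 * q * (a * b) ^ 2 + q * (a * b) ^ 3 + 2 * q\<^sup>2 * b ^ 5 - 2 * a ^ 5"
      unfolding \<alpha>_def \<beta>_def \<gamma>_def \<delta>_def by (simp add: algebra_simps eval_nat_numeral)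
    then show ?thesis using ab(1) by (simp add: Dt_def)
  qed
  have "- (euler q)\<^sup>2 * (2 * X') = K * (E\<^sup>2 / 5 * (f2 * (\<delta> - \<beta>) - \<alpha> * f1 + E\<^sup>2 * (\<delta> * (\<alpha> - \<gamma>) - \<beta> * \<gamma>)))"
    unfolding lim dd by (simp add: field_simps)
  also have "\<dots> = - 2 * E ^ 4 / 5 * euler q"
    unfolding f ee K_def using Dt(2) by (simp add: eval_nat_numeral)
  finally have "5 * X' * (euler q)\<^sup>2 = E ^ 4 * euler q" by (simp add: field_simps)
  then have X'_eq: "5 * X' = E ^ 4 / euler q"
    using euler_nonzero[OF q(1)] by (simp add: field_simps power2_eq_square)
  have "((\<lambda>k. (r 1 k / (1 - 1 * q powi k) + 5 * (r 1 k * q powi k / (1 - 1 * q powi k) ^ 2))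
      - (4 * (r 4 k / (1 - 1 * q powi k)) + 5 * (r 4 k * q powi k / (1 - 1 * q powi k) ^ 2))) has_sum
     (L 1 1 + 5 * deriv (L 1) 1) - (4 * L 4 1 + 5 * deriv (L 4) 1)) (- {0})"
    by (intro has_sum_diff has_sum_add has_sum_cmult_right L_holomorphic(3,4) one_in_S)
  moreover have "(L 1 1 + 5 * deriv (L 1) 1) - (4 * L 4 1 + 5 * deriv (L 4) 1) = E ^ 4 / euler q"
    unfolding X'_eq[symmetric] X'_def by simp
  moreover have "(r 1 k / (1 - 1 * q powi k) + 5 * (r 1 k * q powi k / (1 - 1 * q powi k) ^ 2))
      - (4 * (r 4 k / (1 - 1 * q powi k)) + 5 * (r 4 k * q powi k / (1 - 1 * q powi k) ^ 2))
    = r 1 k * (1 / (1 - q powi k) + 5 * q powi k / (1 - q powi k)\<^sup>2)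
       - r 4 k * (4 / (1 - q powi k) + 5 * q powi k / (1 - q powi k)\<^sup>2)" for k
    by (simp add: algebra_simps)
  ultimately show ?thesis by (simp only:)
qed

end

section \<open>Ranks and boxes of partitions\<close>

definition pbox :: "nat \<Rightarrow> nat \<Rightarrow> nat \<Rightarrow> nat multiset set" where
  "pbox n l k = {p \<in> partitions_of n. (\<forall>x\<in>#p. x \<le> l) \<and> size p \<le> k}"

lemma finite_box [simp]: "finite (pbox n l k)"
  using finite_partitions_of[of n] by (simp add: pbox_def)

lemma box_largest:
  assumes "l > 0"
  shows "{p \<in> pbox n l (Suc k). l \<in># p} = (if l \<le> n then add_mset l ` pbox (n - l) l k else {})"
proof -
  have "p \<in> add_mset l ` pbox (n - l) l k \<and> l \<le> n" if "p \<in> pbox n l (Suc k)" "l \<in># p" for p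
  proof -
    obtain q where q: "p = add_mset l q" using \<open>l \<in># p\<close> by (meson mset_add)
    with that have "q \<in> pbox (n - l) l k" "l \<le> n" by (auto simp: pbox_def partitions_of_def)
    with q show ?thesis by blast
  qed
  moreover have "add_mset l q \<in> pbox n l (Suc k)" if "q \<in> pbox (n - l) l k" "l \<le> n" for q
    using that assms by (auto simp: pbox_def partitions_of_def)
  ultimately show ?thesis by auto
qed

lemma card_box_largest:
  assumes "l > 0"
  shows "card {p \<in> pbox n l (Suc k). l \<in># p} = (if l \<le> n then card (pbox (n - l) l k) else 0)"
  by (simp add: box_largest[OF assms] card_image inj_on_def)

lemma sum_mset_image_Suc: "\<Sum>\<^sub># (image_mset Suc q) = \<Sum>\<^sub># q + size q"
  by (induction q) auto

lemma image_Suc_pred: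
  assumes "0 \<notin># (p :: nat multiset)"
  shows "image_mset Suc (image_mset (\<lambda>x. x - 1) p) = p"
  using assms by (induction p) auto

lemma filter_pos_decomp:
  "(q :: nat multiset) = filter_mset (\<lambda>x. 0 < x) q + replicate_mset (size q - size (filter_mset (\<lambda>x. 0 < x) q)) 0"
proof -
  have q: "q = filter_mset (\<lambda>x. 0 < x) q + replicate_mset (count q 0) 0"
  proof -
    have "filter_mset (\<lambda>x. \<not> 0 < x) q = replicate_mset (count q 0) 0"
      by (simp flip: filter_eq_replicate_mset)
    then show ?thesis using multiset_partition[of q "\<lambda>x. 0 < x"] by argo
  qed
  then have "size q = size (filter_mset (\<lambda>x. 0 < x) q) + count q 0"
    by (metis size_union size_replicate_mset)
  then have "size q - size (filter_mset (\<lambda>x. 0 < x) q) = count q 0" by linarith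
  then show ?thesis by (metis q)
qed

text \<open>Removing the first column lowers every part by 1 and drops the zeros. The inverse
  \<open>F\<close> pads with zeros to exactly k parts before adding 1, so the remainder may have any
  number of parts up to k.\<close>

lemma box_first_column:
  shows "card {p \<in> pbox n (Suc l) k. size p = k} = (if k \<le> n then card (pbox (n - k) l k) else 0)"
proof -
  define F where "F = (\<lambda>q. image_mset Suc (q + replicate_mset (k - size q) 0))"
  have szF: "size (F q) = k" if "size q \<le> k" for q using that by (simp add: F_def)
  have inj: "inj_on F (pbox m l k)" for m
  proof (rule inj_onI)
    fix p q assume pq: "p \<in> pbox m l k" "q \<in> pbox m l k" "F p = F q"
    then have "image_mset (\<lambda>x. x - 1) (F p) = image_mset (\<lambda>x. x - 1) (F q)" by simp
    then have "p + replicate_mset (k - size p) 0 = q + replicate_mset (k - size q) 0"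
      by (simp add: F_def multiset.map_comp comp_def)
    then have "filter_mset (\<lambda>x. 0 < x) (p + replicate_mset (k - size p) 0)
      = filter_mset (\<lambda>x. 0 < x) (q + replicate_mset (k - size q) 0)" by simp
    moreover have "filter_mset (\<lambda>x. 0 < x) r = r" if "r \<in> pbox m l k" for r
      using that by (auto simp: pbox_def partitions_of_def filter_mset_eq_conv intro!: Nat.gr0I)
    moreover have "filter_mset (\<lambda>x. 0 < x) (replicate_mset a (0::nat)) = {#}" for a :: nat
      by simp
    ultimately show "p = q" using pq by simp
  qed
  have sumF: "\<Sum>\<^sub># (F q) = \<Sum>\<^sub># q + k" if "size q \<le> k" for q
    using that by (simp add: F_def sum_mset_image_Suc)
  have "{p \<in> pbox n (Suc l) k. size p = k} = (if k \<le> n then F ` pbox (n - k) l k else {})"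
  proof -
    have "p \<in> F ` pbox (n - k) l k \<and> k \<le> n" if p: "p \<in> pbox n (Suc l) k" "size p = k" for p
    proof -
      define q where "q = filter_mset (\<lambda>x. 0 < x) (image_mset (\<lambda>x. x - 1) p)"
      have 0: "0 \<notin># p" "\<Sum>\<^sub># p = n" using p by (auto simp: pbox_def partitions_of_def)
      have sz: "size q \<le> k" using p unfolding q_def by (metis size_filter_mset_lesseq size_image_mset)
      have "image_mset (\<lambda>x. x - 1) p = q + replicate_mset (k - size q) 0"
        using filter_pos_decomp[of "image_mset (\<lambda>x. x - 1) p"] p by (simp add: q_def)
      then have Fq: "p = F q" using image_Suc_pred[OF 0(1)] by (simp add: F_def)
      moreover have n: "n = \<Sum>\<^sub># q + k" using sumF[OF sz] 0 Fq by simp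
      moreover have "q \<in> pbox (n - k) l k"
        using n sz p by (auto simp: pbox_def partitions_of_def q_def le_diff_conv)
      ultimately show ?thesis by auto
    qed
    moreover have "F q \<in> pbox n (Suc l) k \<and> size (F q) = k" if "q \<in> pbox (n - k) l k" "k \<le> n" for q
    proof -
      have sz: "size q \<le> k" using that by (simp add: pbox_def)
      show ?thesis using that sz szF[OF sz] sumF[OF sz]
        by (auto simp: pbox_def partitions_of_def F_def)
    qed
    ultimately show ?thesis by auto
  qed
  then show ?thesis by (simp add: card_image[OF inj])
qed

lemma card_box_0: "card (pbox n l 0) = (if n = 0 then 1 else 0)" "card (pbox n 0 k) = (if n = 0 then 1 else 0)"
proof -
  have "pbox n l 0 = (if n = 0 then {{#}} else {})" by (auto simp: pbox_def partitions_of_def)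
  then show "card (pbox n l 0) = (if n = 0 then 1 else 0)" by simp
  have "p = {#}" if "0 \<notin># p" "\<forall>x\<in>#p. x \<le> 0" for p :: "nat multiset"
    using that by (metis le_zero_eq multiset_nonemptyE)
  then have "p = {#}" if "p \<in> pbox n 0 k" for p
    using that by (simp add: pbox_def partitions_of_def)
  moreover have "{#} \<in> pbox n 0 k \<longleftrightarrow> n = 0" by (auto simp: pbox_def partitions_of_def)
  ultimately have "pbox n 0 k = (if n = 0 then {{#}} else {})" by auto
  then show "card (pbox n 0 k) = (if n = 0 then 1 else 0)" by simp
qed

lemma card_box_Suc_largest:
  "card (pbox n (Suc l) (Suc k)) = card (pbox n l (Suc k)) + (if Suc l \<le> n then card (pbox (n - Suc l) (Suc l) k) else 0)"
proof -
  have "p \<in> pbox n l (Suc k)" if "p \<in> pbox n (Suc l) (Suc k)" "Suc l \<notin># p" for p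
  proof -
    have "x \<le> l" if "x \<in># p" for x
      using that \<open>p \<in> _\<close> \<open>Suc l \<notin># p\<close> unfolding pbox_def by (metis (mono_tags, lifting) le_SucE mem_Collect_eq)
    then show ?thesis using that by (simp add: pbox_def)
  qed
  moreover have "pbox n l (Suc k) \<subseteq> pbox n (Suc l) (Suc k)" by (auto simp: pbox_def)
  ultimately have "card (pbox n (Suc l) (Suc k)) = card (pbox n l (Suc k) \<union> {p \<in> pbox n (Suc l) (Suc k). Suc l \<in># p})"
    by (intro arg_cong[where f = card]) blast
  moreover have "pbox n l (Suc k) \<inter> {p \<in> pbox n (Suc l) (Suc k). Suc l \<in># p} = {}"
    by (auto simp: pbox_def)
  ultimately show ?thesis
    using card_Un_disjoint[of "pbox n l (Suc k)" "{p \<in> pbox n (Suc l) (Suc k). Suc l \<in># p}"]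
      card_box_largest[of "Suc l" n k] by simp
qed

lemma card_box_Suc_column:
  "card (pbox n (Suc l) (Suc k)) = card (pbox n (Suc l) k) + (if Suc k \<le> n then card (pbox (n - Suc k) l (Suc k)) else 0)"
proof -
  have "p \<in> pbox n (Suc l) k" if "p \<in> pbox n (Suc l) (Suc k)" "size p \<noteq> Suc k" for p
    using that by (simp add: pbox_def)
  moreover have "pbox n (Suc l) k \<subseteq> pbox n (Suc l) (Suc k)" by (auto simp: pbox_def)
  ultimately have "card (pbox n (Suc l) (Suc k)) = card (pbox n (Suc l) k \<union> {p \<in> pbox n (Suc l) (Suc k). size p = Suc k})"
    by (intro arg_cong[where f = card]) blast
  moreover have "pbox n (Suc l) k \<inter> {p \<in> pbox n (Suc l) (Suc k). size p = Suc k} = {}"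
    by (auto simp: pbox_def)
  ultimately show ?thesis
    using card_Un_disjoint[of "pbox n (Suc l) k" "{p \<in> pbox n (Suc l) (Suc k). size p = Suc k}"]
      box_first_column[of n l "Suc k"] by simp
qed

text \<open>Symmetry under conjugation without a conjugation map: the recurrence by largest part and
  the one by number of parts are mirror images, so induction on l + k suffices.\<close>

lemma card_box_commute: "card (pbox n l k) = card (pbox n k l)"
proof (induction "l + k" arbitrary: n l k rule: less_induct)
  case (less l k)
  show ?case
  proof (cases "l = 0 \<or> k = 0")
    case True
    then show ?thesis by (auto simp: card_box_0)
  next
    case False
    then obtain l' k' where [simp]: "l = Suc l'" "k = Suc k'" by (meson not0_implies_Suc)
    have "card (pbox m (Suc l') k') = card (pbox m k' (Suc l'))" for m by (rule less) simp
    moreover have "card (pbox m l' (Suc k')) = card (pbox m (Suc k') l')" for m by (rule less) simp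
    ultimately show ?thesis
      using card_box_Suc_largest[of n k' l'] card_box_Suc_column[of n l' k'] by simp
  qed
qed

definition shape :: "nat multiset \<Rightarrow> nat \<times> nat" where
  "shape p = (Max (set_mset p), size p)"

definition shaped :: "nat \<Rightarrow> nat \<Rightarrow> nat \<Rightarrow> nat multiset set" where
  "shaped n l k = {p \<in> partitions_of n. p \<noteq> {#} \<and> shape p = (l, k)}"

lemma shaped_eq:
  assumes "l > 0" "k > 0"
  shows "shaped n l k = pbox n l k - (pbox n (l - 1) k \<union> pbox n l (k - 1))"
proof -
  have *: "(Max (set_mset p) = l) \<longleftrightarrow> (\<forall>x\<in>#p. x \<le> l) \<and> \<not> (\<forall>x\<in>#p. x \<le> l - 1)" if "p \<noteq> {#}" for p
  proof -
    have "(\<forall>x\<in>#p. x \<le> m) \<longleftrightarrow> Max (set_mset p) \<le> m" for m using that by simp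
    then show ?thesis using assms by auto
  qed
  show ?thesis
  proof (intro equalityI subsetI)
    fix p assume "p \<in> shaped n l k"
    then show "p \<in> pbox n l k - (pbox n (l - 1) k \<union> pbox n l (k - 1))"
      using * assms by (auto simp: shaped_def pbox_def shape_def)
  next
    fix p assume p: "p \<in> pbox n l k - (pbox n (l - 1) k \<union> pbox n l (k - 1))"
    then have "p \<noteq> {#}" by (auto simp: pbox_def)
    with p show "p \<in> shaped n l k"
      using *[OF \<open>p \<noteq> {#}\<close>] assms by (auto simp: shaped_def pbox_def shape_def)
  qed
qed

text \<open>Inclusion and exclusion over four boxes reduces a prescribed shape to
  \<open>card_box_commute\<close>.\<close>

lemma card_shaped_commute: "card (shaped n l k) = card (shaped n k l)"
proof (cases "l = 0 \<or> k = 0")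
  case True
  have "p \<notin> shaped n l k" if "l = 0 \<or> k = 0" for p l k
  proof
    assume "p \<in> shaped n l k"
    then have "p \<noteq> {#}" "0 \<notin># p" "Max (set_mset p) = l" "size p = k"
      by (auto simp: shaped_def shape_def partitions_of_def)
    then show False using that by (metis Max_in finite_set_mset set_mset_eq_empty_iff size_eq_0_iff_empty)
  qed
  then have "shaped n l k = {}" "shaped n k l = {}" using True by blast+
  then show ?thesis by simp
next
  case False
  have "int (card (shaped n l k)) = int (card (pbox n l k)) - card (pbox n (l - 1) k) - card (pbox n l (k - 1)) + card (pbox n (l - 1) (k - 1))"
    if "l > 0" "k > 0" for l k
  proof -
    have "card (pbox n (l - 1) k \<union> pbox n l (k - 1)) + card (pbox n (l - 1) k \<inter> pbox n l (k - 1)) = card (pbox n (l - 1) k) + card (pbox n l (k - 1))"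
      by (rule card_Un_Int[symmetric]) auto
    moreover have "pbox n (l - 1) k \<inter> pbox n l (k - 1) = pbox n (l - 1) (k - 1)" by (auto simp: pbox_def)
    moreover have sub: "pbox n (l - 1) k \<union> pbox n l (k - 1) \<subseteq> pbox n l k" by (auto simp: pbox_def)
    moreover have "card (shaped n l k) = card (pbox n l k) - card (pbox n (l - 1) k \<union> pbox n l (k - 1))"
      unfolding shaped_eq[OF that] by (rule card_Diff_subset[OF finite_subset[OF sub] sub]) auto
    moreover have "card (pbox n (l - 1) k \<union> pbox n l (k - 1)) \<le> card (pbox n l k)"
      by (rule card_mono[OF _ sub]) auto
    ultimately show ?thesis by simp
  qed
  from this[of l k] this[of k l] False show ?thesis
    using card_box_commute[of n k l] card_box_commute[of n "k - 1" l]
      card_box_commute[of n "l - 1" k] card_box_commute[of n "l - 1" "k - 1"] by linarith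
qed

lemma shape_bounds:
  assumes "p \<in> partitions_of n" "p \<noteq> {#}"
  shows "shape p \<in> {1..n} \<times> {1..n}"
proof -
  have p: "0 \<notin># p" "\<Sum>\<^sub># p = n" using assms by (auto simp: partitions_of_def)
  have "Max (set_mset p) \<in># p" using assms by simp
  then have "Max (set_mset p) \<ge> 1" "Max (set_mset p) \<le> n"
    using p by (metis One_nat_def Suc_leI gr0I, metis sum_mset.remove le_add1)
  moreover have "size p \<le> \<Sum>\<^sub># p" using p(1) by (induction p) auto
  moreover have "size p \<ge> 1" using assms by (simp add: Suc_leI nonempty_has_size)
  ultimately show ?thesis using p by (auto simp: shape_def)
qed

lemma sum_shape:
  fixes g :: "nat \<times> nat \<Rightarrow> int"
  assumes "n > 0"
  shows "(\<Sum>p\<in>partitions_of n. g (shape p)) = (\<Sum>(l,k)\<in>{1..n}\<times>{1..n}. g (l,k) * int (card (shaped n l k)))"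
proof -
  have ne: "p \<noteq> {#}" if "p \<in> partitions_of n" for p using that assms by (auto simp: partitions_of_def)
  have "(\<Sum>p\<in>partitions_of n. g (shape p)) = (\<Sum>y\<in>{1..n}\<times>{1..n}. \<Sum>p\<in>{p \<in> partitions_of n. shape p = y}. g (shape p))"
  proof (rule sum.group[symmetric])
    show "shape ` partitions_of n \<subseteq> {1..n} \<times> {1..n}" using ne shape_bounds by blast
  qed (simp_all add: finite_partitions_of)
  also have "\<dots> = (\<Sum>y\<in>{1..n}\<times>{1..n}. g y * int (card (shaped n (fst y) (snd y))))"
  proof (rule sum.cong[OF refl], goal_cases)
    case (1 y)
    have "{p \<in> partitions_of n. shape p = y} = shaped n (fst y) (snd y)"
      using ne by (auto simp: shaped_def)
    moreover have "g (shape p) = g y" if "p \<in> shaped n (fst y) (snd y)" for p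
      using that by (simp add: shaped_def)
    ultimately show ?case by simp
  qed
  finally show ?thesis by (simp add: case_prod_unfold)
qed

lemma sum_shape_swap:
  fixes g :: "nat \<times> nat \<Rightarrow> int"
  assumes "n > 0"
  shows "(\<Sum>p\<in>partitions_of n. g (shape p)) = (\<Sum>p\<in>partitions_of n. g (prod.swap (shape p)))"
proof -
  have "(\<Sum>p\<in>partitions_of n. g (prod.swap (shape p))) = (\<Sum>(l,k)\<in>{1..n}\<times>{1..n}. g (k,l) * int (card (shaped n l k)))"
    using sum_shape[OF assms, of "\<lambda>y. g (prod.swap y)"] by (simp add: case_prod_unfold)
  also have "\<dots> = (\<Sum>(l,k)\<in>{1..n}\<times>{1..n}. g (l,k) * int (card (shaped n l k)))"
    by (rule sum.reindex_bij_witness[of _ prod.swap prod.swap]) (auto simp: card_shaped_commute)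
  finally show ?thesis using sum_shape[OF assms, of g] by simp
qed

lemma partition_rank_shape:
  "p \<noteq> {#} \<Longrightarrow> partition_rank p = int (fst (shape p)) - int (snd (shape p))"
  unfolding partition_rank_def shape_def by simp

text \<open>A positive rank r congruent to 4 stands for the conjugate partition, whose rank -r is
  congruent to 1 and counts with its own negative value.\<close>

definition residue_weight :: "nat \<Rightarrow> int" where
  "residue_weight r = (if r mod 5 = 1 then int r else if r mod 5 = 4 then - int r else 0)"

definition rank_ge :: "nat \<Rightarrow> nat \<Rightarrow> nat" where
  "rank_ge m n = card {p \<in> partitions_of n. int m \<le> partition_rank p}"

text \<open>By conjugation, numbers of parts at rank 4 modulo 5 become largest parts at rank 1
  modulo 5, so the difference is the sum of all ranks congruent to 1. A second conjugation makes the
  negative ones among them positive.\<close>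

lemma NT_diff:
  assumes "n > 0"
  shows "int (NT 4 5 n) - int (NT 1 5 n) = (\<Sum>r=1..n. residue_weight r * (int (rank_ge r n) - int (rank_ge (Suc r) n)))"
proof -
  have ne: "p \<noteq> {#}" if "p \<in> partitions_of n" for p using that assms by (auto simp: partitions_of_def)
  note fin = finite_partitions_of[of n]
  have NT: "int (NT m 5 n) = (\<Sum>p\<in>partitions_of n. (\<lambda>(l,k). if [int l - int k = m] (mod 5) then int k else 0) (shape p))" for m
  proof -
    have "int (NT m 5 n) = (\<Sum>p\<in>partitions_of n. if [partition_rank p = m] (mod 5) then int (size p) else 0)"
      using fin by (simp add: NT_def sum.If_cases Int_def)
    also have "\<dots> = (\<Sum>p\<in>partitions_of n. (\<lambda>(l,k). if [int l - int k = m] (mod 5) then int k else 0) (shape p))"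
      by (rule sum.cong) (auto simp: partition_rank_shape ne shape_def)
    finally show ?thesis .
  qed
  have "int (NT 4 5 n) = (\<Sum>p\<in>partitions_of n. (\<lambda>(l,k). if [int k - int l = 4] (mod 5) then int l else 0) (shape p))"
    unfolding NT by (subst sum_shape_swap[OF assms]) (simp only: case_prod_unfold fst_swap snd_swap)
  also have "\<dots> = (\<Sum>p\<in>partitions_of n. (\<lambda>(l,k). if [int l - int k = 1] (mod 5) then int l else 0) (shape p))"
  proof (rule sum.cong[OF refl], goal_cases)
    case (1 p)
    have "[b - a = 4] (mod 5) \<longleftrightarrow> [a - b = 1] (mod 5)" for a b :: int
      unfolding cong_iff_dvd_diff by presburger
    then show ?case by (simp add: case_prod_unfold)
  qed
  finally have NT4: "int (NT 4 5 n) = (\<Sum>p\<in>partitions_of n. (\<lambda>(l,k). if [int l - int k = 1] (mod 5) then int l else 0) (shape p))" .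
  have "int (NT 4 5 n) - int (NT 1 5 n) = (\<Sum>p\<in>partitions_of n. if partition_rank p mod 5 = 1 then partition_rank p else 0)"
    unfolding NT4 NT[of 1] sum_subtractf[symmetric]
    by (auto intro!: sum.cong simp: case_prod_unfold partition_rank_shape ne Cong.cong_def)
  also have "\<dots> = (\<Sum>p\<in>partitions_of n. (if 0 < partition_rank p then (if partition_rank p mod 5 = 1 then partition_rank p else 0) else 0))
     + (\<Sum>p\<in>partitions_of n. (if partition_rank p < 0 then (if partition_rank p mod 5 = 1 then partition_rank p else 0) else 0))"
    by (subst sum.distrib[symmetric]) (auto intro!: sum.cong)
  also have "(\<Sum>p\<in>partitions_of n. (if partition_rank p < 0 then (if partition_rank p mod 5 = 1 then partition_rank p else 0) else 0))
    = (\<Sum>p\<in>partitions_of n. (\<lambda>(l,k). (if int l - int k < 0 then (if (int l - int k) mod 5 = 1 then int l - int k else 0) else 0)) (shape p))"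
    by (rule sum.cong) (auto simp: partition_rank_shape ne case_prod_unfold)
  also have "\<dots> = (\<Sum>p\<in>partitions_of n. (if 0 < partition_rank p then (if partition_rank p mod 5 = 4 then - partition_rank p else 0) else 0))"
  proof (subst sum_shape_swap[OF assms], rule sum.cong[OF refl], goal_cases)
    case (1 p)
    have "(b - a) mod 5 = 1 \<longleftrightarrow> (a - b) mod 5 = 4" for a b :: int by presburger
    then show ?case using ne[OF 1] by (auto simp: partition_rank_shape case_prod_unfold)
  qed
  also have "(\<Sum>p\<in>partitions_of n. (if 0 < partition_rank p then (if partition_rank p mod 5 = 1 then partition_rank p else 0) else 0)) + \<dots>
    = (\<Sum>p\<in>partitions_of n. if 0 < partition_rank p then residue_weight (nat (partition_rank p)) else 0)"
    unfolding sum.distrib[symmetric]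
  proof (rule sum.cong[OF refl], goal_cases)
    case (1 p)
    show ?case
    proof (cases "0 < partition_rank p")
      case True
      then obtain r where "partition_rank p = int r" by (metis pos_int_cases)
      moreover have "int r mod 5 = int (r mod 5)" by (simp add: zmod_int)
      then have "int r mod 5 = 1 \<longleftrightarrow> r mod 5 = 1" "int r mod 5 = 4 \<longleftrightarrow> r mod 5 = 4" by linarith+
      ultimately show ?thesis by (auto simp: residue_weight_def)
    qed auto
  qed
  also have "\<dots> = (\<Sum>p\<in>partitions_of n. \<Sum>r=1..n. if partition_rank p = int r then residue_weight r else 0)"
  proof (rule sum.cong[OF refl], goal_cases)
    case (1 p)
    show ?case
    proof (cases "0 < partition_rank p")
      case True
      then obtain r where r: "partition_rank p = int r" "r > 0" by (metis pos_int_cases)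
      moreover have "r \<le> n" using r ne[OF 1] shape_bounds[OF 1 ne[OF 1]] by (auto simp: partition_rank_shape)
      ultimately show ?thesis by (simp add: sum.delta)
    next
      case False
      then show ?thesis by (auto intro!: sum.neutral[symmetric])
    qed
  qed
  also have "\<dots> = (\<Sum>r=1..n. \<Sum>p\<in>partitions_of n. if partition_rank p = int r then residue_weight r else 0)"
    by (rule sum.swap)
  also have "\<dots> = (\<Sum>r=1..n. residue_weight r * int (card {p \<in> partitions_of n. partition_rank p = int r}))"
    using fin by (simp add: sum.If_cases Int_def mult.commute)
  also have "\<dots> = (\<Sum>r=1..n. residue_weight r * (int (rank_ge r n) - int (rank_ge (Suc r) n)))"
  proof (rule sum.cong[OF refl], goal_cases)
    case (1 r)
    have "{p \<in> partitions_of n. int r \<le> partition_rank p} = {p \<in> partitions_of n. partition_rank p = int r} \<union> {p \<in> partitions_of n. int (Suc r) \<le> partition_rank p}"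
      by auto
    then have "rank_ge r n = card {p \<in> partitions_of n. partition_rank p = int r} + rank_ge (Suc r) n"
      unfolding rank_ge_def using fin by (simp add: card_Un_disjoint disjoint_iff)
    then show ?case by simp
  qed
  finally show ?thesis .
qed

text \<open>Sort by the number k of parts and delete the first column. The right side is the one of
  \<open>card_by_largest\<close>; equating the two counts is the point of both lemmas.\<close>

lemma card_by_size:
  "card {p \<in> partitions_of n. partition_rank p \<le> int r + 1} = (\<Sum>k\<le>n. card (pbox (n - k) (k + r) k))"
proof -
  have "{p \<in> partitions_of n. partition_rank p \<le> int r + 1} = (\<Union>k\<le>n. {p \<in> pbox n (Suc (k + r)) k. size p = k})"
  proof (intro equalityI subsetI)
    fix p assume p: "p \<in> {p \<in> partitions_of n. partition_rank p \<le> int r + 1}"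
    show "p \<in> (\<Union>k\<le>n. {p \<in> pbox n (Suc (k + r)) k. size p = k})"
    proof (cases "p = {#}")
      case True
      then show ?thesis using p by (auto simp: pbox_def partitions_of_def)
    next
      case False
      have "size p \<le> n" using shape_bounds[OF _ False] p by (auto simp: shape_def)
      moreover have "int (Max (set_mset p)) - int (size p) \<le> int r + 1"
        using p False by (simp add: partition_rank_def)
      then have "Max (set_mset p) \<le> Suc (size p + r)" by linarith
      then have "\<forall>x\<in>#p. x \<le> Suc (size p + r)" using False by simp
      ultimately show ?thesis using p by (auto simp: pbox_def)
    qed
  next
    fix p assume p: "p \<in> (\<Union>k\<le>n. {p \<in> pbox n (Suc (k + r)) k. size p = k})"
    then have "\<forall>x\<in>#p. x \<le> Suc (size p + r)" by (auto simp: pbox_def)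
    then have "p \<noteq> {#} \<longrightarrow> Max (set_mset p) \<le> Suc (size p + r)" by simp
    then have "p \<noteq> {#} \<longrightarrow> int (Max (set_mset p)) - int (size p) \<le> int r + 1" by linarith
    then show "p \<in> {p \<in> partitions_of n. partition_rank p \<le> int r + 1}"
      using p by (auto simp: pbox_def partition_rank_def simp del: Max_le_iff)
  qed
  then have "card {p \<in> partitions_of n. partition_rank p \<le> int r + 1} = (\<Sum>k\<le>n. card {p \<in> pbox n (Suc (k + r)) k. size p = k})"
    by (simp, subst card_UN_disjoint) auto
  then show ?thesis by (simp add: box_first_column)
qed

text \<open>Sort by the largest part k + r and delete it: rank at least r - 1 says that at most k
  other parts remain, all bounded by k + r.\<close>

lemma card_by_largest:
  assumes "r > 0"
  shows "card {p \<in> partitions_of (n + r). p \<noteq> {#} \<and> int r - 1 \<le> partition_rank p} = (\<Sum>k\<le>n. card (pbox (n - k) (k + r) k))"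
proof -
  have "{p \<in> partitions_of (n + r). p \<noteq> {#} \<and> int r - 1 \<le> partition_rank p} = (\<Union>k\<le>n. {p \<in> pbox (n + r) (k + r) (Suc k). k + r \<in># p})"
  proof (intro equalityI subsetI)
    fix p assume p: "p \<in> {p \<in> partitions_of (n + r). p \<noteq> {#} \<and> int r - 1 \<le> partition_rank p}"
    define l where "l = Max (set_mset p)"
    have sb: "size p \<ge> 1" "l \<le> n + r" using shape_bounds[of p "n + r"] p by (auto simp: shape_def l_def)
    have l: "int r - 1 \<le> int l - int (size p)" using p by (auto simp: partition_rank_def l_def)
    then have "p \<in> {p \<in> pbox (n + r) (l - r + r) (Suc (l - r)). l - r + r \<in># p}"
      using p sb by (auto simp: pbox_def l_def)
    moreover have "l - r \<le> n" using sb by simp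
    ultimately show "p \<in> (\<Union>k\<le>n. {p \<in> pbox (n + r) (k + r) (Suc k). k + r \<in># p})" by blast
  next
    fix p assume "p \<in> (\<Union>k\<le>n. {p \<in> pbox (n + r) (k + r) (Suc k). k + r \<in># p})"
    then obtain k where k: "p \<in> pbox (n + r) (k + r) (Suc k)" "k + r \<in># p" by blast
    then have "Max (set_mset p) \<ge> k + r" by simp
    moreover have "size p \<le> Suc k" using k by (simp add: pbox_def)
    ultimately have "int r - 1 \<le> int (Max (set_mset p)) - int (size p)" by linarith
    moreover have "p \<noteq> {#}" using k by auto
    ultimately show "p \<in> {p \<in> partitions_of (n + r). p \<noteq> {#} \<and> int r - 1 \<le> partition_rank p}"
      using k by (simp add: pbox_def partition_rank_def)
  qed
  moreover have "card (\<Union>k\<le>n. {p \<in> pbox (n + r) (k + r) (Suc k). k + r \<in># p}) = (\<Sum>k\<le>n. card {p \<in> pbox (n + r) (k + r) (Suc k). k + r \<in># p})"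
  proof (rule card_UN_disjoint)
    show "\<forall>i\<in>{..n}. \<forall>j\<in>{..n}. i \<noteq> j \<longrightarrow> {p \<in> pbox (n + r) (i + r) (Suc i). i + r \<in># p} \<inter> {p \<in> pbox (n + r) (j + r) (Suc j). j + r \<in># p} = {}"
      by (fastforce simp: pbox_def)
  qed auto
  ultimately show ?thesis using assms by (simp add: card_box_largest)
qed

text \<open>Dyson's adjoint: removing the first column, of length \<open>k\<close>, and inserting a new largest
  part \<open>k + m + 1\<close> exchanges the two bounds on the rank.\<close>

lemma rank_ge_rec:
  assumes "m > 0"
  shows "rank_ge m (n + Suc m) + rank_ge (m + 3) n = card (partitions_of n)"
proof -
  have "p \<noteq> {#}" if "int m \<le> partition_rank p" for p
    using that assms by (auto simp: partition_rank_def)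
  then have "{p \<in> partitions_of (n + Suc m). int m \<le> partition_rank p} = {p \<in> partitions_of (n + Suc m). p \<noteq> {#} \<and> int (Suc m) - 1 \<le> partition_rank p}"
    by auto
  then have "rank_ge m (n + Suc m) = card {p \<in> partitions_of n. partition_rank p \<le> int (Suc m) + 1}"
    unfolding rank_ge_def card_by_size by (simp only: card_by_largest zero_less_Suc)
  moreover have "card (partitions_of n) = card {p \<in> partitions_of n. partition_rank p \<le> int (Suc m) + 1} + card {p \<in> partitions_of n. int (m + 3) \<le> partition_rank p}"
    using finite_partitions_of[of n]
    by (subst card_Un_disjoint[symmetric]) (auto intro!: arg_cong[of _ _ card])
  ultimately show ?thesis by (simp add: rank_ge_def)
qed

lemma rank_ge_eq_0:
  assumes "m > 0" "n \<le> m"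
  shows "rank_ge m n = 0"
proof -
  have "\<not> int m \<le> partition_rank p" if "p \<in> partitions_of n" for p
  proof (cases "p = {#}")
    case False
    then show ?thesis using shape_bounds[OF that False] assms by (auto simp: partition_rank_shape)
  qed (use assms in \<open>auto simp: partition_rank_def\<close>)
  then have "{p \<in> partitions_of n. int m \<le> partition_rank p} = {}" by blast
  then show ?thesis unfolding rank_ge_def by (rule ssubst) simp
qed

section \<open>Generating functions\<close>

lemma has_sum_shift:
  fixes f :: "nat \<Rightarrow> 'a :: {comm_monoid_add, topological_space}"
  assumes "(f has_sum s) UNIV"
  shows "((\<lambda>n. if k \<le> n then f (n - k) else 0) has_sum s) UNIV"
proof -
  have "((\<lambda>n. f (n - k)) has_sum s) (range (\<lambda>n. n + k))"
    by (subst has_sum_reindex) (use assms in \<open>auto simp: o_def inj_on_def\<close>)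
  moreover have "range (\<lambda>n. n + k) = {k..}" by (auto simp: image_iff le_iff_add add.commute)
  ultimately have "((\<lambda>n. f (n - k)) has_sum s) {k..}" by simp
  then show ?thesis by (rule has_sum_cong_neutral[THEN iffD1, rotated -1]) auto
qed

lemma has_sum_residue:
  fixes f :: "nat \<Rightarrow> 'a :: {comm_monoid_add, topological_space}"
  assumes "((\<lambda>i. f (5 * i + j)) has_sum s) UNIV" "j < 5"
  shows "((\<lambda>n. if n mod 5 = j then f n else 0) has_sum s) UNIV"
proof -
  have "(f has_sum s) (range (\<lambda>i. 5 * i + j))"
    by (subst has_sum_reindex) (use assms in \<open>auto simp: o_def inj_on_def\<close>)
  moreover have "n \<in> range (\<lambda>i. 5 * i + j)" if "n mod 5 = j" for n
    using that by (metis mult_div_mod_eq rangeI)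
  ultimately show ?thesis
    by (elim has_sum_cong_neutral[THEN iffD1, rotated -1]) (use assms in auto)
qed

lemma has_sum_sum:
  fixes f :: "'i \<Rightarrow> 'a \<Rightarrow> 'b :: topological_comm_monoid_add"
  assumes "\<And>i. i \<in> I \<Longrightarrow> (f i has_sum s i) A"
  shows "((\<lambda>x. \<Sum>i\<in>I. f i x) has_sum (\<Sum>i\<in>I. s i)) A"
  using assms by (induction I rule: infinite_finite_induct) (auto intro!: has_sum_add)

section \<open>The generating function of the partition numbers\<close>

definition parts_le :: "nat \<Rightarrow> nat \<Rightarrow> nat" where
  "parts_le l n = card {p \<in> partitions_of n. \<forall>i\<in>#p. i \<le> l}"

lemma parts_le_rec: "parts_le (Suc l) n = parts_le l n + (if Suc l \<le> n then parts_le (Suc l) (n - Suc l) else 0)"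
proof -
  let ?A = "{p \<in> partitions_of n. \<forall>i\<in>#p. i \<le> l}" and ?B = "{p \<in> partitions_of n. (\<forall>i\<in>#p. i \<le> Suc l) \<and> Suc l \<in># p}"
  have "{p \<in> partitions_of n. \<forall>i\<in>#p. i \<le> Suc l} = ?A \<union> ?B" by (auto simp: le_Suc_eq)
  moreover have "?A \<inter> ?B = {}" by auto
  ultimately have "parts_le (Suc l) n = parts_le l n + card ?B"
    using finite_partitions_of[of n] by (simp add: parts_le_def card_Un_disjoint)
  moreover have "?B = (if Suc l \<le> n then add_mset (Suc l) ` {p \<in> partitions_of (n - Suc l). \<forall>i\<in>#p. i \<le> Suc l} else {})"
  proof -
    have "p \<in> add_mset (Suc l) ` {p \<in> partitions_of (n - Suc l). \<forall>i\<in>#p. i \<le> Suc l} \<and> Suc l \<le> n" if p: "p \<in> ?B" for p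
    proof -
      obtain r where r: "p = add_mset (Suc l) r" using p by (auto dest: mset_add)
      then have "r \<in> {p \<in> partitions_of (n - Suc l). \<forall>i\<in>#p. i \<le> Suc l}" "Suc l \<le> n"
        using p by (auto simp: partitions_of_def)
      then show ?thesis using r by blast
    qed
    moreover have "add_mset (Suc l) r \<in> ?B" if "r \<in> partitions_of (n - Suc l)" "\<forall>i\<in>#r. i \<le> Suc l" "Suc l \<le> n" for r
      using that by (auto simp: partitions_of_def)
    ultimately show ?thesis by auto
  qed
  ultimately show ?thesis by (auto simp: parts_le_def card_image inj_on_def)
qed

lemma parts_le_0: "parts_le 0 n = (if n = 0 then 1 else 0)"
proof -
  have "p \<in> {p \<in> partitions_of n. \<forall>i\<in>#p. i \<le> 0} \<longleftrightarrow> n = 0 \<and> p = {#}" for p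
    by (cases p) (auto simp: partitions_of_def)
  then have "{p \<in> partitions_of n. \<forall>i\<in>#p. i \<le> 0} = (if n = 0 then {{#}} else {})" by auto
  then show ?thesis by (simp add: parts_le_def)
qed

lemma parts_le_eq:
  assumes "n \<le> l"
  shows "parts_le l n = card (partitions_of n)"
proof -
  have "i \<le> l" if "p \<in> partitions_of n" "i \<in># p" for p i
    using that assms by (auto simp: partitions_of_def dest: sum_mset.remove)
  then have "{p \<in> partitions_of n. \<forall>i\<in>#p. i \<le> l} = partitions_of n" by auto
  then show ?thesis by (simp add: parts_le_def)
qed

lemma parts_le_bound: "parts_le l n \<le> card (partitions_of n)"
  unfolding parts_le_def by (rule card_mono[OF finite_partitions_of]) auto

lemma sum_shift_le:
  fixes f :: "nat \<Rightarrow> real"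
  assumes "\<And>n. f n \<ge> 0"
  shows "(\<Sum>n\<le>N. if k \<le> n then f (n - k) else 0) \<le> (\<Sum>n\<le>N. f n)"
proof -
  have "(\<Sum>n\<le>N. if k \<le> n then f (n - k) else 0) = (\<Sum>n\<in>{n\<in>{..N}. k \<le> n}. f (n - k))"
    by (rule sum.inter_filter[symmetric]) simp
  also have "\<dots> = sum f ((\<lambda>n. n - k) ` {n\<in>{..N}. k \<le> n})"
    by (subst sum.reindex) (auto simp: inj_on_def)
  also have "\<dots> \<le> (\<Sum>n\<le>N. f n)"
    by (rule sum_mono2) (use assms in auto)
  finally show ?thesis .
qed

lemma parts_le_partial_sum:
  fixes t :: real
  assumes t: "0 \<le> t" "t < 1"
  shows "(\<Sum>n\<le>N. real (parts_le l n) * t ^ n) \<le> 1 / (\<Prod>i<l. 1 - t * t ^ i)"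
proof (induction l)
  case 0
  have "(\<Sum>n\<le>N. real (parts_le 0 n) * t ^ n) = (\<Sum>n\<le>N. if n = 0 then 1 else 0)"
    by (rule sum.cong) (auto simp: parts_le_0)
  then show ?case by simp
next
  case (Suc l)
  let ?S = "\<lambda>l. \<Sum>n\<le>N. real (parts_le l n) * t ^ n"
  have "?S (Suc l) = ?S l + t ^ Suc l * (\<Sum>n\<le>N. if Suc l \<le> n then real (parts_le (Suc l) (n - Suc l)) * t ^ (n - Suc l) else 0)"
    unfolding sum_distrib_left sum.distrib[symmetric]
  proof (rule sum.cong[OF refl])
    fix n
    show "real (parts_le (Suc l) n) * t ^ n = real (parts_le l n) * t ^ n
      + t ^ Suc l * (if Suc l \<le> n then real (parts_le (Suc l) (n - Suc l)) * t ^ (n - Suc l) else 0)"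
    proof (cases "Suc l \<le> n")
      case True
      then have "t ^ n = t ^ Suc l * t ^ (n - Suc l)" by (simp only: power_add[symmetric] le_add_diff_inverse[OF True])
      then show ?thesis using True by (simp only: parts_le_rec[of l n] if_True) (simp add: algebra_simps)
    qed (simp add: parts_le_rec[of l n])
  qed
  also have "\<dots> \<le> ?S l + t ^ Suc l * ?S (Suc l)"
    using t by (intro add_left_mono mult_left_mono sum_shift_le[where f = "\<lambda>n. real (parts_le (Suc l) n) * t ^ n"]) auto
  finally have "?S (Suc l) * (1 - t * t ^ l) \<le> ?S l" by (simp add: algebra_simps)
  moreover have "1 - t * t ^ l > 0" using t power_Suc_less_one[of t l] by (cases "t = 0") auto
  ultimately have "?S (Suc l) \<le> ?S l / (1 - t * t ^ l)" by (simp add: pos_le_divide_eq)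
  also have "\<dots> \<le> (1 / (\<Prod>i<l. 1 - t * t ^ i)) / (1 - t * t ^ l)"
    using \<open>1 - t * t ^ l > 0\<close> Suc.IH by (intro divide_right_mono) auto
  finally show ?case by (simp add: mult.commute)
qed

text \<open>For real t the finite products decrease to the norm of \<open>euler\<close> at t, which
  is positive because \<open>euler\<close> has no zero in the disc; so the reciprocals bounding the
  partial sums stay bounded. Up to index N, partitions with parts at most N are all
  partitions.\<close>

lemma summable_partitions:
  fixes t :: real
  assumes t: "0 \<le> t" "t < 1"
  shows "summable (\<lambda>n. real (card (partitions_of n)) * t ^ n)"
proof (rule bounded_imp_summable)
  define p where "p = (\<lambda>l. \<Prod>i<l. 1 - t * t ^ i)"
  have factor: "0 < 1 - t * t ^ i" "1 - t * t ^ i \<le> 1" for i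
    using t power_Suc_less_one[of t i] by (cases "t = 0"; simp)+
  have "(\<lambda>l. norm (\<Prod>i<l. 1 - complex_of_real t * complex_of_real t ^ i)) \<longlonglongrightarrow> norm (euler (complex_of_real t))"
    unfolding euler_def using t by (intro tendsto_norm qpoch_LIMSEQ) simp
  moreover have "norm (\<Prod>i<l. 1 - complex_of_real t * complex_of_real t ^ i) = p l" for l
  proof -
    have "(\<Prod>i<l. 1 - complex_of_real t * complex_of_real t ^ i) = complex_of_real (p l)" by (simp add: p_def)
    moreover have "p l > 0" unfolding p_def using factor by (intro prod_pos) auto
    ultimately show ?thesis by (simp only: norm_of_real)
  qed
  ultimately have lim: "p \<longlonglongrightarrow> norm (euler (complex_of_real t))" by (simp only:)
  have p_pos: "p l > 0" for l unfolding p_def using factor by (intro prod_pos) auto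
  have "decseq p"
    by (rule decseq_SucI) (use p_pos factor in \<open>simp add: p_def mult_left_le prod_nonneg less_imp_le\<close>)
  then have ge: "norm (euler (complex_of_real t)) \<le> p l" for l using lim by (rule decseq_ge)
  have pos: "norm (euler (complex_of_real t)) > 0" using euler_nonzero[of "complex_of_real t"] t by simp
  show "(\<Sum>n\<le>N. real (card (partitions_of n)) * t ^ n) \<le> 1 / norm (euler (complex_of_real t))" for N
  proof -
    have "(\<Sum>n\<le>N. real (card (partitions_of n)) * t ^ n) = (\<Sum>n\<le>N. real (parts_le N n) * t ^ n)"
      by (rule sum.cong) (auto simp: parts_le_eq)
    also have "\<dots> \<le> 1 / p N" unfolding p_def by (rule parts_le_partial_sum[OF t])
    also have "\<dots> \<le> 1 / norm (euler (complex_of_real t))" using ge pos by (simp add: frac_le)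
    finally show ?thesis .
  qed
qed (use t in auto)

lemma summable_on_partitions:
  fixes x :: complex
  assumes "norm x < 1" "\<And>n. norm (c n) \<le> real (card (partitions_of n))"
  shows "(\<lambda>n. c n * x ^ n) summable_on UNIV"
proof -
  have "summable (\<lambda>n. norm (c n * x ^ n))"
    by (rule summable_comparison_test'[OF summable_partitions[of "norm x"]])
       (use assms in \<open>auto simp: norm_mult norm_power intro!: mult_right_mono\<close>)
  then show ?thesis by (rule norm_summable_imp_summable_on)
qed

text \<open>Domination for \<open>NT_gap\<close>, whose values are at most n p(n); the series comes
  from differentiating that of the partition numbers.\<close>

lemma summable_n_partitions:
  fixes t :: real
  assumes "0 \<le> t" "t < 1"
  shows "(\<lambda>n. real (n * card (partitions_of n)) * t ^ n) summable_on UNIV"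
proof -
  define c where "c = (\<lambda>n. real (card (partitions_of n)))"
  have "summable (\<lambda>n. diffs c n * t ^ n)"
  proof (rule termdiff_converges[where K = 1])
    show "summable (\<lambda>n. c n * y ^ n)" if "norm y < 1" for y
      by (rule summable_norm_cancel, rule summable_comparison_test'[OF summable_partitions[of "norm y"]])
         (use that in \<open>auto simp: c_def abs_mult power_abs\<close>)
  qed (use assms in auto)
  then have "summable (\<lambda>n. t * (diffs c n * t ^ n))" by (rule summable_mult)
  then have "summable (\<lambda>n. real (Suc n * card (partitions_of (Suc n))) * t ^ Suc n)"
    by (simp add: diffs_def c_def algebra_simps)
  then have "summable (\<lambda>n. real (n * card (partitions_of n)) * t ^ n)"
    by (subst (asm) summable_Suc_iff)
  then show ?thesis
    by (intro norm_summable_imp_summable_on) (use assms in \<open>simp add: abs_mult power_abs\<close>)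
qed

lemma parts_le_has_sum:
  fixes x :: complex
  assumes x: "norm x < 1"
  shows "((\<lambda>n. of_nat (parts_le l n) * x ^ n) has_sum 1 / (\<Prod>i<l. 1 - x * x ^ i)) UNIV"
proof (induction l)
  case 0
  have "((\<lambda>n. of_nat (parts_le 0 n) * x ^ n) has_sum 1) {0}"
    using has_sum_finite[of "{0::nat}" "\<lambda>n. of_nat (parts_le 0 n) * x ^ n"] by (simp add: parts_le_0)
  then show ?case
    by (subst has_sum_cong_neutral[where T = "{0}"]) (auto simp: parts_le_0)
next
  case (Suc l)
  define f where "f = (\<lambda>l n. of_nat (parts_le l n) * x ^ n)"
  have "f (Suc l) summable_on UNIV"
    unfolding f_def by (rule summable_on_partitions[OF x]) (use parts_le_bound in simp)
  then obtain A where A: "(f (Suc l) has_sum A) UNIV" by (auto simp: summable_on_def)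
  have "((\<lambda>n. f l n + x ^ Suc l * (if Suc l \<le> n then f (Suc l) (n - Suc l) else 0)) has_sum
     1 / (\<Prod>i<l. 1 - x * x ^ i) + x ^ Suc l * A) UNIV"
    by (intro has_sum_add has_sum_cmult_right has_sum_shift A) (use Suc.IH in \<open>simp add: f_def\<close>)
  moreover have "f l n + x ^ Suc l * (if Suc l \<le> n then f (Suc l) (n - Suc l) else 0) = f (Suc l) n" for n
  proof (cases "Suc l \<le> n")
    case True
    then have "x ^ n = x ^ Suc l * x ^ (n - Suc l)" by (simp only: power_add[symmetric] le_add_diff_inverse[OF True])
    then show ?thesis using True by (simp only: f_def parts_le_rec[of l n] if_True) (simp add: algebra_simps)
  qed (simp add: f_def parts_le_rec[of l n])
  ultimately have "A = 1 / (\<Prod>i<l. 1 - x * x ^ i) + x ^ Suc l * A"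
    using has_sum_unique[OF A, of "1 / (\<Prod>i<l. 1 - x * x ^ i) + x ^ Suc l * A"] by (simp only:)
  then have "A * (1 - x * x ^ l) = 1 / (\<Prod>i<l. 1 - x * x ^ i)" by (simp add: algebra_simps)
  moreover have "1 - x * x ^ l \<noteq> 0" using norm_power_less_1[OF x, of "Suc l"] by auto
  ultimately have "A = 1 / (\<Prod>i<l. 1 - x * x ^ i) / (1 - x * x ^ l)"
    by (metis nonzero_mult_div_cancel_right)
  then have "A = 1 / (\<Prod>i<Suc l. 1 - x * x ^ i)"
    by (simp only: divide_divide_eq_left prod.lessThan_Suc)
  then show ?case using A by (simp add: f_def)
qed

lemma partitions_has_sum:
  fixes x :: complex
  assumes x: "norm x < 1"
  shows "((\<lambda>n. of_nat (card (partitions_of n)) * x ^ n) has_sum 1 / euler x) UNIV"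
proof (rule has_sum_dominated_limit[OF parts_le_has_sum[OF x]])
  show "norm (of_nat (parts_le l n) * x ^ n) \<le> real (card (partitions_of n)) * norm x ^ n" for l n
    using parts_le_bound[of l n] by (auto simp: norm_mult norm_power intro!: mult_right_mono)
  show "(\<lambda>n. real (card (partitions_of n)) * norm x ^ n) summable_on UNIV"
    by (rule norm_summable_imp_summable_on) (use summable_partitions[of "norm x"] x in \<open>simp add: abs_mult\<close>)
  show "(\<lambda>l. of_nat (parts_le l n) * x ^ n) \<longlonglongrightarrow> of_nat (card (partitions_of n)) * x ^ n" for n
    by (intro tendsto_eventually eventually_mono[OF eventually_ge_at_top[of n]]) (simp add: parts_le_eq)
  show "(\<lambda>l. 1 / (\<Prod>i<l. 1 - x * x ^ i)) \<longlonglongrightarrow> 1 / euler x"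
    unfolding euler_def by (intro tendsto_divide tendsto_const qpoch_LIMSEQ[OF x]) (use euler_nonzero[OF x] in \<open>simp add: euler_def\<close>)
qed

section \<open>Generating functions of ranks\<close>

definition rank_gf :: "nat \<Rightarrow> complex \<Rightarrow> complex" where
  "rank_gf m x = (\<Sum>\<^sub>\<infinity>n. of_nat (rank_ge m n) * x ^ n)"

lemma rank_ge_mono: "rank_ge (Suc r) n \<le> rank_ge r n" "rank_ge r n \<le> card (partitions_of n)"
  unfolding rank_ge_def using finite_partitions_of[of n] by (auto intro!: card_mono)

lemma rank_gf_has_sum:
  assumes "norm x < 1"
  shows "((\<lambda>n. of_nat (rank_ge m n) * x ^ n) has_sum rank_gf m x) UNIV"
  unfolding rank_gf_def by (intro has_sum_infsum summable_on_partitions assms) (simp add: rank_ge_mono)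

lemma rank_gf_rec:
  assumes x: "norm x < 1" and "m > 0"
  shows "rank_gf m x = x ^ (m + 1) * (1 / euler x - rank_gf (m + 3) x)"
proof -
  define f where "f = (\<lambda>n. of_nat (card (partitions_of n)) * x ^ n - of_nat (rank_ge (m + 3) n) * x ^ n)"
  have "(f has_sum (1 / euler x - rank_gf (m + 3) x)) UNIV"
    unfolding f_def by (intro has_sum_diff partitions_has_sum rank_gf_has_sum x)
  then have "((\<lambda>n. x ^ (m + 1) * (if m + 1 \<le> n then f (n - (m + 1)) else 0)) has_sum x ^ (m + 1) * (1 / euler x - rank_gf (m + 3) x)) UNIV"
    by (intro has_sum_cmult_right has_sum_shift)
  moreover have "x ^ (m + 1) * (if m + 1 \<le> n then f (n - (m + 1)) else 0) = of_nat (rank_ge m n) * x ^ n" for n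
  proof (cases "m + 1 \<le> n")
    case True
    then obtain j where j: "n = j + Suc m" by (metis Suc_eq_plus1 le_add_diff_inverse2)
    have "(of_nat (rank_ge m n) :: complex) + of_nat (rank_ge (m + 3) j) = of_nat (card (partitions_of j))"
      using rank_ge_rec[OF \<open>m > 0\<close>, of j] unfolding j by (metis of_nat_add)
    then have e: "(of_nat (rank_ge m n) :: complex) = of_nat (card (partitions_of j)) - of_nat (rank_ge (m + 3) j)"
      by (simp add: eq_diff_eq)
    have "x ^ (m + 1) * f j = of_nat (rank_ge m n) * x ^ n"
      unfolding f_def left_diff_distrib[symmetric] e[symmetric] by (simp add: j power_add)
    then show ?thesis using True j by simp
  next
    case False
    then show ?thesis using rank_ge_eq_0[OF \<open>m > 0\<close>, of n] by simp
  qed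
  ultimately show ?thesis using has_sum_unique[OF rank_gf_has_sum[OF x]] by simp
qed

text \<open>\<open>rank_exp m K = m K + K (3 K - 1) / 2\<close>, the exponent after \<open>K\<close> steps of the recurrence.\<close>

definition rank_exp :: "nat \<Rightarrow> nat \<Rightarrow> nat" where
  "rank_exp m K = (\<Sum>i<K. m + 1 + 3 * i)"

lemma rank_exp_add: "rank_exp (m + s) K = K * m + rank_exp s K"
  by (induction K) (simp_all add: rank_exp_def)

lemma rank_exp_ge: "m + k \<le> rank_exp m (Suc k)"
proof -
  have "k \<le> (\<Sum>i<k. m + 1 + 3 * Suc i)" by (induction k) auto
  then show ?thesis unfolding rank_exp_def sum.lessThan_Suc_shift by linarith
qed

text \<open>The exponents for m = 1 and m = 0 are the pentagonal numbers at K and at -K; this lets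
  two one-sided series merge into one over the nonzero integers.\<close>

lemma rank_exp_tri: "int (rank_exp 1 K) = 3 * tri (int K) + 2 * int K" "int (rank_exp 0 K) = 3 * tri (- int K) - 2 * int K"
proof -
  have t: "tri (int (Suc K)) = tri (int K) + int K" "tri (- int (Suc K)) = tri (- int K) + int K + 1" for K
    using two_tri[of "int (Suc K)"] two_tri[of "int K"] two_tri[of "- int (Suc K)"] two_tri[of "- int K"] by (simp_all add: algebra_simps)
  show "int (rank_exp 1 K) = 3 * tri (int K) + 2 * int K"
    by (induction K) (simp_all add: rank_exp_def t tri_def[of 0] del: of_nat_Suc, simp_all)
  show "int (rank_exp 0 K) = 3 * tri (- int K) - 2 * int K"
    by (induction K) (simp_all add: rank_exp_def t tri_def[of 0] del: of_nat_Suc, simp_all)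
qed

lemma rank_gf_partial:
  assumes x: "norm x < 1" and "m > 0"
  shows "rank_gf m x = (\<Sum>k<K. (-1) ^ k * x ^ rank_exp m (Suc k)) / euler x + (-1) ^ K * x ^ rank_exp m K * rank_gf (m + 3 * K) x"
proof (induction K)
  case 0
  then show ?case by (simp add: rank_exp_def)
next
  case (Suc K)
  have "rank_gf (m + 3 * K) x = x ^ (m + 3 * K + 1) * (1 / euler x - rank_gf (m + 3 * Suc K) x)"
    using rank_gf_rec[OF x, of "m + 3 * K"] \<open>m > 0\<close> by (simp add: algebra_simps)
  moreover have "x ^ rank_exp m (Suc K) = x ^ rank_exp m K * x ^ (m + 3 * K + 1)"
    by (simp add: rank_exp_def flip: power_add power_Suc)
  ultimately have "x ^ rank_exp m K * rank_gf (m + 3 * K) x = x ^ rank_exp m (Suc K) / euler x - x ^ rank_exp m (Suc K) * rank_gf (m + 3 * Suc K) x"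
    by (simp only: right_diff_distrib mult.assoc) simp
  then have "(-1) ^ K * x ^ rank_exp m K * rank_gf (m + 3 * K) x
    = (-1) ^ K * x ^ rank_exp m (Suc K) / euler x + (-1) ^ Suc K * x ^ rank_exp m (Suc K) * rank_gf (m + 3 * Suc K) x"
    by (simp add: mult.assoc right_diff_distrib)
  then show ?case unfolding Suc.IH by (simp add: add_divide_distrib)
qed

text \<open>The remainder of the iterated recurrence tends to 0: \<open>rank_exp m K\<close> is at
  least K, and all \<open>rank_gf m x\<close> are bounded by the partition series at
  \<open>norm x\<close>, uniformly in m.\<close>

lemma rank_gf_sum:
  assumes x: "norm x < 1" and "m > 0"
  shows "((\<lambda>k. (-1) ^ k * x ^ rank_exp m (Suc k)) has_sum euler x * rank_gf m x) UNIV"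
proof (rule norm_summable_imp_has_sum)
  have geo: "summable (\<lambda>k. norm x ^ k)" using x by (simp add: summable_geometric)
  show "summable (\<lambda>k. norm ((-1) ^ k * x ^ rank_exp m (Suc k)))"
  proof (rule summable_comparison_test'[OF geo])
    show "norm (norm ((-1) ^ k * x ^ rank_exp m (Suc k))) \<le> norm x ^ k" for k
      using rank_exp_ge[of m k] x by (auto simp: norm_mult norm_power intro!: power_decreasing)
  qed
  obtain B where B: "norm (rank_gf m x) \<le> B" for m
  proof
    fix m
    have "((\<lambda>n. norm (of_nat (rank_ge m n) * x ^ n)) summable_on UNIV)"
      using has_sum_imp_summable[OF rank_gf_has_sum[OF x, of m]] summable_on_iff_abs_summable_on_complex[of "\<lambda>n. of_nat (rank_ge m n) * x ^ n" UNIV] by simp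
    then have "norm (rank_gf m x) \<le> (\<Sum>\<^sub>\<infinity>n. norm (of_nat (rank_ge m n) * x ^ n))"
      unfolding rank_gf_def by (rule norm_infsum_bound)
    also have "\<dots> \<le> (\<Sum>\<^sub>\<infinity>n. real (card (partitions_of n)) * norm x ^ n)"
    proof (rule infsum_mono)
      show "(\<lambda>n. real (card (partitions_of n)) * norm x ^ n) summable_on UNIV"
        by (rule norm_summable_imp_summable_on) (use summable_partitions[of "norm x"] x in \<open>simp add: abs_mult\<close>)
    qed (use \<open>((\<lambda>n. norm (of_nat (rank_ge m n) * x ^ n)) summable_on UNIV)\<close> rank_ge_mono(2)[of m] in
        \<open>auto simp: norm_mult norm_power intro!: mult_right_mono\<close>)
    finally show "norm (rank_gf m x) \<le> (\<Sum>\<^sub>\<infinity>n. real (card (partitions_of n)) * norm x ^ n)" .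
  qed
  have e0: "euler x \<noteq> 0" by (rule euler_nonzero[OF x])
  have "(\<lambda>K. (-1) ^ K * x ^ rank_exp m K * rank_gf (m + 3 * K) x) \<longlonglongrightarrow> 0"
  proof (rule Lim_null_comparison)
    show "(\<lambda>K. norm x ^ K * B) \<longlonglongrightarrow> 0"
      using tendsto_mult[OF LIMSEQ_power_zero[of "norm x"] tendsto_const[of B]] x by simp
    have "K \<le> rank_exp m K" for K
      using rank_exp_ge[of m "K - 1"] \<open>m > 0\<close> by (cases K) auto
    then have "norm ((-1) ^ K * x ^ rank_exp m K * rank_gf (m + 3 * K) x) \<le> norm x ^ K * B" for K
      using x B[of "m + 3 * K"] by (auto simp: norm_mult norm_power intro!: mult_mono power_decreasing)
    then show "\<forall>\<^sub>F K in sequentially. norm ((-1) ^ K * x ^ rank_exp m K * rank_gf (m + 3 * K) x) \<le> norm x ^ K * B" by simp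
  qed
  from tendsto_mult[OF tendsto_const[of "euler x"] tendsto_diff[OF tendsto_const[of "rank_gf m x"] this]]
  have "(\<lambda>K. euler x * (rank_gf m x - (-1) ^ K * x ^ rank_exp m K * rank_gf (m + 3 * K) x)) \<longlonglongrightarrow> euler x * rank_gf m x" by simp
  moreover have "euler x * (rank_gf m x - (-1) ^ K * x ^ rank_exp m K * rank_gf (m + 3 * K) x) = (\<Sum>k<K. (-1) ^ k * x ^ rank_exp m (Suc k))" for K
    using rank_gf_partial[OF assms, of K] e0 by simp
  ultimately show "(\<lambda>k. (-1) ^ k * x ^ rank_exp m (Suc k)) sums (euler x * rank_gf m x)"
    unfolding sums_def by (simp only:)
qed

text \<open>Closed form of the power series of \<open>residue_weight\<close>, arranged so that only
  the outer factors z and z^4 change when z is multiplied by a fifth root of unity.\<close>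

definition weight_gf :: "complex \<Rightarrow> complex" where
  "weight_gf z = z * (1 / (1 - z ^ 5) + 5 * z ^ 5 / (1 - z ^ 5)\<^sup>2) - z ^ 4 * (4 / (1 - z ^ 5) + 5 * z ^ 5 / (1 - z ^ 5)\<^sup>2)"

lemma weight_gf_has_sum:
  assumes z: "norm z < 1"
  shows "((\<lambda>r. of_int (residue_weight r) * z ^ r) has_sum weight_gf z) UNIV"
proof -
  define y where "y = z ^ 5"
  have y: "norm y < 1" using norm_power_less_1[OF z] by (simp add: y_def)
  have s1: "summable (\<lambda>i. norm (y ^ i))" using y by (simp add: norm_power summable_geometric)
  have g1: "((\<lambda>i. y ^ i) has_sum 1 / (1 - y)) UNIV"
    by (rule norm_summable_imp_has_sum[OF s1 geometric_sums[OF y]])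
  have s2: "summable (\<lambda>i. norm (of_nat (Suc i) * y ^ i))"
    using sums_summable[OF geometric_deriv_sums[of "norm y"]] y by (simp only: norm_mult norm_power norm_of_nat) simp
  have g2: "((\<lambda>i. of_nat (Suc i) * y ^ i) has_sum 1 / (1 - y) ^ 2) UNIV"
    by (rule norm_summable_imp_has_sum[OF s2 geometric_deriv_sums[OF y]])
  have y1: "1 - y \<noteq> 0" using y by auto
  have cls: "((\<lambda>n. if n mod 5 = j then of_nat n * z ^ n else 0) has_sum z ^ j * (of_nat j / (1 - y) + 5 * y / (1 - y)\<^sup>2)) UNIV"
    if j: "j < 5" for j
  proof (rule has_sum_residue[OF _ j])
    have "((\<lambda>i. z ^ j * (5 * (of_nat (Suc i) * y ^ i) + (of_nat j - 5) * y ^ i)) has_sum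
       z ^ j * (5 * (1 / (1 - y)\<^sup>2) + (of_nat j - 5) * (1 / (1 - y)))) UNIV"
      by (intro has_sum_cmult_right has_sum_add g1 g2)
    moreover have "z ^ j * (5 * (of_nat (Suc i) * y ^ i) + (of_nat j - 5) * y ^ i) = of_nat (5 * i + j) * z ^ (5 * i + j)" for i
    proof -
      have "z ^ (5 * i + j) = z ^ j * y ^ i" by (simp add: y_def power_add power_mult)
      then show ?thesis by (simp only:) (simp add: algebra_simps)
    qed
    moreover have "5 * (1 / (1 - y)\<^sup>2) + (of_nat j - 5) * (1 / (1 - y)) = of_nat j / (1 - y) + 5 * y / (1 - y)\<^sup>2"
    proof -
      have "1 / (1 - y) = (1 - y) / (1 - y)\<^sup>2" using y1 by (simp add: power2_eq_square)
      then have "5 * (1 / (1 - y)\<^sup>2) - 5 * (1 / (1 - y)) = 5 * y / (1 - y)\<^sup>2"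
        by (simp add: diff_divide_distrib[symmetric] right_diff_distrib[symmetric])
      then show ?thesis by (simp add: left_diff_distrib algebra_simps)
    qed
    ultimately show "((\<lambda>i. of_nat (5 * i + j) * z ^ (5 * i + j)) has_sum z ^ j * (of_nat j / (1 - y) + 5 * y / (1 - y)\<^sup>2)) UNIV"
      by (simp only:)
  qed
  have "((\<lambda>n. (if n mod 5 = 1 then of_nat n * z ^ n else 0) - (if n mod 5 = 4 then of_nat n * z ^ n else 0)) has_sum weight_gf z) UNIV"
    using has_sum_diff[OF cls[of 1] cls[of 4]] by (simp add: weight_gf_def y_def)
  moreover have "(if n mod 5 = 1 then of_nat n * z ^ n else 0) - (if n mod 5 = 4 then of_nat n * z ^ n else 0) = of_int (residue_weight n) * z ^ n" for n
    by (simp add: residue_weight_def)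
  ultimately show ?thesis by (simp only:)
qed

lemma residue_weight_bound: "\<bar>residue_weight r\<bar> \<le> int r"
  by (simp add: residue_weight_def)

text \<open>The weights are applied to cumulative counts, for which the recurrence holds; the
  difference of s = 0 and s = 1 returns to exact ranks.\<close>

definition rank_moment :: "nat \<Rightarrow> complex \<Rightarrow> complex" where
  "rank_moment s x = (\<Sum>\<^sub>\<infinity>r. of_int (residue_weight r) * (euler x * rank_gf (r + s) x))"

lemma rank_moment_has_sum:
  assumes x: "norm x < 1"
  shows "((\<lambda>r. of_int (residue_weight r) * (euler x * rank_gf (r + s) x)) has_sum rank_moment s x) UNIV"
    and "((\<lambda>k. (-1) ^ k * (x ^ rank_exp s (Suc k) * weight_gf (x ^ Suc k))) has_sum rank_moment s x) UNIV"
proof -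
  define F where "F = (\<lambda>r k. of_int (residue_weight r) * ((-1) ^ k * x ^ rank_exp (r + s) (Suc k)) :: complex)"
  have "(\<lambda>(r, k). F r k) summable_on UNIV \<times> UNIV"
  proof (rule abs_summable_summable, rule summable_on_comparison_test)
    have "summable (\<lambda>r. real (Suc r) * norm x ^ r)"
      using sums_summable[OF geometric_deriv_sums[of "norm x"]] x by simp
    then have s1: "(\<lambda>r. real (Suc r) * norm x ^ r) summable_on UNIV"
      by (intro norm_summable_imp_summable_on) (simp add: abs_mult)
    have s2: "(\<lambda>k. norm x ^ k) summable_on UNIV"
      using x by (intro norm_summable_imp_summable_on) (simp add: summable_geometric)
    show "(\<lambda>(r, k). (real (Suc r) * norm x ^ r) * norm x ^ k) summable_on UNIV \<times> UNIV"
    proof (rule summable_on_SigmaI)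
      show "((\<lambda>k. (case (r, k) of (r, k) \<Rightarrow> (real (Suc r) * norm x ^ r) * norm x ^ k)) has_sum
        (real (Suc r) * norm x ^ r) * (\<Sum>\<^sub>\<infinity>k. norm x ^ k)) UNIV" for r :: nat
        using has_sum_cmult_right[OF has_sum_infsum[OF s2]] by simp
      show "(\<lambda>r. (real (Suc r) * norm x ^ r) * (\<Sum>\<^sub>\<infinity>k. norm x ^ k)) summable_on UNIV"
        by (rule summable_on_cmult_left[OF s1])
    qed auto
    fix z :: "nat \<times> nat"
    obtain r k where z: "z = (r, k)" by force
    have "norm (F r k) = \<bar>real_of_int (residue_weight r)\<bar> * norm x ^ rank_exp (r + s) (Suc k)"
      by (simp add: F_def norm_mult norm_power)
    also have "\<dots> \<le> real (Suc r) * norm x ^ (r + k)"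
    proof (rule mult_mono)
      show "\<bar>real_of_int (residue_weight r)\<bar> \<le> real (Suc r)" using residue_weight_bound[of r] by linarith
      show "norm x ^ rank_exp (r + s) (Suc k) \<le> norm x ^ (r + k)"
        using rank_exp_ge[of "r + s" k] x by (intro power_decreasing) auto
    qed auto
    finally show "norm (case z of (r, k) \<Rightarrow> F r k) \<le> (case z of (r, k) \<Rightarrow> (real (Suc r) * norm x ^ r) * norm x ^ k)"
      by (simp add: z power_add mult_ac)
  qed auto
  then obtain D where D: "((\<lambda>(r, k). F r k) has_sum D) (UNIV \<times> UNIV)" by (auto simp: summable_on_def)
  have "((\<lambda>k. F r k) has_sum of_int (residue_weight r) * (euler x * rank_gf (r + s) x)) UNIV" for r
  \<comment> \<open>The iterated recurrence needs a positive rank bound, which fails for r = s = 0;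
    there the weight is 0.\<close>
  proof (cases "r = 0")
    case True
    then show ?thesis by (simp add: F_def residue_weight_def)
  next
    case False
    then show ?thesis unfolding F_def by (intro has_sum_cmult_right rank_gf_sum[OF x]) simp
  qed
  then have "((\<lambda>r. of_int (residue_weight r) * (euler x * rank_gf (r + s) x)) has_sum D) UNIV"
    by (intro has_sum_SigmaD[OF D]) simp
  moreover from this have "D = rank_moment s x" by (simp add: rank_moment_def infsumI)
  ultimately show "((\<lambda>r. of_int (residue_weight r) * (euler x * rank_gf (r + s) x)) has_sum rank_moment s x) UNIV" by simp
  have *: "((\<lambda>r. F r k) has_sum (-1) ^ k * (x ^ rank_exp s (Suc k) * weight_gf (x ^ Suc k))) UNIV" for k
  proof -
    have "((\<lambda>r. ((-1) ^ k * x ^ rank_exp s (Suc k)) * (of_int (residue_weight r) * (x ^ Suc k) ^ r)) has_sum ((-1) ^ k * x ^ rank_exp s (Suc k)) * weight_gf (x ^ Suc k)) UNIV"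
      using norm_power_less_1[OF x, of "Suc k"] by (intro has_sum_cmult_right weight_gf_has_sum) simp
    moreover have "((-1) ^ k * x ^ rank_exp s (Suc k)) * (of_int (residue_weight r) * (x ^ Suc k) ^ r) = F r k" for r
      unfolding F_def rank_exp_add power_add power_mult by simp
    ultimately show ?thesis by (simp only: mult.assoc)
  qed
  then have "((\<lambda>k. (-1) ^ k * (x ^ rank_exp s (Suc k) * weight_gf (x ^ Suc k))) has_sum D) UNIV"
  proof -
    have "((\<lambda>z. F (snd z) (fst z)) has_sum D) (UNIV \<times> UNIV)"
      using D[unfolded has_sum_swap[of "\<lambda>(r, k). F r k"]] by (simp add: case_prod_unfold)
    then show ?thesis by (rule has_sum_SigmaD) (use * in simp)
  qed
  then show "((\<lambda>k. (-1) ^ k * (x ^ rank_exp s (Suc k) * weight_gf (x ^ Suc k))) has_sum rank_moment s x) UNIV"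
    using \<open>D = rank_moment s x\<close> by simp
qed

text \<open>Inversion exchanges the classes 1 and 4: the rational function with constant c becomes
  the one with 5 - c.\<close>

lemma weight_gf_inverse:
  assumes "z \<noteq> 0" "z ^ 5 \<noteq> 1"
  shows "weight_gf (1 / z) = - weight_gf z"
proof -
  define y where "y = z ^ 5"
  have y: "y \<noteq> 0" "1 - y \<noteq> 0" "y - 1 \<noteq> 0" using assms by (auto simp: y_def)
  have i: "(1 / z) ^ 5 = 1 / y" "1 / z = z ^ 4 / y" "(1 / z) ^ 4 = z / y"
    using assms(1) by (simp_all add: y_def power_divide eval_nat_numeral)
  have c: "1 / y * (c / (1 - 1 / y) + 5 * (1 / y) / (1 - 1 / y)\<^sup>2) = (5 - c) / (1 - y) + 5 * y / (1 - y)\<^sup>2 "  for c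
  proof -
    have "1 - 1 / y = - (1 - y) / y" using y by (simp add: field_simps)
    then have "1 / y * (c / (1 - 1 / y) + 5 * (1 / y) / (1 - 1 / y)\<^sup>2) = 1 / y * (- (c * y / (1 - y)) + 5 * y / (1 - y)\<^sup>2)"
    proof -
      have "c / (- (1 - y) / y) = - (c * y / (1 - y))" by (metis divide_divide_eq_right divide_minus_right minus_divide_left)
      moreover have "5 * (1 / y) / (- (1 - y) / y)\<^sup>2 = 5 * y / (1 - y)\<^sup>2"
        using y by (simp add: power_divide power2_minus power2_commute[of y 1]) (simp add: power2_eq_square)
      ultimately show ?thesis using \<open>1 - 1 / y = - (1 - y) / y\<close> by simp
    qed
    also have "\<dots> = - c / (1 - y) + 5 / (1 - y)\<^sup>2" using y by (simp add: field_simps)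
    also have "5 / (1 - y)\<^sup>2 = 5 / (1 - y) + 5 * y / (1 - y)\<^sup>2"
    proof -
      have "1 / (1 - y) = (1 - y) / (1 - y)\<^sup>2" using y by (simp add: power2_eq_square)
      then have "5 / (1 - y) = (5 - 5 * y) / (1 - y)\<^sup>2"
        by (metis mult.right_neutral right_diff_distrib times_divide_eq_right)
      then show ?thesis by (simp add: add_divide_distrib[symmetric])
    qed
    finally show ?thesis by (simp add: diff_divide_distrib)
  qed
  have "weight_gf (1 / z) = z ^ 4 * (1 / y * (1 / (1 - 1 / y) + 5 * (1 / y) / (1 - 1 / y)\<^sup>2)) - z * (1 / y * (4 / (1 - 1 / y) + 5 * (1 / y) / (1 - 1 / y)\<^sup>2))"
    unfolding weight_gf_def i(1,3) by (subst i(2)) simp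
  also have "\<dots> = - weight_gf z" unfolding c by (simp add: weight_gf_def y_def)
  finally show ?thesis .
qed

text \<open>Since \<open>weight_gf\<close> is odd under inversion, the series of
  \<open>rank_moment 0\<close> is the part over negative k, and minus that of
  \<open>rank_moment 1\<close> is the part over positive k.\<close>

lemma rank_moment_diff_has_sum:
  assumes x: "norm x < 1" "x \<noteq> 0"
  shows "((\<lambda>k. (-1) powi k * x powi (3 * tri k + 2 * k) * weight_gf (x powi k)) has_sum rank_moment 0 x - rank_moment 1 x) (- {0})"
proof -
  define G where "G = (\<lambda>k. (-1) powi k * x powi (3 * tri k + 2 * k) * weight_gf (x powi k))"
  have pw: "(-1 :: complex) powi (1 + int k) = - ((-1) ^ k)" "(-1 :: complex) powi (- 1 - int k) = - ((-1) ^ k)" for k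
    by (simp_all add: minus_one_powi)
  have "((\<lambda>k. G (int (Suc k))) has_sum - rank_moment 1 x) UNIV"
  proof -
    have "((\<lambda>k. - ((-1) ^ k * (x ^ rank_exp 1 (Suc k) * weight_gf (x ^ Suc k)))) has_sum - rank_moment 1 x) UNIV"
      using rank_moment_has_sum(2)[OF x(1), of 1] by (simp add: has_sum_uminus)
    moreover have "- ((-1) ^ k * (x ^ rank_exp 1 (Suc k) * weight_gf (x ^ Suc k))) = G (int (Suc k))" for k
      unfolding G_def rank_exp_tri(1)[symmetric] power_int_of_nat by simp
    ultimately show ?thesis by (simp only:)
  qed
  then have 1: "(G has_sum - rank_moment 1 x) (range (\<lambda>k. int (Suc k)))"
    by (subst has_sum_reindex) (auto simp: o_def inj_on_def)
  have "((\<lambda>k. G (- int (Suc k))) has_sum rank_moment 0 x) UNIV"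
  proof -
    have "(-1) ^ k * (x ^ rank_exp 0 (Suc k) * weight_gf (x ^ Suc k)) = G (- int (Suc k))" for k
    proof -
      have "norm ((x ^ Suc k) ^ 5) < 1" using norm_power_less_1[OF x(1), of "Suc k * 5"] by (simp only: power_mult) simp
      then have "(x ^ Suc k) ^ 5 \<noteq> 1" by auto
      then have w: "weight_gf (x powi (- int (Suc k))) = - weight_gf (x ^ Suc k)"
        using weight_gf_inverse[of "x ^ Suc k"] x by (simp only: power_int_minus power_int_of_nat inverse_eq_divide) simp
      have e: "3 * tri (- int (Suc k)) + 2 * (- int (Suc k)) = int (rank_exp 0 (Suc k))" by (simp only: rank_exp_tri)
      show ?thesis unfolding G_def e w power_int_of_nat by (simp add: minus_one_powi)
    qed
    then show ?thesis using rank_moment_has_sum(2)[OF x(1), of 0] by (simp only:)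
  qed
  then have 2: "(G has_sum rank_moment 0 x) (range (\<lambda>k. - int (Suc k)))"
    by (subst has_sum_reindex) (auto simp: o_def inj_on_def)
  have "(G has_sum (- rank_moment 1 x + rank_moment 0 x)) (range (\<lambda>k. int (Suc k)) \<union> range (\<lambda>k. - int (Suc k)))"
    by (rule has_sum_Un_disjoint[OF 1 2]) auto
  moreover have "range (\<lambda>k. int (Suc k)) \<union> range (\<lambda>k. - int (Suc k)) = - {0}"
  proof -
    have "k \<in> range (\<lambda>k. int (Suc k)) \<union> range (\<lambda>k. - int (Suc k))" if "k \<noteq> 0" for k
    proof (cases "k > 0")
      case True
      then have "k = int (Suc (nat (k - 1)))" by simp
      then show ?thesis by blast
    next
      case False
      then have "k = - int (Suc (nat (- k - 1)))" using that by simp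
      then show ?thesis by blast
    qed
    then show ?thesis by auto
  qed
  ultimately show ?thesis by (simp add: G_def)
qed

definition NT_gap :: "nat \<Rightarrow> int" where
  "NT_gap n = (\<Sum>r=1..n. residue_weight r * (int (rank_ge r n) - int (rank_ge (Suc r) n)))"

text \<open>The sum over ranks is cut off at M. Because \<open>rank_ge\<close> decreases in the
  rank, the absolute values telescope, which gives the bound n p(n) uniform in M for dominated
  convergence.\<close>

lemma NT_gap_has_sum:
  assumes x: "norm x < 1"
  shows "((\<lambda>n. of_int (NT_gap n) * x ^ n) has_sum (rank_moment 0 x - rank_moment 1 x) / euler x) UNIV"
proof -
  define g where "g = (\<lambda>r n. residue_weight r * (int (rank_ge r n) - int (rank_ge (Suc r) n)))"
  have bound: "\<bar>\<Sum>r=1..M. g r n\<bar> \<le> int (n * card (partitions_of n))" for M n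
  proof -
    have g0: "g r n = 0" if "r > n" for r using that rank_ge_eq_0[of r n] rank_ge_eq_0[of "Suc r" n] by (simp add: g_def)
    have "\<bar>\<Sum>r=1..M. g r n\<bar> \<le> (\<Sum>r=1..M. \<bar>g r n\<bar>)" by (rule sum_abs)
    also have "\<dots> \<le> (\<Sum>r=1..M. int n * (int (rank_ge r n) - int (rank_ge (Suc r) n)))"
    proof (rule sum_mono)
      fix r
      show "\<bar>g r n\<bar> \<le> int n * (int (rank_ge r n) - int (rank_ge (Suc r) n))"
      proof (cases "r > n")
        case True
        then show ?thesis using g0[of r] rank_ge_mono(1)[of r n] by simp
      next
        case False
        then have "\<bar>residue_weight r\<bar> \<le> int n" using residue_weight_bound[of r] by linarith
        then show ?thesis using rank_ge_mono(1)[of r n] by (auto simp: g_def abs_mult intro!: mult_mono)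
      qed
    qed
    also have "\<dots> = int n * (int (rank_ge 1 n) - int (rank_ge (Suc M) n))"
      unfolding sum_distrib_left[symmetric] by (induction M) auto
    also have "\<dots> \<le> int n * int (card (partitions_of n))"
      using rank_ge_mono(2)[of 1 n] by (intro mult_left_mono) auto
    finally show ?thesis by simp
  qed
  show ?thesis
  proof (rule has_sum_dominated_limit[where f = "\<lambda>M n. of_int (\<Sum>r=1..M. g r n) * x ^ n" and M = "\<lambda>n. real (n * card (partitions_of n)) * norm x ^ n"
        and S = "\<lambda>M. \<Sum>r=1..M. of_int (residue_weight r) * (rank_gf r x - rank_gf (Suc r) x)"])
    show "((\<lambda>n. of_int (\<Sum>r=1..M. g r n) * x ^ n) has_sum (\<Sum>r=1..M. of_int (residue_weight r) * (rank_gf r x - rank_gf (Suc r) x))) UNIV" for M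
    proof -
      have "((\<lambda>n. \<Sum>r=1..M. of_int (residue_weight r) * (of_nat (rank_ge r n) * x ^ n - of_nat (rank_ge (Suc r) n) * x ^ n)) has_sum
        (\<Sum>r=1..M. of_int (residue_weight r) * (rank_gf r x - rank_gf (Suc r) x))) UNIV"
        by (intro has_sum_sum has_sum_cmult_right has_sum_diff rank_gf_has_sum x)
      moreover have "(\<Sum>r=1..M. of_int (residue_weight r) * (of_nat (rank_ge r n) * x ^ n - of_nat (rank_ge (Suc r) n) * x ^ n))
        = of_int (\<Sum>r=1..M. g r n) * x ^ n" for n
        by (simp add: g_def sum_distrib_right left_diff_distrib right_diff_distrib mult.assoc)
      ultimately show ?thesis by (simp only:)
    qed
    show "norm (of_int (\<Sum>r=1..M. g r n) * x ^ n) \<le> real (n * card (partitions_of n)) * norm x ^ n" for M n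
    proof -
      have "\<bar>real_of_int (\<Sum>r=1..M. g r n)\<bar> \<le> real (n * card (partitions_of n))"
      proof -
      have "real_of_int \<bar>\<Sum>r=1..M. g r n\<bar> \<le> real_of_int (int (n * card (partitions_of n)))"
        using bound by (simp only: of_int_le_iff)
      then show ?thesis by (simp only: of_int_abs of_int_of_nat_eq)
    qed
      then show ?thesis unfolding norm_mult norm_power norm_of_int by (rule mult_right_mono) simp
    qed
    show "(\<lambda>n. real (n * card (partitions_of n)) * norm x ^ n) summable_on UNIV"
      by (rule summable_n_partitions) (use x in auto)
    show "(\<lambda>M. of_int (\<Sum>r=1..M. g r n) * x ^ n) \<longlonglongrightarrow> of_int (NT_gap n) * x ^ n" for n
    proof (intro tendsto_eventually eventually_mono[OF eventually_ge_at_top[of n]])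
      fix M assume "M \<ge> n"
      then have "(\<Sum>r=1..M. g r n) = (\<Sum>r=1..n. g r n)"
        using rank_ge_eq_0[of _ n] by (intro sum.mono_neutral_right) (auto simp: g_def)
      then show "of_int (\<Sum>r=1..M. g r n) * x ^ n = of_int (NT_gap n) * x ^ n" by (simp add: NT_gap_def g_def)
    qed
    have e0: "euler x \<noteq> 0" by (rule euler_nonzero[OF x])
    have "((\<lambda>r. (of_int (residue_weight r) * (euler x * rank_gf (r + 0) x) - of_int (residue_weight r) * (euler x * rank_gf (r + 1) x)) * (1 / euler x)) has_sum
       (rank_moment 0 x - rank_moment 1 x) * (1 / euler x)) UNIV"
      by (intro has_sum_cmult_left has_sum_diff rank_moment_has_sum x)
    moreover have "(of_int (residue_weight r) * (euler x * rank_gf (r + 0) x) - of_int (residue_weight r) * (euler x * rank_gf (r + 1) x)) * (1 / euler x)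
      = of_int (residue_weight r) * (rank_gf r x - rank_gf (Suc r) x)" for r
      using e0 by (simp add: field_simps)
    ultimately have "((\<lambda>r. of_int (residue_weight r) * (rank_gf r x - rank_gf (Suc r) x)) has_sum (rank_moment 0 x - rank_moment 1 x) / euler x) UNIV" by simp
    then have "(\<lambda>r. of_int (residue_weight r) * (rank_gf r x - rank_gf (Suc r) x)) sums ((rank_moment 0 x - rank_moment 1 x) / euler x)"
      by (rule has_sum_imp_sums)
    then have "(\<lambda>M. \<Sum>r<Suc M. of_int (residue_weight r) * (rank_gf r x - rank_gf (Suc r) x)) \<longlonglongrightarrow> (rank_moment 0 x - rank_moment 1 x) / euler x"
      unfolding sums_def by (rule LIMSEQ_Suc)
    moreover have "(\<Sum>r<Suc M. of_int (residue_weight r) * (rank_gf r x - rank_gf (Suc r) x)) = (\<Sum>r=1..M. of_int (residue_weight r) * (rank_gf r x - rank_gf (Suc r) x))" for M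
      by (rule sum.mono_neutral_right) (auto simp: residue_weight_def Suc_le_eq)
    ultimately show "(\<lambda>M. \<Sum>r=1..M. of_int (residue_weight r) * (rank_gf r x - rank_gf (Suc r) x)) \<longlonglongrightarrow> (rank_moment 0 x - rank_moment 1 x) / euler x"
      by (simp only:)
  qed
qed

lemma has_sum_progression:
  assumes x: "norm x < 1" "x \<noteq> 0" and "j < 5"
    and f: "\<And>w. norm w < 1 \<Longrightarrow> w \<noteq> 0 \<Longrightarrow> ((\<lambda>n. c n * w ^ n) has_sum f w) UNIV"
  shows "((\<lambda>n. c (5 * n + j) * (x ^ 5) ^ n) has_sum avg (\<lambda>z. z powi (- int j) * f z) x) UNIV"
proof -
  define g where "g = (\<lambda>n. c n * avg (\<lambda>z. z powi (int n - int j)) x)"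
  have "((\<lambda>n. avg (\<lambda>z. c n * z powi (int n - int j)) x) has_sum avg (\<lambda>z. z powi (- int j) * f z) x) UNIV"
  proof (rule has_sum_avg)
    fix i :: nat
    define w where "w = om ^ i * x"
    have w: "norm w < 1" "w \<noteq> 0" using om_power_mult[OF x] by (simp_all add: w_def)
    have "((\<lambda>n. w powi (- int j) * (c n * w ^ n)) has_sum w powi (- int j) * f w) UNIV"
      by (intro has_sum_cmult_right f w)
    moreover have "w powi (- int j) * (c n * w ^ n) = c n * w powi (int n - int j)" for n
      using w by (simp add: power_int_diff power_int_minus divide_inverse)
    ultimately show "((\<lambda>n. c n * (om ^ i * x) powi (int n - int j)) has_sum (om ^ i * x) powi (- int j) * f (om ^ i * x)) UNIV"
      unfolding w_def[symmetric] by (simp only:)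
  qed
  then have g: "(g has_sum avg (\<lambda>z. z powi (- int j) * f z) x) UNIV" unfolding avg_cmult g_def .
  have g0: "g n = 0" if "n mod 5 \<noteq> j" for n
  proof -
    have "(int n - int j) mod 5 \<noteq> 0" using that \<open>j < 5\<close> by presburger
    then show ?thesis using avg_powi[OF x(2)] by (simp add: g_def)
  qed
  have g1: "g (5 * n + j) = c (5 * n + j) * (x ^ 5) ^ n" for n
  proof -
    have "x powi (5 * int n) = (x ^ 5) ^ n" by (simp add: power_int_mult)
    then show ?thesis using avg_powi[OF x(2), of "5 * int n"] by (simp add: g_def)
  qed
  have "(g has_sum avg (\<lambda>z. z powi (- int j) * f z) x) (range (\<lambda>n. 5 * n + j))"
  proof (rule has_sum_cong_neutral[THEN iffD1, OF _ _ _ g])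
    fix n :: nat assume "n \<in> UNIV - range (\<lambda>n. 5 * n + j)"
    then have "n mod 5 \<noteq> j" by (metis DiffD2 mult_div_mod_eq rangeI)
    then show "g n = 0" by (rule g0)
  qed auto
  then show ?thesis by (subst (asm) has_sum_reindex) (auto simp: o_def g1 inj_on_def)
qed

text \<open>The rational factors \<open>c1\<close> and \<open>c4\<close> depend on z^5 = q only and
  come out of the average; what is averaged are the terms \<open>R 1 k\<close> and
  \<open>R 4 k\<close>.\<close>

lemma (in dissected) NT_gap_progression:
  "((\<lambda>n. of_int (NT_gap (5 * n + 4)) * q ^ n) has_sum E ^ 4 / euler q) UNIV"
proof -
  define s where "s = (\<lambda>z. z powi (-4) * ((rank_moment 0 z - rank_moment 1 z) / euler z))"
  have z: "norm (om ^ i * x) < 1" "om ^ i * x \<noteq> 0" "(om ^ i * x) ^ 5 = q" for i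
    using om_power_mult[OF x] by (auto simp: q_def)
  define c1 c4 where "c1 = (\<lambda>k. 1 / (1 - q powi k) + 5 * q powi k / (1 - q powi k)\<^sup>2)"
    and "c4 = (\<lambda>k. 4 / (1 - q powi k) + 5 * q powi k / (1 - q powi k)\<^sup>2)"
  have "((\<lambda>k. avg (\<lambda>z. c1 k * R 1 k z + (- c4 k) * R 4 k z) x) has_sum avg s x) (- {0})"
  proof (rule has_sum_avg)
    fix i :: nat
    define w where "w = om ^ i * x"
    have w: "norm w < 1" "w \<noteq> 0" "w ^ 5 = q" using z by (simp_all add: w_def)
    have "((\<lambda>k. (w powi (-4) / euler w) * ((-1) powi k * w powi (3 * tri k + 2 * k) * weight_gf (w powi k))) has_sum
      (w powi (-4) / euler w) * (rank_moment 0 w - rank_moment 1 w)) (- {0})"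
      by (intro has_sum_cmult_right rank_moment_diff_has_sum w)
    moreover have "(w powi (-4) / euler w) * ((-1) powi k * w powi (3 * tri k + 2 * k) * weight_gf (w powi k)) = c1 k * R 1 k w + (- c4 k) * R 4 k w" for k
    proof -
      have p: "(w powi k) ^ 5 = q powi k" "(w powi k) ^ 4 = w powi (4 * k)"
        unfolding w(3)[symmetric] by (simp_all add: power_int_power power_int_power' mult.commute)
      have "w powi (3 * tri k + 2 * k + 1 * k - 4) = w powi (-4) * w powi (3 * tri k + 2 * k) * w powi k"
        "w powi (3 * tri k + 2 * k + 4 * k - 4) = w powi (-4) * w powi (3 * tri k + 2 * k) * w powi (4 * k)"
        by (simp_all only: power_int_add[OF disjI1[OF w(2)], symmetric]) (simp_all add: algebra_simps)
      then have "R 1 k w = (w powi (-4) / euler w) * ((-1) powi k * w powi (3 * tri k + 2 * k) * w powi k)"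
        "R 4 k w = (w powi (-4) / euler w) * ((-1) powi k * w powi (3 * tri k + 2 * k) * w powi (4 * k))"
        unfolding R_def by (simp_all only:) simp_all
      moreover have "weight_gf (w powi k) = w powi k * c1 k - w powi (4 * k) * c4 k"
        unfolding weight_gf_def p c1_def c4_def ..
      ultimately show ?thesis by (simp only:) (simp add: right_diff_distrib mult_ac)
    qed
    ultimately show "((\<lambda>k. c1 k * R 1 k (om ^ i * x) + (- c4 k) * R 4 k (om ^ i * x)) has_sum s (om ^ i * x)) (- {0})"
      unfolding s_def w_def[symmetric] by simp
  qed
  then have "((\<lambda>k. r 1 k * c1 k - r 4 k * c4 k) has_sum avg s x) (- {0})"
    unfolding avg_add avg_cmult r_def by (simp add: mult.commute)
  then have s: "avg s x = E ^ 4 / euler q"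
    using has_sum_unique[OF lambert_sum] unfolding c1_def c4_def by auto
  show ?thesis
    using has_sum_progression[OF x, of 4 "\<lambda>n. of_int (NT_gap n)", OF _ NT_gap_has_sum]
    by (simp add: q_def flip: s[unfolded s_def q_def])
qed

lemma fifth_root:
  fixes q :: complex
  assumes "norm q < 1" "q \<noteq> 0"
  obtains x where "norm x < 1" "x \<noteq> 0" "x ^ 5 = q"
proof
  define x where "x = exp (Ln q / 5)"
  show x5: "x ^ 5 = q" using assms by (simp add: x_def flip: exp_of_nat_mult)
  then show "norm x < 1" using assms(1) by (metis norm_power norm_ge_zero not_le one_le_power)
qed simp

theorem NT_gap_generating_function:
  assumes q: "norm q < 1" "q \<noteq> 0"
  shows "((\<lambda>n. of_int (NT_gap (5 * n + 4)) * q ^ n) has_sum euler (q ^ 5) ^ 4 / euler q) UNIV"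
proof -
  obtain x where x: "norm x < 1" "x \<noteq> 0" "x ^ 5 = q" using fifth_root[OF q] .
  then show ?thesis using dissected.NT_gap_progression[of x] unfolding dissected_def x(3) by blast
qed

section \<open>The 5-adic induction\<close>

text \<open>\<open>modular_coeff (i + 4) l\<close> is the coefficient of \<open>\<tau>^l\<close> in the image of \<open>\<eta>^i\<close> under the operator extracting every
  fifth coefficient, for \<open>i \<ge> -4\<close>; the recurrence is the modular equation for \<open>\<eta>\<close>.\<close>

fun modular_coeff :: "nat \<Rightarrow> nat \<Rightarrow> int" where
  "modular_coeff k 0 = (if k < 5 then [-5, 5, -1, -1, 1] ! k else 0)"
| "modular_coeff k (Suc l) = (if k < 5 then 0 else modular_coeff (k - 5) l + 5 * modular_coeff (k - 4) l
    + 15 * modular_coeff (k - 3) l + 25 * modular_coeff (k - 2) l + 25 * modular_coeff (k - 1) l)"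

lemma modular_coeff_eq_0: "5 * l + 4 < k \<Longrightarrow> modular_coeff k l = 0" "k < l \<Longrightarrow> modular_coeff k l = 0"
  by (induction l arbitrary: k) auto

text \<open>In the recurrence the term with index k - 5 + r lowers 5 l - k by r, for r = 0, ..., 4.
  The coefficients 1, 5, 15, 25, 25 contain 0, 1, 1, 2, 2 factors 5, that is r/2 rounded up, which
  explains the slope 1/2.\<close>

lemma modular_coeff_dvd: "5 ^ ((5 * l + 3 - k) div 2) dvd modular_coeff k l"
proof (induction l arbitrary: k)
  case 0
  show ?case
  proof (cases "k < 5")
    case True
    then have "k = 0 \<or> k = 1 \<or> k = 2 \<or> k = 3 \<or> k = 4" by linarith
    then show ?thesis by auto
  qed simp
next
  case (Suc l)
  show ?case
  proof (cases "k < 5")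
    case False
    have *: "5 ^ ((5 * Suc l + 3 - k) div 2) dvd 5 ^ e * modular_coeff (k - 5 + r) l" if "r \<le> 2 * e" "r < 5" for r e
    proof -
      have "(5 * Suc l + 3 - k) div 2 \<le> ((5 * l + 3 - (k - 5 + r)) + 2 * e) div 2"
      proof (rule div_le_mono)
        obtain j where j: "k = j + 5" using False by (metis add.commute le_add_diff_inverse linorder_not_less)
        have "5 * l + 3 - j \<le> 5 * l + 3 - j - r + 2 * e" using that by linarith
        then show "5 * Suc l + 3 - k \<le> 5 * l + 3 - (k - 5 + r) + 2 * e" by (simp add: j)
      qed
      then have "(5 * Suc l + 3 - k) div 2 \<le> e + (5 * l + 3 - (k - 5 + r)) div 2" by simp
      then have "(5::int) ^ ((5 * Suc l + 3 - k) div 2) dvd 5 ^ (e + (5 * l + 3 - (k - 5 + r)) div 2)" by (rule le_imp_power_dvd)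
      also have "\<dots> dvd 5 ^ e * modular_coeff (k - 5 + r) l" unfolding power_add by (intro mult_dvd_mono Suc.IH dvd_refl)
      finally show ?thesis .
    qed
    have k: "k - 5 + 0 = k - 5" "k - 5 + 1 = k - 4" "k - 5 + 2 = k - 3" "k - 5 + 3 = k - 2" "k - 5 + 4 = k - 1"
      using False by simp_all
    have "modular_coeff k (Suc l) = 5 ^ 0 * modular_coeff (k - 5 + 0) l + 5 ^ 1 * modular_coeff (k - 5 + 1) l
      + 3 * (5 ^ 1 * modular_coeff (k - 5 + 2) l) + 5 ^ 2 * modular_coeff (k - 5 + 3) l + 5 ^ 2 * modular_coeff (k - 5 + 4) l"
      unfolding k using False by simp
    then show ?thesis by (simp only:) (intro dvd_add dvd_mult *; simp)
  qed simp
qed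

text \<open>For u = a/z and v = -z b the expression u + v - 1 will be \<zeta>. The first three
  identities make its powers Laurent polynomials in z, ready for averaging; the last eliminates u
  and v from u^5 + v^5 - 11 and is the source of the coefficients 5, 15, 25, 25.\<close>

lemma fifth_root_powers:
  fixes u v :: "'a :: field_char_0"
  assumes "u * v = - 1"
  shows "(u + v - 1) ^ 2 = u ^ 2 + v ^ 2 - 2 * u - 2 * v - 1"
    and "(u + v - 1) ^ 3 = u ^ 3 + v ^ 3 - 3 * u ^ 2 - 3 * v ^ 2 + 5"
    and "(u + v - 1) ^ 4 = u ^ 4 + v ^ 4 - 4 * u ^ 3 - 4 * v ^ 3 + 2 * u ^ 2 + 2 * v ^ 2 + 8 * u + 8 * v - 5"
    and "(u + v - 1) ^ 5 + 5 * (u + v - 1) ^ 4 + 15 * (u + v - 1) ^ 3 + 25 * (u + v - 1) ^ 2 + 25 * (u + v - 1) = u ^ 5 + v ^ 5 - 11"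
proof -
  have uv: "u * v = - 1" "u * (v * w) = - w" for w using assms by (simp_all add: mult.assoc[symmetric])
  show 2: "(u + v - 1) ^ 2 = u ^ 2 + v ^ 2 - 2 * u - 2 * v - 1"
    by (simp add: uv power2_eq_square algebra_simps)
  have "(u + v - 1) ^ 3 = (u + v - 1) ^ 2 * (u + v - 1)" by (simp add: eval_nat_numeral)
  then show 3: "(u + v - 1) ^ 3 = u ^ 3 + v ^ 3 - 3 * u ^ 2 - 3 * v ^ 2 + 5"
    unfolding 2 by (simp add: uv eval_nat_numeral algebra_simps)
  have "(u + v - 1) ^ 4 = (u + v - 1) ^ 3 * (u + v - 1)" by (simp add: eval_nat_numeral)
  then show 4: "(u + v - 1) ^ 4 = u ^ 4 + v ^ 4 - 4 * u ^ 3 - 4 * v ^ 3 + 2 * u ^ 2 + 2 * v ^ 2 + 8 * u + 8 * v - 5"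
    unfolding 3 by (simp add: uv eval_nat_numeral algebra_simps)
  have "(u + v - 1) ^ 5 = (u + v - 1) ^ 4 * (u + v - 1)" by (simp add: eval_nat_numeral)
  then show "(u + v - 1) ^ 5 + 5 * (u + v - 1) ^ 4 + 15 * (u + v - 1) ^ 3 + 25 * (u + v - 1) ^ 2 + 25 * (u + v - 1) = u ^ 5 + v ^ 5 - 11"
    unfolding 2 3 4 by (simp add: uv eval_nat_numeral algebra_simps)
qed

lemma avg_sum: "avg (\<lambda>z. \<Sum>i\<in>I. f i z) x = (\<Sum>i\<in>I. avg (f i) x)"
  by (induction I rule: infinite_finite_induct) (simp_all add: avg_0 avg_add)

text \<open>In terms of Dedekind's eta function this is (eta(5 t) / eta(t))^6, a Hauptmodul of level
  5.\<close>

definition hauptmodul :: "complex \<Rightarrow> complex" where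
  "hauptmodul q = q * euler (q ^ 5) ^ 6 / euler q ^ 6"

context dissected
begin

definition \<tau> :: complex where "\<tau> = hauptmodul q"

lemma \<tau>: "\<tau> = q * E ^ 6 / euler q ^ 6" "\<tau> = q / Dt" "\<tau> \<noteq> 0"
proof -
  show 1: "\<tau> = q * E ^ 6 / euler q ^ 6" by (simp add: \<tau>_def hauptmodul_def E_def)
  show "\<tau> = q / Dt" unfolding 1 Dt(1)[symmetric] using E0 Dt(2) by simp
  then show "\<tau> \<noteq> 0" using q Dt(2) by simp
qed

text \<open>The reciprocal \<open>\<eta> z\<close> is z E(z^25) / E(z), the Hauptmodul of level 25;
  \<open>\<zeta>\<close> is the side on which the dissection of the Euler product is
  visible.\<close>

definition \<zeta> :: "complex \<Rightarrow> complex" where "\<zeta> z = euler z / (E * z)"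
definition \<eta> :: "complex \<Rightarrow> complex" where "\<eta> z = E * z / euler z"

context
  fixes z :: complex
  assumes z: "norm z < 1" "z \<noteq> 0" "z ^ 5 = q"
begin

lemma \<zeta>_eq: "\<zeta> z = a / z + - z * b - 1" "(a / z) * (- z * b) = - 1"
proof -
  have z25: "z ^ 25 = q ^ 5"
  proof -
    have "z ^ 25 = (z ^ 5) ^ 5" by (simp flip: power_mult)
    then show ?thesis by (simp add: z)
  qed
  have "euler z = E * (a - z - z ^ 2 * b)"
    using euler_dissection[OF z(1,2)] unfolding z(3) z25 dissA_eq dissB_eq E_def[symmetric] by (simp add: algebra_simps)
  then show "\<zeta> z = a / z + - z * b - 1" using E0 z(2) by (simp add: \<zeta>_def field_simps power2_eq_square)
  show "(a / z) * (- z * b) = - 1" using ab(1) z(2) by simp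
qed

lemma \<eta>_\<zeta>: "\<eta> z * \<zeta> z = 1"
  using E0 z(2) euler_nonzero[OF z(1)] by (simp add: \<eta>_def \<zeta>_def)

text \<open>With u = a/z and v = -z b, u^5 + v^5 depends on z^5 = q alone and equals 1/\<tau> + 11.
  This is a quintic equation for \<zeta>, and multiplication by \<eta>^5 reverses it.\<close>

lemma modular_equation: "\<eta> z ^ 5 = \<tau> * (1 + 5 * \<eta> z + 15 * \<eta> z ^ 2 + 25 * \<eta> z ^ 3 + 25 * \<eta> z ^ 4)"
proof -
  have "(a / z) ^ 5 + (- z * b) ^ 5 - 11 = (a ^ 5 - 11 * z ^ 5 - (z ^ 5) ^ 2 * b ^ 5) / z ^ 5"
    using z(2) by (simp add: power_mult_distrib field_simps flip: power_add power_mult)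
  also have "\<dots> = Dt / q" unfolding z(3) by (simp add: Dt_def)
  also have "\<dots> = 1 / \<tau>" unfolding \<tau>(2) by simp
  finally have "\<zeta> z ^ 5 + 5 * \<zeta> z ^ 4 + 15 * \<zeta> z ^ 3 + 25 * \<zeta> z ^ 2 + 25 * \<zeta> z = 1 / \<tau>"
    using fifth_root_powers(4)[OF \<zeta>_eq(2)] unfolding \<zeta>_eq(1) by simp
  then have "\<tau> * (\<zeta> z ^ 5 + 5 * \<zeta> z ^ 4 + 15 * \<zeta> z ^ 3 + 25 * \<zeta> z ^ 2 + 25 * \<zeta> z) * \<eta> z ^ 5 = \<eta> z ^ 5"
    using \<tau>(3) by simp
  moreover have "\<zeta> z ^ j * \<eta> z ^ 5 = \<eta> z ^ (5 - j)" if "j \<le> 5" for j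
  proof -
    have "\<eta> z ^ 5 = \<eta> z ^ j * \<eta> z ^ (5 - j)" using that by (simp flip: power_add)
    then have "\<zeta> z ^ j * \<eta> z ^ 5 = (\<eta> z * \<zeta> z) ^ j * \<eta> z ^ (5 - j)" by (simp add: power_mult_distrib)
    then show ?thesis using \<eta>_\<zeta> by simp
  qed
  from this[of 5] this[of 4] this[of 3] this[of 2] this[of 1]
  have "(\<zeta> z ^ 5 + 5 * \<zeta> z ^ 4 + 15 * \<zeta> z ^ 3 + 25 * \<zeta> z ^ 2 + 25 * \<zeta> z) * \<eta> z ^ 5
    = 1 + 5 * \<eta> z + 15 * \<eta> z ^ 2 + 25 * \<eta> z ^ 3 + 25 * \<eta> z ^ 4"
    by (simp add: distrib_right mult.assoc)
  ultimately show ?thesis by (simp only: mult.assoc)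
qed

lemma \<zeta>_powers:
  "\<zeta> z ^ 1 = a * z powi (-1) + ((- b) * z powi 1 + (- 1) * z powi 0)"
  "\<zeta> z ^ 2 = a ^ 2 * z powi (-2) + (b ^ 2 * z powi 2 + ((- 2 * a) * z powi (-1) + ((2 * b) * z powi 1 + (- 1) * z powi 0)))"
  "\<zeta> z ^ 3 = a ^ 3 * z powi (-3) + ((- (b ^ 3)) * z powi 3 + ((- 3 * a ^ 2) * z powi (-2) + ((- 3 * b ^ 2) * z powi 2 + 5 * z powi 0)))"
  "\<zeta> z ^ 4 = a ^ 4 * z powi (-4) + (b ^ 4 * z powi 4 + ((- 4 * a ^ 3) * z powi (-3) + ((4 * b ^ 3) * z powi 3
    + (2 * a ^ 2 * z powi (-2) + (2 * b ^ 2 * z powi 2 + ((8 * a) * z powi (-1) + ((- 8 * b) * z powi 1 + (- 5) * z powi 0)))))))"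
proof -
  have p: "z powi (-1) = 1 / z" "z powi (-2) = 1 / z ^ 2" "z powi (-3) = 1 / z ^ 3" "z powi (-4) = 1 / z ^ 4"
    by (simp_all add: power_int_minus inverse_eq_divide)
  show "\<zeta> z ^ 1 = a * z powi (-1) + ((- b) * z powi 1 + (- 1) * z powi 0)"
    unfolding \<zeta>_eq(1) p by simp
  show "\<zeta> z ^ 2 = a ^ 2 * z powi (-2) + (b ^ 2 * z powi 2 + ((- 2 * a) * z powi (-1) + ((2 * b) * z powi 1 + (- 1) * z powi 0)))"
    unfolding \<zeta>_eq(1) p fifth_root_powers(1)[OF \<zeta>_eq(2)] by (simp add: power_divide power_mult_distrib mult.commute)
  show "\<zeta> z ^ 3 = a ^ 3 * z powi (-3) + ((- (b ^ 3)) * z powi 3 + ((- 3 * a ^ 2) * z powi (-2) + ((- 3 * b ^ 2) * z powi 2 + 5 * z powi 0)))"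
    unfolding \<zeta>_eq(1) p fifth_root_powers(2)[OF \<zeta>_eq(2)] by (simp add: power_divide power_mult_distrib mult.commute)
  show "\<zeta> z ^ 4 = a ^ 4 * z powi (-4) + (b ^ 4 * z powi 4 + ((- 4 * a ^ 3) * z powi (-3) + ((4 * b ^ 3) * z powi 3
    + (2 * a ^ 2 * z powi (-2) + (2 * b ^ 2 * z powi 2 + ((8 * a) * z powi (-1) + ((- 8 * b) * z powi 1 + (- 5) * z powi 0)))))))"
    unfolding \<zeta>_eq(1) p fifth_root_powers(3)[OF \<zeta>_eq(2)] by (simp add: power_divide power_mult_distrib mult.commute)
qed

end

lemma roots: "norm (om ^ i * x) < 1" "om ^ i * x \<noteq> 0" "(om ^ i * x) ^ 5 = q"
  using om_power_mult[OF x] by (auto simp: q_def)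

text \<open>The factor \<zeta>^4 shifts the index so that the five starting values of the recurrence
  are averages of \<zeta>^4, ..., \<zeta>^0, which are Laurent polynomials in z.\<close>

definition M :: "nat \<Rightarrow> complex" where
  "M k = avg (\<lambda>z. \<zeta> z ^ 4 * \<eta> z ^ k) x"

lemma M_initial:
  assumes "k < 5"
  shows "M k = [-5, 5, -1, -1, 1] ! k"
proof -
  have M: "M k = avg (\<lambda>z. \<zeta> z ^ (4 - k)) x"
    unfolding M_def
  proof (rule avg_cong)
    fix i :: nat
    define z where "z = om ^ i * x"
    have "\<zeta> z ^ 4 = \<zeta> z ^ (4 - k) * \<zeta> z ^ k" using assms by (simp flip: power_add)
    then have "\<zeta> z ^ 4 * \<eta> z ^ k = \<zeta> z ^ (4 - k) * (\<eta> z * \<zeta> z) ^ k" by (simp add: power_mult_distrib)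
    also have "\<eta> z * \<zeta> z = 1" unfolding z_def by (rule \<eta>_\<zeta>[OF roots])
    finally show "\<zeta> (om ^ i * x) ^ 4 * \<eta> (om ^ i * x) ^ k = \<zeta> (om ^ i * x) ^ (4 - k)" by (simp add: z_def)
  qed
  note Z = avg_powi[OF x(2)]
  have "avg (\<lambda>z. \<zeta> z ^ 1) x = -1"
    using avg_cong[where f = "\<lambda>z. \<zeta> z ^ 1" and x = x, OF \<zeta>_powers(1)[OF roots]] unfolding avg_add avg_cmult Z by simp
  moreover have "avg (\<lambda>z. \<zeta> z ^ 2) x = -1"
    using avg_cong[where f = "\<lambda>z. \<zeta> z ^ 2" and x = x, OF \<zeta>_powers(2)[OF roots]] unfolding avg_add avg_cmult Z by simp
  moreover have "avg (\<lambda>z. \<zeta> z ^ 3) x = 5"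
    using avg_cong[where f = "\<lambda>z. \<zeta> z ^ 3" and x = x, OF \<zeta>_powers(3)[OF roots]] unfolding avg_add avg_cmult Z by simp
  moreover have "avg (\<lambda>z. \<zeta> z ^ 4) x = -5"
    using avg_cong[where f = "\<lambda>z. \<zeta> z ^ 4" and x = x, OF \<zeta>_powers(4)[OF roots]] unfolding avg_add avg_cmult Z by simp
  moreover have "avg (\<lambda>z. \<zeta> z ^ 0) x = 1" by (simp add: avg_def)
  moreover have "k = 0 \<or> k = 1 \<or> k = 2 \<or> k = 3 \<or> k = 4" using assms by linarith
  ultimately show ?thesis unfolding M by (elim disjE) simp_all
qed

lemma M_rec: "M (k + 5) = \<tau> * (M k + 5 * M (k + 1) + 15 * M (k + 2) + 25 * M (k + 3) + 25 * M (k + 4))"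
proof -
  have "M (k + 5) = avg (\<lambda>z. \<tau> * (\<zeta> z ^ 4 * \<eta> z ^ k + 5 * (\<zeta> z ^ 4 * \<eta> z ^ (k + 1)) + 15 * (\<zeta> z ^ 4 * \<eta> z ^ (k + 2))
     + 25 * (\<zeta> z ^ 4 * \<eta> z ^ (k + 3)) + 25 * (\<zeta> z ^ 4 * \<eta> z ^ (k + 4)))) x"
    unfolding M_def
  proof (rule avg_cong)
    fix i :: nat
    define z where "z = om ^ i * x"
    have "\<zeta> z ^ 4 * \<eta> z ^ (k + 5) = \<zeta> z ^ 4 * \<eta> z ^ k * \<eta> z ^ 5" by (simp add: power_add)
    also have "\<dots> = \<tau> * (\<zeta> z ^ 4 * \<eta> z ^ k + 5 * (\<zeta> z ^ 4 * \<eta> z ^ (k + 1)) + 15 * (\<zeta> z ^ 4 * \<eta> z ^ (k + 2))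
     + 25 * (\<zeta> z ^ 4 * \<eta> z ^ (k + 3)) + 25 * (\<zeta> z ^ 4 * \<eta> z ^ (k + 4)))"
      unfolding modular_equation[OF roots[of i], folded z_def] power_add by (simp add: algebra_simps)
    finally show "\<zeta> (om ^ i * x) ^ 4 * \<eta> (om ^ i * x) ^ (k + 5) = \<tau> * (\<zeta> (om ^ i * x) ^ 4 * \<eta> (om ^ i * x) ^ k
      + 5 * (\<zeta> (om ^ i * x) ^ 4 * \<eta> (om ^ i * x) ^ (k + 1)) + 15 * (\<zeta> (om ^ i * x) ^ 4 * \<eta> (om ^ i * x) ^ (k + 2))
     + 25 * (\<zeta> (om ^ i * x) ^ 4 * \<eta> (om ^ i * x) ^ (k + 3)) + 25 * (\<zeta> (om ^ i * x) ^ 4 * \<eta> (om ^ i * x) ^ (k + 4)))"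
      unfolding z_def .
  qed
  then show ?thesis unfolding avg_cmult avg_add M_def .
qed

lemma M_eq: "k \<le> N \<Longrightarrow> M k = (\<Sum>l\<le>N. of_int (modular_coeff k l) * \<tau> ^ l)"
proof (induction k arbitrary: N rule: less_induct)
  case (less k)
  show ?case
  proof (cases "k < 5")
    case True
    have "modular_coeff k l = 0" if "l \<noteq> 0" for l using that True by (cases l) auto
    then have "(\<Sum>l\<le>N. of_int (modular_coeff k l) * \<tau> ^ l) = (\<Sum>l\<in>{0}. of_int (modular_coeff k l) * \<tau> ^ l)"
      by (intro sum.mono_neutral_right) auto
    moreover have "k = 0 \<or> k = 1 \<or> k = 2 \<or> k = 3 \<or> k = 4" using True by linarith
    ultimately show ?thesis using M_initial[OF True] by auto
  next
    case False
    define j where "j = k - 5"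
    have k: "k = j + 5" using False by (simp add: j_def)
    obtain N' where N: "N = Suc N'" using less.prems k by (cases N) auto
    have IH: "M (j + i) = (\<Sum>l\<le>N'. of_int (modular_coeff (j + i) l) * \<tau> ^ l)" if "i < 5" for i
      using that less.prems by (intro less.IH) (auto simp: k N)
    have "(\<Sum>l\<le>N. of_int (modular_coeff k l) * \<tau> ^ l) = (\<Sum>l\<le>N'. of_int (modular_coeff k (Suc l)) * \<tau> ^ Suc l)"
      unfolding N sum.atMost_Suc_shift using False by simp
    also have "\<dots> = \<tau> * (M (j + 0) + 5 * M (j + 1) + 15 * M (j + 2) + 25 * M (j + 3) + 25 * M (j + 4))"
    proof -
      have kk: "k - 5 = j + 0" "k - 4 = j + 1" "k - 3 = j + 2" "k - 2 = j + 3" "k - 1 = j + 4" using k by auto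
      have "of_int (modular_coeff k (Suc l)) * \<tau> ^ Suc l = \<tau> * (of_int (modular_coeff (j + 0) l) * \<tau> ^ l
        + 5 * (of_int (modular_coeff (j + 1) l) * \<tau> ^ l) + 15 * (of_int (modular_coeff (j + 2) l) * \<tau> ^ l)
        + 25 * (of_int (modular_coeff (j + 3) l) * \<tau> ^ l) + 25 * (of_int (modular_coeff (j + 4) l) * \<tau> ^ l))" for l
        using False by (simp only: modular_coeff.simps(2) if_False kk) (simp add: algebra_simps)
      then show ?thesis
        using IH[of 0] IH[of 1] IH[of 2] IH[of 3] IH[of 4]
        by (simp only: sum.distrib sum_distrib_left[symmetric])
    qed
    finally show ?thesis using M_rec[of j] k by simp
  qed
qed

text \<open>The coefficient of \<tau>^l vanishes for 5 l + 4 < k; with k = 6 j + s + 4 and s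
  positive this covers all l up to j. The factor \<tau>^(j+1) so gained pays for the \<tau>^(-j)
  that comes with the j-th power of \<open>hauptmodul z\<close> and leaves one \<tau>.\<close>

lemma avg_\<eta>_power:
  assumes "s \<ge> 1" "6 * j + s + 4 \<le> n + j"
  shows "avg (\<lambda>z. \<eta> z ^ (6 * j + s)) x = \<tau> ^ (j + 1) * (\<Sum>i<n. of_int (modular_coeff (6 * j + s + 4) (i + j + 1)) * \<tau> ^ i)"
proof -
  let ?k = "6 * j + s + 4"
  have "avg (\<lambda>z. \<eta> z ^ (6 * j + s)) x = M ?k"
    unfolding M_def
  proof (rule avg_cong)
    fix i :: nat
    have "\<zeta> z ^ 4 * \<eta> z ^ ?k = (\<eta> z * \<zeta> z) ^ 4 * \<eta> z ^ (6 * j + s)" for z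
      by (simp add: power_mult_distrib power_add)
    then show "\<eta> (om ^ i * x) ^ (6 * j + s) = \<zeta> (om ^ i * x) ^ 4 * \<eta> (om ^ i * x) ^ ?k"
      using \<eta>_\<zeta>[OF roots, of i] by simp
  qed
  also have "\<dots> = (\<Sum>l<(j + 1) + n. of_int (modular_coeff ?k l) * \<tau> ^ l)"
    using M_eq[OF assms(2)] by (simp add: lessThan_Suc_atMost add.commute)
  also have "\<dots> = (\<Sum>l<j + 1. of_int (modular_coeff ?k l) * \<tau> ^ l) + (\<Sum>i<n. of_int (modular_coeff ?k (i + j + 1)) * \<tau> ^ (i + j + 1))"
    by (induction n) (simp_all add: add_ac)
  also have "(\<Sum>l<j + 1. of_int (modular_coeff ?k l) * \<tau> ^ l) = 0"
    using assms(1) by (intro sum.neutral) (auto simp: modular_coeff_eq_0(1))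
  finally show ?thesis by (simp add: sum_distrib_left power_add mult_ac)
qed

end

section \<open>One step of the 5-adic induction\<close>

definition next_coeff :: "nat \<Rightarrow> nat \<Rightarrow> (nat \<Rightarrow> int) \<Rightarrow> nat \<Rightarrow> int" where
  "next_coeff s J c i = (\<Sum>j<J. c j * modular_coeff (6 * j + s + 4) (i + j + 1))"

text \<open>The factor \<open>modular_coeff\<close> contributes about (5 i - j + 4 - s)/2 factors 5.
  As s is at most 2, the constant supplies the gain of 1, and the loss j/2 is covered by floor(5 j /
  2) in the hypothesis.\<close>

lemma next_coeff_dvd:
  assumes "\<And>j. 5 ^ (\<alpha> + (5 * j) div 2) dvd c j" "s \<le> 2"
  shows "5 ^ (Suc \<alpha> + (5 * i) div 2) dvd next_coeff s J c i"
  unfolding next_coeff_def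
proof (rule dvd_sum)
  fix j
  let ?e = "(5 * (i + j + 1) + 3 - (6 * j + s + 4)) div 2"
  have "Suc \<alpha> + (5 * i) div 2 \<le> (\<alpha> + (5 * j) div 2) + ?e"
  proof -
    have sub: "x \<le> a - b + c" if "x + b \<le> a + c" for x a b c :: nat using that by linarith
    have "(5 * i + 2) div 2 \<le> ((5 * (i + j + 1) + 3 - (6 * j + s + 4)) + 2 * (2 * j)) div 2"
      using sub[of "5 * i + 2" "6 * j + s + 4" "5 * (i + j + 1) + 3" "2 * (2 * j)"] assms(2) by (intro div_le_mono) simp
    moreover have "2 * j \<le> (5 * j) div 2" by linarith
    ultimately show ?thesis by simp
  qed
  then have "(5::int) ^ (Suc \<alpha> + (5 * i) div 2) dvd 5 ^ (\<alpha> + (5 * j) div 2) * 5 ^ ?e"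
    unfolding power_add[symmetric] by (rule le_imp_power_dvd)
  also have "\<dots> dvd c j * modular_coeff (6 * j + s + 4) (i + j + 1)"
    by (intro mult_dvd_mono assms(1) modular_coeff_dvd)
  finally show "5 ^ (Suc \<alpha> + (5 * i) div 2) dvd c j * modular_coeff (6 * j + s + 4) (i + j + 1)" .
qed

text \<open>As z^6 = z q, \<open>hauptmodul z\<close> is \<eta>^6 / \<tau>, where \<tau> is the same
  for all fifth roots of q; a polynomial in it becomes a combination of the powers \<eta>^(6 j +
  s).\<close>

lemma (in dissected) avg_hauptmodul_sum:
  assumes s: "1 \<le> s" "s \<le> 2"
  shows "avg (\<lambda>z. \<eta> z ^ s * (\<Sum>j<J. of_int (c j) * hauptmodul z ^ j)) x
    = \<tau> * (\<Sum>i<5 * J + 6. of_int (next_coeff s J c i) * \<tau> ^ i)"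
proof -
  have "avg (\<lambda>z. \<eta> z ^ s * (\<Sum>j<J. of_int (c j) * hauptmodul z ^ j)) x
    = avg (\<lambda>z. \<Sum>j<J. (of_int (c j) / \<tau> ^ j) * \<eta> z ^ (6 * j + s)) x"
  proof (rule avg_cong)
    fix i :: nat
    define z where "z = om ^ i * x"
    have z: "norm z < 1" "z \<noteq> 0" "z ^ 5 = q" using roots by (simp_all add: z_def)
    have "z ^ 6 = z * q" using z(3) by (simp add: eval_nat_numeral)
    then have "hauptmodul z = \<eta> z ^ 6 / \<tau>"
      unfolding hauptmodul_def \<eta>_def \<tau>(1) z(3) power_divide power_mult_distrib
      using q E0 euler_nonzero[OF q(1)] euler_nonzero[OF z(1)] by (simp add: field_simps)
    then have "\<eta> z ^ s * (of_int (c j) * hauptmodul z ^ j) = (of_int (c j) / \<tau> ^ j) * \<eta> z ^ (6 * j + s)" for j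
      by (simp add: power_divide power_add power_mult)
    then show "\<eta> (om ^ i * x) ^ s * (\<Sum>j<J. of_int (c j) * hauptmodul (om ^ i * x) ^ j)
      = (\<Sum>j<J. (of_int (c j) / \<tau> ^ j) * \<eta> (om ^ i * x) ^ (6 * j + s))"
      unfolding z_def by (simp add: sum_distrib_left)
  qed
  also have "\<dots> = (\<Sum>j<J. of_int (c j) / \<tau> ^ j * avg (\<lambda>z. \<eta> z ^ (6 * j + s)) x)"
    unfolding avg_sum avg_cmult ..
  also have "\<dots> = (\<Sum>j<J. \<Sum>i<5 * J + 6. \<tau> * (of_int (c j * modular_coeff (6 * j + s + 4) (i + j + 1)) * \<tau> ^ i))"
  proof (rule sum.cong[OF refl])
    fix j assume "j \<in> {..<J}"
    then have *: "6 * j + s + 4 \<le> (5 * J + 6) + j" using s by simp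
    show "of_int (c j) / \<tau> ^ j * avg (\<lambda>z. \<eta> z ^ (6 * j + s)) x
      = (\<Sum>i<5 * J + 6. \<tau> * (of_int (c j * modular_coeff (6 * j + s + 4) (i + j + 1)) * \<tau> ^ i))"
      unfolding avg_\<eta>_power[OF s(1) *] using \<tau>(3) by (simp add: sum_distrib_left mult_ac)
  qed
  also have "\<dots> = (\<Sum>i<5 * J + 6. \<Sum>j<J. \<tau> * (of_int (c j * modular_coeff (6 * j + s + 4) (i + j + 1)) * \<tau> ^ i))"
    by (rule sum.swap)
  also have "\<dots> = \<tau> * (\<Sum>i<5 * J + 6. of_int (next_coeff s J c i) * \<tau> ^ i)"
    by (simp add: next_coeff_def sum_distrib_left sum_distrib_right mult_ac)
  finally show ?thesis .
qed

definition prefactor :: "nat \<Rightarrow> complex \<Rightarrow> complex" where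
  "prefactor \<alpha> q = (if even \<alpha> then euler (q ^ 5) ^ 4 / euler q else euler (q ^ 5) ^ 5 / euler q ^ 2)"

definition form :: "nat \<Rightarrow> nat \<Rightarrow> (nat \<Rightarrow> int) \<Rightarrow> complex \<Rightarrow> complex" where
  "form \<alpha> J c q = prefactor \<alpha> q * (\<Sum>j<J. of_int (c j) * hauptmodul q ^ j)"

text \<open>\<open>shift\<close> is the residue class extracted at a step; \<open>weight\<close> is
  the power of \<eta> left when z^(-shift) multiplies the prefactor at z and factors depending on q
  are split off.\<close>

definition shift :: "nat \<Rightarrow> nat" where "shift \<alpha> = (if even \<alpha> then 4 else 3)"
definition weight :: "nat \<Rightarrow> nat" where "weight \<alpha> = (if even \<alpha> then 1 else 2)"

lemma (in dissected) avg_form: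
  "avg (\<lambda>z. z powi (- int (shift m)) * form m J c z) x = form (Suc m) (5 * J + 6) (next_coeff (weight m) J c) q"
proof -
  define C where "C = (if even m then euler q ^ 4 / (E * q) else euler q ^ 5 / (E ^ 2 * q))"
  have "avg (\<lambda>z. z powi (- int (shift m)) * form m J c z) x
    = avg (\<lambda>z. C * (\<eta> z ^ weight m * (\<Sum>j<J. of_int (c j) * hauptmodul z ^ j))) x"
  proof (rule avg_cong)
    fix i :: nat
    define z where "z = om ^ i * x"
    have z: "norm z < 1" "z \<noteq> 0" "z ^ 5 = q" using roots by (simp_all add: z_def)
    have "z powi (- int (shift m)) * prefactor m z = C * \<eta> z ^ weight m"
    proof -
      have p: "z powi (- 4) = z / q" "z powi (- 3) = z ^ 2 / q"
        using z(2) unfolding z(3)[symmetric] by (simp_all add: power_int_minus inverse_eq_divide field_simps eval_nat_numeral)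
      show ?thesis
        using z q E0 euler_nonzero[OF z(1)]
        by (simp add: shift_def weight_def prefactor_def C_def \<eta>_def p power_divide power_mult_distrib)
    qed
    then show "(om ^ i * x) powi (- int (shift m)) * form m J c (om ^ i * x)
      = C * (\<eta> (om ^ i * x) ^ weight m * (\<Sum>j<J. of_int (c j) * hauptmodul (om ^ i * x) ^ j))"
      unfolding form_def z_def by (simp only: mult.assoc[symmetric])
  qed
  also have "\<dots> = (C * \<tau>) * (\<Sum>i<5 * J + 6. of_int (next_coeff (weight m) J c i) * \<tau> ^ i)"
    unfolding avg_cmult by (subst avg_hauptmodul_sum) (simp_all add: weight_def)
  also have "C * \<tau> = prefactor (Suc m) q"
  proof -
    have "prefactor (Suc m) q = (if even m then E ^ 5 / euler q ^ 2 else E ^ 4 / euler q)"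
      by (simp add: prefactor_def E_def)
    moreover have "euler q ^ 4 / (E * q) * \<tau> = E ^ 5 / euler q ^ 2" "euler q ^ 5 / (E ^ 2 * q) * \<tau> = E ^ 4 / euler q"
      using q E0 euler_nonzero[OF q(1)] unfolding \<tau>(1) by (simp_all add: field_simps flip: power_add power_Suc)
    ultimately show ?thesis by (simp add: C_def)
  qed
  finally show ?thesis by (simp add: form_def \<tau>_def)
qed

lemma power_25_mod_24: "\<exists>j. (5::nat) ^ (2 * k) = 24 * j + 1"
proof (induction k)
  case (Suc k)
  then obtain j where "(5::nat) ^ (2 * k) = 24 * j + 1" by blast
  then have "(5::nat) ^ (2 * Suc k) = 24 * (25 * j + 1) + 1" by simp
  then show ?case by blast
qed simp

text \<open>Extracting the indices 5 n + \<open>shift \<alpha>\<close> adds 5^\<alpha> times the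
  shift to the offset; the closed form of \<open>delta_tilde\<close> is the result of iterating
  this.\<close>

lemma delta_tilde_Suc: "delta_tilde (Suc \<alpha>) = 5 ^ \<alpha> * shift \<alpha> + delta_tilde \<alpha>"
proof -
  obtain j where j: "(5::nat) ^ (2 * (\<alpha> div 2)) = 24 * j + 1" using power_25_mod_24 by blast
  show ?thesis
  proof (cases "even \<alpha>")
    case True
    then have "(5::nat) ^ \<alpha> = 24 * j + 1" using j by simp
    then show ?thesis using True by (simp add: delta_tilde_def shift_def)
  next
    case False
    then have "\<alpha> = Suc (2 * (\<alpha> div 2))" by simp
    then have "(5::nat) ^ \<alpha> = 24 * (5 * j) + 5" using j by (metis power_Suc distrib_left mult.left_commute mult.right_neutral)
    then show ?thesis using False by (simp add: delta_tilde_def shift_def)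
  qed
qed

text \<open>The induction starts at \<alpha> = 0, below the range of the theorem:
  \<open>delta_tilde 0\<close> is 0 and the form is the bare prefactor. The growth floor(5 j / 2) in
  the divisibility is what lets the step gain a factor 5.\<close>

lemma NT_gap_form:
  "\<exists>J c. (\<forall>j. 5 ^ (\<alpha> + (5 * j) div 2) dvd c j) \<and>
    (\<forall>q. norm q < 1 \<longrightarrow> q \<noteq> 0 \<longrightarrow> ((\<lambda>n. of_int (NT_gap (5 * (5 ^ \<alpha> * n + delta_tilde \<alpha>) + 4)) * q ^ n) has_sum form \<alpha> J c q) UNIV)"
proof (induction \<alpha>)
  case 0
  show ?case
  proof (intro exI conjI allI impI)
    fix j :: nat
    show "5 ^ (0 + (5 * j) div 2) dvd (if j = 0 then 1 else 0 :: int)" by simp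
  next
    fix q :: complex assume "norm q < 1" "q \<noteq> 0"
    then show "((\<lambda>n. of_int (NT_gap (5 * (5 ^ 0 * n + delta_tilde 0) + 4)) * q ^ n) has_sum form 0 1 (\<lambda>j. if j = 0 then 1 else 0) q) UNIV"
      using NT_gap_generating_function by (simp add: form_def prefactor_def delta_tilde_def)
  qed
next
  case (Suc \<alpha>)
  then obtain J c where c: "\<And>j. 5 ^ (\<alpha> + (5 * j) div 2) dvd c j"
    and sum: "\<And>q. norm q < 1 \<Longrightarrow> q \<noteq> 0 \<Longrightarrow> ((\<lambda>n. of_int (NT_gap (5 * (5 ^ \<alpha> * n + delta_tilde \<alpha>) + 4)) * q ^ n) has_sum form \<alpha> J c q) UNIV"
    by blast
  show ?case
  proof (intro exI conjI allI impI)
    fix j :: nat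
    show "5 ^ (Suc \<alpha> + (5 * j) div 2) dvd next_coeff (weight \<alpha>) J c j"
      by (rule next_coeff_dvd[OF c]) (simp add: weight_def)
  next
    fix q :: complex assume q: "norm q < 1" "q \<noteq> 0"
    obtain x where x: "norm x < 1" "x \<noteq> 0" "x ^ 5 = q" using fifth_root[OF q] .
    then have d: "dissected x" by (simp add: dissected_def)
    have "shift \<alpha> < 5" by (simp add: shift_def)
    from has_sum_progression[OF x(1,2) this sum]
    have "((\<lambda>n. of_int (NT_gap (5 * (5 ^ \<alpha> * (5 * n + shift \<alpha>) + delta_tilde \<alpha>) + 4)) * q ^ n) has_sum
      avg (\<lambda>z. z powi (- int (shift \<alpha>)) * form \<alpha> J c z) x) UNIV" unfolding x(3) .
    also have "avg (\<lambda>z. z powi (- int (shift \<alpha>)) * form \<alpha> J c z) x = form (Suc \<alpha>) (5 * J + 6) (next_coeff (weight \<alpha>) J c) q"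
      using dissected.avg_form[OF d] unfolding x(3) .
    finally show "((\<lambda>n. of_int (NT_gap (5 * (5 ^ Suc \<alpha> * n + delta_tilde (Suc \<alpha>)) + 4)) * q ^ n) has_sum
      form (Suc \<alpha>) (5 * J + 6) (next_coeff (weight \<alpha>) J c) q) UNIV"
      by (simp add: delta_tilde_Suc algebra_simps)
  qed
qed

section \<open>Power series with integer coefficients\<close>

definition int_series :: "(complex \<Rightarrow> complex) \<Rightarrow> bool" where
  "int_series f \<longleftrightarrow> (\<exists>c :: nat \<Rightarrow> int. \<forall>q. norm q < 1 \<longrightarrow> (\<lambda>n. of_int (c n) * q ^ n) sums f q)"

lemma int_seriesI:
  "(\<And>q. norm q < 1 \<Longrightarrow> (\<lambda>n. of_int (c n) * q ^ n) sums f q) \<Longrightarrow> int_series f"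
  unfolding int_series_def by auto

lemma int_series_mult:
  assumes "int_series f" "int_series g"
  shows "int_series (\<lambda>q. f q * g q)"
proof -
  obtain c d :: "nat \<Rightarrow> int" where c: "\<And>q. norm q < 1 \<Longrightarrow> (\<lambda>n. of_int (c n) * q ^ n) sums f q"
    and d: "\<And>q. norm q < 1 \<Longrightarrow> (\<lambda>n. of_int (d n) * q ^ n) sums g q"
    using assms unfolding int_series_def by blast
  have abs: "summable (\<lambda>n. norm (of_int (e n) * q ^ n))"
    if q: "norm q < 1" and e: "\<And>q :: complex. norm q < 1 \<Longrightarrow> (\<lambda>n. of_int (e n) * q ^ n) sums h q" for q :: complex and e :: "nat \<Rightarrow> int" and h
  proof (rule powser_insidea)
    define r where "r = (1 + norm q) / 2"
    have r: "norm q < r" "0 \<le> r" "r < 1" using q unfolding r_def by auto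
    then show "summable (\<lambda>n. of_int (e n) * complex_of_real r ^ n)" using e[of "complex_of_real r"] by (simp add: sums_summable)
    show "norm q < norm (complex_of_real r)" using r by simp
  qed
  have *: "(\<lambda>n. of_int (\<Sum>i\<le>n. c i * d (n - i)) * q ^ n) sums (f q * g q)" if q: "norm q < 1" for q
  proof -
    have "(\<lambda>n. \<Sum>i\<le>n. (of_int (c i) * q ^ i) * (of_int (d (n - i)) * q ^ (n - i))) sums (f q * g q)"
      using Cauchy_product_sums[OF abs[OF q c] abs[OF q d]] sums_unique[OF c[OF q]] sums_unique[OF d[OF q]] by simp
    moreover have "(\<Sum>i\<le>n. (of_int (c i) * q ^ i) * (of_int (d (n - i)) * q ^ (n - i))) = of_int (\<Sum>i\<le>n. c i * d (n - i)) * q ^ n" for n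
    proof -
      have "(of_int (c i) * q ^ i) * (of_int (d (n - i)) * q ^ (n - i)) = of_int (c i * d (n - i)) * q ^ n" if "i \<le> n" for i
      proof -
        have "q ^ n = q ^ i * q ^ (n - i)" using that by (simp flip: power_add)
        then show ?thesis by simp
      qed
      then show ?thesis unfolding of_int_sum sum_distrib_right by (intro sum.cong) simp_all
    qed
    ultimately show ?thesis by (simp only:)
  qed
  show ?thesis by (rule int_seriesI, rule *)
qed

lemma int_series_add:
  assumes "int_series f" "int_series g"
  shows "int_series (\<lambda>q. f q + g q)"
proof -
  obtain c d :: "nat \<Rightarrow> int" where c: "\<And>q. norm q < 1 \<Longrightarrow> (\<lambda>n. of_int (c n) * q ^ n) sums f q"
    and d: "\<And>q. norm q < 1 \<Longrightarrow> (\<lambda>n. of_int (d n) * q ^ n) sums g q"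
    using assms unfolding int_series_def by blast
  have *: "(\<lambda>n. of_int (c n + d n) * q ^ n) sums (f q + g q)" if "norm q < 1" for q
    using sums_add[OF c[OF that] d[OF that]] by (simp only: of_int_add distrib_right)
  show ?thesis by (rule int_seriesI, rule *)
qed

lemma int_series_const: "int_series (\<lambda>q. of_int k)"
  unfolding int_series_def
proof (intro exI allI impI)
  show "(\<lambda>n. of_int (if n = 0 then k else 0) * q ^ n) sums of_int k" for q :: complex
    using sums_finite[of "{0}" "\<lambda>n. of_int (if n = 0 then k else 0) * q ^ n"] by simp
qed

lemma int_series_id: "int_series (\<lambda>q. q)"
  unfolding int_series_def
proof (intro exI allI impI)
  show "(\<lambda>n. of_int (if n = 1 then 1 else 0) * q ^ n) sums q" for q :: complex
    using sums_finite[of "{1}" "\<lambda>n. of_int (if n = 1 then 1 else 0) * q ^ n"] by simp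
qed

lemma int_series_power: "int_series f \<Longrightarrow> int_series (\<lambda>q. f q ^ n)"
  using int_series_const[of 1] by (induction n) (auto intro: int_series_mult)

lemma int_series_sum: "(\<And>i. i \<in> I \<Longrightarrow> int_series (f i)) \<Longrightarrow> int_series (\<lambda>q. \<Sum>i\<in>I. f i q)"
  using int_series_const[of 0] by (induction I rule: infinite_finite_induct) (auto intro: int_series_add)

lemma int_series_inverse_euler: "int_series (\<lambda>q. 1 / euler q)"
  unfolding int_series_def
  using has_sum_imp_sums[OF partitions_has_sum] by (intro exI[of _ "\<lambda>n. int (card (partitions_of n))"]) simp

lemma euler_0: "euler 0 = 1"
  using partitions_has_sum[of 0] has_sum_imp_sums[OF partitions_has_sum[of 0]] sums_unique
  by (simp add: euler_def qpoch_def)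

text \<open>The pentagonal exponents are nonnegative and pairwise distinct, so every coefficient is
  0, 1 or -1. The point q = 0, excluded in \<open>pentagonal_number\<close>, is treated
  separately.\<close>

lemma int_series_euler: "int_series euler"
proof -
  define e where "e = (\<lambda>k. nat (3 * tri k + 2 * k))"
  have pos: "0 \<le> 3 * tri k + 2 * k" for k
  proof -
    have "2 * (3 * tri k + 2 * k) = k * (3 * k + 1)" using two_tri[of k] by (simp add: algebra_simps)
    moreover have "0 \<le> k * (3 * k + 1)" by (cases "k \<ge> 0") (auto simp: mult_nonpos_nonpos)
    ultimately have "0 \<le> 2 * (3 * tri k + 2 * k)" by (simp only:)
    then show ?thesis by (simp only: zero_le_mult_iff) simp
  qed
  have inj: "inj e"
  proof (rule injI)
    fix k l assume "e k = e l"
    then have "3 * tri k + 2 * k = 3 * tri l + 2 * l" using pos[of k] pos[of l] by (simp add: e_def)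
    then have "(k - l) * (3 * (k + l) + 1) = 0" using two_tri[of k] two_tri[of l] by (simp add: algebra_simps)
    moreover have "3 * (k + l) + 1 \<noteq> 0" by presburger
    ultimately show "k = l" by simp
  qed
  define c where "c = (\<lambda>n. if n \<in> range e then (if even (inv_into UNIV e n) then 1 else -1) else 0 :: int)"
  have *: "(\<lambda>n. of_int (c n) * q ^ n) sums euler q" if q: "norm q < 1" for q
  proof (cases "q = 0")
    case True
    have "c 0 = 1"
    proof -
      have "e 0 = 0" by (simp add: e_def tri_def)
      then have "0 \<in> range e" "inv_into UNIV e 0 = 0" using inv_f_f[OF inj, of 0] by (metis rangeI, simp)
      then show ?thesis by (simp add: c_def)
    qed
    then show ?thesis using True sums_finite[of "{0}" "\<lambda>n. of_int (c n) * q ^ n"] by (simp add: euler_0)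
  next
    case False
    have "of_int (c (e k)) * q ^ e k = (-1) powi k * q powi (3 * tri k + 2 * k)" for k
    proof -
      have "q powi (3 * tri k + 2 * k) = q ^ e k" using pos[of k] by (simp add: e_def power_int_nonneg_exp)
      then show ?thesis using inv_f_f[OF inj, of k] by (simp add: c_def minus_one_powi)
    qed
    then have "((\<lambda>k. of_int (c (e k)) * q ^ e k) has_sum euler q) UNIV"
      using pentagonal_number[OF q False] by (simp only:)
    then have "((\<lambda>n. of_int (c n) * q ^ n) has_sum euler q) (range e)"
      by (subst has_sum_reindex[OF inj]) (simp add: o_def)
    then have "((\<lambda>n. of_int (c n) * q ^ n) has_sum euler q) UNIV"
      by (rule has_sum_cong_neutral[THEN iffD1, rotated -1]) (auto simp: c_def)
    then show ?thesis by (rule has_sum_imp_sums)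
  qed
  show ?thesis by (rule int_seriesI, rule *)
qed

lemma int_series_euler5: "int_series (\<lambda>q. euler (q ^ 5))"
proof -
  obtain c :: "nat \<Rightarrow> int" where c: "\<And>q. norm q < 1 \<Longrightarrow> (\<lambda>n. of_int (c n) * q ^ n) sums euler q"
    using int_series_euler unfolding int_series_def by blast
  have *: "(\<lambda>n. of_int (if n \<in> range ((*) 5) then c (n div 5) else 0) * q ^ n) sums euler (q ^ 5)" if q: "norm q < 1" for q
  proof -
    have mono: "strict_mono (\<lambda>n::nat. 5 * n)" by (simp add: strict_mono_def)
    have "(\<lambda>n. of_int (if 5 * n \<in> range ((*) 5) then c (5 * n div 5) else 0) * q ^ (5 * n)) sums euler (q ^ 5)"
      using c[of "q ^ 5"] norm_power_less_1[OF q, of 5] by (simp add: power_mult)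
    then show ?thesis
      by (subst sums_mono_reindex[OF mono, symmetric]) (simp_all only: if_False of_int_0 mult_zero_left)
  qed
  show ?thesis by (rule int_seriesI, rule *)
qed

text \<open>When 5^\<alpha> is taken out of the coefficients of a form, the remaining function must
  still expand with integers to yield a congruence. Partition numbers provide this for 1 /
  \<open>euler\<close>, pentagonal numbers for \<open>euler\<close>.\<close>

lemma int_series_form: "int_series (form \<alpha> J c)"
proof -
  have h: "int_series hauptmodul"
  proof -
    have "int_series (\<lambda>q. q * euler (q ^ 5) ^ 6 * (1 / euler q) ^ 6)"
      by (intro int_series_mult int_series_power int_series_id int_series_euler5 int_series_inverse_euler)
    then show ?thesis by (simp add: hauptmodul_def[abs_def] power_one_over)
  qed
  have "int_series (\<lambda>q. euler (q ^ 5) ^ 4 * (1 / euler q))" "int_series (\<lambda>q. euler (q ^ 5) ^ 5 * (1 / euler q) ^ 2)"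
    by (intro int_series_mult int_series_power int_series_euler5 int_series_inverse_euler)+
  then have "int_series (prefactor \<alpha>)" by (cases "even \<alpha>") (simp_all add: prefactor_def[abs_def] power_one_over)
  then show ?thesis unfolding form_def[abs_def]
    by (intro int_series_mult int_series_sum int_series_const int_series_power h)
qed

text \<open>The expansions are known only for q distinct from 0, since averaging involves negative
  powers. Multiplying the difference by q gives a series with constant term 0, which converges
  trivially at 0, so zeros would have to be isolated there.\<close>

lemma power_series_unique:
  fixes c d :: "nat \<Rightarrow> int"
  assumes "\<And>q::complex. norm q < 1 \<Longrightarrow> q \<noteq> 0 \<Longrightarrow> (\<lambda>n. of_int (c n) * q ^ n) sums f q"
    and "\<And>q::complex. norm q < 1 \<Longrightarrow> q \<noteq> 0 \<Longrightarrow> (\<lambda>n. of_int (d n) * q ^ n) sums f q"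
  shows "c = d"
proof (rule ccontr)
  assume "c \<noteq> d"
  then obtain m where m: "c m \<noteq> d m" by auto
  define a where "a = case_nat 0 (\<lambda>n. of_int (c n) - of_int (d n) :: complex)"
  have sums: "(\<lambda>n. a n * (q - 0) ^ n) sums 0" if "norm (q - 0) < 1" for q
  proof (cases "q = 0")
    case True
    then have "(\<lambda>n. a n * (q - 0) ^ n) = (\<lambda>n. 0)" by (auto simp: a_def split: nat.split)
    then show ?thesis by simp
  next
    case False
    have "norm q < 1" using that by simp
    from sums_mult[OF sums_diff[OF assms(1)[OF this False] assms(2)[OF this False]], of q]
    have "(\<lambda>n. a (Suc n) * q ^ Suc n) sums 0" by (simp add: a_def algebra_simps)
    then have "(\<lambda>n. a n * q ^ n) sums (0 + a 0 * q ^ 0)" by (rule sums_Suc)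
    then show ?thesis by (simp add: a_def)
  qed
  have "a (Suc m) \<noteq> 0" using m by (simp add: a_def)
  from powser_0_nonzero[of 1 0 a "\<lambda>_. 0", OF _ sums _ this]
  obtain s where "0 < s" "\<And>z :: complex. z \<in> cball 0 s - {0} \<Longrightarrow> (0 :: complex) \<noteq> 0" by auto
  from this(2)[of "of_real s"] this(1) show False by (simp add: dist_norm)
qed

theorem NT_gap_dvd: "5 ^ \<alpha> dvd NT_gap (5 * (5 ^ \<alpha> * n + delta_tilde \<alpha>) + 4)"
proof -
  obtain J c where c: "\<And>j. 5 ^ (\<alpha> + (5 * j) div 2) dvd c j"
    and sum: "\<And>q. norm q < 1 \<Longrightarrow> q \<noteq> 0 \<Longrightarrow> ((\<lambda>n. of_int (NT_gap (5 * (5 ^ \<alpha> * n + delta_tilde \<alpha>) + 4)) * q ^ n) has_sum form \<alpha> J c q) UNIV"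
    using NT_gap_form by blast
  have "c j = 5 ^ \<alpha> * (c j div 5 ^ \<alpha>)" for j
    using dvd_trans[OF le_imp_power_dvd c[of j], of \<alpha>] by simp
  then have f: "form \<alpha> J c q = 5 ^ \<alpha> * form \<alpha> J (\<lambda>j. c j div 5 ^ \<alpha>) q" for q
  proof -
    have "(\<Sum>j<J. of_int (c j) * hauptmodul q ^ j) = (\<Sum>j<J. 5 ^ \<alpha> * (of_int (c j div 5 ^ \<alpha>) * hauptmodul q ^ j))"
      by (rule sum.cong[OF refl], subst \<open>\<And>j. c j = _\<close>) (simp only: of_int_mult of_int_power of_int_numeral mult.assoc)
    then show ?thesis by (simp add: form_def sum_distrib_left mult_ac)
  qed
  obtain d :: "nat \<Rightarrow> int" where d: "\<And>q. norm q < 1 \<Longrightarrow> (\<lambda>n. of_int (d n) * q ^ n) sums form \<alpha> J (\<lambda>j. c j div 5 ^ \<alpha>) q"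
    using int_series_form unfolding int_series_def by blast
  have "(\<lambda>n. NT_gap (5 * (5 ^ \<alpha> * n + delta_tilde \<alpha>) + 4)) = (\<lambda>n. 5 ^ \<alpha> * d n)"
  proof (rule power_series_unique)
    fix q :: complex assume q: "norm q < 1" "q \<noteq> 0"
    show "(\<lambda>n. of_int (NT_gap (5 * (5 ^ \<alpha> * n + delta_tilde \<alpha>) + 4)) * q ^ n) sums form \<alpha> J c q"
      by (rule has_sum_imp_sums[OF sum[OF q]])
    show "(\<lambda>n. of_int (5 ^ \<alpha> * d n) * q ^ n) sums form \<alpha> J c q"
      using sums_mult[OF d[OF q(1)], of "5 ^ \<alpha>"] by (simp add: f mult.assoc)
  qed
  then show ?thesis by (metis dvd_triv_left)
qed

theorem theorem1p1:
  fixes \<alpha> n :: nat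
  assumes "\<alpha> \<ge> 1"
  shows "[NT 1 5 (5 ^ (\<alpha> + 1) * n + 5 * delta_tilde \<alpha> + 4)
        = NT 4 5 (5 ^ (\<alpha> + 1) * n + 5 * delta_tilde \<alpha> + 4)] (mod 5 ^ \<alpha>)"
proof -
  let ?N = "5 ^ (\<alpha> + 1) * n + 5 * delta_tilde \<alpha> + 4"
  have "?N = 5 * (5 ^ \<alpha> * n + delta_tilde \<alpha>) + 4" by simp
  then have "5 ^ \<alpha> dvd NT_gap ?N" using NT_gap_dvd[of \<alpha> n] by (simp only:)
  moreover have "int (NT 4 5 ?N) - int (NT 1 5 ?N) = NT_gap ?N" unfolding NT_gap_def by (rule NT_diff) simp
  ultimately have "[int (NT 4 5 ?N) = int (NT 1 5 ?N)] (mod 5 ^ \<alpha>)" by (simp add: cong_iff_dvd_diff)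
  then have "[int (NT 1 5 ?N) = int (NT 4 5 ?N)] (mod int (5 ^ \<alpha>))" by (simp add: cong_sym)
  then show ?thesis by (simp only: cong_int_iff)
qed

end
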